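(* Let $(\Omega,\mathcal F,\mathbb P)$ with the shifts $\tau_z$ be stationary and ergodic. Let $\alpha>0$ and $f\in L^2(\mathbb R^d)$. For $a\in\Omega$ and $\varepsilon>0$ let $u_\varepsilon(a,\cdot),u_0\in H^1(\mathbb R^d)$ denote the unique weak solutions to $$\alpha u_\varepsilon-\nabla\cdot a(\tfrac{x}{\varepsilon})\nabla u_\varepsilon(a,\cdot)=f,\qquad \alpha u_0-\nabla\cdot a_{\mathrm{hom}}\nabla u_0=f\qquad\text{in }\mathbb R^d.$$ Let $(\phi,\sigma)=(\phi_1,\dots,\phi_d,\sigma_1,\dots,\sigma_d)$ be the extended corrector, and set $$Z_\varepsilon(a,\cdot)=u_\varepsilon(a,\cdot)-\Big(u_0+\varepsilon\sum_{i=1}^d\phi_i(a,\tfrac{\cdot}{\varepsilon})\partial_iu_0\Big).$$ Then there is a constant $C(d,\lambda)$ depending only on $d$ and $\lambda$ such that $\mathbb P$-a.s. $$\alpha\int|Z_\varepsilon|^2+\lambda\int|\nabla Z_\varepsilon|^2\le C(d,\lambda)\,\varepsilon^2\Big(\alpha\int|\phi(\tfrac\cdot\varepsilon)|^2|\nabla u_0|^2+\int\big(|\sigma(\tfrac\cdot\varepsilon)|^2+|a(\tfrac\cdot\varepsilon)|^2|\phi(\tfrac\cdot\varepsilon)|^2\big)|\nabla\nabla u_0|^2\Big),$$ where all integrals are over $\mathbb R^d$.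
   Context: Let $d\ge1$ and $\lambda>0$ be fixed. $\Omega$ is the set of measurable $a:\mathbb R^d\to\mathbb R^{d\times d}_{\mathrm{sym}}$ such that for a.e. $x$ and all $\xi\in\mathbb R^d$: $\xi\cdot a(x)\xi\ge\lambda|\xi|^2$ and $|a(x)\xi|\le|\xi|$. $(\Omega,\mathcal F,\mathbb P)$ is a probability space, $\langle\cdot\rangle$ the expectation, and the shift $\tau:\mathbb R^d\times\Omega\to\Omega$, $\tau_za:=a(\cdot+z)$, is assumed measurable. $\Box:=(-\frac12,\frac12)^d$. Stationary: for all $z\in\mathbb R^d$ and $f\in L^1(\Omega,\mathbb P)$, $\langle f\circ\tau_z\rangle=\langle f\rangle$. Ergodic: for all $f\in L^1(\Omega,\mathbb P)$, $\lim_{R\uparrow\infty}\frac1{|R\Box|}\int_{R\Box}f(\tau_za)\,dz=\langle f\rangle$ for $\mathbb P$-a.e. $a$. A measurable $u:\Omega\times\mathbb R^d\to\mathbb R$ is a stationary random field if $\langle\int_Q|u|\rangle<\infty$ for all cubes $Q=x+r\Box$ and for $\mathbb P$-a.e. $a$: $\int_{x+Q}u(a,y)\,dy=\int_Qu(\tau_xa,y)\,dy$ for all cubes $Q$ and $x\in\mathbb R^d$ (componentwise for vector fields). Let $\mathcal H$ be the space of random fields $u:\Omega\times\mathbb R^d\to\mathbb R$ with $\langle\int_\Box|u|^2+|\nabla u|^2\rangle<\infty$, $\langle|\int_\Box u|\rangle=0$, $\nabla u$ stationary and $\langle\int_\Box\nabla u\rangle=0$. Extended corrector (it exists and is unique):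 for $i=1,\dots,d$, $\phi_i\in\mathcal H$ is a scalar field and $\sigma_i=(\sigma_{ijk})_{j,k}$ a matrix field with $\sigma_{ijk}\in\mathcal H$, such that $\mathbb P$-a.s. in $\mathcal D'(\mathbb R^d)$ $$-\nabla\cdot a(\nabla\phi_i+e_i)=0,\qquad q_i:=a(\nabla\phi_i+e_i)-a_{\mathrm{hom}}e_i,\qquad -\Delta\sigma_{ijk}=\partial_jq_{ik}-\partial_kq_{ij},$$ where $a_{\mathrm{hom}}\in\mathbb R^{d\times d}$ is the homogenized matrix, $a_{\mathrm{hom}}e_i:=\langle\int_\Box a(\nabla\phi_i+e_i)\rangle$, and $q_{ij}$ is the $j$-th component of $q_i$; moreover $\sigma_i$ is skew symmetric ($\sigma_{ijk}=-\sigma_{ikj}$) and $\sum_{k}\partial_k\sigma_{ijk}=q_{ij}$. *)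

theory Defs
  imports "HOL-Probability.Probability"
begin

section \<open>Test functions and distributional derivatives on \<open>real ^ 'n\<close>\<close>

definition partial :: "'n::finite \<Rightarrow> (real ^ 'n \<Rightarrow> real) \<Rightarrow> real ^ 'n \<Rightarrow> real" where
  "partial k f x = frechet_derivative f (at x) (axis k 1)"

primrec C_k :: "nat \<Rightarrow> (real ^ 'n::finite \<Rightarrow> real) \<Rightarrow> bool" where
  "C_k 0 f \<longleftrightarrow> continuous_on UNIV f"
| "C_k (Suc m) f \<longleftrightarrow> (\<forall>x. f differentiable at x) \<and> (\<forall>k. C_k m (partial k f))"

definition test_fun :: "(real ^ 'n::finite \<Rightarrow> real) \<Rightarrow> bool" where
  "test_fun \<psi> \<longleftrightarrow> (\<forall>m. C_k m \<psi>) \<and> compact (closure {x. \<psi> x \<noteq> 0})"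

definition loc_integrable ::
  "(real ^ 'n::finite \<Rightarrow> 'b::{banach, second_countable_topology}) \<Rightarrow> bool" where
  "loc_integrable f \<longleftrightarrow> (\<forall>K. compact K \<longrightarrow> set_integrable lebesgue K f)"

text \<open>Distributions generated by locally integrable functions, as functionals of the
  test function \<open>\<psi>\<close>.\<close>

definition distr_partial ::
  "'n::finite \<Rightarrow> (real ^ 'n \<Rightarrow> real) \<Rightarrow> (real ^ 'n \<Rightarrow> real) \<Rightarrow> real" where
  "distr_partial k g \<psi> = - (LINT x|lebesgue. g x * partial k \<psi> x)"

definition distr_div ::
  "(real ^ 'n::finite \<Rightarrow> real ^ 'n) \<Rightarrow> (real ^ 'n \<Rightarrow> real) \<Rightarrow> real" where
  "distr_div F \<psi> = (\<Sum>k\<in>UNIV. distr_partial k (\<lambda>x. F x $ k) \<psi>)"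

definition distr_laplace ::
  "(real ^ 'n::finite \<Rightarrow> real) \<Rightarrow> (real ^ 'n \<Rightarrow> real) \<Rightarrow> real" where
  "distr_laplace g \<psi> = (LINT x|lebesgue. g x * (\<Sum>k\<in>UNIV. partial k (partial k \<psi>) x))"

text \<open>Weak derivatives are only determined almost everywhere, so gradients are given by a
  relation: \<open>has_weak_grad u Du\<close> says that \<open>Du\<close> is a representative of the weak gradient.\<close>

definition has_weak_grad ::
  "(real ^ 'n::finite \<Rightarrow> real) \<Rightarrow> (real ^ 'n \<Rightarrow> real ^ 'n) \<Rightarrow> bool" where
  "has_weak_grad u Du \<longleftrightarrow> loc_integrable u \<and> loc_integrable Du \<and>
     (\<forall>k \<psi>. test_fun \<psi> \<longrightarrow> distr_partial k u \<psi> = (LINT x|lebesgue. Du x $ k * \<psi> x))"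

definition in_L2 :: "(real ^ 'n::finite \<Rightarrow> 'b::euclidean_space) \<Rightarrow> bool" where
  "in_L2 f \<longleftrightarrow> f \<in> borel_measurable lebesgue \<and> integrable lebesgue (\<lambda>x. (norm (f x))\<^sup>2)"

definition in_H1 :: "(real ^ 'n::finite \<Rightarrow> real) \<Rightarrow> (real ^ 'n \<Rightarrow> real ^ 'n) \<Rightarrow> bool" where
  "in_H1 u Du \<longleftrightarrow> has_weak_grad u Du \<and> in_L2 u \<and> in_L2 Du"

text \<open>Weak solutions \<open>u \<in> H\<^sup>1\<close>, with \<open>\<nabla>u = Du\<close>, of \<open>\<alpha> u - \<nabla>\<cdot>A\<nabla>u = f\<close> on the whole space.\<close>

definition weak_solution ::
  "real \<Rightarrow> (real ^ 'n \<Rightarrow> real ^ 'n ^ 'n) \<Rightarrow> (real ^ 'n::finite \<Rightarrow> real)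
     \<Rightarrow> (real ^ 'n \<Rightarrow> real) \<Rightarrow> (real ^ 'n \<Rightarrow> real ^ 'n) \<Rightarrow> bool" where
  "weak_solution \<alpha> A f u Du \<longleftrightarrow> in_H1 u Du \<and>
     (\<forall>v Dv. in_H1 v Dv \<longrightarrow>
        \<alpha> * (LINT x|lebesgue. u x * v x) + (LINT x|lebesgue. Dv x \<bullet> (A x *v Du x))
          = (LINT x|lebesgue. f x * v x))"


section \<open>Random coefficient fields\<close>

type_synonym 'n coeff = "real ^ 'n \<Rightarrow> real ^ 'n ^ 'n"

definition coeff_fields :: "real \<Rightarrow> 'n::finite coeff set" where
  "coeff_fields lam = {a. a \<in> borel_measurable lebesgue \<and> (\<forall>x. transpose (a x) = a x) \<and>
     (AE x in lebesgue. \<forall>\<xi>. \<xi> \<bullet> (a x *v \<xi>) \<ge> lam * (norm \<xi>)\<^sup>2 \<and> norm (a x *v \<xi>) \<le> norm \<xi>)}"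

definition shift :: "real ^ 'n \<Rightarrow> 'n::finite coeff \<Rightarrow> 'n coeff" where
  "shift z a = (\<lambda>x. a (x + z))"

definition random_medium :: "real \<Rightarrow> 'n::finite coeff measure \<Rightarrow> bool" where
  "random_medium lam P \<longleftrightarrow> prob_space P \<and> space P = coeff_fields lam \<and>
     (\<lambda>(z, a). shift z a) \<in> measurable (borel \<Otimes>\<^sub>M P) P"

definition unit_cube :: "(real ^ 'n::finite) set" where
  "unit_cube = box (\<chi> i. - 1 / 2) (\<chi> i. 1 / 2)"

definition cube :: "real ^ 'n::finite \<Rightarrow> real \<Rightarrow> (real ^ 'n) set" where
  "cube x r = (\<lambda>y. x + r *\<^sub>R y) ` unit_cube"

definition stationary :: "'n::finite coeff measure \<Rightarrow> bool" where
  "stationary P \<longleftrightarrow> (\<forall>z. \<forall>f :: 'n coeff \<Rightarrow> real. integrable P f \<longrightarrow>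
     (LINT a|P. f (shift z a)) = (LINT a|P. f a))"

definition ergodic :: "'n::finite coeff measure \<Rightarrow> bool" where
  "ergodic P \<longleftrightarrow> (\<forall>f :: 'n coeff \<Rightarrow> real. integrable P f \<longrightarrow>
     (AE a in P. ((\<lambda>R. (1 / measure lebesgue (cube (0 :: real ^ 'n) R)) *
          (LINT z:cube 0 R|lebesgue. f (shift z a))) \<longlongrightarrow> (LINT a'|P. f a')) at_top))"

definition random_field ::
  "'n::finite coeff measure \<Rightarrow> ('n coeff \<Rightarrow> real ^ 'n \<Rightarrow> real) \<Rightarrow> bool" where
  "random_field P u \<longleftrightarrow> (\<lambda>(a, x). u a x) \<in> borel_measurable (P \<Otimes>\<^sub>M borel)"

definition stationary_field ::
  "'n::finite coeff measure \<Rightarrow> ('n coeff \<Rightarrow> real ^ 'n \<Rightarrow> real) \<Rightarrow> bool" where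
  "stationary_field P u \<longleftrightarrow> random_field P u \<and>
     (\<forall>x0 r. r > 0 \<longrightarrow> (\<integral>\<^sup>+ a. (\<integral>\<^sup>+ y\<in>cube x0 r. ennreal \<bar>u a y\<bar> \<partial>lebesgue) \<partial>P) < \<infinity>) \<and>
     (AE a in P. \<forall>x x0 r. r > 0 \<longrightarrow>
        (LINT y:(\<lambda>y. x + y) ` cube x0 r|lebesgue. u a y)
          = (LINT y:cube x0 r|lebesgue. u (shift x a) y))"

text \<open>\<open>in_H P u Du\<close>: the random field \<open>u\<close> lies in the space \<open>\<H>\<close>, and \<open>Du\<close> is a jointly
  measurable version of its gradient \<open>\<nabla>u\<close>.\<close>

definition in_H ::
  "'n::finite coeff measure \<Rightarrow> ('n coeff \<Rightarrow> real ^ 'n \<Rightarrow> real)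
     \<Rightarrow> ('n coeff \<Rightarrow> real ^ 'n \<Rightarrow> real ^ 'n) \<Rightarrow> bool" where
  "in_H P u Du \<longleftrightarrow> random_field P u \<and>
     (AE a in P. has_weak_grad (u a) (Du a)) \<and>
     (\<integral>\<^sup>+ a. (\<integral>\<^sup>+ y\<in>unit_cube. ennreal ((u a y)\<^sup>2 + (norm (Du a y))\<^sup>2) \<partial>lebesgue) \<partial>P) < \<infinity> \<and>
     (LINT a|P. \<bar>LINT y:unit_cube|lebesgue. u a y\<bar>) = 0 \<and>
     (\<forall>k. stationary_field P (\<lambda>a x. Du a x $ k)) \<and>
     (LINT a|P. (LINT y:unit_cube|lebesgue. Du a y)) = 0"


section \<open>The extended corrector\<close>

text \<open>The matrix whose \<open>i\<close>-th column is the expectation of the integral of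
  \<open>a (\<nabla>\<phi>\<^sub>i + e\<^sub>i)\<close> over the unit cube.\<close>

definition a_hom ::
  "'n::finite coeff measure \<Rightarrow> ('n \<Rightarrow> 'n coeff \<Rightarrow> real ^ 'n \<Rightarrow> real ^ 'n) \<Rightarrow> real ^ 'n ^ 'n" where
  "a_hom P D\<phi> = (\<chi> j i.
     (LINT a|P. (LINT y:unit_cube|lebesgue. a y *v (D\<phi> i a y + axis i 1))) $ j)"

definition flux ::
  "'n::finite coeff measure \<Rightarrow> ('n \<Rightarrow> 'n coeff \<Rightarrow> real ^ 'n \<Rightarrow> real ^ 'n)
     \<Rightarrow> 'n \<Rightarrow> 'n coeff \<Rightarrow> real ^ 'n \<Rightarrow> real ^ 'n" where
  "flux P D\<phi> i a x = a x *v (D\<phi> i a x + axis i 1) - a_hom P D\<phi> *v axis i 1"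

definition extended_corrector ::
  "'n::finite coeff measure
     \<Rightarrow> ('n \<Rightarrow> 'n coeff \<Rightarrow> real ^ 'n \<Rightarrow> real)
     \<Rightarrow> ('n \<Rightarrow> 'n coeff \<Rightarrow> real ^ 'n \<Rightarrow> real ^ 'n)
     \<Rightarrow> ('n \<Rightarrow> 'n \<Rightarrow> 'n \<Rightarrow> 'n coeff \<Rightarrow> real ^ 'n \<Rightarrow> real)
     \<Rightarrow> ('n \<Rightarrow> 'n \<Rightarrow> 'n \<Rightarrow> 'n coeff \<Rightarrow> real ^ 'n \<Rightarrow> real ^ 'n) \<Rightarrow> bool" where
  "extended_corrector P \<phi> D\<phi> \<sigma> D\<sigma> \<longleftrightarrow>
     (\<forall>i. in_H P (\<phi> i) (D\<phi> i)) \<and>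
     (\<forall>i j k. in_H P (\<sigma> i j k) (D\<sigma> i j k)) \<and>
     (\<forall>i. AE a in P. \<forall>\<psi>. test_fun \<psi> \<longrightarrow>
        - distr_div (\<lambda>x. a x *v (D\<phi> i a x + axis i 1)) \<psi> = 0) \<and>
     (\<forall>i j k. AE a in P. \<forall>\<psi>. test_fun \<psi> \<longrightarrow>
        - distr_laplace (\<sigma> i j k a) \<psi> =
            distr_partial j (\<lambda>x. flux P D\<phi> i a x $ k) \<psi>
          - distr_partial k (\<lambda>x. flux P D\<phi> i a x $ j) \<psi>) \<and>
     (\<forall>i j k. AE a in P. AE x in lebesgue. \<sigma> i j k a x = - \<sigma> i k j a x) \<and>
     (\<forall>i j. AE a in P. AE x in lebesgue.
        (\<Sum>k\<in>UNIV. D\<sigma> i j k a x $ k) = flux P D\<phi> i a x $ j)"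

definition two_scale_error ::
  "real \<Rightarrow> ('n \<Rightarrow> 'n coeff \<Rightarrow> real ^ 'n \<Rightarrow> real) \<Rightarrow> 'n::finite coeff
     \<Rightarrow> (real ^ 'n \<Rightarrow> real) \<Rightarrow> (real ^ 'n \<Rightarrow> real) \<Rightarrow> (real ^ 'n \<Rightarrow> real ^ 'n)
     \<Rightarrow> real ^ 'n \<Rightarrow> real" where
  "two_scale_error \<epsilon> \<phi> a u\<^sub>\<epsilon> u\<^sub>0 Du\<^sub>0 x =
     u\<^sub>\<epsilon> x - (u\<^sub>0 x + \<epsilon> * (\<Sum>i\<in>UNIV. \<phi> i a (x /\<^sub>R \<epsilon>) * Du\<^sub>0 x $ i))"

end

theory Submission
  imports Defs
begin

text \<open>The error \<open>Z\<close> solves an elliptic equation whose right-hand side is, thanks to the skew symmetry of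
  \<open>\<sigma>\<close>, the divergence of \<open>\<epsilon> (\<phi> a - \<sigma>) \<nabla>\<nabla>u\<^sub>0\<close> plus \<open>\<alpha> \<epsilon> \<phi> \<cdot> \<nabla>u\<^sub>0\<close>; testing with \<open>Z\<close> gives the estimate.
  That \<open>Z\<close> is admissible when the right-hand side is finite follows from a Caccioppoli inequality
  for the corrector equation with weight \<open>\<partial>\<^sub>i u\<^sub>0\<close>, with the weight truncated.  The
  second derivatives of \<open>u\<^sub>0\<close> exist because \<open>a\<^sub>h\<^sub>o\<^sub>m\<close> is coercive: the flux
  \<open>a (\<nabla>\<phi>\<^sub>i + e\<^sub>i)\<close> is divergence free and \<open>\<nabla>\<phi>\<^sub>j\<close> is a stationary gradient of mean zero, hence they
  are orthogonal by stationarity (the correlation with the shifted gradient does not depend on the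
  shift) and the mean ergodic theorem (its average over large cubes tends to zero).\<close>

text \<open>Three obstacles shape the proof. The gradient of \<open>Z\<close> contains \<partial>_i
  u_0 times the gradient of \<phi>_i, a term that the right-hand side does not bound directly; hence
  the separate argument for admissibility. If the right-hand side is infinite there is nothing to
  prove, so the bound is formulated with extended nonnegative integrals, and finiteness becomes a
  hypothesis of the energy argument. The constant \<open>1 + 2 / lam\<close> comes from Young's
  inequality alone, \<open>1\<close> from the zeroth-order term and \<open>2 / lam\<close> from the
  divergence term, so it does not involve the dimension. For the coercivity, \<open>a_hom\<close> is
  defined through the mean flux and not through an energy, and only the gradient of the corrector is
  stationary, not the corrector itself; testing the flux with \<phi> would call for sublinear
  growth. Increments \<phi>(w + .) - \<phi> have uniformly bounded second moments, which is enough.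
  The exceptional null set consists of the realizations for which some property of the corrector
  fails, and therefore serves all \<epsilon> at once.\<close>

abbreviation lborel_nn_integral :: "('a::euclidean_space \<Rightarrow> ennreal) \<Rightarrow> ennreal"  (binder "LBINT\<^sup>+ " 10) where
  "lborel_nn_integral f \<equiv> nn_integral lborel f"

subsection \<open>Smooth functions\<close>

lemma partial_eq: "(f has_derivative f') (at x) \<Longrightarrow> partial k f x = f' (axis k 1)"
  by (simp add: partial_def frechet_derivative_at[symmetric])

lemma C_k_SucD: "C_k (Suc m) f \<Longrightarrow> C_k m f"
proof (induction m arbitrary: f)
  case 0
  then show ?case
    by (auto simp: continuous_on_eq_continuous_at intro: differentiable_imp_continuous_within)
next
  case (Suc m)
  then show ?case by (metis C_k.simps(2))
qed

text \<open>Product and sum share one induction because the partial derivative of a product is a sum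
  of products; \<open>C_k_SucD\<close> lowers the order of the factor that is not
  differentiated.\<close>

lemma C_k_mult: "C_k m f \<Longrightarrow> C_k m g \<Longrightarrow> C_k m (\<lambda>x. f x * g x)"
  and C_k_add: "C_k m f \<Longrightarrow> C_k m g \<Longrightarrow> C_k m (\<lambda>x. f x + g x)"
proof (induction m arbitrary: f g)
  case 0
  { case 1 then show ?case by (auto intro: continuous_intros) }
  { case 2 then show ?case by (auto intro: continuous_intros) }
next
  case (Suc m)
  have D: "(f has_derivative frechet_derivative f (at x)) (at x)"
    if "C_k (Suc m) f" for f :: "real ^ 'n::finite \<Rightarrow> real" and x
    using that by (auto simp: frechet_derivative_works)
  { case 1
    have "((\<lambda>x. f x * g x) has_derivative
       (\<lambda>h. f x * frechet_derivative g (at x) h + frechet_derivative f (at x) h * g x)) (at x)" for x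
      by (intro has_derivative_mult D 1)
    moreover from this have "partial k (\<lambda>x. f x * g x) = (\<lambda>x. f x * partial k g x + partial k f x * g x)" for k
      by (intro ext) (subst partial_eq, assumption, simp add: partial_def)
    moreover have "C_k m f" "C_k m g" using 1 C_k_SucD by blast+
    ultimately show ?case using 1 Suc by (auto simp: differentiable_def) }
  { case 2
    have "((\<lambda>x. f x + g x) has_derivative
       (\<lambda>h. frechet_derivative f (at x) h + frechet_derivative g (at x) h)) (at x)" for x
      by (intro has_derivative_add D 2)
    moreover from this have "partial k (\<lambda>x. f x + g x) = (\<lambda>x. partial k f x + partial k g x)" for k
      by (intro ext) (subst partial_eq, assumption, simp add: partial_def)
    ultimately show ?case using 2 Suc by (auto simp: differentiable_def) }
qed

lemma C_k_const: "C_k m (\<lambda>x :: real ^ 'n::finite. c)"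
proof (induction m arbitrary: c)
  case (Suc m)
  have "partial k (\<lambda>x. c) = (\<lambda>x :: real ^ 'n. 0)" for k and c :: real by (auto simp: partial_def)
  with Suc show ?case by auto
qed simp

lemma C_k_nth: "C_k m (\<lambda>x :: real ^ 'n::finite. x $ i)"
proof (cases m)
  case (Suc m')
  have d: "((\<lambda>x. x $ i) has_derivative (\<lambda>x. x $ i)) (at x)" for x :: "real ^ 'n"
    by (intro bounded_linear_imp_has_derivative bounded_linear_vec_nth)
  then have "partial k (\<lambda>x. x $ i) = (\<lambda>x::real ^ 'n. axis k 1 $ i)" for k
    by (intro ext) (simp add: partial_eq[OF d])
  with d show ?thesis by (auto simp: Suc C_k_const differentiable_def)
qed (auto intro: continuous_intros)

lemma
  fixes f :: "real ^ 'n::finite \<Rightarrow> real"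
  shows C_k_affine: "C_k m f \<Longrightarrow> C_k m (\<lambda>x. f (c *\<^sub>R x + z))"
  and partial_affine: "(\<And>x. f differentiable at x) \<Longrightarrow>
        partial k (\<lambda>x. f (c *\<^sub>R x + z)) x = c * partial k f (c *\<^sub>R x + z)"
proof -
  have D: "((\<lambda>x. f (c *\<^sub>R x + z)) has_derivative
      (\<lambda>h. frechet_derivative f (at (c *\<^sub>R x + z)) (c *\<^sub>R h))) (at x)"
    if "\<And>x. f differentiable at x" for f :: "real ^ 'n \<Rightarrow> real" and x
  proof -
    have "((\<lambda>x. c *\<^sub>R x + z) has_derivative (\<lambda>h. c *\<^sub>R h)) (at x)"
      by (auto intro!: derivative_eq_intros)
    from has_derivative_compose[OF this, of f "frechet_derivative f (at (c *\<^sub>R x + z))"]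
    show ?thesis using that by (simp add: frechet_derivative_works)
  qed
  have P: "partial k (\<lambda>x. f (c *\<^sub>R x + z)) x = c * partial k f (c *\<^sub>R x + z)"
    if "\<And>x. f differentiable at x" for f :: "real ^ 'n \<Rightarrow> real" and x k
  proof -
    have "linear (frechet_derivative f (at (c *\<^sub>R x + z)))"
      using that by (rule linear_frechet_derivative)
    then show ?thesis
      by (subst partial_eq[OF D[OF that]]) (simp add: partial_def linear_cmul)
  qed
  show "(\<And>x. f differentiable at x) \<Longrightarrow> partial k (\<lambda>x. f (c *\<^sub>R x + z)) x = c * partial k f (c *\<^sub>R x + z)"
    by (rule P)
  show "C_k m f \<Longrightarrow> C_k m (\<lambda>x. f (c *\<^sub>R x + z))"
  proof (induction m arbitrary: f)
    case 0
    then show ?case by (auto intro!: continuous_intros continuous_on_compose2[of UNIV f])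
  next
    case (Suc m)
    then have d: "\<And>x. f differentiable at x" by simp
    have "partial k (\<lambda>x. f (c *\<^sub>R x + z)) = (\<lambda>x. c * partial k f (c *\<^sub>R x + z))" for k
      using P[OF d] by auto
    with Suc D[OF d] show ?case by (auto simp: differentiable_def intro!: C_k_mult C_k_const)
  qed
qed

definition smooth :: "(real ^ 'n::finite \<Rightarrow> real) \<Rightarrow> bool" where
  "smooth f \<longleftrightarrow> (\<forall>m. C_k m f)"

lemma smooth_diff: "smooth f \<Longrightarrow> f differentiable at x"
  unfolding smooth_def using C_k.simps(2) by blast

lemma smooth_partial: "smooth f \<Longrightarrow> smooth (partial k f)"
  unfolding smooth_def using C_k.simps(2) by blast

lemma smooth_has_derivative: "smooth f \<Longrightarrow> (f has_derivative frechet_derivative f (at x)) (at x)"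
  using smooth_diff frechet_derivative_works by blast

lemma smooth_continuous: "smooth f \<Longrightarrow> continuous_on UNIV f"
  unfolding smooth_def using C_k.simps(1) by blast

lemma smooth_borel: "smooth f \<Longrightarrow> f \<in> borel_measurable borel"
  by (simp add: smooth_continuous borel_measurable_continuous_onI)

lemma smooth_mult: "smooth f \<Longrightarrow> smooth g \<Longrightarrow> smooth (\<lambda>x. f x * g x)"
  by (simp add: smooth_def C_k_mult)

lemma smooth_add: "smooth f \<Longrightarrow> smooth g \<Longrightarrow> smooth (\<lambda>x. f x + g x)"
  by (simp add: smooth_def C_k_add)

lemma smooth_const: "smooth (\<lambda>x. c)"
  by (simp add: smooth_def C_k_const)

lemma smooth_cmult: "smooth f \<Longrightarrow> smooth (\<lambda>x. c * f x)"
  by (simp add: smooth_mult smooth_const)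

lemma smooth_affine: "smooth f \<Longrightarrow> smooth (\<lambda>x. f (c *\<^sub>R x + z))"
  by (simp add: smooth_def C_k_affine)

lemma partial_mult:
  assumes "smooth f" "smooth g"
  shows "partial k (\<lambda>x. f x * g x) x = f x * partial k g x + partial k f x * g x"
  by (subst partial_eq[OF has_derivative_mult[OF smooth_has_derivative smooth_has_derivative]])
     (use assms in \<open>auto simp: partial_def\<close>)

lemma partial_add:
  assumes "smooth f" "smooth g"
  shows "partial k (\<lambda>x. f x + g x) x = partial k f x + partial k g x"
  by (subst partial_eq[OF has_derivative_add[OF smooth_has_derivative smooth_has_derivative]])
     (use assms in \<open>auto simp: partial_def\<close>)

lemma partial_cmult:
  assumes "smooth f"
  shows "partial k (\<lambda>x. c * f x) x = c * partial k f x"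
  by (subst partial_eq[OF has_derivative_mult_right[OF smooth_has_derivative]])
     (use assms in \<open>auto simp: partial_def\<close>)

lemma frechet_derivative_eq_sum_partial:
  assumes "f differentiable at x"
  shows "frechet_derivative f (at x) h = (\<Sum>k\<in>UNIV. h $ k * partial k f x)"
proof -
  have l: "linear (frechet_derivative f (at x))" using assms by (rule linear_frechet_derivative)
  have "frechet_derivative f (at x) h = frechet_derivative f (at x) (\<Sum>k\<in>UNIV. h $ k *\<^sub>R axis k 1)"
    using basis_expansion[of h] by (simp add: scalar_mult_eq_scaleR)
  also have "\<dots> = (\<Sum>k\<in>UNIV. h $ k * partial k f x)"
    by (simp add: linear_sum[OF l] linear_cmul[OF l] partial_def)
  finally show ?thesis .
qed

lemma partial_eq_0_outside:
  assumes "\<And>x. x \<notin> S \<Longrightarrow> f x = 0" "closed S" "x \<notin> S"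
  shows "partial k f x = 0"
proof -
  have "(f has_derivative (\<lambda>h. 0)) (at x)"
    by (rule has_derivative_transform_within_open[of "\<lambda>x. 0" _ _ _ "- S"]) (use assms in auto)
  then show ?thesis by (simp add: partial_eq)
qed

subsection \<open>A smooth bump\<close>

text \<open>The exponent closes the family under differentiation: \<open>expinv j\<close> has derivative \<open>expinv (j + 2) - j * expinv (j + 1)\<close>.\<close>

definition expinv :: "nat \<Rightarrow> real \<Rightarrow> real" where
  "expinv j t = (if t > 0 then (1 / t) ^ j * exp (- (1 / t)) else 0)"

text \<open>With s = 1/t, a single term of the exponential series gives s^(j+2) \<le> (j+2)! exp s.
  The power t^2 is what makes the difference quotient at 0 vanish in
  \<open>DERIV_expinv\<close>.\<close>

lemma expinv_le: "expinv j t \<le> fact (j + 2) * t^2"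
proof (cases "t > 0")
  case True
  define s where "s = 1 / t"
  have s: "s > 0" using True by (simp add: s_def)
  have "s ^ (j + 2) / fact (j + 2) \<le> exp s"
  proof -
    have "(\<Sum>n\<in>{j + 2}. inverse (fact n) * s ^ n) \<le> (\<Sum>n. inverse (fact n) * s ^ n)"
      using s summable_exp[of s] by (intro sum_le_suminf) auto
    then show ?thesis by (simp add: exp_def field_simps scaleR_conv_of_real)
  qed
  moreover define c :: real where "c = fact (j + 2)"
  moreover have "c > 0" unfolding c_def by (rule fact_gt_zero)
  ultimately have "s ^ j * s^2 \<le> exp s * c" by (simp add: field_simps power_add power2_eq_square)
  then have "s ^ j * s^2 * exp (- s) \<le> fact (j + 2)"
    unfolding c_def[symmetric] by (simp add: exp_minus field_simps)
  then have "s ^ j * exp (- s) \<le> fact (j + 2) / s^2"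
    using s by (simp add: field_simps)
  then show ?thesis using True by (simp add: expinv_def s_def field_simps)
qed (simp add: expinv_def)

lemma expinv_nonneg: "0 \<le> expinv j t"
  by (simp add: expinv_def)

text \<open>On the two open half-lines this is calculus for an explicit formula; at 0 the quotient
  is at most a constant times |h| by \<open>expinv_le\<close>, and all functions of the family
  vanish there.\<close>

lemma DERIV_expinv:
  "(expinv j has_real_derivative (expinv (j + 2) t - real j * expinv (j + 1) t)) (at t)"
proof -
  consider "t > 0" | "t < 0" | "t = 0" by linarith
  then show ?thesis
  proof cases
    case 1
    have *: "((\<lambda>t. (1 / t) ^ j * exp (- (1 / t))) has_real_derivative
       (expinv (j + 2) t - real j * expinv (j + 1) t)) (at t)"
      using 1 power_eq_if[of t "j - 1"] by (cases j)
       (auto intro!: derivative_eq_intros simp: expinv_def power2_eq_square divide_simps; simp add: algebra_simps)+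
    show ?thesis
      by (rule DERIV_cong_ev[THEN iffD1, OF refl _ refl *])
         (use 1 in \<open>auto simp: expinv_def eventually_nhds intro!: exI[of _ "{0<..}"]\<close>)
  next
    case 2
    have *: "((\<lambda>t. 0) has_real_derivative (expinv (j + 2) t - real j * expinv (j + 1) t)) (at t)"
      using 2 by (auto simp: expinv_def)
    show ?thesis
      by (rule DERIV_cong_ev[THEN iffD1, OF refl _ refl *])
         (use 2 in \<open>auto simp: expinv_def eventually_nhds intro!: exI[of _ "{..<0}"]\<close>)
  next
    case 3
    have "((\<lambda>h. (expinv j h - expinv j 0) / h) \<longlongrightarrow> 0) (at 0)"
    proof (rule Lim_null_comparison)
      show "\<forall>\<^sub>F h in at 0. norm ((expinv j h - expinv j 0) / h) \<le> fact (j + 2) * \<bar>h\<bar>"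
      proof (intro always_eventually allI)
        fix h :: real
        have "\<bar>expinv j h\<bar> \<le> fact (j + 2) * \<bar>h\<bar> * \<bar>h\<bar>"
          using expinv_le[of j h] expinv_nonneg[of j h] by (simp add: power2_eq_square mult.assoc)
        then show "norm ((expinv j h - expinv j 0) / h) \<le> fact (j + 2) * \<bar>h\<bar>"
          by (cases "h = 0") (auto simp: expinv_def[of _ 0] divide_simps)
      qed
      show "((\<lambda>h. fact (j + 2) * \<bar>h\<bar>) \<longlongrightarrow> 0) (at (0::real))"
        by (auto intro!: tendsto_eq_intros)
    qed
    then show ?thesis using 3 by (simp add: has_field_derivative_iff expinv_def)
  qed
qed

text \<open>For j = 0 this is the classical profile exp(-1/(1 - |x|^2)) on the unit ball. The index
  is kept because the partial derivatives of \<open>bump j\<close> are polynomials times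
  \<open>bump (j + 1)\<close> and \<open>bump (j + 2)\<close>, so smoothness of all members follows
  by one induction.\<close>

definition bump :: "nat \<Rightarrow> real ^ 'n::finite \<Rightarrow> real" where
  "bump j x = expinv j (1 - x \<bullet> x)"

lemma bump_has_derivative:
  "(bump j has_derivative (\<lambda>h. (bump (j + 2) x - real j * bump (j + 1) x) * (- (2 * (x \<bullet> h))))) (at x)"
proof -
  have "((\<lambda>x. 1 - x \<bullet> x) has_derivative (\<lambda>h. - (2 * (x \<bullet> h)))) (at x)"
    by (auto intro!: derivative_eq_intros simp: inner_commute)
  from has_derivative_compose[OF this DERIV_expinv[of j "1 - x \<bullet> x", unfolded has_field_derivative_def]]
  show ?thesis unfolding bump_def .
qed

lemma smooth_bump: "smooth (bump j :: real ^ 'n::finite \<Rightarrow> real)"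
proof -
  have "C_k m (bump j :: real ^ 'n \<Rightarrow> real)" for m
  proof (induction m arbitrary: j)
    case 0
    then show ?case using bump_has_derivative
      by (auto simp: continuous_on_eq_continuous_at intro: has_derivative_continuous)
  next
    case (Suc m)
    have "partial k (bump j) = (\<lambda>x. (bump (j + 2) x + (- real j) * bump (j + 1) x) * (- 2 * x $ k))" for k :: 'n
      by (intro ext) (simp add: partial_eq[OF bump_has_derivative] inner_axis)
    then have "C_k m (partial k (bump j))" for k :: 'n
      by (simp only:) (intro C_k_mult C_k_add C_k_const C_k_nth Suc)
    with bump_has_derivative show ?case by (auto simp: differentiable_def)
  qed
  then show ?thesis by (simp add: smooth_def)
qed

lemma bump_outside: "norm x \<ge> 1 \<Longrightarrow> bump j x = 0"
  by (simp add: bump_def expinv_def dot_square_norm not_less one_le_power)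

lemma bump_nonneg: "0 \<le> bump j x"
  by (simp add: bump_def expinv_nonneg)

lemma bump_0: "bump 0 0 > 0"
  by (simp add: bump_def expinv_def)

subsection \<open>Test functions\<close>

text \<open>Compact support expressed by a radius: in this form it passes through products, sums,
  affine substitutions and convolutions by the triangle inequality.\<close>

lemma test_fun_iff: "test_fun \<psi> \<longleftrightarrow> smooth \<psi> \<and> (\<exists>R>0. \<forall>x. R < norm x \<longrightarrow> \<psi> x = 0)"
proof
  assume t: "test_fun \<psi>"
  then have "bounded (closure {x. \<psi> x \<noteq> 0})" by (simp add: test_fun_def compact_imp_bounded)
  then obtain R where "R > 0" "\<forall>x\<in>closure {x. \<psi> x \<noteq> 0}. norm x \<le> R"
    unfolding bounded_pos by auto
  moreover have "{x. \<psi> x \<noteq> 0} \<subseteq> closure {x. \<psi> x \<noteq> 0}" by (rule closure_subset)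
  ultimately have "\<forall>x. R < norm x \<longrightarrow> \<psi> x = 0" by force
  with t \<open>R > 0\<close> show "smooth \<psi> \<and> (\<exists>R>0. \<forall>x. R < norm x \<longrightarrow> \<psi> x = 0)"
    by (auto simp: test_fun_def smooth_def)
next
  assume "smooth \<psi> \<and> (\<exists>R>0. \<forall>x. R < norm x \<longrightarrow> \<psi> x = 0)"
  then obtain R where s: "smooth \<psi>" and R: "\<And>x. R < norm x \<Longrightarrow> \<psi> x = 0" by auto
  have "closure {x. \<psi> x \<noteq> 0} \<subseteq> cball 0 R"
    by (rule closure_minimal) (use R in \<open>force simp: dist_norm not_less\<close>)+
  then have "bounded (closure {x. \<psi> x \<noteq> 0})" using bounded_cball bounded_subset by blast
  with s show "test_fun \<psi>" by (auto simp: test_fun_def smooth_def compact_eq_bounded_closed)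
qed

lemma test_fun_smooth: "test_fun \<psi> \<Longrightarrow> smooth \<psi>"
  by (simp add: test_fun_iff)

lemma test_funE:
  assumes "test_fun \<psi>"
  obtains R where "R > 0" "\<And>x. R < norm x \<Longrightarrow> \<psi> x = 0" "\<And>x k. R < norm x \<Longrightarrow> partial k \<psi> x = 0"
proof -
  obtain R where R: "R > 0" "\<And>x. R < norm x \<Longrightarrow> \<psi> x = 0" using assms by (auto simp: test_fun_iff)
  have "partial k \<psi> x = 0" if "R < norm x" for x k
    by (rule partial_eq_0_outside[of "cball 0 R"]) (use that R in auto)
  with that R show thesis by blast
qed

lemma test_fun_partial: "test_fun \<psi> \<Longrightarrow> test_fun (partial k \<psi>)"
  by (metis test_fun_iff smooth_partial test_funE)

lemma test_fun_mult: "smooth f \<Longrightarrow> test_fun \<psi> \<Longrightarrow> test_fun (\<lambda>x. f x * \<psi> x)"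
  by (auto simp: test_fun_iff smooth_mult)

lemma test_fun_add: "test_fun f \<Longrightarrow> test_fun \<psi> \<Longrightarrow> test_fun (\<lambda>x. f x + \<psi> x)"
  unfolding test_fun_iff
  by (elim conjE exE, intro conjI smooth_add, assumption+) (rule exI[of _ "max R Ra" for R Ra], auto)

lemma test_fun_cmult: "test_fun \<psi> \<Longrightarrow> test_fun (\<lambda>x. c * \<psi> x)"
  by (simp add: test_fun_mult smooth_const)

lemma test_fun_affine:
  assumes "test_fun \<psi>" "c \<noteq> 0" shows "test_fun (\<lambda>x. \<psi> (c *\<^sub>R x + z))"
proof -
  obtain R where R: "R > 0" "\<And>x. R < norm x \<Longrightarrow> \<psi> x = 0" using assms by (auto simp: test_fun_iff)
  have "\<psi> (c *\<^sub>R x + z) = 0" if "(R + norm z) / \<bar>c\<bar> < norm x" for x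
  proof (rule R)
    have "R + norm z < \<bar>c\<bar> * norm x" using that assms by (simp add: field_simps)
    also have "\<bar>c\<bar> * norm x = norm ((c *\<^sub>R x + z) - z)" by simp
    also have "\<dots> \<le> norm (c *\<^sub>R x + z) + norm z" by (rule norm_triangle_ineq4)
    finally show "R < norm (c *\<^sub>R x + z)" by simp
  qed
  moreover have "(R + norm z) / \<bar>c\<bar> > 0" using R assms by (simp add: add_pos_nonneg)
  ultimately show ?thesis using assms by (auto simp: test_fun_iff smooth_affine)
qed

lemma test_fun_bump: "test_fun (bump j)"
  by (auto simp: test_fun_iff smooth_bump intro!: exI[of _ 1] bump_outside)

lemma test_fun_bounded:
  assumes "test_fun \<psi>" obtains B where "B > 0" "\<And>x. \<bar>\<psi> x\<bar> \<le> B"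
proof -
  obtain R where R: "R > 0" "\<And>x. R < norm x \<Longrightarrow> \<psi> x = 0" using assms by (auto simp: test_fun_iff)
  have "compact (\<psi> ` cball 0 R)"
    by (intro compact_continuous_image continuous_on_subset[OF smooth_continuous[OF test_fun_smooth[OF assms]]]) auto
  then obtain B where B: "B > 0" "\<forall>y\<in>\<psi> ` cball 0 R. norm y \<le> B"
    using compact_imp_bounded bounded_pos by metis
  have "\<bar>\<psi> x\<bar> \<le> B" for x
    using B R(2)[of x] by (cases "norm x \<le> R") auto
  with that B show thesis by blast
qed

subsection \<open>Integration on Euclidean space\<close>

lemma cball_measurable [measurable, simp]: "cball (a :: 'a::euclidean_space) r \<in> sets borel"
  by (rule borel_closed) simp

lemma nn_integral_lborel_affine:
  fixes f :: "'a::euclidean_space \<Rightarrow> ennreal"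
  assumes [measurable]: "f \<in> borel_measurable borel" and c: "c \<noteq> 0"
  shows "(LBINT\<^sup>+ x. f x) = ennreal (\<bar>c\<bar> ^ DIM('a)) * (LBINT\<^sup>+ x. f (t + c *\<^sub>R x))"
  by (subst lborel_affine[OF c, of t], subst nn_integral_density)
     (auto simp: nn_integral_distr nn_integral_cmult)

lemma integrable_lborel_affine:
  fixes f :: "'a::euclidean_space \<Rightarrow> real"
  assumes f: "integrable lborel f" and c: "c \<noteq> 0"
  shows "integrable lborel (\<lambda>x. f (t + c *\<^sub>R x))"
proof -
  have [measurable]: "f \<in> borel_measurable borel" using f by (auto dest: borel_measurable_integrable)
  have "ennreal (\<bar>c\<bar> ^ DIM('a)) * (LBINT\<^sup>+ x. norm (f (t + c *\<^sub>R x))) < \<infinity>"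
    using f c nn_integral_lborel_affine[of "\<lambda>x. ennreal (norm (f x))" c t] by (simp add: integrable_iff_bounded)
  then show ?thesis using c by (auto simp: integrable_iff_bounded ennreal_mult_less_top)
qed

lemma integral_lborel_affine:
  fixes f :: "'a::euclidean_space \<Rightarrow> real"
  assumes [measurable]: "f \<in> borel_measurable borel" and c: "c \<noteq> 0"
  shows "(LBINT x. f x) = \<bar>c\<bar> ^ DIM('a) * (LBINT x. f (t + c *\<^sub>R x))"
  by (subst lborel_affine[OF c, of t], subst integral_density)
     (auto simp: integral_distr)

lemma nn_integral_lborel_translate:
  fixes f :: "'a::euclidean_space \<Rightarrow> ennreal"
  assumes "f \<in> borel_measurable borel"
  shows "(LBINT\<^sup>+ x. f (t + x)) = (LBINT\<^sup>+ x. f x)"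
  using nn_integral_lborel_affine[OF assms, of 1 t] by simp

lemma integral_lborel_reflect:
  fixes f :: "'a::euclidean_space \<Rightarrow> real"
  assumes "f \<in> borel_measurable borel"
  shows "(LBINT y. f (x - y)) = (LBINT y. f y)"
  using integral_lborel_affine[OF assms, of "-1" x] by simp

lemma integral_lborel_translate:
  fixes f :: "'a::euclidean_space \<Rightarrow> real"
  assumes "f \<in> borel_measurable borel"
  shows "(LBINT y. f (x + y)) = (LBINT y. f y)"
  using integral_lborel_affine[OF assms, of 1 x] by simp

lemma integrable_lborel_translate:
  fixes f :: "'a::euclidean_space \<Rightarrow> real"
  shows "integrable lborel f \<Longrightarrow> integrable lborel (\<lambda>y. f (x + y))"
  using integrable_lborel_affine[of f 1 x] by simp

text \<open>Jensen's inequality for the square, that is, nonnegativity of the variance. If the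
  square of \<open>h\<close> is not integrable, the right-hand side is infinite. It replaces
  Minkowski's integral inequality throughout: for convolutions, segment averages and averages over
  cubes.\<close>

lemma square_integral_le_nn_integral:
  assumes "prob_space M" and [measurable]: "h \<in> borel_measurable M"
  shows "ennreal ((LINT y|M. h y)^2) \<le> (\<integral>\<^sup>+y. ennreal ((h y)^2) \<partial>M)"
proof -
  interpret prob_space M by fact
  show ?thesis
  proof (cases "integrable M (\<lambda>y. (h y)^2)")
    case True
    then have "integrable M h" by (rule square_integrable_imp_integrable[rotated]) simp
    with True have "(LINT y|M. h y)^2 \<le> (LINT y|M. (h y)^2)"
      using variance_eq[of h] variance_positive[of h] by simp
    also have "ennreal \<dots> = (\<integral>\<^sup>+y. ennreal ((h y)^2) \<partial>M)"
      using True by (simp add: nn_integral_eq_integral)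
    finally show ?thesis by (simp add: ennreal_leI)
  next
    case False
    then have "(\<integral>\<^sup>+y. ennreal ((h y)^2) \<partial>M) = \<infinity>"
      by (auto simp: integrable_iff_bounded not_less top_unique)
    then show ?thesis by simp
  qed
qed

section \<open>Local and global Lebesgue classes of Borel functions\<close>

definition L1l :: "(real ^ 'n::finite \<Rightarrow> real) \<Rightarrow> bool" where
  "L1l f \<longleftrightarrow> f \<in> borel_measurable borel \<and> (\<forall>R. integrable lborel (\<lambda>x. indicator (cball 0 R) x * f x))"

definition L2l :: "(real ^ 'n::finite \<Rightarrow> real) \<Rightarrow> bool" where
  "L2l f \<longleftrightarrow> f \<in> borel_measurable borel \<and> (\<forall>R. integrable lborel (\<lambda>x. indicator (cball 0 R) x * (f x)^2))"

definition L2 :: "(real ^ 'n::finite \<Rightarrow> real) \<Rightarrow> bool" where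
  "L2 f \<longleftrightarrow> f \<in> borel_measurable borel \<and> integrable lborel (\<lambda>x. (f x)^2)"

text \<open>The class of kernels and localizing factors: a locally integrable function may be
  integrated against every member, and test functions as well as indicators of balls and cubes
  belong to it.\<close>

definition bcs :: "(real ^ 'n::finite \<Rightarrow> real) \<Rightarrow> bool" where
  "bcs f \<longleftrightarrow> f \<in> borel_measurable borel \<and> (\<exists>B. \<forall>x. \<bar>f x\<bar> \<le> B) \<and> (\<exists>R. \<forall>x. R < norm x \<longrightarrow> f x = 0)"

lemma L1l_borel [measurable_dest]: "L1l f \<Longrightarrow> f \<in> borel_measurable borel" by (simp add: L1l_def)
lemma L2l_borel [measurable_dest]: "L2l f \<Longrightarrow> f \<in> borel_measurable borel" by (simp add: L2l_def)
lemma L2_borel [measurable_dest]: "L2 f \<Longrightarrow> f \<in> borel_measurable borel" by (simp add: L2_def)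
lemma bcs_borel [measurable_dest]: "bcs f \<Longrightarrow> f \<in> borel_measurable borel" by (simp add: bcs_def)

lemma test_fun_bcs: "test_fun \<psi> \<Longrightarrow> bcs \<psi>"
  by (metis bcs_def test_fun_bounded test_funE smooth_borel test_fun_smooth)

lemma bcs_mult: "bcs f \<Longrightarrow> bcs g \<Longrightarrow> bcs (\<lambda>x. f x * g x)"
proof -
  assume f: "bcs f" and g: "bcs g"
  obtain B C R where B: "\<And>x. \<bar>f x\<bar> \<le> B" and C: "\<And>x. \<bar>g x\<bar> \<le> C" and R: "\<And>x. R < norm x \<Longrightarrow> f x = 0"
    using f g unfolding bcs_def by metis
  have "\<bar>f x * g x\<bar> \<le> B * C" for x
    unfolding abs_mult by (intro mult_mono B C) (use B[of x] in auto)
  moreover have "(\<lambda>x. f x * g x) \<in> borel_measurable borel" using f g by measurable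
  ultimately show ?thesis unfolding bcs_def using R by (metis mult_zero_left)
qed

lemma bcs_indicator: "bcs (indicator (cball 0 R) :: real ^ 'n::finite \<Rightarrow> real)"
  unfolding bcs_def
proof (intro conjI)
  show "\<exists>B. \<forall>x::real ^ 'n. \<bar>indicator (cball 0 R) x :: real\<bar> \<le> B" by (rule exI[of _ 1]) (simp add: indicator_def)
  show "\<exists>Q. \<forall>x::real ^ 'n. Q < norm x \<longrightarrow> (indicator (cball 0 R) x :: real) = 0" by (rule exI[of _ R]) simp
qed measurable

lemma L1l_bcs:
  assumes f: "L1l f" and g: "bcs g"
  shows "integrable lborel (\<lambda>x. f x * g x)"
proof -
  have [measurable]: "f \<in> borel_measurable borel" "g \<in> borel_measurable borel"
    using f g by measurable
  obtain B R where B: "\<And>x. \<bar>g x\<bar> \<le> B" and R: "\<And>x. R < norm x \<Longrightarrow> g x = 0"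
    using g unfolding bcs_def by metis
  show ?thesis
  proof (rule Bochner_Integration.integrable_bound)
    show "integrable lborel (\<lambda>x. B * (indicator (cball 0 R) x * f x))"
      using f by (intro integrable_mult_right) (auto simp: L1l_def)
    have "norm (f x * g x) \<le> norm (B * (indicator (cball 0 R) x * f x))" for x
      using R[of x] B[of x] mult_left_mono[OF B[of x], of "\<bar>f x\<bar>"]
      by (cases "norm x \<le> R") (auto simp: abs_mult mult.commute)
    then show "AE x in lborel. norm (f x * g x) \<le> norm (B * (indicator (cball 0 R) x * f x))" by simp
  qed measurable
qed

lemma L2_mult_integrable:
  assumes "L2 f" "L2 g" shows "integrable lborel (\<lambda>x. f x * g x)"
proof (rule Bochner_Integration.integrable_bound)
  show "integrable lborel (\<lambda>x. (f x)^2 + (g x)^2)"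
    using assms by (auto simp: L2_def intro!: borel_measurable_indicator)
  show "(\<lambda>x. f x * g x) \<in> borel_measurable lborel" using assms by measurable
  have "norm (f x * g x) \<le> norm ((f x)^2 + (g x)^2)" for x
    using sum_squares_bound[of "\<bar>f x\<bar>" "\<bar>g x\<bar>"] mult_nonneg_nonneg[of "\<bar>f x\<bar>" "\<bar>g x\<bar>"]
    by (simp add: abs_mult del: mult_nonneg_nonneg)
  then show "AE x in lborel. norm (f x * g x) \<le> norm ((f x)^2 + (g x)^2)" by simp
qed

lemma L2_bound:
  assumes "g \<in> borel_measurable borel" "integrable lborel h" "\<And>x. (g x)^2 \<le> h x"
  shows "L2 g"
  unfolding L2_def
  by (intro conjI assms(1) Bochner_Integration.integrable_bound[OF assms(2)])
     (use assms in \<open>auto intro!: AE_I2 order_trans[OF assms(3)]\<close>)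

lemma L2_add: assumes "L2 f" "L2 g" shows "L2 (\<lambda>x. f x + g x)"
proof (rule L2_bound)
  show "(f x + g x)^2 \<le> 2 * (f x)^2 + 2 * (g x)^2" for x
    using sum_squares_bound[of "f x" "g x"] by (simp add: power2_sum)
  show "(\<lambda>x. f x + g x) \<in> borel_measurable borel" using assms by measurable
qed (use assms in \<open>auto simp: L2_def\<close>)

lemma L2_cmult: "L2 f \<Longrightarrow> L2 (\<lambda>x. c * f x)"
  by (auto simp: L2_def power_mult_distrib)

lemma L2_0: "L2 (\<lambda>x. 0)" by (simp add: L2_def)

lemma L2_uminus: "L2 f \<Longrightarrow> L2 (\<lambda>x. - f x)"
  using L2_cmult[of f "-1"] by simp

lemma L2_diff: "L2 f \<Longrightarrow> L2 g \<Longrightarrow> L2 (\<lambda>x. f x - g x)"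
  using L2_add[of f "\<lambda>x. - g x"] L2_uminus[of g] by simp

lemma L2_sum: "(\<And>i. i \<in> I \<Longrightarrow> L2 (f i)) \<Longrightarrow> L2 (\<lambda>x. \<Sum>i\<in>I. f i x)"
  by (induction I rule: infinite_finite_induct) (auto intro: L2_0 L2_add)

lemma L2_bounded_mult:
  assumes f: "L2 f" and [measurable]: "g \<in> borel_measurable borel" and B: "\<And>x. \<bar>g x\<bar> \<le> B"
  shows "L2 (\<lambda>x. f x * g x)"
proof (rule L2_bound)
  show "(\<lambda>x. f x * g x) \<in> borel_measurable borel" using f by measurable
  show "integrable lborel (\<lambda>x. B^2 * (f x)^2)" using f by (auto simp: L2_def intro!: borel_measurable_indicator)
  have "(g x)^2 \<le> B^2" for x using B[of x] abs_le_square_iff[of "g x" B] by auto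
  then show "(f x * g x)^2 \<le> B^2 * (f x)^2" for x
    by (simp add: power_mult_distrib mult.commute[of "(f x)^2"] mult_right_mono)
qed

lemma bcs_L2: assumes "bcs f" shows "L2 f"
proof -
  obtain B R where B: "\<And>x. \<bar>f x\<bar> \<le> B" and R: "\<And>x. R < norm x \<Longrightarrow> f x = 0"
    using assms unfolding bcs_def by metis
  show ?thesis
  proof (rule L2_bound)
    show "f \<in> borel_measurable borel" using assms by measurable
    show "integrable lborel (\<lambda>x::real ^ 'a. B^2 * indicator (cball 0 R) x)"
      by (intro integrable_mult_right integrable_real_indicator)
         (auto simp: emeasure_lborel_cball_finite[unfolded infinity_ennreal_def])
    have "(f x)^2 \<le> B^2" for x using B[of x] abs_le_square_iff[of "f x" B] by auto
    then show "(f x)^2 \<le> B^2 * indicator (cball 0 R) x" for x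
      using R[of x] by (auto simp: indicator_def)
  qed
qed

lemma L2l_bcs: assumes f: "L2l f" and g: "bcs g" shows "L2 (\<lambda>x. f x * g x)"
proof -
  obtain B R where B: "\<And>x. \<bar>g x\<bar> \<le> B" and R: "\<And>x. R < norm x \<Longrightarrow> g x = 0"
    using g unfolding bcs_def by metis
  show ?thesis
  proof (rule L2_bound)
    show "(\<lambda>x. f x * g x) \<in> borel_measurable borel" using f g by measurable
    show "integrable lborel (\<lambda>x. B^2 * (indicator (cball 0 R) x * (f x)^2))"
      using f by (intro integrable_mult_right) (auto simp: L2l_def)
    have "(g x)^2 \<le> B^2" for x using B[of x] abs_le_square_iff[of "g x" B] by auto
    then show "(f x * g x)^2 \<le> B^2 * (indicator (cball 0 R) x * (f x)^2)" for x
      using R[of x] by (auto simp: indicator_def power_mult_distrib mult.commute[of "(f x)^2"] mult_right_mono)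
  qed
qed

lemma L2l_iff: "L2l f \<longleftrightarrow> f \<in> borel_measurable borel \<and> (\<forall>R. L2 (\<lambda>x. f x * indicator (cball 0 R) x))"
proof -
  have "(\<lambda>x. (f x * indicator (cball 0 R) x)^2) = (\<lambda>x. indicator (cball 0 R) x * (f x)^2)" for R
    by (auto simp: indicator_def)
  then show ?thesis by (auto simp: L2l_def L2_def intro!: borel_measurable_times borel_measurable_indicator)
qed

lemma L2_L2l: "L2 f \<Longrightarrow> L2l f"
  unfolding L2l_iff by (intro conjI allI L2_bounded_mult[where B=1]) (auto simp: L2_def intro!: borel_measurable_indicator)

lemma L2l_add: "L2l f \<Longrightarrow> L2l g \<Longrightarrow> L2l (\<lambda>x. f x + g x)"
  unfolding L2l_iff by (auto simp: distrib_right intro: L2_add)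

lemma L2l_cmult: "L2l f \<Longrightarrow> L2l (\<lambda>x. c * f x)"
  unfolding L2l_iff by (auto simp: mult.assoc intro: L2_cmult)

lemma L2l_sum: "(\<And>i. i \<in> I \<Longrightarrow> L2l (f i)) \<Longrightarrow> L2l (\<lambda>x. \<Sum>i\<in>I. f i x)"
  by (induction I rule: infinite_finite_induct) (auto intro: L2l_add L2_L2l L2_0)

lemma L2l_mult_L1l: assumes "L2l f" "L2l g" shows "L1l (\<lambda>x. f x * g x)"
  unfolding L1l_def
proof (intro conjI allI)
  show "(\<lambda>x. f x * g x) \<in> borel_measurable borel" using assms by measurable
  fix R
  have "(\<lambda>x. indicator (cball 0 R) x * (f x * g x)) =
    (\<lambda>x. (f x * indicator (cball 0 R) x) * (g x * indicator (cball 0 R) x))"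
    by (auto simp: indicator_def)
  then show "integrable lborel (\<lambda>x. indicator (cball 0 R) x * (f x * g x))"
    using assms by (auto simp: L2l_iff intro!: L2_mult_integrable)
qed

lemma continuous_L2l:
  assumes "continuous_on UNIV f" shows "L2l f"
  unfolding L2l_iff
proof (intro conjI allI)
  show m: "f \<in> borel_measurable borel" using assms by (rule borel_measurable_continuous_onI)
  fix R
  have "compact (f ` cball 0 R)"
    by (intro compact_continuous_image continuous_on_subset[OF assms]) auto
  then obtain B where B: "\<forall>y\<in>f ` cball 0 R. norm y \<le> B"
    using compact_imp_bounded bounded_iff by metis
  have "bcs (\<lambda>x. f x * indicator (cball 0 R) x)"
    unfolding bcs_def using m B
    by (intro conjI exI[of _ "max B 0"] exI[of _ R]) (auto simp: indicator_def le_max_iff_disj intro!: borel_measurable_times)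
  then show "L2 (\<lambda>x. f x * indicator (cball 0 R) x)" by (rule bcs_L2)
qed

lemma L2l_L1l: "L2l f \<Longrightarrow> L1l f"
  using L2l_mult_L1l[of f "\<lambda>x. 1"] continuous_L2l[of "\<lambda>x. 1"] by simp

lemma L1l_add: "L1l f \<Longrightarrow> L1l g \<Longrightarrow> L1l (\<lambda>x. f x + g x)"
  by (auto simp: L1l_def distrib_left)

lemma L1l_cmult: "L1l f \<Longrightarrow> L1l (\<lambda>x. c * f x)"
  by (auto simp: L1l_def mult.left_commute)

lemma L1l_diff: "L1l f \<Longrightarrow> L1l g \<Longrightarrow> L1l (\<lambda>x. f x - g x)"
  using L1l_add[of f "\<lambda>x. - 1 * g x"] L1l_cmult[of g "-1"] by simp

lemma L1l_sum: "(\<And>i. i \<in> I \<Longrightarrow> L1l (f i)) \<Longrightarrow> L1l (\<lambda>x. \<Sum>i\<in>I. f i x)"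
  by (induction I rule: infinite_finite_induct) (auto intro: L1l_add L2l_L1l L2_L2l L2_0)

lemma L2l_affine: assumes f: "L2l f" and c: "c \<noteq> 0" shows "L2l (\<lambda>x. f (w + c *\<^sub>R x))"
  unfolding L2l_iff
proof (intro conjI allI)
  have [measurable]: "f \<in> borel_measurable borel" using f by measurable
  show [measurable]: "(\<lambda>x. f (w + c *\<^sub>R x)) \<in> borel_measurable borel" by measurable
  fix R
  have "integrable lborel (\<lambda>x. indicator (cball 0 (norm w + \<bar>c\<bar> * R)) (w + c *\<^sub>R x) * (f (w + c *\<^sub>R x))^2)"
    using f c by (intro integrable_lborel_affine) (auto simp: L2l_def)
  then show "L2 (\<lambda>x. f (w + c *\<^sub>R x) * indicator (cball 0 R) x)"
  proof (rule L2_bound[rotated])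
    fix x :: "real ^ 'a"
    have "norm (w + c *\<^sub>R x) \<le> norm w + \<bar>c\<bar> * R" if "norm x \<le> R"
      using norm_triangle_ineq[of w "c *\<^sub>R x"] mult_left_mono[OF that, of "\<bar>c\<bar>"] by simp
    then show "(f (w + c *\<^sub>R x) * indicator (cball 0 R) x)^2
        \<le> indicator (cball 0 (norm w + \<bar>c\<bar> * R)) (w + c *\<^sub>R x) * (f (w + c *\<^sub>R x))^2"
      by (auto simp: indicator_def)
  qed measurable
qed

lemma L1l_affine: assumes f: "L1l f" and c: "c \<noteq> 0" shows "L1l (\<lambda>x. f (w + c *\<^sub>R x))"
  unfolding L1l_def
proof (intro conjI allI)
  have [measurable]: "f \<in> borel_measurable borel" using f by measurable
  show [measurable]: "(\<lambda>x. f (w + c *\<^sub>R x)) \<in> borel_measurable borel" by measurable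
  fix R
  have "integrable lborel (\<lambda>x. indicator (cball 0 (norm w + \<bar>c\<bar> * R)) (w + c *\<^sub>R x) * (f (w + c *\<^sub>R x)))"
    using f c by (intro integrable_lborel_affine) (auto simp: L1l_def)
  then show "integrable lborel (\<lambda>x. indicator (cball 0 R) x * f (w + c *\<^sub>R x))"
  proof (rule Bochner_Integration.integrable_bound)
    have "norm (w + c *\<^sub>R x) \<le> norm w + \<bar>c\<bar> * R" if "norm x \<le> R" for x :: "real ^ 'a"
      using norm_triangle_ineq[of w "c *\<^sub>R x"] mult_left_mono[OF that, of "\<bar>c\<bar>"] by simp
    then have "norm (indicator (cball 0 R) x * f (w + c *\<^sub>R x))
        \<le> norm (indicator (cball 0 (norm w + \<bar>c\<bar> * R)) (w + c *\<^sub>R x) * (f (w + c *\<^sub>R x)))" for x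
      by (auto simp: indicator_def)
    then show "AE x in lborel. norm (indicator (cball 0 R) x * f (w + c *\<^sub>R x))
        \<le> norm (indicator (cball 0 (norm w + \<bar>c\<bar> * R)) (w + c *\<^sub>R x) * (f (w + c *\<^sub>R x)))" by simp
  qed measurable
qed

subsection \<open>Approximation in \<open>L^2\<close>\<close>

text \<open>Two successive approximations with error e/4 in the squared norm: clip the values at
  height k and cut off at radius k, both continuously; replace \<open>g\<close> inside the clipping
  by continuous functions that converge to it almost everywhere. The clipping supplies the
  dominating function for the second limit.\<close>

lemma L2_approx_continuous:
  fixes g :: "real ^ 'n::finite \<Rightarrow> real"
  assumes g: "L2 g" and e: "e > 0"
  obtains h R where "continuous_on UNIV h" "\<And>x. R < norm x \<Longrightarrow> h x = 0"
    "integrable lborel (\<lambda>x. (g x - h x)^2)" "(LBINT x. (g x - h x)^2) < e"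
proof -
  have [measurable]: "g \<in> borel_measurable borel" using g by measurable
  then have "g \<in> borel_measurable lebesgue" by (simp add: measurable_completion)
  \<comment> \<open>This yields continuous functions that converge to \<open>g\<close> off a
    negligible set, but without any bound; the truncation at k restores one.\<close>
  then have "g measurable_on UNIV" by (rule lebesgue_measurable_imp_measurable_on) simp
  then obtain N h where N: "negligible N" and h: "\<And>n. continuous_on UNIV (h n)"
    and lim: "\<And>x. x \<notin> N \<Longrightarrow> (\<lambda>n. h n x) \<longlonglongrightarrow> g x"
    unfolding measurable_on_def by auto
  have [measurable]: "h n \<in> borel_measurable borel" for n
    using h by (rule borel_measurable_continuous_onI)
  have "AE x in lebesgue. x \<notin> N" using N by (auto simp: negligible_iff_null_sets intro: AE_not_in)
  then have AEN: "AE x in lborel. x \<notin> N" by (simp add: AE_completion_iff)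
  define clp where "clp k t = max (- real k) (min (real k) t)" for k :: nat and t :: real
  define chi where "chi k x = max 0 (min 1 (real k - norm x))" for k :: nat and x :: "real ^ 'n"
  have clp_cont: "continuous_on A (clp k)" for k A unfolding clp_def by (intro continuous_intros)
  have chi_cont: "continuous_on A (chi k)" for k A unfolding chi_def by (intro continuous_intros)
  have [measurable]: "clp k \<in> borel_measurable borel" "chi k \<in> borel_measurable borel" for k
    by (auto intro!: borel_measurable_continuous_onI clp_cont chi_cont)
  have gk_le: "(g x - clp k (g x) * chi k x)^2 \<le> (g x)^2" for k x
  proof -
    have c: "0 \<le> chi k x" "chi k x \<le> 1" by (auto simp: chi_def)
    have "\<bar>g x - clp k (g x) * chi k x\<bar> \<le> \<bar>g x\<bar>"
    proof (cases "g x \<ge> 0")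
      case True
      then have "0 \<le> clp k (g x)" "clp k (g x) \<le> g x" by (auto simp: clp_def)
      then have "0 \<le> clp k (g x) * chi k x" "clp k (g x) * chi k x \<le> clp k (g x)"
        using c by (auto intro: mult_left_le)
      with \<open>clp k (g x) \<le> g x\<close> True show ?thesis by auto
    next
      case False
      then have "clp k (g x) \<le> 0" "clp k (g x) \<ge> g x" by (auto simp: clp_def)
      moreover have "clp k (g x) * chi k x \<le> 0" using c \<open>clp k (g x) \<le> 0\<close> by (simp add: mult_nonpos_nonneg)
      moreover have "clp k (g x) * chi k x \<ge> clp k (g x)"
        using mult_left_le[of "chi k x" "- clp k (g x)"] c \<open>clp k (g x) \<le> 0\<close> by simp
      ultimately show ?thesis using False by auto
    qed
    then show ?thesis by (simp add: abs_le_square_iff)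
  qed
  have "(\<lambda>k. LINT x|lborel. (g x - clp k (g x) * chi k x)^2) \<longlonglongrightarrow> (LINT x::real ^ 'n|lborel. (0::real)) "
  proof (rule integral_dominated_convergence[where w="\<lambda>x. (g x)^2"])
    show "integrable lborel (\<lambda>x. (g x)^2)" using g by (simp add: L2_def)
    show "AE x in lborel. (\<lambda>k. (g x - clp k (g x) * chi k x)^2) \<longlonglongrightarrow> 0"
    proof (rule AE_I2)
      fix x
      have "eventually (\<lambda>k. (g x - clp k (g x) * chi k x)^2 = 0) sequentially"
        using eventually_ge_at_top[of "nat \<lceil>\<bar>g x\<bar> + norm x + 1\<rceil>"]
      proof eventually_elim
        case (elim k)
        then have "real k \<ge> \<bar>g x\<bar> + norm x + 1" by linarith
        then have "\<bar>g x\<bar> \<le> real k" "norm x + 1 \<le> real k" using norm_ge_zero[of x] by linarith+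
        then have "clp k (g x) = g x" "chi k x = 1" by (auto simp: clp_def chi_def max_def min_def)
        then show ?case by simp
      qed
      then show "(\<lambda>k. (g x - clp k (g x) * chi k x)^2) \<longlonglongrightarrow> 0" by (rule tendsto_eventually)
    qed
    show "AE x in lborel. norm ((g x - clp k (g x) * chi k x)^2) \<le> (g x)^2" for k
      using gk_le by simp
  qed measurable
  then have "eventually (\<lambda>k. (LBINT x. (g x - clp k (g x) * chi k x)^2) < e / 4) sequentially"
    using e by (intro order_tendstoD(2)[of _ "LINT x::real ^ 'n|lborel. (0::real)"]) auto
  then obtain k where k: "(LBINT x. (g x - clp k (g x) * chi k x)^2) < e / 4"
    by (auto simp: eventually_sequentially)
  have int1: "integrable lborel (\<lambda>x. (g x - clp k (g x) * chi k x)^2)"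
    by (rule Bochner_Integration.integrable_bound[of _ "\<lambda>x. (g x)^2"]) (use g gk_le in \<open>auto simp: L2_def\<close>)
  have clp_b: "\<bar>clp k t\<bar> \<le> real k" for t by (auto simp: clp_def)
  have bnd: "(clp k t * chi k x - clp k s * chi k x)^2 \<le> (2 * real k)^2 * indicator (cball 0 (real k)) x" for t s x
  proof (cases "norm x \<le> real k")
    case True
    have "\<bar>clp k t * chi k x - clp k s * chi k x\<bar> = \<bar>clp k t - clp k s\<bar> * \<bar>chi k x\<bar>"
      by (simp add: abs_mult[symmetric] algebra_simps)
    also have "\<dots> \<le> (2 * real k) * 1"
      by (intro mult_mono) (use clp_b[of t] clp_b[of s] in \<open>auto simp: chi_def\<close>)
    finally have "\<bar>clp k t * chi k x - clp k s * chi k x\<bar> \<le> \<bar>2 * real k\<bar>" by simp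
    from iffD1[OF abs_le_square_iff this] show ?thesis using True by simp
  qed (auto simp: chi_def)
  have intb: "integrable lborel (\<lambda>x::real ^ 'n. (2 * real k)^2 * indicator (cball 0 (real k)) x)"
    by (intro integrable_mult_right integrable_real_indicator) (auto simp: emeasure_lborel_cball_finite[unfolded infinity_ennreal_def])
  have "(\<lambda>n. LINT x|lborel. (clp k (g x) * chi k x - clp k (h n x) * chi k x)^2) \<longlonglongrightarrow> (LINT x::real ^ 'n|lborel. (0::real))"
  proof (rule integral_dominated_convergence[OF _ _ intb])
    show "AE x in lborel. (\<lambda>n. (clp k (g x) * chi k x - clp k (h n x) * chi k x)^2) \<longlonglongrightarrow> 0"
      using AEN
    proof eventually_elim
      case (elim x)
      have "(\<lambda>n. clp k (h n x)) \<longlonglongrightarrow> clp k (g x)"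
        using clp_cont[of UNIV k] lim[OF elim] by (rule continuous_on_tendsto_compose) auto
      then have "(\<lambda>n. (clp k (g x) * chi k x - clp k (h n x) * chi k x)^2)
          \<longlonglongrightarrow> (clp k (g x) * chi k x - clp k (g x) * chi k x)^2"
        by (intro tendsto_intros)
      then show ?case by simp
    qed
    show "AE x in lborel. norm ((clp k (g x) * chi k x - clp k (h n x) * chi k x)^2)
      \<le> (2 * real k)^2 * indicator (cball 0 (real k)) x" for n
      using bnd by simp
  qed measurable
  then have "eventually (\<lambda>n. (LBINT x. (clp k (g x) * chi k x - clp k (h n x) * chi k x)^2) < e / 4) sequentially"
    using e by (intro order_tendstoD(2)[of _ "LINT x::real ^ 'n|lborel. (0::real)"]) auto
  then obtain n where n: "(LBINT x. (clp k (g x) * chi k x - clp k (h n x) * chi k x)^2) < e / 4"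
    by (auto simp: eventually_sequentially)
  have int2: "integrable lborel (\<lambda>x. (clp k (g x) * chi k x - clp k (h n x) * chi k x)^2)"
    by (rule Bochner_Integration.integrable_bound[OF intb]) (use bnd in auto)
  define H where "H x = clp k (h n x) * chi k x" for x
  have [measurable]: "H \<in> borel_measurable borel" unfolding H_def by measurable
  have le: "(g x - H x)^2 \<le> 2 * (g x - clp k (g x) * chi k x)^2 + 2 * (clp k (g x) * chi k x - clp k (h n x) * chi k x)^2" for x
    using sum_squares_bound[of "g x - clp k (g x) * chi k x" "clp k (g x) * chi k x - clp k (h n x) * chi k x"]
      power2_sum[of "g x - clp k (g x) * chi k x" "clp k (g x) * chi k x - clp k (h n x) * chi k x"]
    by (simp add: H_def)
  have int: "integrable lborel (\<lambda>x. (g x - H x)^2)"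
    by (rule Bochner_Integration.integrable_bound[OF Bochner_Integration.integrable_add[OF
         integrable_mult_right[OF int1, of 2] integrable_mult_right[OF int2, of 2]]])
       (use le in \<open>auto\<close>)
  show thesis
  proof (rule that[of H "real k"])
    show "continuous_on UNIV H" unfolding H_def
      by (intro continuous_intros chi_cont continuous_on_compose2[OF clp_cont h]) auto
    show "H x = 0" if "real k < norm x" for x using that by (auto simp: H_def chi_def)
    show "integrable lborel (\<lambda>x. (g x - H x)^2)" by fact
    have "(LBINT x. (g x - H x)^2) \<le> (LBINT x. 2 * (g x - clp k (g x) * chi k x)^2
        + 2 * (clp k (g x) * chi k x - clp k (h n x) * chi k x)^2)"
      by (intro integral_mono int Bochner_Integration.integrable_add integrable_mult_right int1 int2 le)
    also have "\<dots> < e" using k n e int1 int2 by simp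
    finally show "(LBINT x. (g x - H x)^2) < e" .
  qed
qed

text \<open>For a continuous, compactly supported approximation the claim is uniform continuity on a
  ball, and the approximation error is the same before and after translation. Three terms, each with
  factor 3 from squaring a sum and each of size e/9, add up to e.\<close>

lemma L2_translation_continuous:
  fixes g :: "real ^ 'n::finite \<Rightarrow> real"
  assumes g: "L2 g" and e: "e > 0"
  obtains d where "d > 0" "\<And>y. norm y < d \<Longrightarrow> (LBINT\<^sup>+ x. ennreal ((g (x - y) - g x)^2)) \<le> ennreal e"
proof -
  obtain h R where h: "continuous_on UNIV h" and R: "\<And>x. R < norm x \<Longrightarrow> h x = 0"
    and i: "integrable lborel (\<lambda>x. (g x - h x)^2)" and ie: "(LBINT x. (g x - h x)^2) < e / 9"
    using L2_approx_continuous[OF g, of "e / 9"] e by auto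
  have [measurable]: "g \<in> borel_measurable borel" using g by measurable
  have [measurable]: "h \<in> borel_measurable borel" using h by (rule borel_measurable_continuous_onI)
  define V where "V = measure lborel (cball (0::real ^ 'n) (R + 1))"
  have V: "V \<ge> 0" "emeasure lborel (cball (0::real ^ 'n) (R + 1)) = ennreal V"
    unfolding V_def using emeasure_lborel_cball_finite[of "0::real ^ 'n" "R + 1"]
    by (auto simp: emeasure_eq_ennreal_measure)
  \<comment> \<open>Chosen so that the modulus of continuity, squared and integrated over the ball
    of radius R + 1, costs at most e/9; the summand 1 guards against a ball of volume zero.\<close>
  define \<eta> where "\<eta> = sqrt (e / (9 * (V + 1)))"
  have \<eta>: "\<eta> > 0" "\<eta>^2 = e / (9 * (V + 1))" using e V by (auto simp: \<eta>_def)
  have "uniformly_continuous_on (cball 0 (R + 2)) h"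
    by (intro compact_uniformly_continuous continuous_on_subset[OF h]) auto
  then obtain d where d: "d > 0" "\<And>x x'. x \<in> cball 0 (R + 2) \<Longrightarrow> x' \<in> cball 0 (R + 2) \<Longrightarrow> dist x' x < d \<Longrightarrow> dist (h x') (h x) < \<eta>"
    using \<eta>(1) unfolding uniformly_continuous_on_def by metis
  show thesis
  proof (rule that[of "min d 1"])
    show "min d 1 > 0" using d by simp
    fix y :: "real ^ 'n" assume y: "norm y < min d 1"
    have hb: "(h (x - y) - h x)^2 \<le> \<eta>^2 * indicator (cball 0 (R + 1)) x" for x
    proof (cases "norm x \<le> R + 1")
      case True
      have "norm (x - y) \<le> norm x + norm y" by (rule norm_triangle_ineq4)
      then have "dist (h (x - y)) (h x) < \<eta>" using True y by (intro d(2)) auto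
      then have "\<bar>h (x - y) - h x\<bar> \<le> \<bar>\<eta>\<bar>" by (simp add: dist_real_def)
      then show ?thesis using True by (simp add: abs_le_square_iff)
    next
      case False
      have "norm x \<le> norm (x - y) + norm y" using norm_triangle_ineq[of "x - y" y] by simp
      then show ?thesis using False y R[of x] R[of "x - y"] by (auto simp: indicator_def)
    qed
    have "(a - b)^2 \<le> 3 * (a - p)^2 + 3 * (p - q)^2 + 3 * (b - q)^2" for a b p q :: real
    proof -
      have "0 \<le> ((a - p) - (p - q))^2 + ((a - p) - (q - b))^2 + ((p - q) - (q - b))^2" by simp
      then show ?thesis by (simp add: power2_eq_square algebra_simps)
    qed
    then have le: "(g (x - y) - g x)^2 \<le> 3 * (g (x - y) - h (x - y))^2 + 3 * (\<eta>^2 * indicator (cball 0 (R + 1)) x) + 3 * (g x - h x)^2" for x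
      using hb[of x] by (smt (verit) mult_left_mono)
    have ig: "(LBINT\<^sup>+ x. ennreal ((g x - h x)^2)) \<le> ennreal (e / 9)"
      using i ie by (simp add: nn_integral_eq_integral ennreal_leI)
    have it: "(LBINT\<^sup>+ x. ennreal ((g (x - y) - h (x - y))^2)) = (LBINT\<^sup>+ x. ennreal ((g x - h x)^2))"
      using nn_integral_lborel_translate[of "\<lambda>x. ennreal ((g x - h x)^2)" "- y"] by simp
    have ii: "(LBINT\<^sup>+ x. ennreal (\<eta>^2 * indicator (cball 0 (R + 1)) (x :: real ^ 'n))) = ennreal (\<eta>^2 * V)"
      using V by (simp add: ennreal_mult' nn_integral_cmult ennreal_indicator)
    have "(LBINT\<^sup>+ x. ennreal ((g (x - y) - g x)^2)) \<le>
      (LBINT\<^sup>+ x. 3 * ennreal ((g (x - y) - h (x - y))^2) + 3 * ennreal (\<eta>^2 * indicator (cball 0 (R + 1)) x) + 3 * ennreal ((g x - h x)^2))"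
    proof (rule nn_integral_mono)
      fix x :: "real ^ 'n"
      have "3 * ennreal t = ennreal (3 * t)" for t by (simp add: ennreal_mult')
      then show "ennreal ((g (x - y) - g x)^2) \<le> 3 * ennreal ((g (x - y) - h (x - y))^2) + 3 * ennreal (\<eta>^2 * indicator (cball 0 (R + 1)) x) + 3 * ennreal ((g x - h x)^2)"
        using ennreal_leI[OF le[of x]] by (simp add: ennreal_plus[symmetric] del: ennreal_plus)
    qed
    also have "\<dots> = 3 * (LBINT\<^sup>+ x. ennreal ((g x - h x)^2)) + 3 * ennreal (\<eta>^2 * V) + 3 * (LBINT\<^sup>+ x. ennreal ((g x - h x)^2))"
      by (simp add: nn_integral_add nn_integral_cmult it ii)
    also have "\<dots> \<le> 3 * ennreal (e / 9) + 3 * ennreal (e / 9) + 3 * ennreal (e / 9)"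
    proof (intro add_mono mult_left_mono ig ennreal_leI)
      have "e * V \<le> e * (V + 1)" using e by simp
      then show "\<eta>^2 * V \<le> e / 9" unfolding \<eta>(2) using V by (simp add: field_simps)
    qed auto
    also have "\<dots> = ennreal e"
    proof -
      have "3 * ennreal t = ennreal (3 * t)" for t by (simp add: ennreal_mult')
      then show ?thesis using e by (simp add: ennreal_plus[symmetric] del: ennreal_plus)
    qed
    finally show "(LBINT\<^sup>+ x. ennreal ((g (x - y) - g x)^2)) \<le> ennreal e" .
  qed
qed

subsection \<open>Convolution\<close>

definition conv :: "(real ^ 'n::finite \<Rightarrow> real) \<Rightarrow> (real ^ 'n \<Rightarrow> real) \<Rightarrow> real ^ 'n \<Rightarrow> real" where
  "conv g \<kappa> x = (LBINT y. g y * \<kappa> (x - y))"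

text \<open>A probability density supported in a ball of radius r. Convolution with it is an
  expectation, which makes Jensen's inequality applicable, and both smooth mollifiers and normalized
  cubes are covered.\<close>

definition kern :: "(real ^ 'n::finite \<Rightarrow> real) \<Rightarrow> real \<Rightarrow> bool" where
  "kern \<kappa> r \<longleftrightarrow> bcs \<kappa> \<and> (\<forall>x. 0 \<le> \<kappa> x) \<and> (\<forall>x. r < norm x \<longrightarrow> \<kappa> x = 0) \<and> (LBINT x. \<kappa> x) = 1"

lemma bcs_reflect:
  assumes "bcs \<kappa>" shows "bcs (\<lambda>y. \<kappa> (x - y))"
proof -
  obtain B R where B: "\<And>x. \<bar>\<kappa> x\<bar> \<le> B" and R: "\<And>x. R < norm x \<Longrightarrow> \<kappa> x = 0"
    using assms unfolding bcs_def by metis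
  have [measurable]: "\<kappa> \<in> borel_measurable borel" using assms by measurable
  have "\<kappa> (x - y) = 0" if "R + norm x < norm y" for y
    using that norm_triangle_ineq4[of x "x - y"] by (intro R) simp
  moreover have "(\<lambda>y. \<kappa> (x - y)) \<in> borel_measurable borel" by measurable
  ultimately show ?thesis unfolding bcs_def using B by blast
qed

lemma kern_bcs: "kern \<kappa> r \<Longrightarrow> bcs \<kappa>" by (simp add: kern_def)

lemma kern_reflect: "kern \<kappa> r \<Longrightarrow> kern (\<lambda>x. \<kappa> (- x)) r"
  using bcs_reflect[of \<kappa> 0] integral_lborel_reflect[of \<kappa> 0]
  by (auto simp: kern_def dest: bcs_borel)

lemma conv_integrable: "L1l g \<Longrightarrow> bcs \<kappa> \<Longrightarrow> integrable lborel (\<lambda>y. g y * \<kappa> (x - y))"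
  by (intro L1l_bcs bcs_reflect)

lemma conv_borel:
  assumes "g \<in> borel_measurable borel" "\<kappa> \<in> borel_measurable borel"
  shows "conv g \<kappa> \<in> borel_measurable borel"
proof -
  have [measurable]: "g \<in> borel_measurable borel" "\<kappa> \<in> borel_measurable borel" using assms by auto
  have "(\<lambda>x. LINT y|lborel. g y * \<kappa> (x - y)) \<in> borel_measurable lborel"
    by (intro lborel.borel_measurable_lebesgue_integral) measurable
  then show ?thesis unfolding conv_def[abs_def] by simp
qed

lemma conv_altdef:
  assumes "g \<in> borel_measurable borel" "\<kappa> \<in> borel_measurable borel"
  shows "conv g \<kappa> x = (LBINT y. g (x - y) * \<kappa> y)"
  unfolding conv_def using integral_lborel_reflect[of "\<lambda>y. g y * \<kappa> (x - y)" x] assms by simp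

lemma conv_diff: "L1l g \<Longrightarrow> L1l h \<Longrightarrow> bcs \<kappa> \<Longrightarrow> conv (\<lambda>x. g x - h x) \<kappa> x = conv g \<kappa> x - conv h \<kappa> x"
  unfolding conv_def by (simp add: left_diff_distrib conv_integrable)

lemma conv_eq_0:
  assumes "\<And>x. R < norm x \<Longrightarrow> g x = 0" "\<And>x. r < norm x \<Longrightarrow> \<kappa> x = 0" "R + r < norm x"
  shows "conv g \<kappa> x = 0"
proof -
  have "g y * \<kappa> (x - y) = 0" for y
    using assms(1)[of y] assms(2)[of "x - y"] assms(3) norm_triangle_ineq[of y "x - y"]
    by (cases "R < norm y") auto
  then have "(\<lambda>y. g y * \<kappa> (x - y)) = (\<lambda>y. 0)" by blast
  then show ?thesis by (simp only: conv_def) simp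
qed

lemma kern_conv_bounds:
  assumes k: "kern \<kappa> r" and g: "g \<in> borel_measurable borel" "\<And>x. \<bar>g x\<bar> \<le> B"
  shows "\<bar>conv g \<kappa> x\<bar> \<le> B"
proof -
  have [measurable]: "\<kappa> \<in> borel_measurable borel" using k kern_bcs by measurable
  have int: "integrable lborel (\<lambda>y. \<kappa> (x - y))"
    using conv_integrable[of "\<lambda>x. 1" \<kappa> x] kern_bcs[OF k] L2l_L1l[OF continuous_L2l[of "\<lambda>x. 1"]] by simp
  have [measurable]: "g \<in> borel_measurable borel" by fact
  have le: "norm (g y * \<kappa> (x - y)) \<le> B * \<kappa> (x - y)" for y
    using k g(2) by (auto simp: kern_def abs_mult intro!: mult_right_mono)
  have int2: "integrable lborel (\<lambda>y. B * \<kappa> (x - y))" using int by simp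
  have "integrable lborel (\<lambda>y. g y * \<kappa> (x - y))"
    by (rule Bochner_Integration.integrable_bound[OF int2]) (use order_trans[OF le abs_ge_self] in auto)
  then have "\<bar>conv g \<kappa> x\<bar> \<le> (LBINT y. B * \<kappa> (x - y))"
    unfolding conv_def by (rule integral_abs_bound_integral) (use int2 le in auto)
  also have "\<dots> = B" using integral_lborel_reflect[of \<kappa> x] k by (simp add: kern_def)
  finally show ?thesis .
qed

lemma prob_space_kern: assumes "kern \<kappa> r" shows "prob_space (density lborel \<kappa>)"
proof
  have [measurable]: "\<kappa> \<in> borel_measurable borel" using assms kern_bcs by measurable
  have i: "integrable lborel \<kappa>"
    using L1l_bcs[of "\<lambda>x. 1" \<kappa>] kern_bcs[OF assms] L2l_L1l[OF continuous_L2l[of "\<lambda>x. 1"]] by simp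
  have "emeasure (density lborel \<kappa>) (space (density lborel \<kappa>)) = (LBINT\<^sup>+ x. ennreal (\<kappa> x))"
    by (subst emeasure_density) auto
  also have "\<dots> = 1" using assms i by (subst nn_integral_eq_integral) (auto simp: kern_def)
  finally show "emeasure (density lborel \<kappa>) (space (density lborel \<kappa>)) = 1" .
qed

text \<open>The difference of \<open>conv g \<kappa>\<close> and \<open>g\<close> at x is the
  expectation of g(x - y) - g(x) under the density \<kappa>. Jensen and Tonelli therefore bound its
  squared norm by an average of the squared norms of the translation differences.\<close>

lemma kern_conv_diff_bound:
  assumes k: "kern \<kappa> r" and g: "L2 g"
    and d: "\<And>y. norm y \<le> r \<Longrightarrow> (LBINT\<^sup>+ x. ennreal ((g (x - y) - g x)^2)) \<le> e"
  shows "(LBINT\<^sup>+ x. ennreal ((conv g \<kappa> x - g x)^2)) \<le> e"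
proof -
  have [measurable]: "\<kappa> \<in> borel_measurable borel" "g \<in> borel_measurable borel"
    using k kern_bcs g by measurable
  have k0: "\<kappa> y \<ge> 0" for y using k by (simp add: kern_def)
  interpret K: prob_space "density lborel \<kappa>" using k by (rule prob_space_kern)
  have "conv g \<kappa> x - g x = (LINT y|density lborel \<kappa>. g (x - y) - g x)" for x
  proof -
    have i1: "integrable lborel (\<lambda>y. g (x - y) * \<kappa> y)"
      using integrable_lborel_affine[OF conv_integrable[OF L2l_L1l[OF L2_L2l[OF g]] kern_bcs[OF k]], of "-1" x x] by simp
    have i2: "integrable lborel \<kappa>"
      using L1l_bcs[of "\<lambda>x. 1" \<kappa>] kern_bcs[OF k] L2l_L1l[OF continuous_L2l[of "\<lambda>x. 1"]] by simp
    have "(LINT y|density lborel \<kappa>. g (x - y) - g x) = (LBINT y. \<kappa> y * (g (x - y) - g x))"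
      using k0 by (subst integral_density) auto
    also have "\<dots> = (LBINT y. g (x - y) * \<kappa> y - g x * \<kappa> y)" by (simp add: algebra_simps)
    also have "\<dots> = (LBINT y. g (x - y) * \<kappa> y) - g x"
      using i1 i2 k by (simp add: kern_def)
    finally show ?thesis by (simp add: conv_altdef)
  qed
  then have "(LBINT\<^sup>+ x. ennreal ((conv g \<kappa> x - g x)^2))
    = (LBINT\<^sup>+ x. ennreal ((LINT y|density lborel \<kappa>. g (x - y) - g x)^2))" by simp
  also have "\<dots> \<le> (LBINT\<^sup>+ x. (\<integral>\<^sup>+y. ennreal ((g (x - y) - g x)^2) \<partial>density lborel \<kappa>))"
    by (intro nn_integral_mono square_integral_le_nn_integral K.prob_space_axioms) measurable
  also have "\<dots> = (LBINT\<^sup>+ x. (LBINT\<^sup>+ y. ennreal (\<kappa> y) * ennreal ((g (x - y) - g x)^2)))"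
    by (subst nn_integral_density) auto
  also have "\<dots> = (LBINT\<^sup>+ y. (LBINT\<^sup>+ x. ennreal (\<kappa> y) * ennreal ((g (x - y) - g x)^2)))"
    by (rule lborel_pair.Fubini') measurable
  also have "\<dots> = (LBINT\<^sup>+ y. ennreal (\<kappa> y) * (LBINT\<^sup>+ x. ennreal ((g (x - y) - g x)^2)))"
    by (intro nn_integral_cong nn_integral_cmult) measurable
  also have "\<dots> \<le> (LBINT\<^sup>+ y. ennreal (\<kappa> y) * e)"
  proof (rule nn_integral_mono)
    fix y
    show "ennreal (\<kappa> y) * (LBINT\<^sup>+ x. ennreal ((g (x - y) - g x)^2)) \<le> ennreal (\<kappa> y) * e"
      using k d[of y] by (cases "norm y \<le> r") (auto simp: kern_def intro!: mult_left_mono)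
  qed
  also have "\<dots> = (\<integral>\<^sup>+y. e \<partial>density lborel \<kappa>)" by (subst nn_integral_density) auto
  also have "\<dots> = e" using K.emeasure_space_1 by (simp del: K.emeasure_space_1)
  finally show ?thesis .
qed

lemma kern_conv_L2_eventually:
  assumes g: "L2 g" and k: "\<And>n. kern (\<kappa> n) (r n)" and r: "r \<longlonglongrightarrow> 0" and e: "e > 0"
  shows "eventually (\<lambda>n. (LBINT\<^sup>+ x. ennreal ((conv g (\<kappa> n) x - g x)^2)) \<le> ennreal e) sequentially"
proof -
  obtain d where d: "d > 0" "\<And>y. norm y < d \<Longrightarrow> (LBINT\<^sup>+ x. ennreal ((g (x - y) - g x)^2)) \<le> ennreal e"
    using L2_translation_continuous[OF g e] by blast
  have "eventually (\<lambda>n. r n < d) sequentially" using r d(1) by (rule order_tendstoD(2))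
  then show ?thesis
    by eventually_elim (rule kern_conv_diff_bound[OF k g], use d(2) in auto)
qed

text \<open>Here \<kappa> may change sign, so the density is taken to be uniform on a ball that
  contains its support, and \<kappa> itself is treated as a bounded factor; then Jensen and
  translation invariance apply.\<close>

lemma conv_L2:
  assumes g: "L2 g" and k: "bcs \<kappa>"
  shows "L2 (conv g \<kappa>)"
proof -
  have [measurable]: "\<kappa> \<in> borel_measurable borel" "g \<in> borel_measurable borel" using k g by measurable
  obtain B R0 where B: "\<And>x. \<bar>\<kappa> x\<bar> \<le> B" and R0: "\<And>x. R0 < norm x \<Longrightarrow> \<kappa> x = 0"
    using k unfolding bcs_def by metis
  \<comment> \<open>The maximum with 1 gives the ball positive volume, so that the uniform density
    exists.\<close>
  define R where "R = max R0 1"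
  have R: "\<kappa> x = 0" if "R < norm x" for x using that R0 by (simp add: R_def)
  define V where "V = measure lborel (cball (0::real ^ 'a) R)"
  have "V > 0" unfolding V_def R_def by (intro content_cball_pos) simp
  define p where "p y = indicator (cball 0 R) y / V" for y :: "real ^ 'a"
  have [measurable]: "p \<in> borel_measurable borel" unfolding p_def by measurable
  have p0: "0 \<le> p y" for y using \<open>V > 0\<close> by (simp add: p_def)
  have kp: "kern p R"
    unfolding kern_def
  proof (intro conjI allI impI)
    have "\<bar>p y\<bar> \<le> 1 / V" for y using \<open>V > 0\<close> by (auto simp: p_def indicator_def)
    then show "bcs p" unfolding bcs_def by (intro conjI exI[of _ "1 / V"] exI[of _ R]) (auto simp: p_def)
    show "(LBINT y. p y) = 1"
      using \<open>V > 0\<close> by (simp add: p_def V_def emeasure_lborel_cball_finite[unfolded infinity_ennreal_def])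
  qed (use p0 in \<open>auto simp: p_def\<close>)
  interpret K: prob_space "density lborel p" using kp by (rule prob_space_kern)
  have le: "(g t * \<kappa> y * V)^2 \<le> (B * V)^2 * (g t)^2" for t y
  proof -
    have "(\<kappa> y)^2 \<le> B^2" using B[of y] abs_le_square_iff[of "\<kappa> y" B] by auto
    then have "(\<kappa> y)^2 * ((g t)^2 * V^2) \<le> B^2 * ((g t)^2 * V^2)" by (rule mult_right_mono) simp
    then show ?thesis by (simp add: power_mult_distrib mult.commute mult.left_commute)
  qed
  have "conv g \<kappa> x = (LINT y|density lborel p. g (x - y) * \<kappa> y * V)" for x
  proof -
    have "(LINT y|density lborel p. g (x - y) * \<kappa> y * V) = (LBINT y. p y * (g (x - y) * \<kappa> y * V))"
      using p0 by (subst integral_density) auto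
    also have "\<dots> = conv g \<kappa> x"
      using \<open>V > 0\<close> R by (auto simp: conv_altdef p_def indicator_def intro!: Bochner_Integration.integral_cong)
    finally show ?thesis by simp
  qed
  then have "(LBINT\<^sup>+ x. ennreal ((conv g \<kappa> x)^2))
    = (LBINT\<^sup>+ x. ennreal ((LINT y|density lborel p. g (x - y) * \<kappa> y * V)^2))" by simp
  also have "\<dots> \<le> (LBINT\<^sup>+ x. (\<integral>\<^sup>+y. ennreal ((g (x - y) * \<kappa> y * V)^2) \<partial>density lborel p))"
    by (intro nn_integral_mono square_integral_le_nn_integral K.prob_space_axioms) measurable
  also have "\<dots> \<le> (LBINT\<^sup>+ x. (\<integral>\<^sup>+y. ennreal ((B * V)^2 * (g (x - y))^2) \<partial>density lborel p))"
    by (intro nn_integral_mono ennreal_leI le)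
  also have "\<dots> = (LBINT\<^sup>+ x. (LBINT\<^sup>+ y. ennreal (p y) * ennreal ((B * V)^2 * (g (x - y))^2)))"
    by (subst nn_integral_density) auto
  also have "\<dots> = (LBINT\<^sup>+ y. (LBINT\<^sup>+ x. ennreal (p y) * ennreal ((B * V)^2 * (g (x - y))^2)))"
    by (rule lborel_pair.Fubini') measurable
  also have "\<dots> = (LBINT\<^sup>+ y. ennreal (p y) * (LBINT\<^sup>+ x. ennreal ((B * V)^2 * (g x)^2)))"
  proof (rule nn_integral_cong)
    fix y
    show "(LBINT\<^sup>+ x. ennreal (p y) * ennreal ((B * V)^2 * (g (x - y))^2))
      = ennreal (p y) * (LBINT\<^sup>+ x. ennreal ((B * V)^2 * (g x)^2))"
      using nn_integral_lborel_translate[of "\<lambda>x. ennreal ((B * V)^2 * (g x)^2)" "- y"]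
      by (subst nn_integral_cmult) auto
  qed
  also have "\<dots> = (\<integral>\<^sup>+y. (LBINT\<^sup>+ x. ennreal ((B * V)^2 * (g x)^2)) \<partial>density lborel p)"
    by (subst nn_integral_density) auto
  also have "\<dots> = (LBINT\<^sup>+ x. ennreal ((B * V)^2 * (g x)^2))"
    using K.emeasure_space_1 by (simp del: K.emeasure_space_1)
  also have "\<dots> < \<infinity>"
    using g by (subst nn_integral_eq_integral) (auto simp: L2_def)
  finally show ?thesis
    unfolding L2_def integrable_iff_bounded by (auto intro!: conv_borel borel_measurable_power)
qed

section \<open>The fundamental lemma of the calculus of variations\<close>

lemma lborel_pair_integrable_mult:
  fixes f g :: "real ^ 'n::finite \<Rightarrow> real"
  assumes "integrable lborel f" "integrable lborel g"
  shows "integrable (lborel \<Otimes>\<^sub>M lborel) (\<lambda>(x, y). f x * g y)"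
proof (rule lborel_pair.Fubini_integrable)
  have [measurable]: "f \<in> borel_measurable lborel" "g \<in> borel_measurable lborel" using assms by auto
  show "(\<lambda>(x, y). f x * g y) \<in> borel_measurable (lborel \<Otimes>\<^sub>M lborel)" by measurable
  show "integrable lborel (\<lambda>x. LINT y|lborel. norm (case (x, y) of (x, y) \<Rightarrow> f x * g y))"
    using assms by (simp add: abs_mult)
  show "AE x in lborel. integrable lborel (\<lambda>y. case (x, y) of (x, y) \<Rightarrow> f x * g y)"
    using assms by simp
qed

lemma bcs_integrable: "bcs f \<Longrightarrow> integrable lborel f"
  using L1l_bcs[of "\<lambda>x. 1" f] L2l_L1l[OF continuous_L2l[of "\<lambda>x. 1"]] by simp

text \<open>Duality: the integral of \<open>h\<close> against the mollified indicator of a bounded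
  Borel set is the integral of that indicator against the vanishing convolution. Letting the radius
  tend to 0 shows that \<open>h\<close> has integral zero over every bounded Borel set.\<close>

lemma AE_eq_0_if_conv_eq_0:
  assumes h: "L1l h" and k: "\<And>n. kern (\<kappa> n) (r n)" and r: "r \<longlonglongrightarrow> 0"
    and 0: "\<And>n x. conv h (\<kappa> n) x = 0"
  shows "AE x in lborel. h x = 0"
proof -
  have [measurable]: "h \<in> borel_measurable borel" using h by measurable
  have [measurable]: "\<kappa> n \<in> borel_measurable borel" for n using kern_bcs[OF k] by measurable
  have *: "(LBINT x. h x * indicator B x) = 0"
    if B [measurable]: "B \<in> sets borel" and BR: "B \<subseteq> cball 0 R" for B R
  proof -
    define b where "b = (indicator B :: real ^ 'a \<Rightarrow> real)"
    have [measurable]: "b \<in> borel_measurable borel" unfolding b_def by measurable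
    have bb: "bcs b" unfolding bcs_def b_def using BR
      by (intro conjI exI[of _ 1] exI[of _ R]) (auto simp: indicator_def intro!: borel_measurable_indicator B)
    \<comment> \<open>The kernel is reflected because Fubini's theorem moves it from
      \<open>b\<close> to \<open>h\<close> and reverses the sign of its argument.\<close>
    define s where "s n = conv b (\<lambda>x. \<kappa> n (- x))" for n
    have k': "kern (\<lambda>x. \<kappa> n (- x)) (r n)" for n using k by (rule kern_reflect)
    have s_borel [measurable]: "s n \<in> borel_measurable borel" for n unfolding s_def by (intro conv_borel) measurable
    have s0: "(LBINT x. h x * s n x) = 0" for n
    proof -
      obtain C Q where C: "\<And>x. \<bar>\<kappa> n x\<bar> \<le> C" and Q: "\<And>x. Q < norm x \<Longrightarrow> \<kappa> n x = 0"
        using kern_bcs[OF k] unfolding bcs_def by metis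
      have P: "integrable (lborel \<Otimes>\<^sub>M lborel) (\<lambda>(x, y). h x * (b y * \<kappa> n (y - x)))"
      proof (rule Bochner_Integration.integrable_bound)
        have "integrable lborel (\<lambda>x. indicator (cball 0 (R + Q)) x * h x)" using h by (simp add: L1l_def)
        moreover have "integrable lborel (\<lambda>y. C * b y)" using bcs_integrable[OF bb] by simp
        ultimately show "integrable (lborel \<Otimes>\<^sub>M lborel) (\<lambda>(x, y). (indicator (cball 0 (R + Q)) x * h x) * (C * b y))"
          by (rule lborel_pair_integrable_mult)
        have "norm (h x * (b y * \<kappa> n (y - x))) \<le> norm ((indicator (cball 0 (R + Q)) x * h x) * (C * b y))" for x y
        proof (cases "y \<in> B \<and> norm (y - x) \<le> Q")
          case True
          then have "norm y \<le> R" using BR by auto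
          moreover have "norm x \<le> norm y + norm (y - x)" using norm_triangle_ineq4[of y "y - x"] by simp
          ultimately have "norm x \<le> R + Q" using True by linarith
          moreover have "\<bar>\<kappa> n (y - x)\<bar> \<le> \<bar>C\<bar>" using C[of "y - x"] by linarith
          ultimately show ?thesis using True by (auto simp: abs_mult b_def intro!: mult_left_mono)
        next
          case False
          then show ?thesis using Q[of "y - x"] by (auto simp: b_def)
        qed
        then show "AE z in lborel \<Otimes>\<^sub>M lborel. norm (case z of (x, y) \<Rightarrow> h x * (b y * \<kappa> n (y - x)))
            \<le> norm (case z of (x, y) \<Rightarrow> (indicator (cball 0 (R + Q)) x * h x) * (C * b y))"
          by (auto simp: split_beta)
      qed measurable
      have "(LBINT x. h x * s n x) = (LBINT x. LINT y|lborel. h x * (b y * \<kappa> n (y - x)))"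
        unfolding s_def conv_def by simp
      also have "\<dots> = (LBINT y. LINT x|lborel. h x * (b y * \<kappa> n (y - x)))"
        using lborel_pair.Fubini_integral[OF P] by simp
      also have "\<dots> = (LBINT y. b y * conv h (\<kappa> n) y)"
        unfolding conv_def by (simp add: mult.left_commute)
      finally show ?thesis using 0 by simp
    qed
    obtain n0 where n0: "\<And>n. n \<ge> n0 \<Longrightarrow> r n < 1"
      using order_tendstoD(2)[OF r, of 1] by (auto simp: eventually_sequentially)
    have L2sb: "L2 (\<lambda>x. s n x - b x)" for n unfolding s_def
      by (intro L2_diff conv_L2 bcs_L2 bb kern_bcs[OF k'])
    have "(\<lambda>n. LINT x|lborel. norm ((s n x - b x)^2)) \<longlonglongrightarrow> 0"
    proof (rule LIMSEQ_I)
      fix e :: real assume e: "e > 0"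
      then have "eventually (\<lambda>n. (LBINT\<^sup>+ x. ennreal ((s n x - b x)^2)) \<le> ennreal (e / 2)) sequentially"
        unfolding s_def by (intro kern_conv_L2_eventually[OF bcs_L2[OF bb] k' r]) simp
      then obtain N where N: "\<And>n. n \<ge> N \<Longrightarrow> (LBINT\<^sup>+ x. ennreal ((s n x - b x)^2)) \<le> ennreal (e / 2)"
        by (auto simp: eventually_sequentially)
      have "norm ((LBINT x. norm ((s n x - b x)^2)) - 0) < e" if "n \<ge> N" for n
        using N[OF that] L2sb[of n] e by (auto simp: L2_def nn_integral_eq_integral)
      then show "\<exists>N. \<forall>n\<ge>N. norm ((LBINT x. norm ((s n x - b x)^2)) - 0) < e" by blast
    qed
    then obtain q where q: "strict_mono q" and qAE: "AE x in lborel. (\<lambda>n. (s (q n) x - b x)^2) \<longlonglongrightarrow> 0"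
      using tendsto_L1_AE_subseq[of lborel "\<lambda>n x. (s n x - b x)^2"] L2sb by (auto simp: L2_def)
    \<comment> \<open>Convergence in mean square becomes convergence almost everywhere along the
      subsequence \<open>q\<close>. The offset \<open>n0\<close> keeps the radius below 1, so all
      mollified indicators live in one ball; there they are bounded by 1 and |h| dominates.\<close>
    have "(\<lambda>n. LINT x|lborel. h x * s (q (n + n0)) x) \<longlonglongrightarrow> (LBINT x. h x * b x)"
    proof (rule integral_dominated_convergence)
      show "integrable lborel (\<lambda>x. \<bar>indicator (cball 0 (R + 1)) x * h x\<bar>)" using h by (simp add: L1l_def)
      show "AE x in lborel. (\<lambda>n. h x * s (q (n + n0)) x) \<longlonglongrightarrow> h x * b x"
        using qAE
      proof eventually_elim
        case (elim x)
        then have "(\<lambda>n. \<bar>s (q n) x - b x\<bar>) \<longlonglongrightarrow> 0"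
          using tendsto_real_sqrt[OF elim] by simp
        then have "(\<lambda>n. s (q n) x) \<longlonglongrightarrow> b x"
          by (simp add: tendsto_rabs_zero_iff LIM_zero_iff)
        then show ?case by (intro tendsto_mult_left LIMSEQ_ignore_initial_segment)
      qed
      fix n
      have "r (q (n + n0)) < 1" using seq_suble[OF q, of "n + n0"] by (intro n0) simp
      then have "s (q (n + n0)) x = 0" if "R + 1 < norm x" for x
        unfolding s_def
        by (intro conv_eq_0[of R _ "r (q (n + n0))"]) (use that k' BR in \<open>auto simp: b_def indicator_def kern_def\<close>)
      moreover have "\<bar>s (q (n + n0)) x\<bar> \<le> 1" for x unfolding s_def
        by (rule kern_conv_bounds[OF k']) (auto simp: b_def indicator_def)
      ultimately have "norm (h x * s (q (n + n0)) x) \<le> \<bar>indicator (cball 0 (R + 1)) x * h x\<bar>" for x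
        by (cases "norm x \<le> R + 1") (auto simp: abs_mult intro!: mult_left_le)
      then show "AE x in lborel. norm (h x * s (q (n + n0)) x) \<le> \<bar>indicator (cball 0 (R + 1)) x * h x\<bar>" by simp
    qed measurable
    then show ?thesis unfolding s0 b_def by (simp add: LIMSEQ_const_iff)
  qed
  \<comment> \<open>Take for the Borel set the part of the ball where \<open>g\<close> is positive:
    a nonnegative integrand with zero integral vanishes almost everywhere. This is used for
    \<open>h\<close> and for its negative.\<close>
  have **: "AE x in lborel. indicator (cball 0 R) x * g x \<le> 0"
    if g [measurable]: "g \<in> borel_measurable borel" and gh: "\<And>B R. B \<in> sets borel \<Longrightarrow> B \<subseteq> cball 0 R \<Longrightarrow> (LBINT x. g x * indicator B x) = 0"
      and gL: "L1l g" for g :: "real ^ 'a \<Rightarrow> real" and R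
  proof -
    define B where "B = {x. 0 < g x} \<inter> cball 0 R"
    have [measurable]: "B \<in> sets borel" unfolding B_def by measurable
    have "bcs (indicator B :: real ^ 'a \<Rightarrow> real)"
      unfolding bcs_def by (intro conjI exI[of _ 1] exI[of _ R]) (auto simp: B_def indicator_def intro!: borel_measurable_indicator)
    then have "integrable lborel (\<lambda>x. g x * indicator B x)" using gL by (intro L1l_bcs)
    moreover have "(LBINT x. g x * indicator B x) = 0" by (rule gh[of _ R]) (auto simp: B_def)
    moreover have "0 \<le> g x * indicator B x" for x by (auto simp: B_def indicator_def)
    ultimately have "AE x in lborel. g x * indicator B x = 0"
      using integral_nonneg_eq_0_iff_AE[of lborel "\<lambda>x. g x * indicator B x"] by auto
    then show ?thesis by eventually_elim (auto simp: B_def indicator_def split: if_splits)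
  qed
  have "AE x in lborel. indicator (cball 0 (real n)) x * h x \<le> 0" for n using * h by (intro **) auto
  moreover have "AE x in lborel. indicator (cball 0 (real n)) x * (- h x) \<le> 0" for n
    using * L1l_cmult[OF h, of "-1"] by (intro **) auto
  ultimately have "AE x in lborel. indicator (cball 0 (real n)) x * h x \<le> 0 \<and> indicator (cball 0 (real n)) x * (- h x) \<le> 0" for n
    by (intro AE_conjI)
  then have "AE x in lborel. \<forall>n. indicator (cball 0 (real n)) x * h x \<le> 0 \<and> indicator (cball 0 (real n)) x * (- h x) \<le> 0"
    by (simp add: AE_all_countable)
  then show ?thesis
  proof eventually_elim
    case (elim x)
    obtain n where "norm x \<le> real n" using real_arch_simple by blast
    then show ?case using elim[rule_format, of n] by auto
  qed
qed

subsection \<open>Smoothness of convolutions\<close>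

lemma test_fun_has_derivative:
  assumes "test_fun \<psi>"
  shows "(\<psi> has_derivative (\<lambda>h. \<Sum>k\<in>UNIV. h $ k * partial k \<psi> x)) (at x)"
proof -
  have "frechet_derivative \<psi> (at x) = (\<lambda>h. \<Sum>k\<in>UNIV. h $ k * partial k \<psi> x)"
    by (rule ext, rule frechet_derivative_eq_sum_partial[OF smooth_diff[OF test_fun_smooth[OF assms]]])
  then show ?thesis using smooth_has_derivative[OF test_fun_smooth[OF assms], of x] by simp
qed

lemma test_fun_Lipschitz:
  assumes "test_fun (\<psi> :: real ^ 'n::finite \<Rightarrow> real)"
  obtains L where "L \<ge> 0" "\<And>x y. \<bar>\<psi> x - \<psi> y\<bar> \<le> L * norm (x - y)"
proof -
  have "\<exists>B>0. \<forall>x. \<bar>partial k \<psi> x\<bar> \<le> B" for k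
    using test_fun_bounded[OF test_fun_partial[OF assms, of k]] by metis
  then obtain B where B: "\<And>k. B k > 0" "\<And>k x. \<bar>partial k \<psi> x\<bar> \<le> B k" by metis
  have "norm (\<psi> x - \<psi> y) \<le> (\<Sum>k\<in>UNIV. B k) * norm (x - y)" for x y
  proof (rule differentiable_bound[of UNIV])
    show "(\<psi> has_derivative (\<lambda>h. \<Sum>k\<in>UNIV. h $ k * partial k \<psi> x)) (at x within UNIV)" for x
      using test_fun_has_derivative[OF assms] by simp
    show "onorm (\<lambda>h. \<Sum>k\<in>UNIV. h $ k * partial k \<psi> x) \<le> (\<Sum>k\<in>UNIV. B k)" for x
    proof (rule onorm_le)
      fix h :: "real ^ 'n"
      have "norm (\<Sum>k\<in>UNIV. h $ k * partial k \<psi> x) \<le> (\<Sum>k\<in>UNIV. norm h * B k)"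
        by (rule sum_norm_le) (auto simp: abs_mult intro!: mult_mono component_le_norm_cart B)
      then show "norm (\<Sum>k\<in>UNIV. h $ k * partial k \<psi> x) \<le> (\<Sum>k\<in>UNIV. B k) * norm h"
        by (simp add: sum_distrib_left mult.commute)
    qed
  qed auto
  then show thesis using B(1) by (intro that[of "\<Sum>k\<in>UNIV. B k"]) (auto intro!: sum_nonneg simp: less_imp_le)
qed

text \<open>The remainder is uniform in both points because every partial derivative is again a test
  function and hence globally Lipschitz.\<close>

lemma test_fun_Taylor:
  assumes "test_fun (\<psi> :: real ^ 'n::finite \<Rightarrow> real)"
  obtains L where "L \<ge> 0"
    "\<And>x y. \<bar>\<psi> y - \<psi> x - (\<Sum>k\<in>UNIV. (y - x) $ k * partial k \<psi> x)\<bar> \<le> L * (norm (y - x))^2"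
proof -
  have "\<exists>B\<ge>0. \<forall>x y. \<bar>partial k \<psi> x - partial k \<psi> y\<bar> \<le> B * norm (x - y)" for k
    using test_fun_Lipschitz[OF test_fun_partial[OF assms, of k]] by metis
  then obtain B where B: "\<And>k. B k \<ge> 0" "\<And>k x y. \<bar>partial k \<psi> x - partial k \<psi> y\<bar> \<le> B k * norm (x - y)" by metis
  have "norm (\<psi> y - \<psi> x - (\<Sum>k\<in>UNIV. (y - x) $ k * partial k \<psi> x)) \<le> norm (y - x) * ((\<Sum>k\<in>UNIV. B k) * norm (y - x))"
    for x y
  proof (rule differentiable_bound_linearization[where S = "cball x (norm (y - x))"
        and f' = "\<lambda>x h. \<Sum>k\<in>UNIV. h $ k * partial k \<psi> x" and a = x and b = y])
    show "x + t *\<^sub>R (y - x) \<in> cball x (norm (y - x))" if "t \<in> {0..1}" for t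
      using that by (auto simp: dist_norm intro!: mult_left_le_one_le)
    show "(\<psi> has_derivative (\<lambda>h. \<Sum>k\<in>UNIV. h $ k * partial k \<psi> z)) (at z within cball x (norm (y - x)))" for z
      using test_fun_has_derivative[OF assms] by (rule has_derivative_at_withinI)
    show "onorm ((\<lambda>h. \<Sum>k\<in>UNIV. h $ k * partial k \<psi> z) - (\<lambda>h. \<Sum>k\<in>UNIV. h $ k * partial k \<psi> x))
        \<le> (\<Sum>k\<in>UNIV. B k) * norm (y - x)" if z: "z \<in> cball x (norm (y - x))" for z
    proof (rule onorm_le)
      fix h :: "real ^ 'n"
      have "norm (((\<lambda>h. \<Sum>k\<in>UNIV. h $ k * partial k \<psi> z) - (\<lambda>h. \<Sum>k\<in>UNIV. h $ k * partial k \<psi> x)) h)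
        = norm (\<Sum>k\<in>UNIV. h $ k * (partial k \<psi> z - partial k \<psi> x))"
        by (simp add: sum_subtractf[symmetric] right_diff_distrib)
      also have "\<dots> \<le> (\<Sum>k\<in>UNIV. norm h * (B k * norm (y - x)))"
      proof (rule sum_norm_le)
        fix k
        have "\<bar>partial k \<psi> z - partial k \<psi> x\<bar> \<le> B k * norm (z - x)" by (rule B)
        also have "\<dots> \<le> B k * norm (y - x)" using z B by (intro mult_left_mono) (auto simp: dist_norm norm_minus_commute)
        finally show "norm (h $ k * (partial k \<psi> z - partial k \<psi> x)) \<le> norm h * (B k * norm (y - x))"
          by (auto simp: abs_mult intro!: mult_mono component_le_norm_cart)
      qed
      finally show "norm (((\<lambda>h. \<Sum>k\<in>UNIV. h $ k * partial k \<psi> z) - (\<lambda>h. \<Sum>k\<in>UNIV. h $ k * partial k \<psi> x)) h)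
         \<le> (\<Sum>k\<in>UNIV. B k) * norm (y - x) * norm h"
        by (simp add: sum_distrib_left sum_distrib_right mult_ac)
    qed
  qed simp
  then show thesis using B(1) by (intro that[of "\<Sum>k\<in>UNIV. B k"]) (auto intro!: sum_nonneg simp: power2_eq_square mult_ac)
qed

text \<open>The kernel has a uniform quadratic Taylor remainder, so the linearization error of the
  convolution is at most this remainder times the integral of |g| over a fixed ball. Local
  integrability of \<open>g\<close> is therefore enough.\<close>

lemma conv_has_derivative:
  fixes g :: "real ^ 'n::finite \<Rightarrow> real"
  assumes g: "L1l g" and t: "test_fun \<rho>"
  shows "(conv g \<rho> has_derivative (\<lambda>h. \<Sum>k\<in>UNIV. h $ k * conv g (partial k \<rho>) x)) (at x)"
  unfolding has_derivative_at_alt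
proof (intro conjI allI impI)
  show "bounded_linear (\<lambda>h. \<Sum>k\<in>UNIV. h $ k * conv g (partial k \<rho>) x)"
    by (intro bounded_linear_sum bounded_linear_mult_left[THEN bounded_linear_compose] bounded_linear_vec_nth)
  fix e :: real assume e: "e > 0"
  obtain L where L: "L \<ge> 0" "\<And>x y. \<bar>\<rho> y - \<rho> x - (\<Sum>k\<in>UNIV. (y - x) $ k * partial k \<rho> x)\<bar> \<le> L * (norm (y - x))^2"
    using test_fun_Taylor[OF t] by blast
  obtain R where R: "R > 0" "\<And>x. R < norm x \<Longrightarrow> \<rho> x = 0" "\<And>x k. R < norm x \<Longrightarrow> partial k \<rho> x = 0"
    using test_funE[OF t] by blast
  \<comment> \<open>The ball of this radius contains the support of \<rho>(y - .) for every y at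
    distance less than 1 from x.\<close>
  define Q where "Q = norm x + 1 + R"
  have gi: "integrable lborel (\<lambda>x. \<bar>indicator (cball 0 Q) x * g x\<bar>)" using g by (auto simp: L1l_def)
  define M where "M = (LBINT x. \<bar>indicator (cball 0 Q) x * g x\<bar>)"
  have M: "M \<ge> 0" by (simp add: M_def)
  have *: "norm (conv g \<rho> y - conv g \<rho> x - (\<Sum>k\<in>UNIV. (y - x) $ k * conv g (partial k \<rho>) x))
    \<le> L * M * (norm (y - x))^2" if y: "norm (y - x) < 1" for y
  proof -
    have i: "integrable lborel (\<lambda>t. g t * \<rho> (z - t))" "integrable lborel (\<lambda>t. g t * partial k \<rho> (z - t))" for z k
      using g t by (auto intro!: conv_integrable test_fun_bcs test_fun_partial)
    have "conv g \<rho> y - conv g \<rho> x - (\<Sum>k\<in>UNIV. c k * conv g (partial k \<rho>) x)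
      = (LBINT t. g t * (\<rho> (y - t) - \<rho> (x - t) - (\<Sum>k\<in>UNIV. c k * partial k \<rho> (x - t))))" for c
    proof -
      have eq: "g t * (\<rho> (y - t) - \<rho> (x - t) - (\<Sum>k\<in>UNIV. c k * partial k \<rho> (x - t)))
        = (g t * \<rho> (y - t) - g t * \<rho> (x - t)) - (\<Sum>k\<in>UNIV. c k * (g t * partial k \<rho> (x - t)))" for t
        by (simp only: right_diff_distrib sum_distrib_left mult.left_commute)
      have "(LBINT t. (\<Sum>k\<in>UNIV. c k * (g t * partial k \<rho> (x - t)))) = (\<Sum>k\<in>UNIV. c k * conv g (partial k \<rho>) x)"
        unfolding conv_def using i(2) by (subst Bochner_Integration.integral_sum) auto
      then show ?thesis
        unfolding eq using i by (simp add: conv_def)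
    qed
    then have "norm (conv g \<rho> y - conv g \<rho> x - (\<Sum>k\<in>UNIV. (y - x) $ k * conv g (partial k \<rho>) x))
      = norm (LBINT t. g t * (\<rho> (y - t) - \<rho> (x - t) - (\<Sum>k\<in>UNIV. (y - x) $ k * partial k \<rho> (x - t))))"
      by (simp only:)
    also have "\<dots> \<le> (LBINT t. L * (norm (y - x))^2 * \<bar>indicator (cball 0 Q) t * g t\<bar>)"
    proof (rule Bochner_Integration.integral_norm_bound_integral)
      show "integrable lborel (\<lambda>t. g t * (\<rho> (y - t) - \<rho> (x - t) - (\<Sum>k\<in>UNIV. (y - x) $ k * partial k \<rho> (x - t))))"
        unfolding right_diff_distrib sum_distrib_left mult.left_commute[of "g _"]
        by (intro Bochner_Integration.integrable_diff Bochner_Integration.integrable_sum integrable_mult_right i)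
      show "integrable lborel (\<lambda>t. L * (norm (y - x))^2 * \<bar>indicator (cball 0 Q) t * g t\<bar>)" using gi by simp
      fix t
      show "norm (g t * (\<rho> (y - t) - \<rho> (x - t) - (\<Sum>k\<in>UNIV. (y - x) $ k * partial k \<rho> (x - t))))
         \<le> L * (norm (y - x))^2 * \<bar>indicator (cball 0 Q) t * g t\<bar>"
      proof (cases "norm t \<le> Q")
        case True
        then show ?thesis using mult_left_mono[OF L(2)[of "y - t" "x - t"], of "\<bar>g t\<bar>"] by (simp add: abs_mult mult_ac)
      next
        case False
        have "norm t \<le> norm x + norm (x - t)" using norm_triangle_ineq4[of x "x - t"] by simp
        moreover have "norm (x - t) \<le> norm (y - t) + norm (y - x)" using norm_triangle_ineq4[of "y - t" "y - x"] by simp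
        ultimately have "R < norm (x - t)" "R < norm (y - t)" using False y by (auto simp: Q_def)
        then show ?thesis using R(2)[of "y - t"] R(2,3)[of "x - t"] L(1) by (simp del: vector_minus_component)
      qed
    qed
    also have "\<dots> = L * M * (norm (y - x))^2" by (simp add: M_def)
    finally show ?thesis .
  qed
  show "\<exists>d>0. \<forall>y. norm (y - x) < d \<longrightarrow>
      norm (conv g \<rho> y - conv g \<rho> x - (\<Sum>k\<in>UNIV. (y - x) $ k * conv g (partial k \<rho>) x)) \<le> e * norm (y - x)"
  proof (intro exI[of _ "min 1 (e / (L * M + 1))"] conjI allI impI)
    have LM: "L * M + 1 > 0" using L M by (simp add: add_nonneg_pos)
    then show "0 < min 1 (e / (L * M + 1))" using e by simp
    fix y assume y: "norm (y - x) < min 1 (e / (L * M + 1))"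
    then have "norm (y - x) * (L * M + 1) \<le> e" using LM by (simp add: field_simps)
    moreover have "norm (y - x) * (L * M) \<le> norm (y - x) * (L * M + 1)" by (intro mult_left_mono) auto
    ultimately have "L * M * norm (y - x) \<le> e" by (simp add: mult.commute)
    then have "L * M * norm (y - x) * norm (y - x) \<le> e * norm (y - x)" by (rule mult_right_mono) simp
    moreover have "norm (conv g \<rho> y - conv g \<rho> x - (\<Sum>k\<in>UNIV. (y - x) $ k * conv g (partial k \<rho>) x)) \<le> L * M * (norm (y - x))^2"
      by (rule *) (use y in simp)
    ultimately show "norm (conv g \<rho> y - conv g \<rho> x - (\<Sum>k\<in>UNIV. (y - x) $ k * conv g (partial k \<rho>) x)) \<le> e * norm (y - x)"
      by (simp only: power2_eq_square mult.assoc order_trans)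
  qed
qed

lemma partial_conv: "L1l g \<Longrightarrow> test_fun \<rho> \<Longrightarrow> partial k (conv g \<rho>) = conv g (partial k \<rho>)"
  by (rule ext, subst partial_eq[OF conv_has_derivative], assumption+)
     (simp add: axis_def if_distrib[of "\<lambda>x. x * _"] cong: if_cong)

lemma smooth_conv:
  assumes "L1l g" "test_fun \<rho>" shows "smooth (conv g \<rho>)"
proof -
  have "C_k m (conv g \<rho>)" for m
    using assms(2)
  proof (induction m arbitrary: \<rho>)
    case 0
    have "isCont (conv g \<rho>) x" for x
      by (rule has_derivative_continuous[OF conv_has_derivative[OF assms(1) 0]])
    then show ?case by (simp add: continuous_on_eq_continuous_at)
  next
    case (Suc m)
    have "conv g \<rho> differentiable at x" for x
      using conv_has_derivative[OF assms(1) Suc.prems] unfolding differentiable_def by blast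
    then show ?case
      by (simp add: partial_conv[OF assms(1) Suc.prems] Suc.IH test_fun_partial[OF Suc.prems])
  qed
  then show ?thesis by (simp add: smooth_def)
qed

lemma test_fun_conv:
  assumes "L1l g" "test_fun \<rho>" "\<And>x. R < norm x \<Longrightarrow> g x = 0"
  shows "test_fun (conv g \<rho>)"
proof -
  obtain Q where Q: "Q > 0" "\<And>x. Q < norm x \<Longrightarrow> \<rho> x = 0" using assms(2) unfolding test_fun_iff by blast
  have "\<forall>x. max (R + Q) 1 < norm x \<longrightarrow> conv g \<rho> x = 0"
  proof (intro allI impI)
    fix x :: "real ^ 'a" assume "max (R + Q) 1 < norm x"
    then have "R + Q < norm x" by simp
    with assms(3) Q(2) show "conv g \<rho> x = 0" by (rule conv_eq_0)
  qed
  moreover have "max (R + Q) 1 > 0" by simp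
  ultimately show ?thesis unfolding test_fun_iff using smooth_conv[OF assms(1,2)] by blast
qed

section \<open>Standard mollifiers of radius 1/(n+1)\<close>

definition moll :: "nat \<Rightarrow> real ^ 'n::finite \<Rightarrow> real" where
  "moll n x = real (Suc n) ^ CARD('n) * bump 0 (real (Suc n) *\<^sub>R x) / (LBINT y. bump 0 (y :: real ^ 'n))"

lemma integral_bump_pos: "0 < (LBINT y. bump 0 (y :: real ^ 'n::finite))"
proof -
  have "(LBINT y. bump 0 (y :: real ^ 'n)) \<noteq> 0"
  proof
    assume "(LBINT y. bump 0 (y :: real ^ 'n)) = 0"
    then have "AE y in lborel. bump 0 (y :: real ^ 'n) = 0"
      using bcs_integrable[OF test_fun_bcs[OF test_fun_bump]] bump_nonneg
      by (subst integral_nonneg_eq_0_iff_AE[symmetric]) auto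
    then have "AE y in lborel. y \<notin> ball (0 :: real ^ 'n) 1"
      by eventually_elim (auto simp: bump_def expinv_def dot_square_norm abs_square_less_1)
    then have "ball (0 :: real ^ 'n) 1 \<in> null_sets lborel"
      by (subst AE_iff_null_sets) auto
    then show False using content_ball_pos[of 1 "0 :: real ^ 'n"] by (auto simp: measure_eq_0_null_sets)
  qed
  moreover have "0 \<le> (LBINT y. bump 0 (y :: real ^ 'n))" using bump_nonneg by (intro Bochner_Integration.integral_nonneg) auto
  ultimately show ?thesis by simp
qed

lemma test_fun_moll: "test_fun (moll n)"
proof -
  have "moll n = (\<lambda>x :: real ^ 'a. real (Suc n) ^ CARD('a) / (LBINT y. bump 0 (y :: real ^ 'a)) * bump 0 (real (Suc n) *\<^sub>R x + 0))"
    by (auto simp: moll_def[abs_def])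
  then show ?thesis by (simp only:) (intro test_fun_cmult test_fun_affine test_fun_bump, simp)
qed

lemma kern_moll: "kern (moll n :: real ^ 'n::finite \<Rightarrow> real) (1 / real (Suc n))"
  unfolding kern_def
proof (intro conjI allI impI)
  show "bcs (moll n :: real ^ 'n \<Rightarrow> real)" by (intro test_fun_bcs test_fun_moll)
  show "0 \<le> moll n x" for x :: "real ^ 'n"
    unfolding moll_def by (intro divide_nonneg_pos mult_nonneg_nonneg bump_nonneg integral_bump_pos) auto
  show "moll n x = 0" if "1 / real (Suc n) < norm x" for x :: "real ^ 'n"
  proof -
    have "1 \<le> norm (real (Suc n) *\<^sub>R x)" using that by (simp add: field_simps del: of_nat_Suc)
    then show ?thesis using bump_outside[of "real (Suc n) *\<^sub>R x" 0] by (simp add: moll_def)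
  qed
  show "(LBINT x. moll n (x :: real ^ 'n)) = 1"
    using integral_lborel_affine[of "bump 0 :: real ^ 'n \<Rightarrow> real" "real (Suc n)" 0] integral_bump_pos[where 'n='n]
    by (auto simp: moll_def smooth_borel smooth_bump simp del: of_nat_Suc)
qed

lemma moll_radius: "(\<lambda>n. 1 / real (Suc n)) \<longlonglongrightarrow> 0"
  using LIMSEQ_inverse_real_of_nat by (simp add: inverse_eq_divide)

subsection \<open>Weak partial derivatives\<close>

lemma frechet_derivative_worksI: "f differentiable F \<Longrightarrow> F = at x \<Longrightarrow> (f has_derivative frechet_derivative f (at x)) (at x)"
  using frechet_derivative_works by blast

lemma line_derivative:
  assumes "\<And>x. f differentiable at x"
  shows "((\<lambda>t. f (x + t *\<^sub>R axis k 1)) has_real_derivative partial k f (x + t *\<^sub>R axis k 1)) (at t)"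
proof -
  have "((\<lambda>t. x + t *\<^sub>R axis k 1) has_derivative (\<lambda>h. h *\<^sub>R axis k 1)) (at t)"
    by (auto intro!: derivative_eq_intros)
  from has_derivative_compose[OF this frechet_derivative_worksI[OF assms refl]]
  have "((\<lambda>t. f (x + t *\<^sub>R axis k 1)) has_derivative
      (\<lambda>h. frechet_derivative f (at (x + t *\<^sub>R axis k 1)) (h *\<^sub>R axis k 1))) (at t)" .
  moreover have "(\<lambda>h. frechet_derivative f (at y) (h *\<^sub>R axis k 1)) = (*) (partial k f y)" for y
    by (rule ext) (simp add: partial_def linear_cmul[OF linear_frechet_derivative[OF assms]])
  ultimately show ?thesis by (simp only: has_field_derivative_def)
qed

text \<open>Difference quotients integrate to zero by translation invariance. The mean value theorem
  bounds them by B, and for steps of length at most 1 they vanish outside radius R + 1, so dominated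
  convergence passes to the derivative.\<close>

lemma integral_partial_eq_0:
  fixes f :: "real ^ 'n::finite \<Rightarrow> real"
  assumes d: "\<And>x. f differentiable at x" and B: "\<And>x. \<bar>partial k f x\<bar> \<le> B"
    and R: "\<And>x. R < norm x \<Longrightarrow> f x = 0" and m: "partial k f \<in> borel_measurable borel"
  shows "(LBINT x. partial k f x) = 0"
proof -
  have c: "continuous_on UNIV f"
    using d by (auto simp: continuous_on_eq_continuous_at intro: differentiable_imp_continuous_within)
  then have [measurable]: "f \<in> borel_measurable borel" by (rule borel_measurable_continuous_onI)
  have [measurable]: "partial k f \<in> borel_measurable borel" by (rule m)
  have bf: "bcs f"
  proof -
    have "compact (f ` cball 0 R)"
      by (intro compact_continuous_image continuous_on_subset[OF c]) auto
    then obtain C where C: "\<forall>y\<in>f ` cball 0 R. norm y \<le> C"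
      using compact_imp_bounded bounded_iff by metis
    have "\<bar>f x\<bar> \<le> max C 0" for x using C R[of x] by (cases "norm x \<le> R") (auto simp: le_max_iff_disj)
    then show ?thesis unfolding bcs_def using R by (intro conjI) (auto simp: borel_measurable_continuous_onI[OF c])
  qed
  define e where "e = axis k (1::real)"
  have ne: "norm e = 1" by (simp add: e_def norm_axis_1)
  define t where "t n = 1 / real (Suc n)" for n
  have t: "0 < t n" "t n \<le> 1" "t \<longlonglongrightarrow> 0" for n
    using moll_radius by (auto simp: t_def[abs_def])
  define D where "D n x = (f (x + t n *\<^sub>R e) - f x) / t n" for n x
  have fi: "integrable lborel f" using bf by (rule bcs_integrable)
  have D0: "(LBINT x. D n x) = 0" for n
  proof -
    have "integrable lborel (\<lambda>x. f (x + t n *\<^sub>R e))" "(LBINT x. f (x + t n *\<^sub>R e)) = (LBINT x. f x)"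
      using integrable_lborel_translate[OF fi, of "t n *\<^sub>R e"] integral_lborel_translate[of f "t n *\<^sub>R e"]
      by (simp_all add: add.commute)
    then show ?thesis unfolding D_def using fi by simp
  qed
  have [measurable]: "D n \<in> borel_measurable borel" for n unfolding D_def by measurable
  have Db: "\<bar>D n x\<bar> \<le> B" for n x
  proof -
    have "\<exists>z>0. z < t n \<and> f (x + t n *\<^sub>R e) - f (x + 0 *\<^sub>R e) = (t n - 0) * partial k f (x + z *\<^sub>R e)"
      using line_derivative[OF d] t(1)[of n]
      by (intro MVT2[of 0 "t n" "\<lambda>s. f (x + s *\<^sub>R e)" "\<lambda>s. partial k f (x + s *\<^sub>R e)"]) (auto simp: e_def)
    then obtain z where "f (x + t n *\<^sub>R e) - f x = t n * partial k f (x + z *\<^sub>R e)" by auto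
    then have "D n x = partial k f (x + z *\<^sub>R e)" using t(1)[of n] by (simp add: D_def)
    then show ?thesis using B by simp
  qed
  have "(\<lambda>n. LINT x|lborel. D n x) \<longlonglongrightarrow> (LBINT x. partial k f x)"
  proof (rule integral_dominated_convergence[where w = "\<lambda>x. B * indicator (cball 0 (R + 1)) x"])
    show "integrable lborel (\<lambda>x::real ^ 'n. B * indicator (cball 0 (R + 1)) x)"
      by (intro integrable_mult_right bcs_integrable bcs_indicator)
    show "AE x in lborel. (\<lambda>n. D n x) \<longlonglongrightarrow> partial k f x"
    proof (rule AE_I2)
      fix x
      have "((\<lambda>h. (f (x + h *\<^sub>R e) - f x) / h) \<longlongrightarrow> partial k f x) (at 0)"
        using line_derivative[OF d, of x k 0] unfolding e_def has_field_derivative_iff by simp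
      moreover have "filterlim t (at 0) sequentially"
        using t by (auto simp: filterlim_at less_imp_neq[THEN not_sym])
      ultimately show "(\<lambda>n. D n x) \<longlonglongrightarrow> partial k f x"
        unfolding D_def by (rule filterlim_compose)
    qed
    fix n
    have "norm (D n x) \<le> B * indicator (cball 0 (R + 1)) x" for x
    proof (cases "norm x \<le> R + 1")
      case False
      have "norm x \<le> norm (x + t n *\<^sub>R e) + norm (t n *\<^sub>R e)" using norm_triangle_ineq4[of "x + t n *\<^sub>R e" "t n *\<^sub>R e"] by simp
      then have "R < norm (x + t n *\<^sub>R e)" "R < norm x" using False t(1,2)[of n] ne by auto
      then show ?thesis using R[of x] R[of "x + t n *\<^sub>R e"] False by (simp add: D_def)
    qed (use Db in auto)
    then show "AE x in lborel. norm (D n x) \<le> B * indicator (cball 0 (R + 1)) x" by simp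
  qed measurable
  then show ?thesis unfolding D0 by (simp add: LIMSEQ_const_iff)
qed

text \<open>The weak partial derivative for Borel functions, one component at a time;
  \<open>has_weak_grad_iff\<close> connects it with \<open>has_weak_grad\<close>. Working with Borel
  functions keeps compositions and product measures available.\<close>

definition wd :: "'n::finite \<Rightarrow> (real ^ 'n \<Rightarrow> real) \<Rightarrow> (real ^ 'n \<Rightarrow> real) \<Rightarrow> bool" where
  "wd k u g \<longleftrightarrow> L1l u \<and> L1l g \<and>
     (\<forall>\<psi>. test_fun \<psi> \<longrightarrow> (LBINT x. u x * partial k \<psi> x) = - (LBINT x. g x * \<psi> x))"

lemma wdD: "wd k u g \<Longrightarrow> test_fun \<psi> \<Longrightarrow> (LBINT x. u x * partial k \<psi> x) = - (LBINT x. g x * \<psi> x)"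
  by (simp add: wd_def)

lemma L1l_test_integrable: "L1l u \<Longrightarrow> test_fun \<psi> \<Longrightarrow> integrable lborel (\<lambda>x. u x * \<psi> x)"
  by (intro L1l_bcs test_fun_bcs)

lemma wd_add: "wd k u g \<Longrightarrow> wd k v h \<Longrightarrow> wd k (\<lambda>x. u x + v x) (\<lambda>x. g x + h x)"
  unfolding wd_def by (auto simp: L1l_add distrib_right L1l_test_integrable test_fun_partial)

lemma wd_cmult: "wd k u g \<Longrightarrow> wd k (\<lambda>x. c * u x) (\<lambda>x. c * g x)"
  unfolding wd_def by (auto simp: L1l_cmult mult.assoc)

lemma wd_diff: "wd k u g \<Longrightarrow> wd k v h \<Longrightarrow> wd k (\<lambda>x. u x - v x) (\<lambda>x. g x - h x)"
  using wd_add[of k u g "\<lambda>x. - 1 * v x" "\<lambda>x. - 1 * h x"] wd_cmult[of k v h "-1"] by simp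

lemma wd_0: "wd k (\<lambda>x. 0) (\<lambda>x. 0)"
  by (simp add: wd_def L2l_L1l L2_L2l L2_0)

lemma wd_sum: "(\<And>i. i \<in> I \<Longrightarrow> wd k (u i) (g i)) \<Longrightarrow> wd k (\<lambda>x. \<Sum>i\<in>I. u i x) (\<lambda>x. \<Sum>i\<in>I. g i x)"
  by (induction I rule: infinite_finite_induct) (auto intro: wd_add wd_0)

lemma test_fun_reflect: "test_fun \<psi> \<Longrightarrow> test_fun (\<lambda>y. \<psi> (x - y))"
  using test_fun_affine[of \<psi> "-1" x] by simp

lemma partial_reflect: "test_fun \<psi> \<Longrightarrow> partial k (\<lambda>y. \<psi> (x - y)) y = - partial k \<psi> (x - y)"
  using partial_affine[OF smooth_diff[OF test_fun_smooth], of \<psi> k "-1" x y] by simp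

text \<open>The reflected kernel \<rho>(x - .) is a test function. Its derivative carries a minus
  sign, which cancels the one in the definition of the weak derivative.\<close>

lemma wd_conv:
  assumes "wd k u g" "test_fun \<rho>"
  shows "partial k (conv u \<rho>) x = conv g \<rho> x"
proof -
  have "(LBINT y. u y * partial k (\<lambda>y. \<rho> (x - y)) y) = - (LBINT y. g y * \<rho> (x - y))"
    by (rule wdD[OF assms(1) test_fun_reflect[OF assms(2)]])
  then show ?thesis
    using assms by (simp add: partial_conv wd_def partial_reflect) (simp add: conv_def)
qed

text \<open>Stated for continuous derivatives and not only for smooth functions, since the functions
  \<open>B (v' n x)\<close> that occur in the chain rule inherit only the regularity of
  \<open>B\<close>.\<close>

lemma wd_C1:
  assumes d: "\<And>x. f differentiable at x" and c: "continuous_on UNIV (partial k f)"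
  shows "wd k f (partial k f)"
  unfolding wd_def
proof (intro conjI allI impI)
  have cf: "continuous_on UNIV f"
    using d by (auto simp: continuous_on_eq_continuous_at intro: differentiable_imp_continuous_within)
  show L: "L1l f" "L1l (partial k f)" using cf c by (auto intro: L2l_L1l continuous_L2l)
  fix \<psi> :: "real ^ 'a \<Rightarrow> real" assume t: "test_fun \<psi>"
  obtain R where R: "R > 0" "\<And>x. R < norm x \<Longrightarrow> \<psi> x = 0" "\<And>x k. R < norm x \<Longrightarrow> partial k \<psi> x = 0"
    using test_funE[OF t] by blast
  have ct: "continuous_on UNIV \<psi>" "continuous_on UNIV (partial k \<psi>)"
    using t by (auto intro: smooth_continuous test_fun_smooth test_fun_partial)
  have dt: "\<psi> differentiable at x" for x using t by (intro smooth_diff test_fun_smooth)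
  have p: "partial k (\<lambda>x. f x * \<psi> x) = (\<lambda>x. f x * partial k \<psi> x + partial k f x * \<psi> x)"
    by (rule ext, subst partial_eq[OF has_derivative_mult[OF frechet_derivative_worksI[OF d refl] frechet_derivative_worksI[OF dt refl]]])
       (simp add: partial_def)
  have cp: "continuous_on UNIV (partial k (\<lambda>x. f x * \<psi> x))" unfolding p by (intro continuous_intros cf c ct)
  have "compact (partial k (\<lambda>x. f x * \<psi> x) ` cball 0 R)"
    by (intro compact_continuous_image continuous_on_subset[OF cp]) auto
  then obtain C where C: "\<forall>y\<in>partial k (\<lambda>x. f x * \<psi> x) ` cball 0 R. norm y \<le> C"
    using compact_imp_bounded bounded_iff by metis
  have "(LBINT x. partial k (\<lambda>x. f x * \<psi> x) x) = 0"
  proof (rule integral_partial_eq_0[where R = R and B = "max C 0"])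
    show "(\<lambda>x. f x * \<psi> x) differentiable at x" for x using d dt by (intro differentiable_mult)
    show "\<bar>partial k (\<lambda>x. f x * \<psi> x) x\<bar> \<le> max C 0" for x
    proof (cases "norm x \<le> R")
      case True
      then have "partial k (\<lambda>x. f x * \<psi> x) x \<in> partial k (\<lambda>x. f x * \<psi> x) ` cball 0 R" by simp
      then have "norm (partial k (\<lambda>x. f x * \<psi> x) x) \<le> C" using C by blast
      then show ?thesis by simp
    qed (simp add: p R)
    show "f x * \<psi> x = 0" if "R < norm x" for x using R(2)[OF that] by simp
    show "partial k (\<lambda>x. f x * \<psi> x) \<in> borel_measurable borel" by (rule borel_measurable_continuous_onI[OF cp])
  qed
  then have "(LBINT x. f x * partial k \<psi> x) + (LBINT x. partial k f x * \<psi> x) = 0"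
    unfolding p using L t by (simp add: L1l_test_integrable test_fun_partial)
  then show "(LBINT x. f x * partial k \<psi> x) = - (LBINT x. partial k f x * \<psi> x)" by simp
qed

lemma wd_smooth: "smooth f \<Longrightarrow> wd k f (partial k f)"
  by (intro wd_C1 smooth_diff smooth_continuous smooth_partial)

lemma wd_mult_smooth:
  assumes u: "wd k u g" and s: "smooth \<zeta>"
    and L: "L1l (\<lambda>x. u x * \<zeta> x)" "L1l (\<lambda>x. g x * \<zeta> x + u x * partial k \<zeta> x)"
  shows "wd k (\<lambda>x. u x * \<zeta> x) (\<lambda>x. g x * \<zeta> x + u x * partial k \<zeta> x)"
  unfolding wd_def
proof (intro conjI allI impI L)
  fix \<psi> :: "real ^ 'a \<Rightarrow> real" assume t: "test_fun \<psi>"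
  have t': "test_fun (\<lambda>x. \<zeta> x * \<psi> x)" "test_fun (\<lambda>x. \<zeta> x * partial k \<psi> x)" "test_fun (\<lambda>x. partial k \<zeta> x * \<psi> x)"
    using s t by (auto intro!: test_fun_mult smooth_partial test_fun_partial)
  have "(LBINT x. u x * partial k (\<lambda>x. \<zeta> x * \<psi> x) x) = - (LBINT x. g x * (\<zeta> x * \<psi> x))"
    by (rule wdD[OF u t'(1)])
  moreover have "(\<lambda>x. u x * partial k (\<lambda>x. \<zeta> x * \<psi> x) x) = (\<lambda>x. u x * (\<zeta> x * partial k \<psi> x) + u x * (partial k \<zeta> x * \<psi> x))"
    using partial_mult[OF s test_fun_smooth[OF t]] by (auto simp: algebra_simps)
  moreover have "integrable lborel (\<lambda>x. u x * (\<zeta> x * partial k \<psi> x))" "integrable lborel (\<lambda>x. u x * (partial k \<zeta> x * \<psi> x))"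
    "integrable lborel (\<lambda>x. g x * (\<zeta> x * \<psi> x))"
    using u by (auto simp: wd_def intro!: L1l_test_integrable t')
  ultimately show "(LBINT x. u x * \<zeta> x * partial k \<psi> x) = - (LBINT x. (g x * \<zeta> x + u x * partial k \<zeta> x) * \<psi> x)"
    by (simp add: distrib_right mult.assoc)
qed

lemma wd_affine:
  assumes u: "wd k u g" and c: "c \<noteq> 0"
  shows "wd k (\<lambda>x. u (w + c *\<^sub>R x)) (\<lambda>x. c * g (w + c *\<^sub>R x))"
  unfolding wd_def
proof (intro conjI allI impI)
  have L: "L1l u" "L1l g" using u by (auto simp: wd_def)
  have [measurable]: "u \<in> borel_measurable borel" "g \<in> borel_measurable borel" using L by measurable
  show "L1l (\<lambda>x. u (w + c *\<^sub>R x))" "L1l (\<lambda>x. c * g (w + c *\<^sub>R x))"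
    using L c by (auto intro!: L1l_affine L1l_cmult)
  fix \<psi> :: "real ^ 'a \<Rightarrow> real" assume t: "test_fun \<psi>"
  \<comment> \<open>The given test function transported by the inverse substitution; its derivative
    contributes the factor 1/c, which becomes the factor c in front of \<open>g\<close>.\<close>
  define \<theta> where "\<theta> x = \<psi> (inverse c *\<^sub>R x + - (inverse c *\<^sub>R w))" for x
  have th: "test_fun \<theta>" unfolding \<theta>_def using t c by (intro test_fun_affine) auto
  have p: "partial k \<theta> x = inverse c * partial k \<psi> (inverse c *\<^sub>R x + - (inverse c *\<^sub>R w))" for x
    unfolding \<theta>_def using partial_affine[of \<psi>] smooth_diff[OF test_fun_smooth[OF t]] by blast
  have arg: "inverse c *\<^sub>R (w + c *\<^sub>R x) + - (inverse c *\<^sub>R w) = x" for x using c by (simp add: scaleR_add_right)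
  have [measurable]: "\<psi> \<in> borel_measurable borel" "partial k \<psi> \<in> borel_measurable borel"
    using t by (auto intro: smooth_borel test_fun_smooth test_fun_partial)
  have "(LBINT x. u x * partial k \<theta> x) = - (LBINT x. g x * \<theta> x)" by (rule wdD[OF u th])
  moreover have "(LBINT x. u x * partial k \<theta> x) = \<bar>c\<bar> ^ DIM(real ^ 'a) * (LBINT x. u (w + c *\<^sub>R x) * (inverse c * partial k \<psi> x))"
    by (subst integral_lborel_affine[of _ c w]) (use c in \<open>simp_all only: p arg, measurable\<close>)
  moreover have "(LBINT x. g x * \<theta> x) = \<bar>c\<bar> ^ DIM(real ^ 'a) * (LBINT x. g (w + c *\<^sub>R x) * \<psi> x)"
    by (subst integral_lborel_affine[of _ c w]) (use c in \<open>simp_all only: \<theta>_def arg, measurable\<close>)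
  ultimately have "inverse c * (LBINT x. u (w + c *\<^sub>R x) * partial k \<psi> x) = - (LBINT x. g (w + c *\<^sub>R x) * \<psi> x)"
  proof -
    define a X Y where "a = \<bar>c\<bar> ^ DIM(real ^ 'a)" and "X = (LBINT x. u (w + c *\<^sub>R x) * partial k \<psi> x)"
      and "Y = (LBINT x. g (w + c *\<^sub>R x) * \<psi> x)"
    have "a > 0" using c by (simp add: a_def)
    assume *: "(LBINT x. u x * partial k \<theta> x) = - (LBINT x. g x * \<theta> x)"
      "(LBINT x. u x * partial k \<theta> x) = \<bar>c\<bar> ^ DIM(real ^ 'a) * (LBINT x. u (w + c *\<^sub>R x) * (inverse c * partial k \<psi> x))"
      "(LBINT x. g x * \<theta> x) = \<bar>c\<bar> ^ DIM(real ^ 'a) * (LBINT x. g (w + c *\<^sub>R x) * \<psi> x)"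
    have "(LBINT x. u (w + c *\<^sub>R x) * (inverse c * partial k \<psi> x)) = inverse c * X"
      by (simp add: X_def mult.left_commute)
    then have "a * (inverse c * X) = a * (- Y)" using * unfolding a_def Y_def by simp
    then show "inverse c * X = - Y" using \<open>a > 0\<close> by (simp only: mult_cancel_left) simp
  qed
  then show "(LBINT x. u (w + c *\<^sub>R x) * partial k \<psi> x) = - (LBINT x. c * g (w + c *\<^sub>R x) * \<psi> x)"
    using c by (simp add: field_simps)
qed

lemma wd_translate: "wd k u g \<Longrightarrow> wd k (\<lambda>x. u (w + x)) (\<lambda>x. g (w + x))"
  using wd_affine[of k u g 1 w] by simp

subsection \<open>Mollification\<close>

text \<open>A fixed square-integrable weight with bounded support turns local mean-square
  convergence of mollifications into convergence of weighted integrals. All limits in the calculus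
  rules below are of this kind, and no subsequence has to be chosen.\<close>

lemma moll_tendsto:
  fixes g h :: "real ^ 'n::finite \<Rightarrow> real"
  assumes g: "L2l g" and h: "L2 h" and R: "\<And>x. R < norm x \<Longrightarrow> h x = 0"
  shows "(\<lambda>n. LINT x|lborel. \<bar>h x\<bar> * \<bar>conv g (moll n) x - g x\<bar>) \<longlonglongrightarrow> 0"
proof (rule LIMSEQ_I)
  fix e :: real assume e: "e > 0"
  define I where "I = (indicator (cball 0 (R + 1)) :: real ^ 'n \<Rightarrow> real)"
  \<comment> \<open>On the ball of radius R the mollification sees \<open>g\<close> only up to
    radius R + 1, so \<open>g\<close> may be replaced by a globally square-integrable
    function.\<close>
  define g1 where "g1 x = g x * I x" for x
  have g1: "L2 g1" using g unfolding L2l_iff g1_def I_def by blast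
  have eq: "conv g (moll n) x = conv g1 (moll n) x" if "norm x \<le> R" for n x
    unfolding conv_def
  proof (rule Bochner_Integration.integral_cong[OF refl])
    fix y
    show "g y * moll n (x - y) = g1 y * moll n (x - y)"
    proof (cases "norm y \<le> R + 1")
      case False
      have "norm y \<le> norm x + norm (x - y)" using norm_triangle_ineq4[of x "x - y"] by simp
      moreover have "1 / real (Suc n) \<le> 1" by simp
      ultimately have "1 / real (Suc n) < norm (x - y)" using False that by linarith
      then show ?thesis using kern_moll[where 'n='n] by (simp add: kern_def)
    qed (simp add: g1_def I_def)
  qed
  define H where "H = (LBINT x. (h x)^2)"
  have H: "H \<ge> 0" by (simp add: H_def)
  \<comment> \<open>The parameter of Young's inequality: the weight contributes d/2 (H + 1) = e/2,
    and a mollification error of size d e/2, divided by 2 d, contributes e/4.\<close>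
  define d where "d = e / (H + 1)"
  have d: "d > 0" using e H by (simp add: d_def add_nonneg_pos)
  have "eventually (\<lambda>n. (LBINT\<^sup>+ x. ennreal ((conv g1 (moll n) x - g1 x)^2)) \<le> ennreal (d * e / 2)) sequentially"
    using d e by (intro kern_conv_L2_eventually[OF g1 kern_moll moll_radius]) simp
  then obtain N where N: "\<And>n. n \<ge> N \<Longrightarrow> (LBINT\<^sup>+ x. ennreal ((conv g1 (moll n) x - g1 x)^2)) \<le> ennreal (d * e / 2)"
    by (auto simp: eventually_sequentially)
  show "\<exists>N. \<forall>n\<ge>N. norm ((LBINT x. \<bar>h x\<bar> * \<bar>conv g (moll n) x - g x\<bar>) - 0) < e"
  proof (intro exI[of _ N] allI impI)
    fix n assume n: "n \<ge> N"
    have D: "L2 (\<lambda>x. conv g1 (moll n) x - g1 x)"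
      by (intro L2_diff conv_L2 g1 kern_bcs[OF kern_moll])
    then have Di: "integrable lborel (\<lambda>x. (conv g1 (moll n) x - g1 x)^2)" by (simp add: L2_def)
    have De: "(LBINT x. (conv g1 (moll n) x - g1 x)^2) \<le> d * e / 2"
      using N[OF n] Di d e by (simp add: nn_integral_eq_integral)
    have hi: "integrable lborel (\<lambda>x. (h x)^2)" using h by (simp add: L2_def)
    have "(LBINT x. \<bar>h x\<bar> * \<bar>conv g (moll n) x - g x\<bar>) = (LBINT x. \<bar>h x * (conv g1 (moll n) x - g1 x)\<bar>)"
    proof (rule Bochner_Integration.integral_cong[OF refl])
      fix x
      show "\<bar>h x\<bar> * \<bar>conv g (moll n) x - g x\<bar> = \<bar>h x * (conv g1 (moll n) x - g1 x)\<bar>"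
        using R[of x] by (cases "norm x \<le> R") (auto simp: abs_mult eq g1_def I_def)
    qed
    also have "\<dots> \<le> (LBINT x. d / 2 * (h x)^2 + 1 / (2 * d) * (conv g1 (moll n) x - g1 x)^2)"
    proof (rule integral_mono)
      show "integrable lborel (\<lambda>x. \<bar>h x * (conv g1 (moll n) x - g1 x)\<bar>)"
        by (intro integrable_abs L2_mult_integrable h D)
      show "integrable lborel (\<lambda>x. d / 2 * (h x)^2 + 1 / (2 * d) * (conv g1 (moll n) x - g1 x)^2)"
        using hi Di by simp
      fix x
      have "0 \<le> (d * \<bar>h x\<bar> - \<bar>conv g1 (moll n) x - g1 x\<bar>)^2" by simp
      then have "2 * d * (\<bar>h x\<bar> * \<bar>conv g1 (moll n) x - g1 x\<bar>) \<le> d^2 * (h x)^2 + (conv g1 (moll n) x - g1 x)^2"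
        by (simp add: power2_diff power_mult_distrib)
      then show "\<bar>h x * (conv g1 (moll n) x - g1 x)\<bar> \<le> d / 2 * (h x)^2 + 1 / (2 * d) * (conv g1 (moll n) x - g1 x)^2"
        using d by (simp only: abs_mult) (simp add: field_simps power2_eq_square del: abs_mult_self_eq)
    qed
    also have "\<dots> = d / 2 * H + 1 / (2 * d) * (LBINT x. (conv g1 (moll n) x - g1 x)^2)"
      using hi Di by (simp add: H_def)
    also have "\<dots> \<le> d / 2 * (H + 1) + 1 / (2 * d) * (d * e / 2)"
      using d De H by (intro add_mono mult_left_mono) auto
    also have "\<dots> = e / 2 + e / 4"
    proof -
      have "d * (H + 1) = e" using H by (simp add: d_def)
      then show ?thesis using d by simp
    qed
    also have "\<dots> < e" using e by simp
    finally have "(LBINT x. \<bar>h x\<bar> * \<bar>conv g (moll n) x - g x\<bar>) < e" .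
    moreover have "0 \<le> (LBINT x. \<bar>h x\<bar> * \<bar>conv g (moll n) x - g x\<bar>)"
      by (intro Bochner_Integration.integral_nonneg) simp
    ultimately show "norm ((LBINT x. \<bar>h x\<bar> * \<bar>conv g (moll n) x - g x\<bar>) - 0) < e" by simp
  qed
qed

lemma L2l_cs_integrable:
  assumes g: "L2l g" and h: "L2 h" and R: "\<And>x. R < norm x \<Longrightarrow> h x = 0"
  shows "integrable lborel (\<lambda>x. h x * g x)"
proof -
  have "L2 (\<lambda>x. g x * indicator (cball 0 R) x)" using g unfolding L2l_iff by blast
  from L2_mult_integrable[OF h this]
  have "integrable lborel (\<lambda>x. h x * (g x * indicator (cball 0 R) x))" .
  moreover have "(\<lambda>x. h x * (g x * indicator (cball 0 R) x)) = (\<lambda>x. h x * g x)"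
    using R by (intro ext) (metis indicator_simps(1,2) linorder_not_le mem_cball_0 mult.right_neutral mult_zero_left)
  ultimately show ?thesis by simp
qed

lemma smooth_L2l: "smooth f \<Longrightarrow> L2l f"
  by (intro continuous_L2l smooth_continuous)

lemma moll_pairing:
  assumes g: "L2l g" and h: "L2 h" and R: "\<And>x. R < norm x \<Longrightarrow> h x = 0"
  shows "(\<lambda>n. LINT x|lborel. h x * conv g (moll n) x) \<longlonglongrightarrow> (LBINT x. h x * g x)"
proof (rule LIM_zero_cancel, rule Lim_null_comparison[OF _ moll_tendsto[OF g h R]])
  have c: "L2l (conv g (moll n))" for n by (intro smooth_L2l smooth_conv L2l_L1l g test_fun_moll)
  show "\<forall>\<^sub>F n in sequentially. norm ((LBINT x. h x * conv g (moll n) x) - (LBINT x. h x * g x))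
      \<le> (LBINT x. \<bar>h x\<bar> * \<bar>conv g (moll n) x - g x\<bar>)"
  proof (intro always_eventually allI)
    fix n
    have i: "integrable lborel (\<lambda>x. h x * conv g (moll n) x)" "integrable lborel (\<lambda>x. h x * g x)"
      by (auto intro!: L2l_cs_integrable[OF _ h R] c g)
    have "norm ((LBINT x. h x * conv g (moll n) x) - (LBINT x. h x * g x))
       = norm (LBINT x. h x * conv g (moll n) x - h x * g x)" using i by simp
    also have "\<dots> \<le> (LBINT x. norm (h x * conv g (moll n) x - h x * g x))" by (rule integral_norm_bound)
    also have "\<dots> = (LBINT x. \<bar>h x\<bar> * \<bar>conv g (moll n) x - g x\<bar>)"
      by (simp add: abs_mult[symmetric] right_diff_distrib)
    finally show "norm ((LBINT x. h x * conv g (moll n) x) - (LBINT x. h x * g x))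
      \<le> (LBINT x. \<bar>h x\<bar> * \<bar>conv g (moll n) x - g x\<bar>)" .
  qed
qed

lemma L2l_mult_test: "L2l u \<Longrightarrow> test_fun \<psi> \<Longrightarrow> L2 (\<lambda>x. u x * \<psi> x)"
  by (intro L2l_bcs test_fun_bcs)

text \<open>Only the second factor is mollified; for it the rule is obtained by moving the smooth
  factor onto the test function. Each of the three resulting integrals pairs a fixed
  square-integrable function of bounded support with a mollification, and
  \<open>moll_pairing\<close> passes to the limit.\<close>

lemma wd_mult:
  assumes u: "wd k u Du" and v: "wd k v Dv" and L: "L2l u" "L2l Du" "L2l v" "L2l Dv"
  shows "wd k (\<lambda>x. u x * v x) (\<lambda>x. Du x * v x + u x * Dv x)"
  unfolding wd_def
proof (intro conjI allI impI)
  show "L1l (\<lambda>x. u x * v x)" "L1l (\<lambda>x. Du x * v x + u x * Dv x)"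
    using L by (auto intro!: L2l_mult_L1l L1l_add)
  fix \<psi> :: "real ^ 'a \<Rightarrow> real" assume t: "test_fun \<psi>"
  obtain R where R: "R > 0" "\<And>x. R < norm x \<Longrightarrow> \<psi> x = 0" "\<And>x k. R < norm x \<Longrightarrow> partial k \<psi> x = 0"
    using test_funE[OF t] by blast
  define v' where "v' n = conv v (moll n)" for n
  have L1: "L1l v" "L1l Dv" using L by (auto intro: L2l_L1l)
  have s: "smooth (v' n)" for n unfolding v'_def using L1 by (intro smooth_conv test_fun_moll)
  have p: "partial k (v' n) = conv Dv (moll n)" for n
    unfolding v'_def by (rule ext, rule wd_conv[OF v test_fun_moll])
  have Lv: "L2l (v' n)" "L2l (partial k (v' n))" for n using s by (auto intro: smooth_L2l smooth_partial)
  have "wd k (\<lambda>x. u x * v' n x) (\<lambda>x. Du x * v' n x + u x * partial k (v' n) x)" for n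
    using L Lv by (intro wd_mult_smooth u s L2l_mult_L1l L1l_add)
  from wdD[OF this t]
  have n: "(LBINT x. u x * v' n x * partial k \<psi> x) = - (LBINT x. (Du x * v' n x + u x * partial k (v' n) x) * \<psi> x)" for n .
  have h: "L2 (\<lambda>x. u x * partial k \<psi> x)" "L2 (\<lambda>x. Du x * \<psi> x)" "L2 (\<lambda>x. u x * \<psi> x)"
    using L t by (auto intro: L2l_mult_test test_fun_partial)
  have z: "u x * partial k \<psi> x = 0" "Du x * \<psi> x = 0" "u x * \<psi> x = 0" if "R < norm x" for x
    using R(2,3) that by auto
  have lim: "(\<lambda>n. LINT x|lborel. u x * partial k \<psi> x * v' n x) \<longlonglongrightarrow> (LBINT x. u x * partial k \<psi> x * v x)"
    "(\<lambda>n. LINT x|lborel. Du x * \<psi> x * v' n x) \<longlonglongrightarrow> (LBINT x. Du x * \<psi> x * v x)"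
    "(\<lambda>n. LINT x|lborel. u x * \<psi> x * partial k (v' n) x) \<longlonglongrightarrow> (LBINT x. u x * \<psi> x * Dv x)"
    unfolding p unfolding v'_def using h z L by (auto intro!: moll_pairing[where R=R])
  have split: "(LBINT x. (Du x * w x + u x * w' x) * \<psi> x) = (LBINT x. Du x * \<psi> x * w x) + (LBINT x. u x * \<psi> x * w' x)"
    if "L2l w" "L2l w'" for w w'
    using L2l_cs_integrable[OF that(1) h(2) z(2)] L2l_cs_integrable[OF that(2) h(3) z(3)]
    by (subst Bochner_Integration.integral_add[symmetric]) (auto simp: algebra_simps)
  have "(\<lambda>n. LINT x|lborel. u x * partial k \<psi> x * v' n x) \<longlonglongrightarrow> - ((LBINT x. Du x * \<psi> x * v x) + (LBINT x. u x * \<psi> x * Dv x))"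
    using tendsto_minus[OF tendsto_add[OF lim(2,3)]] n unfolding split[OF Lv] by (simp add: mult.commute mult.left_commute)
  from LIMSEQ_unique[OF lim(1) this]
  show "(LBINT x. u x * v x * partial k \<psi> x) = - (LBINT x. (Du x * v x + u x * Dv x) * \<psi> x)"
    unfolding split[OF L(3,4)] by (simp add: mult.commute mult.left_commute)
qed

text \<open>For mollified \<open>v\<close> the classical chain rule applies. Boundedness of B'
  controls the convergence of B(v) and of the differentiated factor, and the Lipschitz bound on B'
  controls the change of its argument.\<close>

lemma wd_chain:
  assumes v: "wd k v Dv" and L: "L2l v" "L2l Dv"
    and B: "\<And>t. (B has_real_derivative B' t) (at t)" and K: "\<And>t. \<bar>B' t\<bar> \<le> K"
    and Lip: "\<And>s t. \<bar>B' s - B' t\<bar> \<le> M * \<bar>s - t\<bar>"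
  shows "wd k (\<lambda>x. B (v x)) (\<lambda>x. B' (v x) * Dv x)"
proof -
  have BLip: "\<bar>B s - B t\<bar> \<le> K * \<bar>s - t\<bar>" for s t
    using field_differentiable_bound[of UNIV B B' K t s] B K by (auto simp: abs_minus_commute)
  have M: "M \<ge> 0" using Lip[of 0 1] by simp
  have cB: "continuous_on A B" for A
    using B by (auto intro!: continuous_at_imp_continuous_on DERIV_isCont)
  have cB': "continuous_on UNIV B'"
    unfolding continuous_on_eq_continuous_at[OF open_UNIV] isCont_def
  proof (intro ballI)
    fix t
    have "((\<lambda>s. M * \<bar>s - t\<bar>) \<longlongrightarrow> 0) (at t)" by (auto intro!: tendsto_eq_intros)
    then have "((\<lambda>s. B' s - B' t) \<longlongrightarrow> 0) (at t)" by (rule Lim_null_comparison[rotated]) (use Lip in auto)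
    then show "B' \<midarrow>t\<rightarrow> B' t" by (rule LIM_zero_cancel)
  qed
  have [measurable]: "B \<in> borel_measurable borel" "B' \<in> borel_measurable borel" "v \<in> borel_measurable borel" "Dv \<in> borel_measurable borel"
    using cB cB' L by (auto intro: borel_measurable_continuous_onI dest: L2l_borel)
  have LB: "L2l (\<lambda>x. B' (v x) * Dv x)"
    unfolding L2l_iff
  proof (intro conjI allI)
    fix R
    have "L2 (\<lambda>x. (Dv x * indicator (cball 0 R) x) * B' (v x))"
      using L K by (intro L2_bounded_mult[where f="\<lambda>x. Dv x * indicator (cball 0 R) x" and g="\<lambda>x. B' (v x)" and B=K]) (auto simp: L2l_iff)
    then show "L2 (\<lambda>x. B' (v x) * Dv x * indicator (cball 0 R) x)" by (simp add: mult_ac)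
  qed measurable
  have LBv: "L2l (\<lambda>x. B (v x))"
    unfolding L2l_iff
  proof (intro conjI allI)
    fix R
    have "L2 (\<lambda>x. \<bar>B 0\<bar> * indicator (cball 0 R) x + K * (\<bar>v x\<bar> * indicator (cball 0 R) x))"
    proof (rule L2_add[OF L2_cmult[OF bcs_L2[OF bcs_indicator]] L2_cmult])
      have "(\<bar>v x\<bar> * indicator (cball 0 R) x)^2 = (v x * indicator (cball 0 R) x)^2" for x by (simp add: power_mult_distrib)
      then show "L2 (\<lambda>x. \<bar>v x\<bar> * indicator (cball 0 R) x)" using L by (auto simp: L2l_iff L2_def)
    qed
    then have "integrable lborel (\<lambda>x. (\<bar>B 0\<bar> * indicator (cball 0 R) x + K * (\<bar>v x\<bar> * indicator (cball 0 R) x))^2)" by (simp add: L2_def)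
    then show "L2 (\<lambda>x. B (v x) * indicator (cball 0 R) x)"
    proof (rule L2_bound[rotated])
      fix x
      have "\<bar>B (v x)\<bar> \<le> \<bar>B 0\<bar> + K * \<bar>v x\<bar>" using BLip[of "v x" 0] by simp
      then have "\<bar>B (v x) * indicator (cball 0 R) x\<bar> \<le> \<bar>\<bar>B 0\<bar> * indicator (cball 0 R) x + K * (\<bar>v x\<bar> * indicator (cball 0 R) x)\<bar>"
        by (auto simp: indicator_def)
      then show "(B (v x) * indicator (cball 0 R) x)^2 \<le> (\<bar>B 0\<bar> * indicator (cball 0 R) x + K * (\<bar>v x\<bar> * indicator (cball 0 R) x))^2"
        by (simp only: abs_le_square_iff)
    qed measurable
  qed measurable
  show ?thesis
    unfolding wd_def
  proof (intro conjI allI impI L2l_L1l LB LBv)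
    fix \<psi> :: "real ^ 'a \<Rightarrow> real" assume t: "test_fun \<psi>"
    obtain R where R: "R > 0" "\<And>x. R < norm x \<Longrightarrow> \<psi> x = 0" "\<And>x k. R < norm x \<Longrightarrow> partial k \<psi> x = 0"
      using test_funE[OF t] by blast
    define v' where "v' n = conv v (moll n)" for n
    define D where "D n = conv Dv (moll n)" for n
    have L1: "L1l v" "L1l Dv" using L by (auto intro: L2l_L1l)
    have s: "smooth (v' n)" "smooth (D n)" for n unfolding v'_def D_def using L1 by (auto intro!: smooth_conv test_fun_moll)
    have Lv: "L2l (v' n)" "L2l (D n)" for n using s by (auto intro: smooth_L2l)
    have cv: "continuous_on UNIV (v' n)" "continuous_on UNIV (D n)" for n using s by (auto intro: smooth_continuous)
    have [measurable]: "v' n \<in> borel_measurable borel" "D n \<in> borel_measurable borel" for n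
      using s by (auto intro: smooth_borel)
    have p: "partial k (v' n) = D n" for n
      unfolding v'_def D_def by (rule ext, rule wd_conv[OF v test_fun_moll])
    have hd: "((\<lambda>x. B (v' n x)) has_derivative (\<lambda>h. B' (v' n x) * frechet_derivative (v' n) (at x) h)) (at x)" for n x
      using has_derivative_compose[OF smooth_has_derivative[OF s(1)] B[unfolded has_field_derivative_def]] .
    then have pB: "partial k (\<lambda>x. B (v' n x)) = (\<lambda>x. B' (v' n x) * D n x)" for n
      by (intro ext) (simp add: partial_eq[OF hd] p[symmetric], simp add: partial_def)
    have n: "(LBINT x. B (v' n x) * partial k \<psi> x) = - (LBINT x. B' (v' n x) * D n x * \<psi> x)" for n
    proof -
      have "wd k (\<lambda>x. B (v' n x)) (partial k (\<lambda>x. B (v' n x)))"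
      proof (rule wd_C1)
        show "(\<lambda>x. B (v' n x)) differentiable at x" for x using hd unfolding differentiable_def by blast
        show "continuous_on UNIV (partial k (\<lambda>x. B (v' n x)))" unfolding pB
          by (intro continuous_on_mult continuous_on_compose2[OF cB' cv(1)] cv) simp
      qed
      from wdD[OF this t] show ?thesis unfolding pB .
    qed
    have tL: "L2 \<psi>" "L2 (partial k \<psi>)" using t by (auto intro: bcs_L2 test_fun_bcs test_fun_partial)
    have [measurable]: "\<psi> \<in> borel_measurable borel" "partial k \<psi> \<in> borel_measurable borel" using tL by measurable
    have int: "integrable lborel (\<lambda>x. \<bar>h x\<bar> * \<bar>g' x - g x\<bar>)"
      if "L2 h" "\<And>x. R < norm x \<Longrightarrow> h x = 0" "L2l g'" "L2l g" for h g g' :: "real ^ 'a \<Rightarrow> real"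
      using integrable_abs[OF L2l_cs_integrable[OF L2l_add[OF that(3) L2l_cmult[OF that(4), of "-1"]] that(1,2)]]
      by (simp add: abs_mult)
    have lim1: "(\<lambda>n. LINT x|lborel. B (v' n x) * partial k \<psi> x) \<longlonglongrightarrow> (LBINT x. B (v x) * partial k \<psi> x)"
    proof (rule LIM_zero_cancel, rule Lim_null_comparison)
      show "(\<lambda>n. K * (LBINT x. \<bar>partial k \<psi> x\<bar> * \<bar>v' n x - v x\<bar>)) \<longlonglongrightarrow> 0"
        unfolding v'_def by (intro tendsto_mult_right_zero moll_tendsto[OF L(1) tL(2) R(3)])
      show "\<forall>\<^sub>F n in sequentially. norm ((LBINT x. B (v' n x) * partial k \<psi> x) - (LBINT x. B (v x) * partial k \<psi> x))
          \<le> K * (LBINT x. \<bar>partial k \<psi> x\<bar> * \<bar>v' n x - v x\<bar>)"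
      proof (intro always_eventually allI)
        fix n
        have i1: "integrable lborel (\<lambda>x. B (v' n x) * partial k \<psi> x)"
          by (intro L1l_test_integrable test_fun_partial t L2l_L1l continuous_L2l continuous_on_compose2[OF cB cv(1)]) auto
        have i2: "integrable lborel (\<lambda>x. B (v x) * partial k \<psi> x)"
          by (intro L1l_test_integrable test_fun_partial t L2l_L1l LBv)
        have "norm ((LBINT x. B (v' n x) * partial k \<psi> x) - (LBINT x. B (v x) * partial k \<psi> x))
          = norm (LBINT x. B (v' n x) * partial k \<psi> x - B (v x) * partial k \<psi> x)" using i1 i2 by simp
        also have "\<dots> \<le> (LBINT x. K * (\<bar>partial k \<psi> x\<bar> * \<bar>v' n x - v x\<bar>))"
        proof (rule Bochner_Integration.integral_norm_bound_integral)
          fix x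
          show "norm (B (v' n x) * partial k \<psi> x - B (v x) * partial k \<psi> x) \<le> K * (\<bar>partial k \<psi> x\<bar> * \<bar>v' n x - v x\<bar>)"
            using mult_left_mono[OF BLip[of "v' n x" "v x"], of "\<bar>partial k \<psi> x\<bar>"]
            by (simp add: left_diff_distrib[symmetric] abs_mult mult_ac)
        qed (use i1 i2 int[OF tL(2) R(3) Lv(1) L(1)] in \<open>auto intro!: integrable_mult_right\<close>)
        finally show "norm ((LBINT x. B (v' n x) * partial k \<psi> x) - (LBINT x. B (v x) * partial k \<psi> x))
          \<le> K * (LBINT x. \<bar>partial k \<psi> x\<bar> * \<bar>v' n x - v x\<bar>)" by simp
      qed
    qed
    have Dpsi: "L2 (\<lambda>x. Dv x * \<psi> x)" "Dv x * \<psi> x = 0" if "R < norm x" for x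
      using that R by (auto intro: L2l_mult_test L t)
    have Dpsi1: "L2 (\<lambda>x. Dv x * \<psi> x)" by (intro L2l_mult_test L t)
    have lim2: "(\<lambda>n. LINT x|lborel. B' (v' n x) * D n x * \<psi> x) \<longlonglongrightarrow> (LBINT x. B' (v x) * Dv x * \<psi> x)"
    proof (rule LIM_zero_cancel, rule Lim_null_comparison)
      show "(\<lambda>n. K * (LBINT x. \<bar>\<psi> x\<bar> * \<bar>D n x - Dv x\<bar>) + M * (LBINT x. \<bar>Dv x * \<psi> x\<bar> * \<bar>v' n x - v x\<bar>)) \<longlonglongrightarrow> 0"
        unfolding v'_def D_def
        using tendsto_add[OF tendsto_mult_left[where c = K, OF moll_tendsto[OF L(2) tL(1), where R = R]]
            tendsto_mult_left[where c = M, OF moll_tendsto[OF L(1) Dpsi1, where R = R]]] R Dpsi(2) by simp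
      show "\<forall>\<^sub>F n in sequentially. norm ((LBINT x. B' (v' n x) * D n x * \<psi> x) - (LBINT x. B' (v x) * Dv x * \<psi> x))
          \<le> K * (LBINT x. \<bar>\<psi> x\<bar> * \<bar>D n x - Dv x\<bar>) + M * (LBINT x. \<bar>Dv x * \<psi> x\<bar> * \<bar>v' n x - v x\<bar>)"
      proof (intro always_eventually allI)
        fix n
        have i1: "integrable lborel (\<lambda>x. B' (v' n x) * D n x * \<psi> x)"
          by (intro L1l_test_integrable t L2l_L1l continuous_L2l continuous_on_mult continuous_on_compose2[OF cB' cv(1)] cv) auto
        have i2: "integrable lborel (\<lambda>x. B' (v x) * Dv x * \<psi> x)"
          by (intro L1l_test_integrable t L2l_L1l LB)
        have j: "integrable lborel (\<lambda>x. \<bar>\<psi> x\<bar> * \<bar>D n x - Dv x\<bar>)" "integrable lborel (\<lambda>x. \<bar>Dv x * \<psi> x\<bar> * \<bar>v' n x - v x\<bar>)"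
          using int[OF tL(1) R(2) Lv(2) L(2)] int[OF Dpsi1 Dpsi(2) Lv(1) L(1)] by auto
        have "norm ((LBINT x. B' (v' n x) * D n x * \<psi> x) - (LBINT x. B' (v x) * Dv x * \<psi> x))
          = norm (LBINT x. B' (v' n x) * D n x * \<psi> x - B' (v x) * Dv x * \<psi> x)" using i1 i2 by simp
        also have "\<dots> \<le> (LBINT x. K * (\<bar>\<psi> x\<bar> * \<bar>D n x - Dv x\<bar>) + M * (\<bar>Dv x * \<psi> x\<bar> * \<bar>v' n x - v x\<bar>))"
        proof (rule Bochner_Integration.integral_norm_bound_integral)
          fix x
          \<comment> \<open>The splitting never multiplies two quantities that both depend on n and
            both tend to zero: the difference of derivatives meets a bounded factor, the difference
            of arguments meets the fixed weight \<open>Dv x * \<psi> x\<close>.\<close>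
          have "B' (v' n x) * D n x * \<psi> x - B' (v x) * Dv x * \<psi> x
            = B' (v' n x) * (\<psi> x * (D n x - Dv x)) + (B' (v' n x) - B' (v x)) * (Dv x * \<psi> x)" by (simp add: algebra_simps)
          also have "norm \<dots> \<le> \<bar>B' (v' n x)\<bar> * \<bar>\<psi> x * (D n x - Dv x)\<bar> + \<bar>B' (v' n x) - B' (v x)\<bar> * \<bar>Dv x * \<psi> x\<bar>"
            unfolding real_norm_def abs_mult[symmetric] by (rule abs_triangle_ineq)
          also have "\<dots> \<le> K * \<bar>\<psi> x * (D n x - Dv x)\<bar> + (M * \<bar>v' n x - v x\<bar>) * \<bar>Dv x * \<psi> x\<bar>"
            by (intro add_mono mult_right_mono K Lip) auto
          finally show "norm (B' (v' n x) * D n x * \<psi> x - B' (v x) * Dv x * \<psi> x)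
             \<le> K * (\<bar>\<psi> x\<bar> * \<bar>D n x - Dv x\<bar>) + M * (\<bar>Dv x * \<psi> x\<bar> * \<bar>v' n x - v x\<bar>)"
            by (simp add: abs_mult mult_ac)
        qed (use i1 i2 j in \<open>auto intro!: integrable_mult_right Bochner_Integration.integrable_diff Bochner_Integration.integrable_add\<close>)
        also have "\<dots> = K * (LBINT x. \<bar>\<psi> x\<bar> * \<bar>D n x - Dv x\<bar>) + M * (LBINT x. \<bar>Dv x * \<psi> x\<bar> * \<bar>v' n x - v x\<bar>)"
          using j by simp
        finally show "norm ((LBINT x. B' (v' n x) * D n x * \<psi> x) - (LBINT x. B' (v x) * Dv x * \<psi> x))
          \<le> K * (LBINT x. \<bar>\<psi> x\<bar> * \<bar>D n x - Dv x\<bar>) + M * (LBINT x. \<bar>Dv x * \<psi> x\<bar> * \<bar>v' n x - v x\<bar>)" .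
      qed
    qed
    have "(\<lambda>n. LINT x|lborel. B (v' n x) * partial k \<psi> x) \<longlonglongrightarrow> - (LBINT x. B' (v x) * Dv x * \<psi> x)"
      using tendsto_minus[OF lim2] n by simp
    from LIMSEQ_unique[OF lim1 this]
    show "(LBINT x. B (v x) * partial k \<psi> x) = - (LBINT x. B' (v x) * Dv x * \<psi> x)" .
  qed
qed


subsection \<open>Testing with Sobolev functions\<close>

text \<open>The mollifications of \<open>v\<close> are test functions whose partial derivatives are
  the mollified weak derivatives. Bounded support allows \<open>F\<close> and \<open>g\<close> to be
  merely locally square integrable, which is the situation for corrector fluxes.\<close>

lemma wd_test_extend_cs:
  fixes v :: "real ^ 'n::finite \<Rightarrow> real"
  assumes F: "\<And>k. L2l (F k)" and g: "L2l g"
    and weak: "\<And>\<psi>. test_fun \<psi> \<Longrightarrow>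
      (\<Sum>k\<in>UNIV. LBINT x. F k x * partial k \<psi> x) + (LBINT x. g x * \<psi> x) = 0"
    and v: "\<And>k. wd k v (Dv k)" and L: "L2 v" "\<And>k. L2 (Dv k)"
    and R: "\<And>x. R < norm x \<Longrightarrow> v x = 0" "\<And>x k. R < norm x \<Longrightarrow> Dv k x = 0"
  shows "(\<Sum>k\<in>UNIV. LBINT x. F k x * Dv k x) + (LBINT x. g x * v x) = 0"
proof -
  define v' where "v' n = conv v (moll n)" for n
  \<comment> \<open>All mollifications vanish beyond radius R + 1, so this indicator changes nothing
    and makes the pairing weight globally square integrable.\<close>
  define I where "I = (indicator (cball 0 (R + 1)) :: real ^ 'n \<Rightarrow> real)"
  have z: "conv f (moll n) x = 0" if "\<And>x. R < norm x \<Longrightarrow> f x = 0" "R + 1 < norm x" for f :: "real ^ 'n \<Rightarrow> real" and n x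
  proof (rule conv_eq_0[of R f "1 / real (Suc n)"])
    have "1 / real (Suc n) \<le> 1" by simp
    then show "R + 1 / real (Suc n) < norm x" using that(2) by linarith
  qed (use that(1) kern_moll[of n, where 'n='n] in \<open>auto simp: kern_def\<close>)
  have t: "test_fun (v' n)" for n
    unfolding v'_def by (rule test_fun_conv[OF L2l_L1l[OF L2_L2l[OF L(1)]] test_fun_moll R(1)])
  have p: "partial k (v' n) = conv (Dv k) (moll n)" for n k
    unfolding v'_def by (rule ext, rule wd_conv[OF v test_fun_moll])
  have lim: "(\<lambda>n. LINT x|lborel. f x * conv w (moll n) x) \<longlonglongrightarrow> (LBINT x. f x * w x)"
    if f: "L2l f" and w: "L2 w" "\<And>x. R < norm x \<Longrightarrow> w x = 0" for f w :: "real ^ 'n \<Rightarrow> real"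
  proof -
    have "(\<lambda>n. LINT x|lborel. (f x * I x) * conv w (moll n) x) \<longlonglongrightarrow> (LBINT x. (f x * I x) * w x)"
    proof (rule moll_pairing[where R = "R + 1"])
      show "L2 (\<lambda>x. f x * I x)" using f unfolding L2l_iff I_def by blast
    qed (use w in \<open>auto simp: I_def intro: L2_L2l\<close>)
    moreover have "f x * I x * conv w (moll n) x = f x * conv w (moll n) x" for n x
      using z[of w, OF w(2)] by (auto simp: I_def indicator_def)
    moreover have "f x * I x * w x = f x * w x" for x using w(2)[of x] by (auto simp: I_def indicator_def)
    ultimately show ?thesis by simp
  qed
  have "(\<lambda>n. (\<Sum>k\<in>UNIV. LBINT x. F k x * partial k (v' n) x) + (LBINT x. g x * v' n x))
    \<longlonglongrightarrow> (\<Sum>k\<in>UNIV. LBINT x. F k x * Dv k x) + (LBINT x. g x * v x)"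
    unfolding p unfolding v'_def by (intro tendsto_add tendsto_sum lim F g L R)
  then show ?thesis unfolding weak[OF t] by (simp add: LIMSEQ_const_iff)
qed

text \<open>A dilated bump normalized to 1 at the origin. It is not constant on large balls, but it
  tends to 1 pointwise and its gradient is of order 1/(n+1), which is all that the cutoff arguments
  use.\<close>

definition cut :: "nat \<Rightarrow> real ^ 'n::finite \<Rightarrow> real" where
  "cut n x = bump 0 (inverse (real (Suc n)) *\<^sub>R x) / bump 0 (0 :: real ^ 'n)"

lemma test_fun_cut: "test_fun (cut n :: real ^ 'n::finite \<Rightarrow> real)"
proof -
  have "cut n = (\<lambda>x :: real ^ 'n. 1 / bump 0 (0 :: real ^ 'n) * bump 0 (inverse (real (Suc n)) *\<^sub>R x + 0))"
    by (auto simp: cut_def[abs_def])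
  then show ?thesis by (simp only:) (intro test_fun_cmult test_fun_affine test_fun_bump, simp)
qed

lemma partial_cut:
  "partial k (cut n) (x :: real ^ 'n::finite) = inverse (real (Suc n)) * (partial k (bump 0) (inverse (real (Suc n)) *\<^sub>R x) / bump 0 (0 :: real ^ 'n))"
proof -
  have "cut n = (\<lambda>x :: real ^ 'n. 1 / bump 0 (0 :: real ^ 'n) * bump 0 (inverse (real (Suc n)) *\<^sub>R x + 0))"
    by (auto simp: cut_def[abs_def])
  then show ?thesis
    by (simp only: partial_cmult[OF smooth_affine[OF smooth_bump]] partial_affine[OF smooth_diff[OF smooth_bump]]) simp
qed

lemma cut_bounds:
  obtains C where "C > 0" "\<And>n x. \<bar>cut n (x :: real ^ 'n::finite)\<bar> \<le> C"
    "\<And>n k x. \<bar>partial k (cut n) (x :: real ^ 'n)\<bar> \<le> C * inverse (real (Suc n))"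
proof -
  obtain B where B: "B > 0" "\<And>x :: real ^ 'n. \<bar>bump 0 x\<bar> \<le> B" using test_fun_bounded[OF test_fun_bump] by metis
  have "\<exists>D>0. \<forall>x :: real ^ 'n. \<bar>partial k (bump 0) x\<bar> \<le> D" for k
    using test_fun_bounded[OF test_fun_partial[OF test_fun_bump]] by metis
  then obtain D where D: "\<And>k. D k > 0" "\<And>k (x :: real ^ 'n). \<bar>partial k (bump 0) x\<bar> \<le> D k" by metis
  have D': "\<bar>partial k (bump 0) x\<bar> \<le> B + (\<Sum>k\<in>UNIV. D k)" for k and x :: "real ^ 'n"
    using D(2)[where x=x and k=k] member_le_sum[of k UNIV D] D(1) B(1) by (smt (verit) finite UNIV_I)
  have B': "\<bar>bump 0 x\<bar> \<le> B + (\<Sum>k\<in>UNIV. D k)" for x :: "real ^ 'n"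
    using B(2)[of x] sum_nonneg[of UNIV D] D(1) by (smt (verit))
  define b where "b = bump 0 (0 :: real ^ 'n)"
  have b: "b > 0" by (simp add: b_def bump_0)
  define E where "E = B + (\<Sum>k\<in>UNIV. D k)"
  have E: "E > 0" unfolding E_def using B(1) sum_nonneg[of UNIV D] D(1) by (smt (verit))
  show thesis
  proof (rule that[of "E / b"])
    show "E / b > 0" using E b by simp
    show "\<bar>cut n (x :: real ^ 'n)\<bar> \<le> E / b" for n x
      using B'[of "inverse (real (Suc n)) *\<^sub>R x"] b
      by (simp add: cut_def b_def[symmetric] E_def divide_right_mono del: of_nat_Suc)
    show "\<bar>partial k (cut n) (x :: real ^ 'n)\<bar> \<le> E / b * inverse (real (Suc n))" for n k x
    proof -
      have "\<bar>partial k (cut n) x\<bar> = inverse (real (Suc n)) * (\<bar>partial k (bump 0) (inverse (real (Suc n)) *\<^sub>R x)\<bar> / b)"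
        unfolding partial_cut b_def[symmetric] using b by (simp add: abs_mult del: of_nat_Suc)
      also have "\<dots> \<le> inverse (real (Suc n)) * (E / b)"
        using D'[of k "inverse (real (Suc n)) *\<^sub>R x"] b
        by (intro mult_left_mono divide_right_mono) (auto simp: E_def)
      finally show ?thesis by (simp add: mult.commute)
    qed
  qed
qed

lemma cut_tendsto: "(\<lambda>n. cut n x) \<longlonglongrightarrow> 1"
proof -
  have "(\<lambda>n. inverse (real (Suc n)) *\<^sub>R x) \<longlonglongrightarrow> 0 *\<^sub>R x"
    by (intro tendsto_intros LIMSEQ_inverse_real_of_nat)
  then have "(\<lambda>n. bump 0 (inverse (real (Suc n)) *\<^sub>R x)) \<longlonglongrightarrow> bump 0 (0 :: real ^ 'a)"
    by (intro continuous_on_tendsto_compose[OF smooth_continuous[OF smooth_bump]]) auto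
  then have "(\<lambda>n. cut n x) \<longlonglongrightarrow> bump 0 (0 :: real ^ 'a) / bump 0 (0 :: real ^ 'a)"
    unfolding cut_def using bump_0[where 'a='a] by (intro tendsto_divide tendsto_const) auto
  then show ?thesis using bump_0[where 'a='a] by simp
qed

lemma test_fun_borel: "test_fun \<psi> \<Longrightarrow> \<psi> \<in> borel_measurable borel"
  by (intro smooth_borel test_fun_smooth)

text \<open>Cut \<open>v\<close> off and apply the compactly supported case. The term with the
  derivative of the cutoff is at most C/(n+1) times the integral of |F v|, which is finite because
  both factors are globally square integrable.\<close>

lemma wd_test_extend:
  fixes v :: "real ^ 'n::finite \<Rightarrow> real"
  assumes F: "\<And>k. L2 (F k)" and g: "L2 g"
    and weak: "\<And>\<psi>. test_fun \<psi> \<Longrightarrow>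
      (\<Sum>k\<in>UNIV. LBINT x. F k x * partial k \<psi> x) + (LBINT x. g x * \<psi> x) = 0"
    and v: "\<And>k. wd k v (Dv k)" and L: "L2 v" "\<And>k. L2 (Dv k)"
  shows "(\<Sum>k\<in>UNIV. LBINT x. F k x * Dv k x) + (LBINT x. g x * v x) = 0"
proof -
  obtain C where C: "C > 0" "\<And>n x. \<bar>cut n (x :: real ^ 'n)\<bar> \<le> C"
    "\<And>n k x. \<bar>partial k (cut n) (x :: real ^ 'n)\<bar> \<le> C * inverse (real (Suc n))"
    using cut_bounds[where 'n='n] by metis
  have s: "smooth (cut n :: real ^ 'n \<Rightarrow> real)" for n by (intro test_fun_smooth test_fun_cut)
  have [measurable]: "(cut n :: real ^ 'n \<Rightarrow> real) \<in> borel_measurable borel" "(partial k (cut n) :: real ^ 'n \<Rightarrow> real) \<in> borel_measurable borel" for n k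
    by (auto intro: test_fun_borel test_fun_cut test_fun_partial)
  have [measurable]: "F k \<in> borel_measurable borel" "g \<in> borel_measurable borel" "v \<in> borel_measurable borel" "Dv k \<in> borel_measurable borel" for k
    using F g L by (auto dest: L2_borel)
  define D where "D n k x = Dv k x * cut n x + v x * partial k (cut n) x" for n k x
  have eq: "(\<Sum>k\<in>UNIV. LBINT x. F k x * D n k x) + (LBINT x. g x * (v x * cut n x)) = 0" for n
  proof -
    obtain R where R: "R > 0" "\<And>x :: real ^ 'n. R < norm x \<Longrightarrow> cut n x = 0" "\<And>(x :: real ^ 'n) k. R < norm x \<Longrightarrow> partial k (cut n) x = 0"
      using test_funE[OF test_fun_cut] by metis
    show ?thesis
    proof (rule wd_test_extend_cs[where R = R])
      show "wd k (\<lambda>x. v x * cut n x) (D n k)" for k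
        unfolding D_def[abs_def] using L s
        by (intro wd_mult v wd_smooth) (auto intro: L2_L2l smooth_L2l smooth_partial)
      show "L2 (\<lambda>x. v x * cut n x)" by (intro L2l_mult_test L2_L2l L test_fun_cut)
      show "L2 (D n k)" for k unfolding D_def[abs_def]
        by (intro L2_add L2l_mult_test L2_L2l L test_fun_cut test_fun_partial)
    qed (use F g weak R in \<open>auto intro: L2_L2l simp: D_def\<close>)
  qed
  have lim1: "(\<lambda>n. LINT x|lborel. f x * (w x * cut n x)) \<longlonglongrightarrow> (LBINT x. f x * w x)" if "L2 f" "L2 w" for f w :: "real ^ 'n \<Rightarrow> real"
  proof (rule integral_dominated_convergence)
    have [measurable]: "f \<in> borel_measurable borel" "w \<in> borel_measurable borel" using that by (auto dest: L2_borel)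
    show "(\<lambda>x. f x * w x) \<in> borel_measurable lborel" "(\<lambda>x. f x * (w x * cut n x)) \<in> borel_measurable lborel" for n by measurable
    show "integrable lborel (\<lambda>x. \<bar>f x * w x\<bar> * C)" using L2_mult_integrable[OF that] by simp
    show "AE x in lborel. (\<lambda>n. f x * (w x * cut n x)) \<longlonglongrightarrow> f x * w x"
    proof (rule AE_I2)
      fix x
      have "(\<lambda>n. f x * (w x * cut n x)) \<longlonglongrightarrow> f x * (w x * 1)" by (intro tendsto_intros cut_tendsto)
      then show "(\<lambda>n. f x * (w x * cut n x)) \<longlonglongrightarrow> f x * w x" by simp
    qed
    show "AE x in lborel. norm (f x * (w x * cut n x)) \<le> \<bar>f x * w x\<bar> * C" for n
    proof (rule AE_I2)
      fix x show "norm (f x * (w x * cut n x)) \<le> \<bar>f x * w x\<bar> * C"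
        using mult_left_mono[OF C(2)[of n x], of "\<bar>f x * w x\<bar>"] by (simp add: abs_mult mult.assoc)
    qed
  qed
  have lim2: "(\<lambda>n. LINT x|lborel. F k x * (v x * partial k (cut n) x)) \<longlonglongrightarrow> 0" for k
  proof (rule Lim_null_comparison)
    have i: "integrable lborel (\<lambda>x. \<bar>F k x * v x\<bar>)" using L2_mult_integrable[OF F L(1)] by simp
    have "(\<lambda>n. (LBINT x. \<bar>F k x * v x\<bar>) * C * inverse (real (Suc n))) \<longlonglongrightarrow> (LBINT x. \<bar>F k x * v x\<bar>) * C * 0"
      by (intro tendsto_intros LIMSEQ_inverse_real_of_nat)
    then show "(\<lambda>n. (LBINT x. \<bar>F k x * v x\<bar>) * C * inverse (real (Suc n))) \<longlonglongrightarrow> 0" by simp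
    have b: "norm (F k x * (v x * partial k (cut n) x)) \<le> \<bar>F k x * v x\<bar> * (C * inverse (real (Suc n)))" for n x
      using mult_left_mono[OF C(3)[of k n x], of "\<bar>F k x * v x\<bar>"] by (simp add: abs_mult mult.assoc)
    have "norm (LBINT x. F k x * (v x * partial k (cut n) x)) \<le> (LBINT x. \<bar>F k x * v x\<bar> * (C * inverse (real (Suc n))))" for n
    proof (rule Bochner_Integration.integral_norm_bound_integral)
      show i2: "integrable lborel (\<lambda>x. \<bar>F k x * v x\<bar> * (C * inverse (real (Suc n))))" using i by simp
      show "integrable lborel (\<lambda>x. F k x * (v x * partial k (cut n) x))"
        by (rule Bochner_Integration.integrable_bound[OF i2]) (use order_trans[OF b abs_ge_self] in auto)
    qed (rule b)
    then show "\<forall>\<^sub>F n in sequentially. norm (LBINT x. F k x * (v x * partial k (cut n) x))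
        \<le> (LBINT x. \<bar>F k x * v x\<bar>) * C * inverse (real (Suc n))"
      by (simp add: mult.assoc)
  qed
  have split: "(LBINT x. F k x * D n k x) = (LBINT x. F k x * (Dv k x * cut n x)) + (LBINT x. F k x * (v x * partial k (cut n) x))" for n k
    unfolding D_def distrib_left
    by (intro Bochner_Integration.integral_add L2_mult_integrable F L2l_mult_test L2_L2l L test_fun_cut test_fun_partial)
  have "(\<lambda>n. (\<Sum>k\<in>UNIV. LBINT x. F k x * D n k x) + (LBINT x. g x * (v x * cut n x)))
    \<longlonglongrightarrow> (\<Sum>k\<in>UNIV. (LBINT x. F k x * Dv k x) + 0) + (LBINT x. g x * v x)"
    unfolding split by (intro tendsto_add tendsto_sum lim1 lim2 F g L)
  then show ?thesis unfolding eq by (simp add: LIMSEQ_const_iff)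
qed

subsection \<open>Differences of Sobolev functions\<close>

text \<open>The uniform law on [0,1], so that the average of a gradient along a segment is an
  expectation and Jensen's inequality applies.\<close>

definition unif :: "real measure" where
  "unif = density lborel (indicator {0..1})"

lemma sets_unif [measurable_cong, simp]: "sets unif = sets borel"
  by (simp add: unif_def)

lemma prob_space_unif: "prob_space unif"
proof
  show "emeasure unif (space unif) = 1"
    unfolding unif_def by (subst emeasure_density) auto
qed

lemma AE_unif: "AE t in unif. 0 \<le> t \<and> t \<le> 1"
  unfolding unif_def by (subst AE_density) (auto simp: indicator_def)

lemma integral_unif:
  fixes f :: "real \<Rightarrow> real"
  assumes [measurable]: "f \<in> borel_measurable borel"
  shows "(LINT t|unif. f t) = (LBINT t. f t * indicator {0..1} t)"
proof -
  have eq: "unif = density lborel (\<lambda>t. ennreal (indicator {0..1} t))"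
    unfolding unif_def by (auto intro!: arg_cong[where f="density lborel"] simp: indicator_def)
  show ?thesis by (subst eq, subst integral_density) (auto simp: mult.commute)
qed

text \<open>Integrability on the product, as Fubini's theorem needs it: for each t in [0,1] the
  slice is bounded, after a translation, by the same integral of |G| over a ball enlarged by
  |w|.\<close>

lemma L1l_segment_integrable:
  fixes G :: "real ^ 'n::finite \<Rightarrow> real"
  assumes G: "L1l G" and b: "bcs b"
  shows "integrable (lborel \<Otimes>\<^sub>M unif) (\<lambda>(x, t). G (x + t *\<^sub>R w) * b x)"
proof -
  interpret U: prob_space unif by (rule prob_space_unif)
  interpret pair_sigma_finite "lborel :: (real ^ 'n) measure" unif ..
  have [measurable]: "G \<in> borel_measurable borel" "b \<in> borel_measurable borel" using G b by measurable
  obtain B R where B: "\<And>x. \<bar>b x\<bar> \<le> B" and R: "\<And>x. R < norm x \<Longrightarrow> b x = 0"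
    using b unfolding bcs_def by metis
  define C where "C = (LBINT\<^sup>+ x. ennreal (norm (B * (indicator (cball 0 (R + norm w)) x * G x))))"
  have C: "C < \<infinity>"
  proof -
    have "integrable lborel (\<lambda>x. B * (indicator (cball 0 (R + norm w)) x * G x))"
      using G by (intro integrable_mult_right) (auto simp: L1l_def)
    then show ?thesis unfolding integrable_iff_bounded C_def by blast
  qed
  have "(\<integral>\<^sup>+z. ennreal (norm (case z of (x, t) \<Rightarrow> G (x + t *\<^sub>R w) * b x)) \<partial>(lborel \<Otimes>\<^sub>M unif))
    = (\<integral>\<^sup>+t. \<integral>\<^sup>+x. ennreal (norm (G (x + t *\<^sub>R w) * b x)) \<partial>lborel \<partial>unif)"
    by (subst nn_integral_snd[symmetric]) (auto simp: split_beta)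
  also have "\<dots> \<le> (\<integral>\<^sup>+t. C \<partial>unif)"
  proof (rule nn_integral_mono_AE)
    show "AE t in unif. (LBINT\<^sup>+ x. ennreal (norm (G (x + t *\<^sub>R w) * b x))) \<le> C"
      using AE_unif
    proof eventually_elim
      case (elim t)
      have "norm (G (x + t *\<^sub>R w) * b x) \<le> norm (B * (indicator (cball 0 (R + norm w)) (t *\<^sub>R w + x) * G (t *\<^sub>R w + x)))" for x
      proof (cases "norm x \<le> R")
        case True
        have "norm (t *\<^sub>R w + x) \<le> \<bar>t\<bar> * norm w + norm x" using norm_triangle_ineq[of "t *\<^sub>R w" x] by simp
        moreover have "\<bar>t\<bar> * norm w \<le> norm w" using elim by (intro mult_left_le_one_le) auto
        ultimately have "norm (t *\<^sub>R w + x) \<le> R + norm w" using True by linarith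
        moreover have "\<bar>b x\<bar> \<le> \<bar>B\<bar>" using B[of x] by linarith
        ultimately show ?thesis
          by (subst add.commute[of x "t *\<^sub>R w"]) (simp add: abs_mult mult.commute[of "\<bar>G (t *\<^sub>R w + x)\<bar>"] mult_right_mono)
      qed (use R in auto)
      then have "(LBINT\<^sup>+ x. ennreal (norm (G (x + t *\<^sub>R w) * b x)))
        \<le> (LBINT\<^sup>+ x. ennreal (norm (B * (indicator (cball 0 (R + norm w)) (t *\<^sub>R w + x) * G (t *\<^sub>R w + x)))))"
        by (intro nn_integral_mono ennreal_leI)
      also have "\<dots> = C" unfolding C_def
        by (rule nn_integral_lborel_translate) measurable
      finally show ?case .
    qed
  qed
  also have "\<dots> = C" using U.emeasure_space_1 by (simp del: U.emeasure_space_1)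
  finally have "(\<integral>\<^sup>+z. ennreal (norm (case z of (x, t) \<Rightarrow> G (x + t *\<^sub>R w) * b x)) \<partial>(lborel \<Otimes>\<^sub>M unif)) < \<infinity>"
    using C by (rule le_less_trans)
  then show ?thesis by (simp add: integrable_iff_bounded split_beta')
qed

text \<open>The fundamental theorem of calculus along a segment, for weak derivatives. After
  mollification it holds at every point, so both sides have the same convolution with each mollifier
  and agree almost everywhere.\<close>

lemma wd_difference_eq:
  fixes u :: "real ^ 'n::finite \<Rightarrow> real"
  assumes u: "\<And>k. wd k u (Du k)"
  shows "AE x in lborel. u (x + w) - u x = (LINT t|unif. (\<Sum>k\<in>UNIV. w $ k * Du k (x + t *\<^sub>R w)))"
proof -
  interpret U: prob_space unif by (rule prob_space_unif)
  interpret pair_sigma_finite "lborel :: (real ^ 'n) measure" unif ..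
  have L: "L1l u" "\<And>k. L1l (Du k)" using u by (auto simp: wd_def)
  define G where "G x = (\<Sum>k\<in>UNIV. w $ k * Du k x)" for x
  have G: "L1l G" unfolding G_def[abs_def] by (intro L1l_sum L1l_cmult L)
  have [measurable]: "G \<in> borel_measurable borel" "u \<in> borel_measurable borel" using G L by measurable
  define gw where "gw x = (LINT t|unif. G (x + t *\<^sub>R w))" for x
  have [measurable]: "gw \<in> borel_measurable borel"
  proof -
    have "(\<lambda>x. LINT t|unif. G (x + t *\<^sub>R w)) \<in> borel_measurable lborel"
      by (intro U.borel_measurable_lebesgue_integral) measurable
    then show ?thesis by (simp add: gw_def[abs_def])
  qed
  have gw: "L1l gw"
    unfolding L1l_def
  proof (intro conjI allI)
    fix R
    have "integrable lborel (\<lambda>x. LINT t|unif. G (x + t *\<^sub>R w) * indicator (cball 0 R) x)"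
      by (rule integrable_fst[OF L1l_segment_integrable[OF G bcs_indicator]])
    then show "integrable lborel (\<lambda>x. indicator (cball 0 R) x * gw x)"
      by (simp add: gw_def mult.commute)
  qed measurable
  have "AE x in lborel. u (w + x) - u x - gw x = 0"
  proof (rule AE_eq_0_if_conv_eq_0[OF _ kern_moll moll_radius])
    show "L1l (\<lambda>x. u (w + x) - u x - gw x)"
      using L1l_affine[OF L(1), of 1 w] by (intro L1l_diff L gw) simp_all
    fix n x
    define \<rho> where "\<rho> = (moll n :: real ^ 'n \<Rightarrow> real)"
    have tr: "test_fun \<rho>" "bcs \<rho>" unfolding \<rho>_def by (auto intro: test_fun_moll test_fun_bcs)
    have [measurable]: "\<rho> \<in> borel_measurable borel" using tr by measurable
    define v where "v = conv u \<rho>"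
    have s: "smooth v" unfolding v_def by (intro smooth_conv L tr)
    have Gc: "conv G \<rho> = (\<lambda>x. \<Sum>k\<in>UNIV. w $ k * partial k v x)"
    proof
      fix x
      have "conv G \<rho> x = (LBINT y. (\<Sum>k\<in>UNIV. w $ k * (Du k y * \<rho> (x - y))))"
        unfolding conv_def G_def by (simp add: sum_distrib_right mult.assoc)
      also have "\<dots> = (\<Sum>k\<in>UNIV. w $ k * conv (Du k) \<rho> x)"
        unfolding conv_def using conv_integrable[OF L(2) tr(2)] by (subst Bochner_Integration.integral_sum) auto
      also have "\<dots> = (\<Sum>k\<in>UNIV. w $ k * partial k v x)"
        unfolding v_def wd_conv[OF u tr(1)] ..
      finally show "conv G \<rho> x = (\<Sum>k\<in>UNIV. w $ k * partial k v x)" .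
    qed
    have Gs: "smooth (conv G \<rho>)" by (intro smooth_conv G tr)
    have der: "((\<lambda>t. v (x + t *\<^sub>R w)) has_real_derivative conv G \<rho> (x + t *\<^sub>R w)) (at t)" for t
    proof -
      have "((\<lambda>t. x + t *\<^sub>R w) has_derivative (\<lambda>h. h *\<^sub>R w)) (at t)"
        by (auto intro!: derivative_eq_intros)
      from has_derivative_compose[OF this smooth_has_derivative[OF s]]
      have "((\<lambda>t. v (x + t *\<^sub>R w)) has_derivative (\<lambda>h. frechet_derivative v (at (x + t *\<^sub>R w)) (h *\<^sub>R w))) (at t)" .
      moreover have "(\<lambda>h. frechet_derivative v (at y) (h *\<^sub>R w)) = (*) (conv G \<rho> y)" for y
        by (rule ext) (simp add: frechet_derivative_eq_sum_partial[OF smooth_diff[OF s]] Gc sum_distrib_left mult_ac)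
      ultimately show ?thesis by (simp only: has_field_derivative_def)
    qed
    have cont: "continuous_on UNIV (\<lambda>t. conv G \<rho> (x + t *\<^sub>R w))"
      by (intro continuous_on_compose2[OF smooth_continuous[OF Gs]] continuous_intros) auto
    have "(LINT t|unif. conv G \<rho> (x + t *\<^sub>R w)) = (LBINT t. conv G \<rho> (x + t *\<^sub>R w) * indicator {0..1} t)"
      using borel_measurable_continuous_onI[OF cont] by (rule integral_unif)
    also have "\<dots> = v (x + 1 *\<^sub>R w) - v (x + 0 *\<^sub>R w)"
      using cont by (intro integral_FTC_Icc_real der) (auto simp: continuous_on_eq_continuous_at)
    finally have 1: "(LINT t|unif. conv G \<rho> (x + t *\<^sub>R w)) = v (x + w) - v x" by simp
    have P: "integrable (lborel \<Otimes>\<^sub>M unif) (\<lambda>(y, t). G (y + t *\<^sub>R w) * \<rho> (x - y))"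
      by (rule L1l_segment_integrable[OF G bcs_reflect[OF tr(2)]])
    have 2: "conv gw \<rho> x = (LINT t|unif. conv G \<rho> (x + t *\<^sub>R w))"
    proof -
      have "conv gw \<rho> x = (LBINT y. LINT t|unif. G (y + t *\<^sub>R w) * \<rho> (x - y))"
        unfolding conv_def gw_def by simp
      also have "\<dots> = (LINT t|unif. LINT y|lborel. G (y + t *\<^sub>R w) * \<rho> (x - y))"
        using Fubini_integral[OF P] by simp
      also have "\<dots> = (LINT t|unif. conv G \<rho> (x + t *\<^sub>R w))"
      proof (rule Bochner_Integration.integral_cong[OF refl])
        fix t
        have "(LBINT y. G (- (t *\<^sub>R w) + y + t *\<^sub>R w) * \<rho> (x - (- (t *\<^sub>R w) + y))) = (LBINT y. G (y + t *\<^sub>R w) * \<rho> (x - y))"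
          by (rule integral_lborel_translate[where f = "\<lambda>y. G (y + t *\<^sub>R w) * \<rho> (x - y)"]) measurable
        then show "(LBINT y. G (y + t *\<^sub>R w) * \<rho> (x - y)) = conv G \<rho> (x + t *\<^sub>R w)"
          unfolding conv_def by (simp add: algebra_simps)
      qed
      finally show ?thesis .
    qed
    have 3: "conv (\<lambda>x. u (w + x)) \<rho> x = v (x + w)"
    proof -
      have "(LBINT y. u (w + y) * \<rho> (x + w - (w + y))) = (LBINT y. u y * \<rho> (x + w - y))"
        by (rule integral_lborel_translate[where f = "\<lambda>y. u y * \<rho> (x + w - y)"]) measurable
      then show ?thesis unfolding v_def conv_def by simp
    qed
    have L': "L1l (\<lambda>x. u (w + x))" using L1l_affine[OF L(1), of 1 w] by simp
    show "conv (\<lambda>x. u (w + x) - u x - gw x) (moll n) x = 0"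
      unfolding \<rho>_def[symmetric]
      by (simp add: conv_diff[OF L1l_diff[OF L' L(1)] gw tr(2)] conv_diff[OF L' L(1) tr(2)] 1 2 3 v_def[symmetric])
  qed
  then show ?thesis by (simp add: gw_def G_def add.commute)
qed

text \<open>Jensen along the segment followed by Tonelli. The weight \<zeta> is arbitrary because it
  is a cube indicator in one application and the absolute derivative of a cutoff in the
  other.\<close>

lemma wd_difference_bound:
  fixes u :: "real ^ 'n::finite \<Rightarrow> real"
  assumes u: "\<And>k. wd k u (Du k)" and [measurable]: "\<zeta> \<in> borel_measurable borel"
  shows "(LBINT\<^sup>+ x. \<zeta> x * ennreal ((u (x + w) - u x)^2))
    \<le> (\<integral>\<^sup>+t. \<integral>\<^sup>+x. \<zeta> x * ennreal ((\<Sum>k\<in>UNIV. w $ k * Du k (x + t *\<^sub>R w))^2) \<partial>lborel \<partial>unif)"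
proof -
  interpret U: prob_space unif by (rule prob_space_unif)
  interpret pair_sigma_finite "lborel :: (real ^ 'n) measure" unif ..
  have [measurable]: "Du k \<in> borel_measurable borel" for k using u[of k] by (auto simp: wd_def L1l_def)
  have "(LBINT\<^sup>+ x. \<zeta> x * ennreal ((u (x + w) - u x)^2))
    = (LBINT\<^sup>+ x. \<zeta> x * ennreal ((LINT t|unif. (\<Sum>k\<in>UNIV. w $ k * Du k (x + t *\<^sub>R w)))^2))"
    by (rule nn_integral_cong_AE) (use wd_difference_eq[OF u, of w] in eventually_elim, simp)
  also have "\<dots> \<le> (LBINT\<^sup>+ x. \<zeta> x * (\<integral>\<^sup>+t. ennreal ((\<Sum>k\<in>UNIV. w $ k * Du k (x + t *\<^sub>R w))^2) \<partial>unif))"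
    by (intro nn_integral_mono mult_left_mono square_integral_le_nn_integral prob_space_unif) auto
  also have "\<dots> = (\<integral>\<^sup>+x. \<integral>\<^sup>+t. \<zeta> x * ennreal ((\<Sum>k\<in>UNIV. w $ k * Du k (x + t *\<^sub>R w))^2) \<partial>unif \<partial>lborel)"
    by (intro nn_integral_cong nn_integral_cmult[symmetric]) measurable
  also have "\<dots> = (\<integral>\<^sup>+t. \<integral>\<^sup>+x. \<zeta> x * ennreal ((\<Sum>k\<in>UNIV. w $ k * Du k (x + t *\<^sub>R w))^2) \<partial>lborel \<partial>unif)"
    by (rule Fubini'[symmetric]) measurable
  finally show ?thesis .
qed

subsection \<open>Completeness of \<open>L^2\<close>\<close>

text \<open>Riesz-Fischer: a fast subsequence converges almost everywhere, and Fatou's lemma turns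
  the Cauchy property of the whole sequence into convergence to the pointwise limit.\<close>

lemma L2_complete:
  fixes g :: "nat \<Rightarrow> real ^ 'n::finite \<Rightarrow> real"
  assumes L: "\<And>n. L2 (g n)"
    and cauchy: "\<And>e. e > 0 \<Longrightarrow> \<exists>N. \<forall>m\<ge>N. \<forall>n\<ge>N. (LBINT x. (g m x - g n x)^2) \<le> e"
  obtains G where "L2 G" "(\<lambda>n. LINT x|lborel. (g n x - G x)^2) \<longlonglongrightarrow> 0"
proof -
  have [measurable]: "g n \<in> borel_measurable borel" for n using L by measurable
  have di: "integrable lborel (\<lambda>x. (g m x - g n x)^2)" for m n using L2_diff[OF L L] by (simp add: L2_def)
  have nn: "(LBINT\<^sup>+ x. ennreal ((g m x - g n x)^2)) = ennreal (LBINT x. (g m x - g n x)^2)" for m n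
    using di by (simp add: nn_integral_eq_integral)
  \<comment> \<open>The rate 8^(-k) beats the weight 4^k used below by the summable factor
    2^(-k).\<close>
  obtain Nf where Nf: "\<And>k m n. m \<ge> Nf k \<Longrightarrow> n \<ge> Nf k \<Longrightarrow> (LBINT x. (g m x - g n x)^2) \<le> (1 / 8) ^ k"
  proof -
    have "\<forall>k. \<exists>N. \<forall>m\<ge>N. \<forall>n\<ge>N. (LBINT x. (g m x - g n x)^2) \<le> (1 / 8) ^ k"
      by (intro allI cauchy) simp
    from choice[OF this] show thesis using that by blast
  qed
  define r where "r k = Max (Nf ` {..k})" for k
  have r: "Nf j \<le> r k" if "j \<le> k" for j k unfolding r_def using that by (intro Max_ge) auto
  define d where "d k x = g (r (Suc k)) x - g (r k) x" for k x
  have [measurable]: "d k \<in> borel_measurable borel" for k unfolding d_def by measurable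
  \<comment> \<open>Finiteness of this weighted sum bounds the increments at almost every point by a
    multiple of 2^(-k), so the telescoping series converges there.\<close>
  have "(LBINT\<^sup>+ x. (\<Sum>k. ennreal (4 ^ k * (d k x)^2))) = (\<Sum>k. \<integral>\<^sup>+x. ennreal (4 ^ k * (d k x)^2) \<partial>lborel)"
    by (rule nn_integral_suminf) measurable
  also have "\<dots> \<le> (\<Sum>k. ennreal ((1 / 2) ^ k))"
  proof (rule suminf_le)
    fix k
    have "(LBINT\<^sup>+ x. ennreal (4 ^ k * (d k x)^2)) = ennreal (4 ^ k) * (LBINT\<^sup>+ x. ennreal ((d k x)^2))"
      by (subst nn_integral_cmult[symmetric]) (auto simp: ennreal_mult')
    also have "\<dots> \<le> ennreal (4 ^ k) * ennreal ((1 / 8) ^ k)"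
      unfolding d_def nn by (intro mult_left_mono ennreal_leI Nf r) auto
    also have "\<dots> = ennreal ((1 / 2) ^ k)"
      by (simp add: ennreal_mult'[symmetric] power_mult_distrib[symmetric])
    finally show "(LBINT\<^sup>+ x. ennreal (4 ^ k * (d k x)^2)) \<le> ennreal ((1 / 2) ^ k)" .
  qed auto
  also have "\<dots> = ennreal (\<Sum>k. (1 / 2) ^ k)" by (rule suminf_ennreal2) (auto intro: summable_geometric)
  also have "\<dots> < \<infinity>" by simp
  finally have "AE x in lborel. (\<Sum>k. ennreal (4 ^ k * (d k x)^2)) \<noteq> \<infinity>"
    by (intro nn_integral_PInf_AE) auto
  then have conv: "AE x in lborel. convergent (\<lambda>k. g (r k) x)"
  proof eventually_elim
    case (elim x)
    define S where "S = (\<Sum>k. ennreal (4 ^ k * (d k x)^2))"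
    have "ennreal (4 ^ k * (d k x)^2) \<le> ennreal (enn2real S)" for k
    proof -
      have "(\<Sum>i\<in>{k}. ennreal (4 ^ i * (d i x)^2)) \<le> S" unfolding S_def by (intro sum_le_suminf) auto
      then show ?thesis using elim by (simp add: S_def less_top)
    qed
    then have S: "4 ^ k * (d k x)^2 \<le> enn2real S" for k by (simp add: ennreal_le_iff)
    have "norm (d k x) \<le> sqrt (enn2real S) * (1 / 2) ^ k" for k
    proof -
      have "(2 ^ k * \<bar>d k x\<bar>)^2 \<le> enn2real S"
      proof -
        have "(2 ^ k * \<bar>d k x\<bar>)^2 = ((2::real) ^ k * 2 ^ k) * (d k x)^2" by (simp add: power2_eq_square abs_mult_self_eq)
        also have "(2::real) ^ k * 2 ^ k = 4 ^ k" by (simp add: power_mult_distrib[symmetric])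
        finally show ?thesis using S[of k] by simp
      qed
      then have "2 ^ k * \<bar>d k x\<bar> \<le> sqrt (enn2real S)" by (rule real_le_rsqrt)
      then show ?thesis by (simp add: field_simps power_divide)
    qed
    then have "summable (\<lambda>k. d k x)"
      by (rule summable_comparison_test'[rotated, where N=0]) (auto intro!: summable_mult summable_geometric)
    then have "convergent (\<lambda>n. \<Sum>k<n. d k x)" by (simp add: summable_iff_convergent)
    moreover have "(\<Sum>k<n. d k x) = g (r n) x - g (r 0) x" for n
      unfolding d_def by (rule sum_lessThan_telescope)
    ultimately have "convergent (\<lambda>n. g (r n) x - g (r 0) x)" by simp
    then have "convergent (\<lambda>n. g (r n) x - g (r 0) x + g (r 0) x)" by (intro convergent_add convergent_const)
    then show ?case by simp
  qed
  define G where "G x = lim (\<lambda>k. g (r k) x)" for x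
  have [measurable]: "G \<in> borel_measurable borel" unfolding G_def by measurable
  have fat: "(LBINT\<^sup>+ x. ennreal ((g n x - G x)^2)) \<le> ennreal ((1 / 8) ^ k)" if n: "n \<ge> Nf k" for n k
  proof -
    have "(LBINT\<^sup>+ x. ennreal ((g n x - G x)^2)) = (LBINT\<^sup>+ x. liminf (\<lambda>j. ennreal ((g n x - g (r j) x)^2)))"
    proof (rule nn_integral_cong_AE)
      show "AE x in lborel. ennreal ((g n x - G x)^2) = liminf (\<lambda>j. ennreal ((g n x - g (r j) x)^2))"
        using conv
      proof eventually_elim
        case (elim x)
        then have "(\<lambda>j. g (r j) x) \<longlonglongrightarrow> G x" unfolding G_def by (simp add: convergent_LIMSEQ_iff)
        then have "(\<lambda>j. ennreal ((g n x - g (r j) x)^2)) \<longlonglongrightarrow> ennreal ((g n x - G x)^2)"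
          by (intro tendsto_intros tendsto_ennrealI)
        from lim_imp_Liminf[OF trivial_limit_sequentially this] show ?case by (rule sym)
      qed
    qed
    also have "\<dots> \<le> liminf (\<lambda>j. \<integral>\<^sup>+x. ennreal ((g n x - g (r j) x)^2) \<partial>lborel)"
      by (rule nn_integral_liminf) measurable
    also have "\<dots> \<le> ennreal ((1 / 8) ^ k)"
    proof (rule Liminf_le)
      show "\<forall>\<^sub>F j in sequentially. (LBINT\<^sup>+ x. ennreal ((g n x - g (r j) x)^2)) \<le> ennreal ((1 / 8) ^ k)"
        using eventually_ge_at_top[of k]
      proof eventually_elim
        case (elim j)
        then show ?case unfolding nn using n r[of k j] by (intro ennreal_leI Nf) auto
      qed
    qed simp
    finally show ?thesis .
  qed
  have LD: "L2 (\<lambda>x. g n x - G x)" if "n \<ge> Nf k" for n k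
    unfolding L2_def integrable_iff_bounded using fat[OF that] by (auto simp: le_less_trans)
  have "L2 (\<lambda>x. g (Nf 0) x - (g (Nf 0) x - G x))" by (intro L2_diff L LD[of 0]) simp
  then have LG: "L2 G" by simp
  have "(\<lambda>n. LINT x|lborel. (g n x - G x)^2) \<longlonglongrightarrow> 0"
  proof (rule LIMSEQ_I)
    fix e :: real assume "e > 0"
    then obtain k where k: "(1 / 8 :: real) ^ k < e" using real_arch_pow_inv[of e "1 / 8"] by auto
    have "norm ((LBINT x. (g n x - G x)^2) - 0) < e" if "n \<ge> Nf k" for n
    proof -
      have "ennreal (LBINT x. (g n x - G x)^2) \<le> ennreal ((1 / 8) ^ k)"
        using fat[OF that] LD[OF that] by (simp add: nn_integral_eq_integral L2_def)
      then have "(LBINT x. (g n x - G x)^2) \<le> (1 / 8) ^ k" by (simp add: ennreal_le_iff)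
      moreover have "0 \<le> (LBINT x. (g n x - G x)^2)" by simp
      ultimately show ?thesis using k by simp
    qed
    then show "\<exists>N. \<forall>n\<ge>N. norm ((LBINT x. (g n x - G x)^2) - 0) < e" by blast
  qed
  with LG show thesis by (rule that)
qed

text \<open>The quadratic form given by the squared norm of s f - t g is nonnegative for all s and
  t; two choices of (s, t) treat b \<noteq> 0 and b = 0.\<close>

lemma L2_Cauchy_Schwarz:
  assumes f: "L2 f" and g: "L2 g"
  shows "(LBINT x. f x * g x)^2 \<le> (LBINT x. (f x)^2) * (LBINT x. (g x)^2)"
proof -
  define a b m where "a = (LBINT x. (f x)^2)" "b = (LBINT x. (g x)^2)" "m = (LBINT x. f x * g x)"
  have i: "integrable lborel (\<lambda>x. (f x)^2)" "integrable lborel (\<lambda>x. (g x)^2)" "integrable lborel (\<lambda>x. f x * g x)"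
    using f g L2_mult_integrable by (auto simp: L2_def)
  have *: "0 \<le> s^2 * a - 2 * s * t * m + t^2 * b" for s t
  proof -
    have "0 \<le> (LBINT x. (s * f x - t * g x)^2)" by simp
    also have "\<dots> = (LBINT x. s^2 * (f x)^2 - 2 * s * t * (f x * g x) + t^2 * (g x)^2)"
      by (rule Bochner_Integration.integral_cong) (auto simp: power2_eq_square algebra_simps)
    also have "\<dots> = s^2 * a - 2 * s * t * m + t^2 * b" using i by (simp add: a_b_m_def)
    finally show ?thesis .
  qed
  have ab: "a \<ge> 0" "b \<ge> 0" unfolding a_b_m_def by auto
  have "m^2 \<le> a * b"
  proof (cases "b = 0")
    case False
    have "0 \<le> b * (a * b - m^2)" using *[of b m] by (simp add: power2_eq_square algebra_simps)
    then show ?thesis using False ab by (simp add: zero_le_mult_iff)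
  next
    case True
    \<comment> \<open>With b = 0 the form is linear in t; t = a + 1 makes the negative term outweigh
      the positive one also when a = 0.\<close>
    have "0 \<le> m^2 * a - 2 * (a + 1) * m^2" using *[of m "a + 1"] True by (simp add: power2_eq_square algebra_simps)
    then have "m^2 * (a + 2) \<le> 0" by (simp add: algebra_simps)
    then have "m^2 \<le> 0" using ab by (simp add: mult_le_0_iff)
    then show ?thesis using True by simp
  qed
  then show ?thesis by (simp add: a_b_m_def)
qed


subsection \<open>Regularity for constant coefficients\<close>

lemma L2_ibp:
  fixes p q :: "real ^ 'n::finite \<Rightarrow> real"
  assumes p: "wd k p Dp" "L2 p" "L2 Dp" and q: "\<And>l. wd l q (Dq l)" "L2 q" "\<And>l. L2 (Dq l)"
  shows "(LBINT x. p x * Dq k x) = - (LBINT x. Dp x * q x)"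
proof -
  define F where "F l = (if l = k then p else (\<lambda>x. 0))" for l
  have d: "(\<Sum>l\<in>UNIV. LBINT x. F l x * h l x) = (LBINT x. p x * h k x)" for h
  proof -
    have "(LBINT x. F l x * h l x) = (if l = k then (LBINT x. p x * h k x) else 0)" for l
      by (simp add: F_def)
    then show ?thesis by simp
  qed
  have "(\<Sum>l\<in>UNIV. LBINT x. F l x * Dq l x) + (LBINT x. Dp x * q x) = 0"
  proof (rule wd_test_extend)
    show "L2 (F l)" for l using p by (auto simp: F_def L2_0)
    show "(\<Sum>l\<in>UNIV. LBINT x. F l x * partial l \<psi> x) + (LBINT x. Dp x * \<psi> x) = 0"
      if "test_fun \<psi>" for \<psi> unfolding d wdD[OF p(1) that] by simp
  qed (use p q in auto)
  then show ?thesis unfolding d by simp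
qed

text \<open>The mollified equation holds pointwise; multiply it by the second derivative of the
  mollified solution in direction k and integrate by parts twice. The zeroth-order term then has a
  favourable sign and the rest is the form of \<open>A\<close> at the vector of derivatives
  \<open>V i k\<close>. No sign of \<kappa> is assumed, so that a difference of two mollifiers can
  be inserted.\<close>

lemma conv_partial_estimate:
  fixes u f :: "real ^ 'n::finite \<Rightarrow> real"
  assumes c: "c > 0" and coer: "\<And>h :: 'n \<Rightarrow> real. c * (\<Sum>i\<in>UNIV. (h i)^2) \<le> (\<Sum>i\<in>UNIV. \<Sum>j\<in>UNIV. A i j * h i * h j)"
    and u: "\<And>k. wd k u (Du k)" "L2 u" "\<And>k. L2 (Du k)" and f: "L2 f" and \<alpha>: "\<alpha> \<ge> 0"
    and weak: "\<And>\<psi>. test_fun \<psi> \<Longrightarrow> \<alpha> * (LBINT x. u x * \<psi> x)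
      + (\<Sum>i\<in>UNIV. \<Sum>j\<in>UNIV. A i j * (LBINT x. Du j x * partial i \<psi> x)) = (LBINT x. f x * \<psi> x)"
    and \<kappa>: "test_fun \<kappa>" and sym: "\<And>i j. partial i (partial j \<kappa>) = partial j (partial i \<kappa>)"
  shows "c^2 * (\<Sum>j\<in>UNIV. LBINT x. (conv (Du j) (partial k \<kappa>) x)^2) \<le> (LBINT x. (conv f \<kappa> x)^2)"
proof -
  have tk: "test_fun (partial i \<kappa>)" "test_fun (partial i (partial j \<kappa>))" for i j using \<kappa> by (auto intro: test_fun_partial)
  have L: "L1l u" "L1l (Du i)" "L1l f" for i using u f by (auto intro: L2l_L1l L2_L2l)
  define U where "U = conv u \<kappa>"
  define U1 where "U1 i = conv (Du i) \<kappa>" for i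
  define V where "V j i = conv (Du j) (partial i \<kappa>)" for j i
  define T where "T j i l = conv (Du j) (partial l (partial i \<kappa>))" for j i l
  have L2s: "L2 U" "L2 (U1 i)" "L2 (V j i)" "L2 (T j i l)" for i j l
    unfolding U_def U1_def V_def T_def using u \<kappa> tk by (auto intro!: conv_L2 test_fun_bcs)
  have LF: "L2 (conv f \<kappa>)" using f \<kappa> by (auto intro!: conv_L2 test_fun_bcs)
  have wU: "wd i U (U1 i)" for i
  proof -
    have "partial i (conv u \<kappa>) = conv (Du i) \<kappa>" by (rule ext, rule wd_conv[OF u(1) \<kappa>])
    then show ?thesis using wd_smooth[OF smooth_conv[OF L(1) \<kappa>], of i] by (simp add: U_def U1_def)
  qed
  have wU1: "wd l (U1 i) (V i l)" for i l
    using wd_smooth[OF smooth_conv[OF L(2) \<kappa>]] unfolding partial_conv[OF L(2) \<kappa>] U1_def V_def .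
  have wV: "wd l (V j i) (T j i l)" for i j l
    using wd_smooth[OF smooth_conv[OF L(2) tk(1)]] unfolding partial_conv[OF L(2) tk(1)] V_def T_def .
  have Vsym: "V j i = V i j" for i j
  proof -
    have "V j i = conv u (partial j (partial i \<kappa>))" for i j
      unfolding V_def by (rule ext) (simp add: wd_conv[OF u(1) tk(1), symmetric] partial_conv[OF L(1) tk(1)])
    then show ?thesis using sym by simp
  qed
  have Tsym: "T j i l = T j l i" for i j l unfolding T_def sym[of l i] ..
  \<comment> \<open>The weak equation tested with \<kappa>(x - .); the minus sign of the reflected
    derivative turns the divergence term into minus \<open>A\<close> contracted with the second
    derivatives.\<close>
  have pt: "\<alpha> * U x - (\<Sum>i\<in>UNIV. \<Sum>j\<in>UNIV. A i j * V j i x) = conv f \<kappa> x" for x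
  proof -
    have "(LBINT y. Du j y * partial i (\<lambda>y. \<kappa> (x - y)) y) = - V j i x" for i j
      unfolding partial_reflect[OF \<kappa>] V_def conv_def by simp
    with weak[OF test_fun_reflect[OF \<kappa>, of x]] show ?thesis
      by (simp add: U_def conv_def sum_negf)
  qed
  have I1: "(LBINT x. U x * V k k x) = - (LBINT x. (U1 k x)^2)"
    using L2_ibp[where p = U and q = "U1 k" and Dq = "V k" and k = k, OF wU] wU1 L2s by (simp add: power2_eq_square)
  \<comment> \<open>Both integrals reduce to the same third-order expression, once symmetry of the
    derivatives of \<kappa> is used. This exchange is what lets a coercivity bound on vectors
    control second derivatives.\<close>
  have I2: "(LBINT x. V j i x * V k k x) = (LBINT x. V i k x * V j k x)" for i j
  proof -
    have "(LBINT x. V k k x * V j i x) = - (LBINT x. T k k i x * U1 j x)"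
      by (rule L2_ibp[where Dq = "V j"]) (use wU1 wV L2s in auto)
    moreover have "(LBINT x. V k i x * V j k x) = - (LBINT x. T k i k x * U1 j x)"
      by (rule L2_ibp[where Dq = "V j"]) (use wU1 wV L2s in auto)
    ultimately show ?thesis unfolding Tsym[of k i k] Vsym[of i k] by (simp add: mult.commute)
  qed
  have iV: "integrable lborel (\<lambda>x. V i j x * V k l x)" "integrable lborel (\<lambda>x. U x * V k l x)"
    "integrable lborel (\<lambda>x. conv f \<kappa> x * V k l x)" for i j k l
    using L2s LF by (auto intro: L2_mult_integrable)
  define S where "S = (\<Sum>j\<in>UNIV. LBINT x. (V j k x)^2)"
  have iV2: "integrable lborel (\<lambda>x. (V i j x)^2)" for i j using L2s by (simp add: L2_def)
  have "(LBINT x. conv f \<kappa> x * V k k x) = (LBINT x. \<alpha> * (U x * V k k x) - (\<Sum>i\<in>UNIV. \<Sum>j\<in>UNIV. A i j * (V j i x * V k k x)))"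
    unfolding pt[symmetric] by (simp add: left_diff_distrib sum_distrib_right mult.assoc)
  also have "\<dots> = \<alpha> * (LBINT x. U x * V k k x) - (\<Sum>i\<in>UNIV. \<Sum>j\<in>UNIV. A i j * (LBINT x. V j i x * V k k x))"
    using iV by (simp add: Bochner_Integration.integral_sum)
  also have "\<dots> = - \<alpha> * (LBINT x. (U1 k x)^2) - (LBINT x. (\<Sum>i\<in>UNIV. \<Sum>j\<in>UNIV. A i j * V i k x * V j k x))"
    unfolding I1 I2 using iV by (simp add: Bochner_Integration.integral_sum mult.assoc)
  also have "\<dots> \<le> - c * S"
  proof -
    have "c * S = (LBINT x. c * (\<Sum>i\<in>UNIV. (V i k x)^2))"
      unfolding S_def using iV2 by (simp add: Bochner_Integration.integral_sum)
    also have "\<dots> \<le> (LBINT x. (\<Sum>i\<in>UNIV. \<Sum>j\<in>UNIV. A i j * V i k x * V j k x))"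
      using iV iV2 by (intro integral_mono coer) (auto simp: mult.assoc)
    finally show ?thesis using \<alpha> by (simp add: algebra_simps) (smt (verit) Bochner_Integration.integral_nonneg mult_nonneg_nonneg zero_le_power2)
  qed
  finally have cS: "c * S \<le> - (LBINT x. conv f \<kappa> x * V k k x)" by simp
  have S0: "S \<ge> 0" unfolding S_def by (intro sum_nonneg) auto
  have VS: "(LBINT x. (V k k x)^2) \<le> S"
    unfolding S_def using member_le_sum[of k UNIV "\<lambda>j. LINT x|lborel. (V j k x)^2"] by simp
  have "(c * S)^2 \<le> (LBINT x. conv f \<kappa> x * V k k x)^2"
    using cS c S0 by (intro abs_le_square_iff[THEN iffD1]) auto
  also have "\<dots> \<le> (LBINT x. (conv f \<kappa> x)^2) * (LBINT x. (V k k x)^2)"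
    by (intro L2_Cauchy_Schwarz LF L2s)
  also have "\<dots> \<le> (LBINT x. (conv f \<kappa> x)^2) * S" by (intro mult_left_mono) (auto intro: VS)
  finally have "S * (c^2 * S) \<le> S * (LBINT x. (conv f \<kappa> x)^2)" by (simp add: power2_eq_square mult_ac)
  then have "S = 0 \<or> c^2 * S \<le> (LBINT x. (conv f \<kappa> x)^2)" using S0 by (auto simp: mult_le_cancel_left)
  then show ?thesis unfolding S_def[symmetric] V_def[symmetric] by auto
qed

text \<open>An explicit computation: the formula \<open>b2\<close> for the second derivatives of the
  bump is visibly symmetric in i and j, and dilation preserves this.\<close>

lemma moll_partial_sym: "partial i (partial j (moll n)) = partial j (partial i (moll n :: real ^ 'n::finite \<Rightarrow> real))"
proof -
  define c s where "c = real (Suc n) ^ CARD('n) / (LBINT y. bump 0 (y :: real ^ 'n))" and "s = real (Suc n)"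
  have m: "moll n = (\<lambda>x :: real ^ 'n. c * bump 0 (s *\<^sub>R x + 0))"
    by (auto simp: moll_def[abs_def] c_def s_def)
  have sb: "smooth (partial j (bump 0 :: real ^ 'n \<Rightarrow> real))" for j by (intro smooth_partial smooth_bump)
  have p1: "partial j (moll n) = (\<lambda>x :: real ^ 'n. (c * s) * partial j (bump 0) (s *\<^sub>R x + 0))" for j
    by (rule ext) (simp only: m partial_cmult[OF smooth_affine[OF smooth_bump]] partial_affine[OF smooth_diff[OF smooth_bump]] mult.assoc)
  have p2: "partial i (partial j (moll n)) = (\<lambda>x :: real ^ 'n. (c * s) * (s * partial i (partial j (bump 0)) (s *\<^sub>R x + 0)))" for i j
    by (rule ext) (simp only: p1 partial_cmult[OF smooth_affine[OF sb]] partial_affine[OF smooth_diff[OF sb]])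
  have b1: "partial j (bump 0) = (\<lambda>x :: real ^ 'n. bump 2 x * (- 2 * x $ j))" for j
    by (intro ext) (simp add: partial_eq[OF bump_has_derivative] inner_axis numeral_2_eq_2)
  have b2: "partial i (partial j (bump 0)) x = (bump 4 x - 2 * bump 3 x) * (4 * (x $ i * x $ j)) - 2 * bump 2 x * (axis i 1 $ j)" for i j and x :: "real ^ 'n"
  proof -
    have "((\<lambda>x :: real ^ 'n. - 2 * x $ j) has_derivative (\<lambda>h. - 2 * h $ j)) (at x)"
      by (intro has_derivative_mult_right bounded_linear_imp_has_derivative bounded_linear_vec_nth)
    from has_derivative_mult[OF bump_has_derivative[of 2] this]
    show ?thesis unfolding b1 by (subst partial_eq, assumption) (simp add: inner_axis algebra_simps numeral_eq_Suc)
  qed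
  have "partial i (partial j (bump 0)) = partial j (partial i (bump 0 :: real ^ 'n \<Rightarrow> real))"
    by (rule ext) (simp add: b2 mult.commute axis_def)
  then show ?thesis unfolding p2 by simp
qed

text \<open>Since the estimate applies to the difference of two mollifiers, the mollified second
  derivatives are Cauchy as soon as the mollifications of \<open>f\<close> are. Completeness gives a
  strong limit, without weak compactness or difference quotients, and this limit is the weak
  derivative.\<close>

lemma H2_regularity:
  fixes u f :: "real ^ 'n::finite \<Rightarrow> real"
  assumes c: "c > 0" and coer: "\<And>h :: 'n \<Rightarrow> real. c * (\<Sum>i\<in>UNIV. (h i)^2) \<le> (\<Sum>i\<in>UNIV. \<Sum>j\<in>UNIV. A i j * h i * h j)"
    and u: "\<And>k. wd k u (Du k)" "L2 u" "\<And>k. L2 (Du k)" and f: "L2 f" and \<alpha>: "\<alpha> \<ge> 0"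
    and weak: "\<And>\<psi>. test_fun \<psi> \<Longrightarrow> \<alpha> * (LBINT x. u x * \<psi> x)
      + (\<Sum>i\<in>UNIV. \<Sum>j\<in>UNIV. A i j * (LBINT x. Du j x * partial i \<psi> x)) = (LBINT x. f x * \<psi> x)"
  obtains G where "L2 G" "wd k (Du i) G"
proof -
  define g where "g n = conv (Du i) (partial k (moll n))" for n
  define F where "F n = conv f (moll n)" for n
  have tm: "test_fun (moll n :: real ^ 'n \<Rightarrow> real)" "test_fun (partial k (moll n) :: real ^ 'n \<Rightarrow> real)" for n k
    by (auto intro: test_fun_moll test_fun_partial)
  have L: "L1l (Du i)" "L1l f" for i using u f by (auto intro: L2l_L1l L2_L2l)
  have Lg: "L2 (g n)" for n unfolding g_def by (intro conv_L2 u test_fun_bcs tm)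
  have LF: "L2 (\<lambda>x. F n x - f x)" "L2 (F n)" for n unfolding F_def by (intro L2_diff conv_L2 f test_fun_bcs tm)+
  have Ff: "\<exists>N. \<forall>n\<ge>N. (LBINT x. (F n x - f x)^2) \<le> e" if "e > 0" for e
  proof -
    have "eventually (\<lambda>n. (LBINT\<^sup>+ x. ennreal ((F n x - f x)^2)) \<le> ennreal e) sequentially"
      unfolding F_def by (intro kern_conv_L2_eventually[OF f kern_moll moll_radius] that)
    then show ?thesis using LF that by (auto simp: eventually_sequentially L2_def nn_integral_eq_integral)
  qed
  have key: "c^2 * (LBINT x. (g m x - g n x)^2) \<le> (LBINT x. (F m x - F n x)^2)" for m n
  proof -
    \<comment> \<open>Linearity of the convolution makes the estimate for this kernel a bound on
      \<open>g m x - g n x\<close> in terms of \<open>F m x - F n x\<close>.\<close>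
    define \<kappa> where "\<kappa> x = moll m x + (- 1) * moll n x" for x :: "real ^ 'n"
    have t\<kappa>: "test_fun \<kappa>" unfolding \<kappa>_def by (intro test_fun_add test_fun_cmult tm)
    have sm: "smooth (moll n :: real ^ 'n \<Rightarrow> real)" "smooth (partial j (moll n) :: real ^ 'n \<Rightarrow> real)" for n j
      using tm by (auto intro: test_fun_smooth)
    have p1: "partial j \<kappa> = (\<lambda>x. partial j (moll m) x + (- 1) * partial j (moll n) x)" for j
      unfolding \<kappa>_def by (rule ext) (simp only: partial_add[OF sm(1) smooth_cmult[OF sm(1)]] partial_cmult[OF sm(1)])
    have p2: "partial i (partial j \<kappa>) = (\<lambda>x. partial i (partial j (moll m)) x + (- 1) * partial i (partial j (moll n)) x)" for i j
      unfolding p1 by (rule ext) (simp only: partial_add[OF sm(2) smooth_cmult[OF sm(2)]] partial_cmult[OF sm(2)])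
    have lin: "conv h (\<lambda>x. a x + (- 1) * b x) x = conv h a x - conv h b x"
      if "L1l h" "test_fun a" "test_fun b" for h a b :: "real ^ 'n \<Rightarrow> real" and x
      unfolding conv_def using conv_integrable[OF that(1) test_fun_bcs[OF that(2)]] conv_integrable[OF that(1) test_fun_bcs[OF that(3)]]
      by (simp add: right_diff_distrib)
    have "c^2 * (\<Sum>j\<in>UNIV. LBINT x. (conv (Du j) (partial k \<kappa>) x)^2) \<le> (LBINT x. (conv f \<kappa> x)^2)"
      by (rule conv_partial_estimate[OF c coer u f \<alpha> weak t\<kappa>])
         (auto simp: p2 moll_partial_sym[of _ _ m] moll_partial_sym[of _ _ n])
    moreover have "conv f \<kappa> x = F m x - F n x" for x
      unfolding F_def \<kappa>_def[abs_def] by (rule lin[OF L(2) tm(1) tm(1)])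
    moreover have "conv (Du i) (partial k \<kappa>) x = g m x - g n x" for x
      unfolding g_def p1 by (rule lin[OF L(1) tm(2) tm(2)])
    moreover have "(LBINT x. (conv (Du i) (partial k \<kappa>) x)^2) \<le> (\<Sum>j\<in>UNIV. LBINT x. (conv (Du j) (partial k \<kappa>) x)^2)"
      using member_le_sum[of i UNIV "\<lambda>j. LINT x|lborel. (conv (Du j) (partial k \<kappa>) x)^2"] by simp
    ultimately show ?thesis by (smt (verit) mult_left_mono zero_le_power2 Bochner_Integration.integral_cong)
  qed
  have cauchy: "\<exists>N. \<forall>m\<ge>N. \<forall>n\<ge>N. (LBINT x. (g m x - g n x)^2) \<le> e" if e: "e > 0" for e
  proof -
    have "c^2 * e / 4 > 0" using e c by simp
    then obtain N where N: "\<And>n. n \<ge> N \<Longrightarrow> (LBINT x. (F n x - f x)^2) \<le> c^2 * e / 4" using Ff by blast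
    have "(LBINT x. (g m x - g n x)^2) \<le> e" if "m \<ge> N" "n \<ge> N" for m n
    proof -
      have i: "integrable lborel (\<lambda>x. (F m x - f x)^2)" for m using LF by (simp add: L2_def)
      have "(LBINT x. (F m x - F n x)^2) \<le> (LBINT x. 2 * (F m x - f x)^2 + 2 * (F n x - f x)^2)"
      proof (rule integral_mono)
        show "integrable lborel (\<lambda>x. (F m x - F n x)^2)" using L2_diff[OF LF(2) LF(2)] by (simp add: L2_def)
        show "integrable lborel (\<lambda>x. 2 * (F m x - f x)^2 + 2 * (F n x - f x)^2)" using i by simp
        fix x
        have "0 \<le> ((F m x - f x) + (F n x - f x))^2" by simp
        then show "(F m x - F n x)^2 \<le> 2 * (F m x - f x)^2 + 2 * (F n x - f x)^2" by (simp add: power2_eq_square algebra_simps)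
      qed
      also have "\<dots> \<le> c^2 * e" using N[OF that(1)] N[OF that(2)] i by simp
      finally have "c^2 * (LBINT x. (g m x - g n x)^2) \<le> c^2 * e" using key[of m n] by linarith
      then show ?thesis using c by simp
    qed
    then show ?thesis by blast
  qed
  obtain G where G: "L2 G" "(\<lambda>n. LINT x|lborel. (g n x - G x)^2) \<longlonglongrightarrow> 0" using L2_complete[OF Lg cauchy] by blast
  have "wd k (Du i) G"
    unfolding wd_def
  proof (intro conjI allI impI L)
    show "L1l G" using G by (intro L2l_L1l L2_L2l)
    fix \<psi> :: "real ^ 'n \<Rightarrow> real" assume t: "test_fun \<psi>"
    obtain R where R: "R > 0" "\<And>x. R < norm x \<Longrightarrow> \<psi> x = 0" "\<And>x k. R < norm x \<Longrightarrow> partial k \<psi> x = 0"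
      using test_funE[OF t] by blast
    have t2: "L2 \<psi>" "L2 (partial k \<psi>)" using t by (auto intro: bcs_L2 test_fun_bcs test_fun_partial)
    have "wd k (conv (Du i) (moll n)) (g n)" for n
      using wd_smooth[OF smooth_conv[OF L(1) tm(1)], of k i n] unfolding partial_conv[OF L(1) tm(1)] g_def .
    from wdD[OF this t] have n: "(LBINT x. partial k \<psi> x * conv (Du i) (moll n) x) = - (LBINT x. g n x * \<psi> x)" for n
      by (simp add: mult.commute)
    have 1: "(\<lambda>n. LINT x|lborel. partial k \<psi> x * conv (Du i) (moll n) x) \<longlonglongrightarrow> (LBINT x. partial k \<psi> x * Du i x)"
      by (rule moll_pairing[OF L2_L2l[OF u(3)] t2(2) R(3)])
    have 2: "(\<lambda>n. LINT x|lborel. g n x * \<psi> x) \<longlonglongrightarrow> (LBINT x. G x * \<psi> x)"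
    proof (rule LIM_zero_cancel, rule Lim_null_comparison)
      have "(\<lambda>n. sqrt ((LBINT x. (g n x - G x)^2) * (LBINT x. (\<psi> x)^2))) \<longlonglongrightarrow> sqrt (0 * (LBINT x. (\<psi> x)^2))"
        by (intro tendsto_intros G)
      then show "(\<lambda>n. sqrt ((LBINT x. (g n x - G x)^2) * (LBINT x. (\<psi> x)^2))) \<longlonglongrightarrow> 0" by simp
      have "norm ((LBINT x. g n x * \<psi> x) - (LBINT x. G x * \<psi> x)) \<le> sqrt ((LBINT x. (g n x - G x)^2) * (LBINT x. (\<psi> x)^2))" for n
      proof -
        have "(LBINT x. g n x * \<psi> x) - (LBINT x. G x * \<psi> x) = (LBINT x. (g n x - G x) * \<psi> x)"
          using L2_mult_integrable[OF Lg t2(1)] L2_mult_integrable[OF G(1) t2(1)] by (simp add: left_diff_distrib)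
        then show ?thesis using L2_Cauchy_Schwarz[OF L2_diff[OF Lg G(1)] t2(1)] by (simp add: real_le_rsqrt)
      qed
      then show "\<forall>\<^sub>F n in sequentially. norm ((LBINT x. g n x * \<psi> x) - (LBINT x. G x * \<psi> x))
         \<le> sqrt ((LBINT x. (g n x - G x)^2) * (LBINT x. (\<psi> x)^2))" by simp
    qed
    have "(\<lambda>n. LINT x|lborel. partial k \<psi> x * conv (Du i) (moll n) x) \<longlonglongrightarrow> - (LBINT x. G x * \<psi> x)"
      unfolding n by (intro tendsto_minus 2)
    from LIMSEQ_unique[OF 1 this] show "(LBINT x. Du i x * partial k \<psi> x) = - (LBINT x. G x * \<psi> x)"
      by (simp add: mult.commute)
  qed
  with G(1) show thesis by (rule that)
qed

subsection \<open>Vectors and matrices\<close>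

lemma borel_measurable_nth [measurable (raw)]:
  fixes f :: "'a \<Rightarrow> 'b::{second_countable_topology, real_normed_vector} ^ 'n::finite"
  assumes "f \<in> borel_measurable M"
  shows "(\<lambda>x. f x $ i) \<in> borel_measurable M"
  by (rule borel_measurable_continuous_on[OF _ assms]) (intro continuous_intros)

lemma norm2_vec: "(norm (x :: 'b::real_inner ^ 'n::finite))^2 = (\<Sum>i\<in>UNIV. (norm (x $ i))^2)"
  by (simp add: power2_norm_eq_inner inner_vec_def)

lemma borel_measurable_vecI:
  fixes f :: "'a \<Rightarrow> real ^ 'n::finite"
  assumes "\<And>i. (\<lambda>x. f x $ i) \<in> borel_measurable M"
  shows "f \<in> borel_measurable M"
proof -
  have "(\<lambda>x. \<Sum>i\<in>UNIV. f x $ i *\<^sub>R axis i (1::real)) \<in> borel_measurable M"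
    using assms by measurable
  moreover have "(\<Sum>i\<in>UNIV. f x $ i *\<^sub>R axis i (1::real)) = f x" for x
    using basis_expansion[of "f x"] by (simp add: scalar_mult_eq_scaleR)
  ultimately show ?thesis by simp
qed

lemma borel_measurable_matrix_vector_mult [measurable (raw)]:
  fixes A :: "'a \<Rightarrow> real ^ 'n::finite ^ 'm::finite"
  assumes [measurable]: "A \<in> borel_measurable M" "w \<in> borel_measurable M"
  shows "(\<lambda>x. A x *v w x) \<in> borel_measurable M"
  by (rule borel_measurable_vecI) (simp add: matrix_vector_mult_def)

lemma norm_matrix_vector_le:
  fixes A :: "real ^ 'n::finite ^ 'm::finite"
  shows "(norm (A *v w))^2 \<le> (norm A)^2 * (norm w)^2"
proof -
  have "(norm ((A *v w) $ i))^2 \<le> (norm (A $ i))^2 * (norm w)^2" for i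
  proof -
    have "(A *v w) $ i = A $ i \<bullet> w" by (simp add: matrix_vector_mult_def inner_vec_def)
    then show ?thesis using Cauchy_Schwarz_ineq2[of "A $ i" w]
      by (metis abs_ge_zero power_mono power_mult_distrib real_norm_def)
  qed
  then show ?thesis unfolding norm2_vec[of "A *v w"] norm2_vec[of A] sum_distrib_right by (intro sum_mono)
qed

lemma L2_bound_AE:
  assumes "g \<in> borel_measurable borel" "integrable lborel h" "AE x in lborel. (g x)^2 \<le> h x"
  shows "L2 g"
  unfolding L2_def
proof (intro conjI assms(1) Bochner_Integration.integrable_bound[OF assms(2)])
  show "(\<lambda>x. (g x)^2) \<in> borel_measurable lborel" using assms(1) by measurable
  show "AE x in lborel. norm ((g x)^2) \<le> norm (h x)" using assms(3) by eventually_elim simp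
qed

lemma L2_norm:
  assumes "\<And>k. L2 (\<lambda>x. F x $ k)"
  shows "integrable lborel (\<lambda>x. (norm (F x :: real ^ 'm::finite))^2)"
  unfolding norm2_vec using assms by (simp add: L2_def)

lemma L2l_bound_AE:
  assumes "g \<in> borel_measurable borel" "\<And>k::'m::finite. L2l (\<lambda>x. F x $ k)" "AE x in lborel. \<bar>g x\<bar> \<le> norm (F x)"
  shows "L2l g"
  unfolding L2l_iff
proof (intro conjI allI assms(1))
  fix R
  have "L2 (\<lambda>x. (indicator (cball 0 R) x *\<^sub>R F x) $ k)" for k
    using assms(2)[of k] by (simp add: L2l_iff mult.commute)
  from L2_norm[OF this] show "L2 (\<lambda>x. g x * indicator (cball 0 R) x)"
  proof (rule L2_bound_AE[rotated])
    show "AE x in lborel. (g x * indicator (cball 0 R) x)^2 \<le> (norm (indicator (cball 0 R) x *\<^sub>R F x))^2"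
      using assms(3)
    proof eventually_elim
      case (elim x)
      then show ?case using power_mono[OF elim, of 2] by (auto simp: indicator_def)
    qed
    show "(\<lambda>x. g x * indicator (cball 0 R) x) \<in> borel_measurable borel"
      by (intro borel_measurable_times assms(1)) simp
  qed
qed

definition elliptic :: "real \<Rightarrow> (real ^ 'n \<Rightarrow> real ^ 'n ^ 'n::finite) \<Rightarrow> bool" where
  "elliptic lam A \<longleftrightarrow> A \<in> borel_measurable borel \<and>
     (AE x in lborel. \<forall>\<xi>. \<xi> \<bullet> (A x *v \<xi>) \<ge> lam * (norm \<xi>)^2 \<and> norm (A x *v \<xi>) \<le> norm \<xi>)"

lemma elliptic_borel [measurable_dest]: "elliptic lam A \<Longrightarrow> A \<in> borel_measurable borel"
  by (simp add: elliptic_def)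

lemma elliptic_AE: "elliptic lam A \<Longrightarrow>
    AE x in lborel. \<forall>\<xi>. \<xi> \<bullet> (A x *v \<xi>) \<ge> lam * (norm \<xi>)^2 \<and> norm (A x *v \<xi>) \<le> norm \<xi>"
  by (simp add: elliptic_def)

lemma elliptic_L2l:
  assumes A: "elliptic lam A" and F: "\<And>k. L2l (\<lambda>x. F x $ k)"
  shows "L2l (\<lambda>x. (A x *v F x) $ k)"
proof (rule L2l_bound_AE[OF _ F])
  have [measurable]: "A \<in> borel_measurable borel" "F \<in> borel_measurable borel"
    using A F by (auto intro: borel_measurable_vecI elliptic_borel L2l_borel)
  show "(\<lambda>x. (A x *v F x) $ k) \<in> borel_measurable borel" by measurable
  show "AE x in lborel. \<bar>(A x *v F x) $ k\<bar> \<le> norm (F x)"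
    using elliptic_AE[OF A]
  proof eventually_elim
    case (elim x)
    then show ?case using component_le_norm_cart[of "A x *v F x" k] by (meson order_trans)
  qed
qed

lemma elliptic_L2:
  assumes A: "elliptic lam A" and F: "\<And>k. L2 (\<lambda>x. F x $ k)"
  shows "L2 (\<lambda>x. (A x *v F x) $ k)"
proof (rule L2_bound_AE[OF _ L2_norm[OF F]])
  have [measurable]: "A \<in> borel_measurable borel" "F \<in> borel_measurable borel"
    using A F by (auto intro: borel_measurable_vecI elliptic_borel L2_borel)
  show "(\<lambda>x. (A x *v F x) $ k) \<in> borel_measurable borel" by measurable
  show "AE x in lborel. ((A x *v F x) $ k)^2 \<le> (norm (F x))^2"
    using elliptic_AE[OF A]
  proof eventually_elim
    case (elim x)
    then have "\<bar>(A x *v F x) $ k\<bar> \<le> norm (F x)" using component_le_norm_cart[of "A x *v F x" k] by (meson order_trans)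
    from power_mono[OF this, of 2] show ?case by simp
  qed
qed

subsection \<open>A weighted Caccioppoli inequality\<close>

text \<open>The vector on the right is the gradient of p^2 \<phi> when D and q are the gradients of
  \<phi> and p. Of the ellipticity term, one quarter absorbs the linear term in D and one quarter
  the mixed term, which leaves the factor \<open>lam / 2\<close>.\<close>

lemma caccioppoli_pointwise:
  fixes A :: "real ^ 'n::finite ^ 'n"
  assumes lam: "lam > 0" and ell: "\<And>\<xi>. \<xi> \<bullet> (A *v \<xi>) \<ge> lam * (norm \<xi>)^2" "\<And>\<xi>. norm (A *v \<xi>) \<le> norm \<xi>"
    and e: "norm e = 1"
  shows "lam / 2 * (p^2 * (norm D)^2) - (1 / lam + 1) * p^2 - (4 / lam + 1) * (\<phi>^2 * (norm q)^2)
    \<le> (A *v (D + e)) \<bullet> (p^2 *\<^sub>R D + (2 * p * \<phi>) *\<^sub>R q)"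
proof -
  define y s where "y = norm D" and "s = \<bar>\<phi>\<bar> * norm q"
  have y: "y \<ge> 0" and s: "s \<ge> 0" by (auto simp: y_def s_def)
  have "\<bar>(A *v e) \<bullet> D\<bar> \<le> norm (A *v e) * norm D" by (rule Cauchy_Schwarz_ineq2)
  also have "\<dots> \<le> 1 * norm D" using ell(2)[of e] e by (intro mult_right_mono) auto
  finally have 1: "(A *v e) \<bullet> D \<ge> - y" by (simp add: y_def)
  have 2: "(A *v D) \<bullet> D \<ge> lam * y^2" using ell(1)[of D] by (simp add: inner_commute y_def)
  have "\<bar>(A *v (D + e)) \<bullet> q\<bar> \<le> norm (A *v (D + e)) * norm q" by (rule Cauchy_Schwarz_ineq2)
  also have "\<dots> \<le> (y + 1) * norm q"
    using ell(2)[of "D + e"] norm_triangle_ineq[of D e] e by (intro mult_right_mono) (auto simp: y_def)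
  finally have 3: "\<bar>(A *v (D + e)) \<bullet> q\<bar> \<le> (y + 1) * norm q" .
  have "\<bar>(2 * p * \<phi>) * ((A *v (D + e)) \<bullet> q)\<bar> \<le> 2 * \<bar>p\<bar> * s * (y + 1)"
    using mult_left_mono[OF 3, of "2 * \<bar>p\<bar> * \<bar>\<phi>\<bar>"] by (simp add: abs_mult s_def mult_ac)
  then have 4: "(2 * p * \<phi>) * ((A *v (D + e)) \<bullet> q) \<ge> - (2 * \<bar>p\<bar> * s * (y + 1))" by linarith
  have 5: "p^2 * ((A *v (D + e)) \<bullet> D) \<ge> p^2 * (lam * y^2 - y)"
    using 1 2 by (intro mult_left_mono) (auto simp: matrix_vector_right_distrib inner_add_left)
  have a1: "p^2 * y \<le> lam / 4 * (p^2 * y^2) + p^2 / lam"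
  proof -
    have "0 \<le> (lam * y / 2 - 1)^2" by simp
    then have "lam * y \<le> lam^2 * y^2 / 4 + 1" by (simp add: power2_eq_square algebra_simps)
    then have "y \<le> lam / 4 * y^2 + 1 / lam" using lam by (simp add: field_simps power2_eq_square)
    then have "p^2 * y \<le> p^2 * (lam / 4 * y^2 + 1 / lam)" by (rule mult_left_mono) simp
    then show ?thesis by (simp add: algebra_simps)
  qed
  have a2: "2 * \<bar>p\<bar> * s * y \<le> lam / 4 * (p^2 * y^2) + 4 / lam * s^2"
  proof -
    have "0 \<le> (lam * (\<bar>p\<bar> * y) / 2 - 2 * s)^2" by simp
    then have "lam * (2 * \<bar>p\<bar> * s * y) \<le> lam^2 * (p^2 * y^2) / 4 + 4 * s^2"
      by (simp add: power2_diff power_mult_distrib power_divide mult_ac)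
    then show ?thesis using lam by (simp add: field_simps power2_eq_square)
  qed
  have a3: "2 * \<bar>p\<bar> * s \<le> p^2 + s^2" using sum_squares_bound[of "\<bar>p\<bar>" s] by simp
  have "(A *v (D + e)) \<bullet> (p^2 *\<^sub>R D + (2 * p * \<phi>) *\<^sub>R q) = p^2 * ((A *v (D + e)) \<bullet> D) + (2 * p * \<phi>) * ((A *v (D + e)) \<bullet> q)"
    by (simp add: inner_add_right)
  moreover have "\<phi>^2 * (norm q)^2 = s^2" by (simp add: s_def power_mult_distrib)
  ultimately show ?thesis using 4 5 a1 a2 a3 by (simp add: y_def[symmetric] algebra_simps)
qed

text \<open>The weight is truncated to \<open>sin (d v) / d\<close>, a bounded smooth function of \<open>v\<close> converging to \<open>v\<close>.\<close>

lemma caccioppoli: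
  fixes A :: "real ^ 'n::finite \<Rightarrow> real ^ 'n ^ 'n"
  assumes lam: "lam > 0" and A: "elliptic lam A" and e: "norm e = 1"
    and \<phi>: "\<And>k. wd k \<phi> (\<lambda>x. D\<phi> x $ k)" "L2l \<phi>" "\<And>k. L2l (\<lambda>x. D\<phi> x $ k)"
    and div: "\<And>\<psi>. test_fun \<psi> \<Longrightarrow> (\<Sum>k\<in>UNIV. LBINT x. (A x *v (D\<phi> x + e)) $ k * partial k \<psi> x) = 0"
    and v: "\<And>k. wd k v (\<lambda>x. Dv x $ k)" "L2 v" "\<And>k. L2 (\<lambda>x. Dv x $ k)"
    and fin: "L2 (\<lambda>x. \<phi> x * v x)" "\<And>k. L2 (\<lambda>x. \<phi> x * Dv x $ k)"
  shows "L2 (\<lambda>x. v x * D\<phi> x $ k)"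
proof -
  have [measurable]: "A \<in> borel_measurable borel" "D\<phi> \<in> borel_measurable borel" "Dv \<in> borel_measurable borel"
    "\<phi> \<in> borel_measurable borel" "v \<in> borel_measurable borel"
    using A \<phi> v by (auto intro: borel_measurable_vecI elliptic_borel L2l_borel L2_borel)
  define F where "F k x = (A x *v (D\<phi> x + e)) $ k" for k x
  have LF: "L2l (F k)" for k unfolding F_def
    by (intro elliptic_L2l[OF A]) (simp add: L2l_add \<phi> continuous_L2l)
  obtain C where C: "C > 0" "\<And>n x. \<bar>cut n (x :: real ^ 'n)\<bar> \<le> C"
    "\<And>n k x. \<bar>partial k (cut n) (x :: real ^ 'n)\<bar> \<le> C * inverse (real (Suc n))"
    using cut_bounds[where 'n='n] by metis
  have C3: "\<bar>partial k (cut n) (x :: real ^ 'n)\<bar> \<le> C" for n k x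
  proof -
    have "inverse (real (Suc n)) \<le> 1" by (simp add: inverse_le_1_iff)
    then have "C * inverse (real (Suc n)) \<le> C * 1" using C(1) by (intro mult_left_mono) auto
    then show ?thesis using C(3)[of k n x] by linarith
  qed
  define d where "d n = inverse (real (Suc n))" for n
  have d: "d n > 0" for n by (simp add: d_def)
  define w where "w n x = sin (d n * v x) / d n" for n x
  define Dw where "Dw n x = cos (d n * v x) *\<^sub>R Dv x" for n x
  define p where "p n x = cut n x * w n x" for n x
  define Dp where "Dp n x = w n x *\<^sub>R (\<chi> k. partial k (cut n) x) + cut n x *\<^sub>R Dw n x" for n x
  \<comment> \<open>Dominates the subtracted terms of the pointwise inequality for all n: |w| \<le>
    |v| for the truncated weight, |cos| \<le> 1 for its derivative, and C for the cutoff and its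
    derivatives. It is integrable exactly because of \<open>v\<close> and
    \<open>fin\<close>.\<close>
  define K where "K x = (1 / lam + 1) * (C^2 * (v x)^2) + (4 / lam + 1) * (2 * C^2 * (real CARD('n) * (\<phi> x * v x)^2 + (\<Sum>k\<in>UNIV. (\<phi> x * Dv x $ k)^2)))" for x
  have Ki: "integrable lborel K" unfolding K_def[abs_def] using v fin by (simp add: L2_def)
  have tc: "test_fun (cut n :: real ^ 'n \<Rightarrow> real)" "test_fun (partial k (cut n) :: real ^ 'n \<Rightarrow> real)" for n k
    by (auto intro: test_fun_cut test_fun_partial)
  have [measurable]: "(cut n :: real ^ 'n \<Rightarrow> real) \<in> borel_measurable borel" "(partial k (cut n) :: real ^ 'n \<Rightarrow> real) \<in> borel_measurable borel" for n k
    using tc by (auto intro: test_fun_borel)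
  have wv: "\<bar>w n x\<bar> \<le> \<bar>v x\<bar>" for n x
    using abs_sin_x_le_abs_x[of "d n * v x"] d[of n] by (simp add: w_def abs_mult field_simps)
  have wb: "\<bar>w n x\<bar> \<le> 1 / d n" for n x
    using abs_sin_le_one[of "d n * v x"] d[of n] by (simp add: w_def divide_right_mono)
  have mw [measurable]: "w n \<in> borel_measurable borel" "Dw n \<in> borel_measurable borel" for n
    unfolding w_def Dw_def by measurable
  have key: "(LBINT\<^sup>+ x. ennreal ((p n x)^2 * (norm (D\<phi> x))^2)) \<le> ennreal (2 / lam * (LBINT x. K x))" for n
  proof -
    have Lw: "L2 (w n)"
    proof (rule L2_bound[where h = "\<lambda>x. (v x)^2"])
      show "(w n x)^2 \<le> (v x)^2" for x using wv[of n x] by (simp add: abs_le_square_iff)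
    qed (use v in \<open>auto simp: L2_def\<close>)
    have LDw: "L2 (\<lambda>x. Dw n x $ k)" for k
    proof -
      have "L2 (\<lambda>x. Dv x $ k * cos (d n * v x))" by (rule L2_bounded_mult[OF v(3), where B = 1]) auto
      then show ?thesis by (simp add: Dw_def mult.commute)
    qed
    have wdw: "wd k (w n) (\<lambda>x. Dw n x $ k)" for k
    proof -
      have "wd k (\<lambda>x. sin (d n * v x) / d n) (\<lambda>x. cos (d n * v x) * Dv x $ k)"
      proof (rule wd_chain[OF v(1) L2_L2l[OF v(2)] L2_L2l[OF v(3)], where B = "\<lambda>t. sin (d n * t) / d n" and B' = "\<lambda>t. cos (d n * t)" and K = 1 and M = "d n"])
        show "((\<lambda>t. sin (d n * t) / d n) has_real_derivative cos (d n * t)) (at t)" for t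
          using d[of n] by (auto intro!: derivative_eq_intros)
        show "\<bar>cos (d n * s) - cos (d n * t)\<bar> \<le> d n * \<bar>s - t\<bar>" for s t
        proof -
          have "norm (cos (d n * s) - cos (d n * t)) \<le> d n * norm (s - t)"
          proof (rule field_differentiable_bound[of UNIV "\<lambda>t. cos (d n * t)" "\<lambda>t. - sin (d n * t) * d n"])
            show "((\<lambda>t. cos (d n * t)) has_field_derivative - sin (d n * z) * d n) (at z within UNIV)" for z
              by (auto intro!: derivative_eq_intros)
            show "norm (- sin (d n * z) * d n) \<le> d n" for z
              using d[of n] abs_sin_le_one[of "d n * z"] by (simp add: abs_mult)
          qed auto
          then show ?thesis by simp
        qed
      qed auto
      then show ?thesis by (simp add: w_def[abs_def] Dw_def)
    qed
    obtain R where R: "R > 0" "\<And>x :: real ^ 'n. R < norm x \<Longrightarrow> cut n x = 0" "\<And>(x :: real ^ 'n) k. R < norm x \<Longrightarrow> partial k (cut n) x = 0"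
      using test_funE[OF test_fun_cut] by metis
    have bp: "bcs (p n)"
      unfolding bcs_def
    proof (intro conjI exI allI impI)
      show "p n \<in> borel_measurable borel" unfolding p_def by measurable
      show "\<bar>p n x\<bar> \<le> C * (1 / d n)" for x
        unfolding p_def abs_mult using C(1) by (intro mult_mono C wb) auto
      show "p n x = 0" if "R < norm x" for x using R(2)[OF that] by (simp add: p_def)
    qed
    have bcw: "bcs (\<lambda>x. w n x * partial k (cut n) x)" for k
      unfolding bcs_def
    proof (intro conjI exI allI impI)
      show "(\<lambda>x. w n x * partial k (cut n) x) \<in> borel_measurable borel" by measurable
      show "\<bar>w n x * partial k (cut n) x\<bar> \<le> 1 / d n * C" for x
        unfolding abs_mult using d[of n] by (intro mult_mono C3 wb) auto
      show "w n x * partial k (cut n) x = 0" if "R < norm x" for x using R(3)[OF that] by simp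
    qed
    have [measurable]: "p n \<in> borel_measurable borel" using bp by measurable
    have Lp: "L2l (p n)" using bp by (intro L2_L2l bcs_L2)
    have Dpk: "Dp n x $ k = w n x * partial k (cut n) x + cut n x * Dw n x $ k" for x k by (simp add: Dp_def)
    have LDp: "L2 (\<lambda>x. Dp n x $ k)" for k
      unfolding Dpk using L2l_mult_test[OF L2_L2l[OF LDw] tc(1)] by (intro L2_add bcs_L2[OF bcw]) (simp add: mult.commute)
    have wdp: "wd k (p n) (\<lambda>x. Dp n x $ k)" for k
      using wd_mult[OF wd_smooth[OF test_fun_smooth[OF tc(1)[of n]]] wdw[of k]] tc Lw LDw
      by (simp add: p_def[abs_def] Dpk mult.commute[of "w n _"] L2_L2l smooth_L2l test_fun_smooth)
    have bp2: "bcs (\<lambda>x. p n x * p n x)" by (intro bcs_mult bp)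
    have LpDp: "L2 (\<lambda>x. p n x * Dp n x $ k)" for k
      using L2l_bcs[OF L2_L2l[OF LDp] bp] by (simp add: mult.commute)
    have wdp2: "wd k (\<lambda>x. p n x * p n x) (\<lambda>x. 2 * (p n x * Dp n x $ k))" for k
      using wd_mult[OF wdp[of k] wdp[of k] Lp L2_L2l[OF LDp[of k]] Lp L2_L2l[OF LDp[of k]]] by (simp add: mult.commute)
    \<comment> \<open>The test function p^2 \<phi>. It is admissible because the truncated, cut-off
      weight \<open>p n\<close> is bounded with bounded support, whereas v^2 \<phi> need not be
      square integrable.\<close>
    define z where "z x = p n x * p n x * \<phi> x" for x
    define Dz where "Dz x = (p n x)^2 *\<^sub>R D\<phi> x + (2 * p n x * \<phi> x) *\<^sub>R Dp n x" for x
    have wdz: "wd k z (\<lambda>x. Dz x $ k)" for k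
    proof -
      have "wd k (\<lambda>x. p n x * p n x * \<phi> x) (\<lambda>x. 2 * (p n x * Dp n x $ k) * \<phi> x + p n x * p n x * D\<phi> x $ k)"
        by (intro wd_mult wdp2 \<phi> L2_L2l L2_cmult LpDp bcs_L2 bp2)
      then show ?thesis by (simp add: z_def[abs_def] Dz_def power2_eq_square algebra_simps)
    qed
    have Lz: "L2 z" unfolding z_def using L2l_bcs[OF \<phi>(2) bp2] by (simp add: mult_ac)
    have LDz: "L2 (\<lambda>x. Dz x $ k)" for k
    proof -
      have 1: "L2 (\<lambda>x. D\<phi> x $ k * (p n x * p n x))" by (intro L2l_bcs \<phi> bp2)
      have 2: "L2 (\<lambda>x. \<phi> x * (p n x * (w n x * partial k (cut n) x)))" by (intro L2l_bcs \<phi> bcs_mult bp bcw)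
      obtain B where B: "\<And>x. \<bar>p n x\<bar> \<le> B" using bp unfolding bcs_def by blast
      have B0: "B \<ge> 0" using B[of 0] by simp
      \<comment> \<open>The one term of the gradient of p^2 \<phi> where \<phi> meets the gradient
        of v, a product of two functions that are only square integrable near each point; its
        integrability is the hypothesis \<open>fin(2)\<close>.\<close>
      have 3: "L2 (\<lambda>x. \<phi> x * Dv x $ k * (p n x * (cut n x * cos (d n * v x))))"
      proof (rule L2_bounded_mult[OF fin(2), where B = "B * (C * 1)"])
        show "\<bar>p n x * (cut n x * cos (d n * v x))\<bar> \<le> B * (C * 1)" for x
          unfolding abs_mult using B0 C(1) by (intro mult_mono B C abs_cos_le_one) auto
      qed measurable
      have "Dz x $ k = D\<phi> x $ k * (p n x * p n x) + (2 * (\<phi> x * (p n x * (w n x * partial k (cut n) x)))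
          + 2 * (\<phi> x * Dv x $ k * (p n x * (cut n x * cos (d n * v x)))))" for x
        by (simp add: Dz_def Dpk Dw_def power2_eq_square algebra_simps)
      then show ?thesis using L2_add[OF 1 L2_add[OF L2_cmult[OF 2, of 2] L2_cmult[OF 3, of 2]]] by simp
    qed
    have z0: "z x = 0" "Dz x = 0" if "R < norm x" for x
      using R(2)[OF that] by (auto simp: z_def Dz_def p_def)
    have "(\<Sum>k\<in>UNIV. LBINT x. F k x * Dz x $ k) + (LBINT x. 0 * z x) = 0"
      by (rule wd_test_extend_cs[where R = R])
         (use LF div wdz Lz LDz z0 in \<open>auto simp: F_def[abs_def] L2_L2l L2_0\<close>)
    then have sum0: "(\<Sum>k\<in>UNIV. LBINT x. F k x * Dz x $ k) = 0" by simp
    have iFk: "integrable lborel (\<lambda>x. F k x * Dz x $ k)" for k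
      using L2l_cs_integrable[OF LF LDz, of R k k] z0 by (simp add: mult.commute)
    have iF: "integrable lborel (\<lambda>x. (A x *v (D\<phi> x + e)) \<bullet> Dz x)"
      using iFk by (simp add: inner_vec_def F_def)
    have I0: "(LBINT x. (A x *v (D\<phi> x + e)) \<bullet> Dz x) = 0"
      using sum0 iFk by (simp add: inner_vec_def F_def Bochner_Integration.integral_sum)
    have bnd: "AE x in lborel. lam / 2 * ((p n x)^2 * (norm (D\<phi> x))^2) \<le> (A x *v (D\<phi> x + e)) \<bullet> Dz x + K x"
      using elliptic_AE[OF A]
    proof eventually_elim
      case (elim x)
      have "lam / 2 * ((p n x)^2 * (norm (D\<phi> x))^2) - (1 / lam + 1) * (p n x)^2 - (4 / lam + 1) * ((\<phi> x)^2 * (norm (Dp n x))^2)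
        \<le> (A x *v (D\<phi> x + e)) \<bullet> Dz x"
        unfolding Dz_def by (rule caccioppoli_pointwise[OF lam _ _ e]) (use elim in auto)
      moreover have "(p n x)^2 \<le> C^2 * (v x)^2"
      proof -
        have "\<bar>p n x\<bar> \<le> C * \<bar>v x\<bar>" unfolding p_def abs_mult using C(1) by (intro mult_mono C wv) auto
        from power_mono[OF this, of 2] show ?thesis by (simp add: power_mult_distrib)
      qed
      moreover have "(\<phi> x)^2 * (norm (Dp n x))^2 \<le> 2 * C^2 * (real CARD('n) * (\<phi> x * v x)^2 + (\<Sum>k\<in>UNIV. (\<phi> x * Dv x $ k)^2))"
      proof -
        have "(\<phi> x)^2 * (Dp n x $ k)^2 \<le> 2 * C^2 * ((\<phi> x * v x)^2 + (\<phi> x * Dv x $ k)^2)" for k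
        proof -
          have "\<bar>w n x * partial k (cut n) x\<bar> \<le> \<bar>v x\<bar> * C" unfolding abs_mult by (intro mult_mono wv C3) auto
          from power_mono[OF this, of 2] have a: "(w n x * partial k (cut n) x)^2 \<le> C^2 * (v x)^2" by (simp add: power_mult_distrib mult.commute)
          have "\<bar>cut n x * Dw n x $ k\<bar> \<le> C * (1 * \<bar>Dv x $ k\<bar>)"
            unfolding abs_mult Dw_def vector_scaleR_component real_scaleR_def using C(1) by (intro mult_mono C abs_cos_le_one) auto
          from power_mono[OF this, of 2] have b: "(cut n x * Dw n x $ k)^2 \<le> C^2 * (Dv x $ k)^2" by (simp add: power_mult_distrib)
          have "(Dp n x $ k)^2 \<le> 2 * (w n x * partial k (cut n) x)^2 + 2 * (cut n x * Dw n x $ k)^2"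
            unfolding Dpk using sum_squares_bound[of "w n x * partial k (cut n) x" "cut n x * Dw n x $ k"] by (simp add: power2_sum)
          also have "\<dots> \<le> 2 * C^2 * ((v x)^2 + (Dv x $ k)^2)" using a b by (simp add: algebra_simps)
          finally have "(\<phi> x)^2 * (Dp n x $ k)^2 \<le> (\<phi> x)^2 * (2 * C^2 * ((v x)^2 + (Dv x $ k)^2))" by (rule mult_left_mono) simp
          then show ?thesis by (simp add: power_mult_distrib algebra_simps)
        qed
        then have "(\<Sum>k\<in>UNIV. (\<phi> x)^2 * (Dp n x $ k)^2) \<le> (\<Sum>k\<in>UNIV. 2 * C^2 * ((\<phi> x * v x)^2 + (\<phi> x * Dv x $ k)^2))"
          by (intro sum_mono)
        then show ?thesis by (simp add: norm2_vec sum_distrib_left sum.distrib distrib_left mult_ac)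
      qed
      ultimately show ?case
        using mult_left_mono[of "(p n x)^2" "C^2 * (v x)^2" "1 / lam + 1"]
          mult_left_mono[of "(\<phi> x)^2 * (norm (Dp n x))^2" "2 * C^2 * (real CARD('n) * (\<phi> x * v x)^2 + (\<Sum>k\<in>UNIV. (\<phi> x * Dv x $ k)^2))" "4 / lam + 1"] lam
        unfolding K_def by (smt (verit) divide_nonneg_pos)
    qed
    have "(LBINT\<^sup>+ x. ennreal ((p n x)^2 * (norm (D\<phi> x))^2))
      \<le> (LBINT\<^sup>+ x. ennreal (2 / lam * ((A x *v (D\<phi> x + e)) \<bullet> Dz x + K x)))"
      by (rule nn_integral_mono_AE) (use bnd in eventually_elim, use lam in \<open>auto intro!: ennreal_leI simp: field_simps\<close>)
    also have "\<dots> = ennreal (LBINT x. 2 / lam * ((A x *v (D\<phi> x + e)) \<bullet> Dz x + K x))"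
    proof (rule nn_integral_eq_integral)
      show "integrable lborel (\<lambda>x. 2 / lam * ((A x *v (D\<phi> x + e)) \<bullet> Dz x + K x))"
        using iF Ki by (intro integrable_mult_right Bochner_Integration.integrable_add)
      show "AE x in lborel. 0 \<le> 2 / lam * ((A x *v (D\<phi> x + e)) \<bullet> Dz x + K x)"
        using bnd
      proof eventually_elim
        case (elim x)
        have "0 \<le> lam / 2 * ((p n x)^2 * (norm (D\<phi> x))^2)" using lam by simp
        with elim have "0 \<le> (A x *v (D\<phi> x + e)) \<bullet> Dz x + K x" by linarith
        then show ?case using lam by simp
      qed
    qed
    also have "(LBINT x. 2 / lam * ((A x *v (D\<phi> x + e)) \<bullet> Dz x + K x)) = 2 / lam * (LBINT x. K x)"
      using iF Ki I0 by simp
    finally show ?thesis .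
  qed
  have plim: "(\<lambda>n. p n x) \<longlonglongrightarrow> v x" for x
  proof -
    have d0: "filterlim d (at 0) sequentially"
      using LIMSEQ_inverse_real_of_nat d by (auto simp: filterlim_at d_def[abs_def])
    have "((\<lambda>s. sin (s * v x)) has_real_derivative v x) (at 0)" by (auto intro!: derivative_eq_intros)
    then have "((\<lambda>s. sin (s * v x) / s) \<longlongrightarrow> v x) (at 0)" by (simp add: has_field_derivative_iff)
    from filterlim_compose[OF this d0] have "(\<lambda>n. w n x) \<longlonglongrightarrow> v x" unfolding w_def .
    then have "(\<lambda>n. cut n x * w n x) \<longlonglongrightarrow> 1 * v x" by (intro tendsto_mult cut_tendsto)
    then show ?thesis by (simp add: p_def)
  qed
  \<comment> \<open>The bounds \<open>key\<close> do not depend on n and the weights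
    \<open>p n\<close> converge pointwise to \<open>v\<close>, so Fatou's lemma removes both
    truncation and cutoff.\<close>
  have "(LBINT\<^sup>+ x. ennreal ((v x)^2 * (norm (D\<phi> x))^2)) = (LBINT\<^sup>+ x. liminf (\<lambda>n. ennreal ((p n x)^2 * (norm (D\<phi> x))^2)))"
  proof (rule nn_integral_cong)
    fix x
    have "(\<lambda>n. ennreal ((p n x)^2 * (norm (D\<phi> x))^2)) \<longlonglongrightarrow> ennreal ((v x)^2 * (norm (D\<phi> x))^2)"
      by (intro tendsto_ennrealI tendsto_intros plim)
    from lim_imp_Liminf[OF trivial_limit_sequentially this]
    show "ennreal ((v x)^2 * (norm (D\<phi> x))^2) = liminf (\<lambda>n. ennreal ((p n x)^2 * (norm (D\<phi> x))^2))" by (rule sym)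
  qed
  also have "\<dots> \<le> liminf (\<lambda>n. \<integral>\<^sup>+x. ennreal ((p n x)^2 * (norm (D\<phi> x))^2) \<partial>lborel)"
    by (rule nn_integral_liminf) (unfold p_def, measurable)
  also have "\<dots> \<le> ennreal (2 / lam * (LBINT x. K x))"
    by (rule Liminf_le) (use key in auto)
  also have "\<dots> < \<infinity>" by simp
  finally have "integrable lborel (\<lambda>x. (v x)^2 * (norm (D\<phi> x))^2)"
    by (simp add: integrable_iff_bounded abs_mult)
  then show ?thesis
  proof (rule L2_bound[rotated])
    fix x
    have "(D\<phi> x $ k)^2 \<le> (norm (D\<phi> x))^2" using power_mono[OF component_le_norm_cart[of "D\<phi> x" k], of 2] by simp
    then show "(v x * D\<phi> x $ k)^2 \<le> (v x)^2 * (norm (D\<phi> x))^2" by (simp add: power_mult_distrib mult_left_mono)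
  qed measurable
qed

subsection \<open>The two-scale expansion\<close>

text \<open>Convolution moves both derivatives onto the mollifier, whose second partial derivatives
  commute by computation. Equality almost everywhere suffices, as it is used only under
  integrals.\<close>

lemma test_fun_partial_commute_AE:
  fixes \<psi> :: "real ^ 'n::finite \<Rightarrow> real"
  assumes t: "test_fun \<psi>"
  shows "AE x in lborel. partial l (partial k \<psi>) x = partial k (partial l \<psi>) x"
proof -
  have tp: "test_fun (partial k \<psi>)" "test_fun (partial l (partial k \<psi>))" for k l using t by (auto intro: test_fun_partial)
  have L: "L1l f" if "test_fun f" for f :: "real ^ 'n \<Rightarrow> real" using that by (intro L2l_L1l smooth_L2l test_fun_smooth)
  have tm: "test_fun (moll n :: real ^ 'n \<Rightarrow> real)" "test_fun (partial k (moll n) :: real ^ 'n \<Rightarrow> real)" for n k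
    by (auto intro: test_fun_moll test_fun_partial)
  have c: "conv (partial l (partial k \<psi>)) (moll n) x = conv \<psi> (partial l (partial k (moll n))) x" for n x k l
  proof -
    have "conv (partial k \<psi>) (moll n) = partial k (conv \<psi> (moll n))"
      by (rule ext) (rule wd_conv[OF wd_smooth[OF test_fun_smooth[OF t]] tm(1), symmetric])
    also have "\<dots> = conv \<psi> (partial k (moll n))" by (rule partial_conv[OF L[OF t] tm(1)])
    finally have "partial l (conv (partial k \<psi>) (moll n)) = conv \<psi> (partial l (partial k (moll n)))"
      by (simp add: partial_conv[OF L[OF t] tm(2)])
    then show ?thesis
      using wd_conv[OF wd_smooth[OF test_fun_smooth[OF tp(1)[of k]], of l] tm(1)[of n], of x] by simp
  qed
  have "AE x in lborel. partial l (partial k \<psi>) x - partial k (partial l \<psi>) x = 0"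
  proof (rule AE_eq_0_if_conv_eq_0[OF _ kern_moll moll_radius])
    show "L1l (\<lambda>x. partial l (partial k \<psi>) x - partial k (partial l \<psi>) x)" by (intro L1l_diff L tp)
    show "conv (\<lambda>x. partial l (partial k \<psi>) x - partial k (partial l \<psi>) x) (moll n) x = 0" for n x
      by (subst conv_diff[OF L[OF tp(2)] L[OF tp(2)] test_fun_bcs[OF tm(1)]])
         (simp add: c moll_partial_sym[of l k])
  qed
  then show ?thesis by simp
qed

text \<open>One fixed realization after rescaling: the factor \<epsilon> is absorbed into \<Phi> and
  S, whose gradients then carry no power of \<epsilon>, and all data are Borel representatives.
  \<open>H\<close> is the Hessian of \<open>u0\<close>. The rest of the argument is
  deterministic.\<close>

locale two_scale =
  fixes lam \<alpha> :: real and A :: "real ^ 'n::finite \<Rightarrow> real ^ 'n ^ 'n" and Ah :: "real ^ 'n ^ 'n"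
    and \<Phi> :: "'n \<Rightarrow> real ^ 'n \<Rightarrow> real" and D\<Phi> :: "'n \<Rightarrow> real ^ 'n \<Rightarrow> real ^ 'n"
    and S :: "'n \<Rightarrow> 'n \<Rightarrow> 'n \<Rightarrow> real ^ 'n \<Rightarrow> real" and DS :: "'n \<Rightarrow> 'n \<Rightarrow> 'n \<Rightarrow> real ^ 'n \<Rightarrow> real ^ 'n"
    and f u u0 :: "real ^ 'n \<Rightarrow> real" and Du Du0 :: "real ^ 'n \<Rightarrow> real ^ 'n" and H :: "real ^ 'n \<Rightarrow> real ^ 'n ^ 'n"
  assumes lam: "lam > 0" and \<alpha>: "\<alpha> > 0" and A: "elliptic lam A"
    and \<Phi>: "wd k (\<Phi> i) (\<lambda>x. D\<Phi> i x $ k)" "L2l (\<Phi> i)" "L2l (\<lambda>x. D\<Phi> i x $ k)"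
    and S: "wd k (S i j l) (\<lambda>x. DS i j l x $ k)" "L2l (S i j l)" "L2l (\<lambda>x. DS i j l x $ k)"
    and div: "test_fun \<psi> \<Longrightarrow> (\<Sum>k\<in>UNIV. LBINT x. (A x *v (D\<Phi> i x + axis i 1)) $ k * partial k \<psi> x) = 0"
    and skew: "AE x in lborel. S i j k x = - S i k j x"
    and divS: "AE x in lborel. (\<Sum>k\<in>UNIV. DS i j k x $ k) = (A x *v (D\<Phi> i x + axis i 1) - Ah *v axis i 1) $ j"
    and u: "wd k u (\<lambda>x. Du x $ k)" "L2 u" "L2 (\<lambda>x. Du x $ k)"
    and u0: "wd k u0 (\<lambda>x. Du0 x $ k)" "L2 u0" "L2 (\<lambda>x. Du0 x $ k)"
    and H: "wd k (\<lambda>x. Du0 x $ i) (\<lambda>x. H x $ i $ k)" "L2 (\<lambda>x. H x $ i $ k)"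
    and equ: "test_fun \<psi> \<Longrightarrow> \<alpha> * (LBINT x. u x * \<psi> x) + (\<Sum>k\<in>UNIV. LBINT x. (A x *v Du x) $ k * partial k \<psi> x)
      = (LBINT x. f x * \<psi> x)"
    and equ0: "test_fun \<psi> \<Longrightarrow> \<alpha> * (LBINT x. u0 x * \<psi> x) + (\<Sum>k\<in>UNIV. LBINT x. (Ah *v Du0 x) $ k * partial k \<psi> x)
      = (LBINT x. f x * \<psi> x)"
begin

definition Z :: "real ^ 'n \<Rightarrow> real" where
  "Z x = u x - (u0 x + (\<Sum>i\<in>UNIV. \<Phi> i x * Du0 x $ i))"

definition DZ :: "real ^ 'n \<Rightarrow> real ^ 'n" where
  "DZ x = Du x - (Du0 x + (\<Sum>i\<in>UNIV. Du0 x $ i *\<^sub>R D\<Phi> i x + \<Phi> i x *\<^sub>R H x $ i))"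

text \<open>The field whose divergence is the right-hand side of the equation for the error: up to
  sign conventions, (\<Phi> a - S) applied to the Hessian of \<open>u0\<close>.\<close>

definition T :: "real ^ 'n \<Rightarrow> real ^ 'n" where
  "T x = (\<chi> k. \<Sum>i\<in>UNIV. \<Sum>l\<in>UNIV. S i k l x * H x $ i $ l) - (\<Sum>i\<in>UNIV. \<Phi> i x *\<^sub>R (A x *v (H x $ i)))"

lemma [measurable]:
  shows "A \<in> borel_measurable borel" "\<Phi> i \<in> borel_measurable borel" "D\<Phi> i \<in> borel_measurable borel"
    "S i j k \<in> borel_measurable borel" "u \<in> borel_measurable borel" "u0 \<in> borel_measurable borel"
    "Du \<in> borel_measurable borel" "Du0 \<in> borel_measurable borel"
    "(\<lambda>x. H x $ i) \<in> borel_measurable borel" "(\<lambda>x. H x $ i $ k) \<in> borel_measurable borel"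
  using A \<Phi> S u u0 H by (auto intro!: borel_measurable_vecI intro: elliptic_borel L2l_borel L2_borel)

lemma DZ_nth: "DZ x $ k = Du x $ k - (Du0 x $ k + (\<Sum>i\<in>UNIV. D\<Phi> i x $ k * Du0 x $ i + \<Phi> i x * H x $ i $ k))"
  by (simp add: DZ_def mult.commute)

lemma wd_Z: "wd k Z (\<lambda>x. DZ x $ k)"
  unfolding Z_def[abs_def] DZ_nth
  by (intro wd_diff wd_add wd_sum wd_mult u u0 \<Phi> H L2_L2l)

text \<open>Writing each corrector flux as the divergence of S, by \<open>divS\<close>, leaves a
  last sum that is the derivative in direction l of S_ikl \<partial>_i u_0. This is the form in
  which skew symmetry can act.\<close>

lemma DZ_flux: "AE x in lborel. \<forall>k. (A x *v DZ x - T x) $ k = (A x *v Du x) $ k - (Ah *v Du0 x) $ k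
    - (\<Sum>i\<in>UNIV. \<Sum>l\<in>UNIV. DS i k l x $ l * Du0 x $ i + S i k l x * H x $ i $ l)"
proof -
  have "AE x in lborel. \<forall>i\<in>UNIV. \<forall>j\<in>UNIV. (\<Sum>k\<in>UNIV. DS i j k x $ k) = (A x *v (D\<Phi> i x + axis i 1) - Ah *v axis i 1) $ j"
    using divS by (intro AE_finite_allI) auto
  then show ?thesis
  proof eventually_elim
    case (elim x)
    have exp: "(M *v y) $ k = (\<Sum>i\<in>UNIV. y $ i * (M *v axis i 1) $ k)" for M :: "real ^ 'n ^ 'n" and y k
      by (simp add: matrix_vector_mult_basis column_def) (simp add: matrix_vector_mult_def mult.commute)
    have lin: "A x *v (\<Sum>i\<in>UNIV. c i *\<^sub>R w i) = (\<Sum>i\<in>UNIV. c i *\<^sub>R (A x *v w i))" for c and w :: "'n \<Rightarrow> real ^ 'n"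
      by (simp add: linear_sum[OF matrix_vector_mul_linear] linear_cmul[OF matrix_vector_mul_linear] o_def)
    have d: "A x *v DZ x = A x *v Du x - A x *v Du0 x - (\<Sum>i\<in>UNIV. Du0 x $ i *\<^sub>R (A x *v D\<Phi> i x)) - (\<Sum>i\<in>UNIV. \<Phi> i x *\<^sub>R (A x *v (H x $ i)))"
      unfolding DZ_def by (simp add: matrix_vector_mult_diff_distrib matrix_vector_right_distrib sum.distrib lin)
    show ?case
    proof
      fix k
      have "(\<Sum>i\<in>UNIV. \<Sum>l\<in>UNIV. DS i k l x $ l * Du0 x $ i)
        = (\<Sum>i\<in>UNIV. Du0 x $ i * (A x *v (D\<Phi> i x + axis i 1) - Ah *v axis i 1) $ k)"
      proof (rule sum.cong[OF refl])
        fix i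
        have s: "(\<Sum>l\<in>UNIV. DS i k l x $ l) = (A x *v (D\<Phi> i x + axis i 1) - Ah *v axis i 1) $ k" using elim by blast
        show "(\<Sum>l\<in>UNIV. DS i k l x $ l * Du0 x $ i) = Du0 x $ i * (A x *v (D\<Phi> i x + axis i 1) - Ah *v axis i 1) $ k"
          unfolding s[symmetric] by (simp add: sum_distrib_left mult.commute)
      qed
      also have "\<dots> = (\<Sum>i\<in>UNIV. Du0 x $ i * (A x *v D\<Phi> i x) $ k) + (A x *v Du0 x) $ k - (Ah *v Du0 x) $ k"
        unfolding exp[of "A x" "Du0 x"] exp[of Ah "Du0 x"]
        by (simp add: matrix_vector_right_distrib algebra_simps sum.distrib sum_subtractf)
      finally show "(A x *v DZ x - T x) $ k = (A x *v Du x) $ k - (Ah *v Du0 x) $ k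
        - (\<Sum>i\<in>UNIV. \<Sum>l\<in>UNIV. DS i k l x $ l * Du0 x $ i + S i k l x * H x $ i $ l)"
        unfolding d by (simp add: T_def sum.distrib)
    qed
  qed
qed

text \<open>A skew matrix is contracted with a symmetric one: exchanging the summation indices shows
  that the sum equals its own negative.\<close>

lemma sum_skew_eq_0:
  assumes t: "test_fun \<psi>"
  shows "(\<Sum>k\<in>UNIV. \<Sum>l\<in>UNIV. LBINT x. S i k l x * Du0 x $ i * partial l (partial k \<psi>) x) = 0"
proof -
  define a where "a k l = (LBINT x. S i k l x * Du0 x $ i * partial l (partial k \<psi>) x)" for k l
  have [measurable]: "partial l (partial k \<psi>) \<in> borel_measurable borel" for k l
    using t by (intro test_fun_borel test_fun_partial)
  have anti: "a k l = - a l k" for k l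
  proof -
    have "a k l = (LBINT x. - (S i l k x * Du0 x $ i * partial k (partial l \<psi>) x))"
      unfolding a_def
    proof (rule integral_cong_AE)
      show "AE x in lborel. S i k l x * Du0 x $ i * partial l (partial k \<psi>) x = - (S i l k x * Du0 x $ i * partial k (partial l \<psi>) x)"
        using skew[of i k l] test_fun_partial_commute_AE[OF t, of l k] by eventually_elim simp
    qed measurable
    then show ?thesis unfolding a_def by simp
  qed
  have "(\<Sum>k\<in>UNIV. \<Sum>l\<in>UNIV. a k l) = (\<Sum>k\<in>UNIV. \<Sum>l\<in>UNIV. - a l k)"
    by (intro sum.cong refl anti)
  also have "\<dots> = - (\<Sum>k\<in>UNIV. \<Sum>l\<in>UNIV. a k l)"
    by (subst sum.swap) (simp add: sum_negf)
  finally show ?thesis unfolding a_def by simp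
qed

text \<open>Local square integrability of the correctors is enough here, since the test function has
  compact support; finiteness of the right-hand side enters only when \<open>Z\<close> itself is
  inserted.\<close>

lemma weak_Z:
  assumes t: "test_fun \<psi>"
  shows "(\<Sum>k\<in>UNIV. LBINT x. (A x *v DZ x - T x) $ k * partial k \<psi> x) + (LBINT x. \<alpha> * (u x - u0 x) * \<psi> x) = 0"
proof -
  have tp: "test_fun (partial k \<psi>)" for k using t by (rule test_fun_partial)
  have [measurable]: "partial k \<psi> \<in> borel_measurable borel" for k using tp by (rule test_fun_borel)
  define W where "W i k l x = DS i k l x $ l * Du0 x $ i + S i k l x * H x $ i $ l" for i k l x
  have wdW: "wd l (\<lambda>x. S i k l x * Du0 x $ i) (W i k l)" for i k l
    unfolding W_def[abs_def] by (intro wd_mult S u0 H L2_L2l)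
  have LW: "L1l (W i k l)" for i k l using wdW by (simp add: wd_def)
  have [measurable]: "W i k l \<in> borel_measurable borel" for i k l using LW by (rule L1l_borel)
  have LAh: "L2 (\<lambda>x. (Ah *v Du0 x) $ k)" for k
    unfolding matrix_vector_mult_def by (simp add: L2_sum L2_cmult u0)
  have i1: "integrable lborel (\<lambda>x. (A x *v Du x) $ k * partial k \<psi> x)"
    "integrable lborel (\<lambda>x. (Ah *v Du0 x) $ k * partial k \<psi> x)"
    "integrable lborel (\<lambda>x. W i k l x * partial k \<psi> x)" for i k l
    by (intro L1l_test_integrable tp L2l_L1l L2_L2l elliptic_L2[OF A] u LAh LW)+
  have k: "(LBINT x. (A x *v DZ x - T x) $ k * partial k \<psi> x)
    = (LBINT x. (A x *v Du x) $ k * partial k \<psi> x) - (LBINT x. (Ah *v Du0 x) $ k * partial k \<psi> x)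
      + (\<Sum>i\<in>UNIV. \<Sum>l\<in>UNIV. LBINT x. S i k l x * Du0 x $ i * partial l (partial k \<psi>) x)" for k
  proof -
    have [measurable]: "T \<in> borel_measurable borel"
      unfolding T_def by (intro borel_measurable_vecI) simp
    have [measurable]: "DZ \<in> borel_measurable borel"
      unfolding DZ_def by measurable
    have "(LBINT x. (A x *v DZ x - T x) $ k * partial k \<psi> x)
      = (LBINT x. (A x *v Du x) $ k * partial k \<psi> x - (Ah *v Du0 x) $ k * partial k \<psi> x
         - (\<Sum>i\<in>UNIV. \<Sum>l\<in>UNIV. W i k l x * partial k \<psi> x))"
    proof (rule integral_cong_AE)
      show "AE x in lborel. (A x *v DZ x - T x) $ k * partial k \<psi> x = (A x *v Du x) $ k * partial k \<psi> x - (Ah *v Du0 x) $ k * partial k \<psi> x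
         - (\<Sum>i\<in>UNIV. \<Sum>l\<in>UNIV. W i k l x * partial k \<psi> x)"
        using DZ_flux
      proof eventually_elim
        case (elim x)
        show ?case unfolding elim[rule_format, of k] W_def by (simp add: left_diff_distrib sum_distrib_right)
      qed
    next
      have [measurable]: "(\<lambda>x. (A x *v DZ x - T x) $ k) \<in> borel_measurable borel"
        "(\<lambda>x. (A x *v Du x) $ k) \<in> borel_measurable borel" "(\<lambda>x. (Ah *v Du0 x) $ k) \<in> borel_measurable borel"
        by (intro borel_measurable_nth borel_measurable_diff borel_measurable_matrix_vector_mult borel_measurable_const; measurable)+
      show "(\<lambda>x. (A x *v DZ x - T x) $ k * partial k \<psi> x) \<in> borel_measurable lborel"
        "(\<lambda>x. (A x *v Du x) $ k * partial k \<psi> x - (Ah *v Du0 x) $ k * partial k \<psi> x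
         - (\<Sum>i\<in>UNIV. \<Sum>l\<in>UNIV. W i k l x * partial k \<psi> x)) \<in> borel_measurable lborel"
        by measurable
    qed
    also have "\<dots> = (LBINT x. (A x *v Du x) $ k * partial k \<psi> x) - (LBINT x. (Ah *v Du0 x) $ k * partial k \<psi> x)
      - (\<Sum>i\<in>UNIV. \<Sum>l\<in>UNIV. LBINT x. W i k l x * partial k \<psi> x)"
      using i1 by (simp add: Bochner_Integration.integral_sum)
    finally have *: "(LBINT x. (A x *v DZ x - T x) $ k * partial k \<psi> x)
      = (LBINT x. (A x *v Du x) $ k * partial k \<psi> x) - (LBINT x. (Ah *v Du0 x) $ k * partial k \<psi> x)
      - (\<Sum>i\<in>UNIV. \<Sum>l\<in>UNIV. LBINT x. W i k l x * partial k \<psi> x)" .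
    \<comment> \<open>A partial derivative of the test function is again a test function, so the
      derivative in direction l can be moved onto it.\<close>
    have W: "(LBINT x. W i k l x * partial k \<psi> x) = - (LBINT x. S i k l x * Du0 x $ i * partial l (partial k \<psi>) x)" for i l
      using wdD[OF wdW[where l = l and i = i and k = k] tp[of k]] by simp
    show ?thesis unfolding * W by (simp add: sum_negf)
  qed
  have "(\<Sum>k\<in>UNIV. \<Sum>i\<in>UNIV. \<Sum>l\<in>UNIV. LBINT x. S i k l x * Du0 x $ i * partial l (partial k \<psi>) x) = 0"
    by (subst sum.swap) (simp add: sum_skew_eq_0[OF t])
  then have "(\<Sum>k\<in>UNIV. LBINT x. (A x *v DZ x - T x) $ k * partial k \<psi> x)
    = (\<Sum>k\<in>UNIV. LBINT x. (A x *v Du x) $ k * partial k \<psi> x) - (\<Sum>k\<in>UNIV. LBINT x. (Ah *v Du0 x) $ k * partial k \<psi> x)"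
    unfolding k by (simp add: sum.distrib sum_subtractf)
  moreover have "(LBINT x. \<alpha> * (u x - u0 x) * \<psi> x) = \<alpha> * (LBINT x. u x * \<psi> x) - \<alpha> * (LBINT x. u0 x * \<psi> x)"
  proof -
    have "integrable lborel (\<lambda>x. u x * \<psi> x)" "integrable lborel (\<lambda>x. u0 x * \<psi> x)"
      by (intro L1l_test_integrable t L2l_L1l L2_L2l u u0)+
    then show ?thesis by (simp add: left_diff_distrib right_diff_distrib mult.assoc)
  qed
  ultimately show ?thesis using equ[OF t] equ0[OF t] by linarith
qed

section \<open>The energy estimate for the two-scale error\<close>

definition X1 :: "real ^ 'n \<Rightarrow> real" where
  "X1 x = (\<Sum>i\<in>UNIV. (\<Phi> i x)^2) * (norm (Du0 x))^2"

definition X2 :: "real ^ 'n \<Rightarrow> real" where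
  "X2 x = ((\<Sum>i\<in>UNIV. \<Sum>j\<in>UNIV. \<Sum>k\<in>UNIV. (S i j k x)^2) + (norm (A x))^2 * (\<Sum>i\<in>UNIV. (\<Phi> i x)^2)) * (norm (H x))^2"

lemma [measurable]: "X1 \<in> borel_measurable borel" "X2 \<in> borel_measurable borel" "T \<in> borel_measurable borel" "DZ \<in> borel_measurable borel" "Z \<in> borel_measurable borel"
proof -
  have [measurable]: "(\<lambda>x. (norm (H x))^2) \<in> borel_measurable borel" unfolding norm2_vec by measurable
  show "X1 \<in> borel_measurable borel" "X2 \<in> borel_measurable borel" unfolding X1_def X2_def by measurable
  show "T \<in> borel_measurable borel" unfolding T_def by (intro borel_measurable_vecI) simp
  show "DZ \<in> borel_measurable borel" unfolding DZ_def by measurable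
  show "Z \<in> borel_measurable borel" unfolding Z_def by measurable
qed

lemma sum_mult_le:
  fixes a b :: "'i \<Rightarrow> real"
  shows "(\<Sum>i\<in>I. a i * b i)^2 \<le> (\<Sum>i\<in>I. (a i)^2) * (\<Sum>i\<in>I. (b i)^2)"
  by (rule Cauchy_Schwarz_ineq_sum)

lemma corr_le: "(\<Sum>i\<in>UNIV. \<Phi> i x * Du0 x $ i)^2 \<le> X1 x"
  using sum_mult_le[of "\<lambda>i. \<Phi> i x" "\<lambda>i. Du0 x $ i" UNIV] by (simp add: X1_def norm2_vec)

text \<open>Cauchy-Schwarz over the pairs (i, l) for the S-part and over i for the \<Phi>-part. The
  factor 2 comes from squaring a difference of two terms.\<close>

lemma T_le: "(norm (T x))^2 \<le> 2 * X2 x"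
proof -
  define a b where "a = (\<chi> k. \<Sum>i\<in>UNIV. \<Sum>l\<in>UNIV. S i k l x * H x $ i $ l)" and "b = (\<Sum>i\<in>UNIV. \<Phi> i x *\<^sub>R (A x *v (H x $ i)))"
  have nH: "(norm (H x))^2 = (\<Sum>i\<in>UNIV. \<Sum>l\<in>UNIV. (H x $ i $ l)^2)" by (simp add: norm2_vec)
  have "(a $ k)^2 \<le> (\<Sum>i\<in>UNIV. \<Sum>l\<in>UNIV. (S i k l x)^2) * (norm (H x))^2" for k
  proof -
    have "a $ k = (\<Sum>(i, l)\<in>UNIV. S i k l x * H x $ i $ l)" by (simp add: a_def sum.cartesian_product)
    then have "(a $ k)^2 \<le> (\<Sum>z\<in>UNIV. (S (fst z) k (snd z) x)^2) * (\<Sum>z\<in>UNIV. (H x $ fst z $ snd z)^2)"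
      using sum_mult_le[of "\<lambda>z. S (fst z) k (snd z) x" "\<lambda>z. H x $ fst z $ snd z" UNIV] by (simp add: split_beta)
    also have "\<dots> = (\<Sum>i\<in>UNIV. \<Sum>l\<in>UNIV. (S i k l x)^2) * (norm (H x))^2"
      by (simp add: nH sum.cartesian_product split_beta)
    finally show ?thesis .
  qed
  then have "(\<Sum>k\<in>UNIV. (a $ k)^2) \<le> (\<Sum>k\<in>UNIV. (\<Sum>i\<in>UNIV. \<Sum>l\<in>UNIV. (S i k l x)^2) * (norm (H x))^2)" by (intro sum_mono)
  also have "\<dots> = (\<Sum>i\<in>UNIV. \<Sum>j\<in>UNIV. \<Sum>k\<in>UNIV. (S i j k x)^2) * (norm (H x))^2"
    by (subst sum_distrib_right[symmetric], subst sum.swap) simp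
  finally have a: "(norm a)^2 \<le> (\<Sum>i\<in>UNIV. \<Sum>j\<in>UNIV. \<Sum>k\<in>UNIV. (S i j k x)^2) * (norm (H x))^2" by (simp add: norm2_vec)
  have "norm b \<le> (\<Sum>i\<in>UNIV. \<bar>\<Phi> i x\<bar> * norm (A x *v (H x $ i)))"
    unfolding b_def by (rule order_trans[OF norm_sum]) simp
  then have "(norm b)^2 \<le> (\<Sum>i\<in>UNIV. \<bar>\<Phi> i x\<bar> * norm (A x *v (H x $ i)))^2" by (intro power_mono) auto
  also have "\<dots> \<le> (\<Sum>i\<in>UNIV. (\<Phi> i x)^2) * (\<Sum>i\<in>UNIV. (norm (A x *v (H x $ i)))^2)"
    using sum_mult_le[of "\<lambda>i. \<bar>\<Phi> i x\<bar>" "\<lambda>i. norm (A x *v (H x $ i))" UNIV] by simp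
  also have "\<dots> \<le> (\<Sum>i\<in>UNIV. (\<Phi> i x)^2) * (\<Sum>i\<in>UNIV. (norm (A x))^2 * (norm (H x $ i))^2)"
    by (intro mult_left_mono sum_mono norm_matrix_vector_le) (auto intro: sum_nonneg)
  also have "\<dots> = (norm (A x))^2 * (\<Sum>i\<in>UNIV. (\<Phi> i x)^2) * (norm (H x))^2"
  proof -
    have "(\<Sum>i\<in>UNIV. (norm (A x))^2 * (norm (H x $ i))^2) = (norm (A x))^2 * (norm (H x))^2"
      by (simp add: norm2_vec[of "H x"] sum_distrib_left)
    then show ?thesis by simp
  qed
  finally have b: "(norm b)^2 \<le> (norm (A x))^2 * (\<Sum>i\<in>UNIV. (\<Phi> i x)^2) * (norm (H x))^2" .
  have "(norm (a - b))^2 \<le> (norm a + norm b)^2" by (intro power_mono norm_triangle_ineq4) auto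
  also have "\<dots> \<le> 2 * (norm a)^2 + 2 * (norm b)^2" using sum_squares_bound[of "norm a" "norm b"] by (simp add: power2_sum)
  also have "\<dots> \<le> 2 * X2 x" using a b by (simp add: X2_def distrib_right)
  finally show ?thesis by (simp add: T_def a_def b_def)
qed

text \<open>The majorant \<open>X2\<close> contains \<Phi> only together with |A|, while the
  gradient of \<open>Z\<close> contains \<Phi> H alone. Ellipticity, applied to a unit vector, gives
  |A| \<ge> lam and removes the factor.\<close>

lemma \<Phi>H_le: "AE x in lborel. (\<Phi> i x * H x $ i $ k)^2 \<le> 1 / lam^2 * X2 x"
  using elliptic_AE[OF A]
proof eventually_elim
  case (elim x)
  have "lam * (norm (axis k (1::real) :: real ^ 'n))^2 \<le> axis k 1 \<bullet> (A x *v axis k 1)" using elim by blast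
  also have "\<dots> \<le> norm (axis k (1::real) :: real ^ 'n) * norm (A x *v axis k 1)" by (rule norm_cauchy_schwarz)
  finally have "lam \<le> norm (A x *v axis k 1)" by (simp add: norm_axis_1)
  then have "lam^2 \<le> (norm (A x *v axis k 1))^2" using lam by (intro power_mono) auto
  also have "\<dots> \<le> (norm (A x))^2" using norm_matrix_vector_le[of "A x" "axis k 1"] by (simp add: norm_axis_1)
  finally have l: "lam^2 \<le> (norm (A x))^2" .
  have p: "(\<Phi> i x)^2 \<le> (\<Sum>i\<in>UNIV. (\<Phi> i x)^2)" using member_le_sum[of i UNIV "\<lambda>i. (\<Phi> i x)^2"] by simp
  have h: "(H x $ i $ k)^2 \<le> (norm (H x))^2"
    using Finite_Cartesian_Product.norm_nth_le[of "H x" i] Finite_Cartesian_Product.norm_nth_le[of "H x $ i" k] power_mono[of "\<bar>H x $ i $ k\<bar>" "norm (H x)" 2] by simp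
  have "lam^2 * (\<Phi> i x * H x $ i $ k)^2 = (lam^2 * (\<Phi> i x)^2) * (H x $ i $ k)^2" by (simp add: power_mult_distrib)
  also have "\<dots> \<le> ((norm (A x))^2 * (\<Sum>i\<in>UNIV. (\<Phi> i x)^2)) * (norm (H x))^2"
    using l p h by (intro mult_mono mult_nonneg_nonneg sum_nonneg) auto
  also have "\<dots> \<le> X2 x" unfolding X2_def by (intro mult_right_mono) (auto intro!: sum_nonneg)
  finally show ?case using lam by (simp add: field_simps)
qed

text \<open>Finiteness makes every part of \<open>Z\<close> and of its gradient square integrable;
  then \<open>Z\<close> may be inserted in its own equation and Young's inequality finishes.\<close>

lemma energy_finite:
  assumes i1: "integrable lborel X1" and i2: "integrable lborel X2"
  shows "L2 Z" "\<And>k. L2 (\<lambda>x. DZ x $ k)"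
    "\<alpha> * (LBINT x. (Z x)^2) + lam * (LBINT x. (norm (DZ x))^2)
      \<le> \<alpha> * (LBINT x. X1 x) + 2 / lam * (LBINT x. X2 x)"
proof -
  have Lc: "L2 (\<lambda>x. \<Sum>i\<in>UNIV. \<Phi> i x * Du0 x $ i)"
    by (rule L2_bound[OF _ i1 corr_le]) measurable
  have L\<Phi>u: "L2 (\<lambda>x. \<Phi> i x * Du0 x $ j)" for i j
  proof (rule L2_bound[OF _ i1])
    fix x
    have "(\<Phi> i x)^2 \<le> (\<Sum>i\<in>UNIV. (\<Phi> i x)^2)" using member_le_sum[of i UNIV "\<lambda>i. (\<Phi> i x)^2"] by simp
    moreover have "(Du0 x $ j)^2 \<le> (norm (Du0 x))^2" using power_mono[OF component_le_norm_cart[of "Du0 x" j], of 2] by simp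
    ultimately show "(\<Phi> i x * Du0 x $ j)^2 \<le> X1 x"
      unfolding X1_def power_mult_distrib by (intro mult_mono) (auto intro: sum_nonneg)
  qed measurable
  have L\<Phi>H: "L2 (\<lambda>x. \<Phi> i x * H x $ i $ k)" for i k
    by (rule L2_bound_AE[OF _ integrable_mult_right[OF i2] \<Phi>H_le]) measurable
  \<comment> \<open>The term that \<open>X1\<close> and \<open>X2\<close> do not bound directly. It
    is obtained from the corrector equation with weight v = \<partial>_i u_0.\<close>
  have LD: "L2 (\<lambda>x. Du0 x $ i * D\<Phi> i x $ k)" for i k
    by (rule caccioppoli[OF lam A _ \<Phi>(1) \<Phi>(2) \<Phi>(3) div[of _ i] H(1)[of _ i] u0(3)[of i] H(2)[of i] L\<Phi>u L\<Phi>H])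
       (auto simp: norm_axis_1)
  show LZ: "L2 Z" unfolding Z_def[abs_def] by (intro L2_diff L2_add u u0 Lc)
  show LDZ: "L2 (\<lambda>x. DZ x $ k)" for k
    unfolding DZ_nth by (intro L2_diff L2_add L2_sum u u0 L\<Phi>H) (simp add: mult.commute LD)
  have LT: "L2 (\<lambda>x. T x $ k)" for k
  proof (rule L2_bound[OF _ integrable_mult_right[OF i2, of 2]])
    show "(T x $ k)^2 \<le> 2 * X2 x" for x
      using T_le[of x] power_mono[OF component_le_norm_cart[of "T x" k], of 2] by simp
  qed measurable
  have LF: "L2 (\<lambda>x. (A x *v DZ x - T x) $ k)" for k
    using L2_diff[OF elliptic_L2[OF A LDZ] LT] by simp
  have Lg: "L2 (\<lambda>x. \<alpha> * (u x - u0 x))" by (intro L2_cmult L2_diff u u0)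
  have eq: "(\<Sum>k\<in>UNIV. LBINT x. (A x *v DZ x - T x) $ k * DZ x $ k) + (LBINT x. \<alpha> * (u x - u0 x) * Z x) = 0"
    by (rule wd_test_extend[OF LF Lg weak_Z wd_Z LZ LDZ])
  have iF: "integrable lborel (\<lambda>x. (A x *v DZ x - T x) \<bullet> DZ x)" "integrable lborel (\<lambda>x. \<alpha> * (u x - u0 x) * Z x)"
    unfolding inner_vec_def inner_real_def by (intro Bochner_Integration.integrable_sum L2_mult_integrable LF LDZ Lg LZ)+
  have I0: "(LBINT x. (A x *v DZ x - T x) \<bullet> DZ x + \<alpha> * (u x - u0 x) * Z x) = 0"
  proof -
    have "(LBINT x. (A x *v DZ x - T x) \<bullet> DZ x) = (\<Sum>k\<in>UNIV. LBINT x. (A x *v DZ x - T x) $ k * DZ x $ k)"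
      unfolding inner_vec_def inner_real_def by (intro Bochner_Integration.integral_sum L2_mult_integrable LF LDZ)
    then show ?thesis using eq iF by simp
  qed
  have iZ: "integrable lborel (\<lambda>x. (Z x)^2)" "integrable lborel (\<lambda>x. (norm (DZ x))^2)"
    using LZ L2_norm[OF LDZ] by (auto simp: L2_def)
  \<comment> \<open>Twice the tested identity is added: one copy of the ellipticity and of \<alpha>
    Z^2 survives on the left, the other absorbs the products of \<open>T\<close> with the gradient
    of \<open>Z\<close> and of the correction term with \<open>Z\<close>.\<close>
  have pt: "AE x in lborel. \<alpha> * (Z x)^2 + lam * (norm (DZ x))^2
     \<le> \<alpha> * X1 x + 2 / lam * X2 x + 2 * ((A x *v DZ x - T x) \<bullet> DZ x + \<alpha> * (u x - u0 x) * Z x)"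
    using elliptic_AE[OF A]
  proof eventually_elim
    case (elim x)
    define c where "c = (\<Sum>i\<in>UNIV. \<Phi> i x * Du0 x $ i)"
    have e: "lam * (norm (DZ x))^2 \<le> (A x *v DZ x) \<bullet> DZ x" using elim by (simp add: inner_commute)
    have T1: "T x \<bullet> DZ x \<le> norm (T x) * norm (DZ x)" by (rule norm_cauchy_schwarz)
    have "0 \<le> (lam * norm (DZ x) - norm (T x))^2" by simp
    then have "lam * (2 * (norm (T x) * norm (DZ x))) \<le> lam * (lam * (norm (DZ x))^2) + (norm (T x))^2"
      by (simp add: power2_eq_square algebra_simps)
    then have "2 * (norm (T x) * norm (DZ x)) \<le> lam * (norm (DZ x))^2 + 1 / lam * (norm (T x))^2"
      using lam by (simp add: field_simps)
    moreover have "1 / lam * (norm (T x))^2 \<le> 1 / lam * (2 * X2 x)" using lam by (intro mult_left_mono T_le) auto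
    ultimately have T2: "2 * (T x \<bullet> DZ x) \<le> lam * (norm (DZ x))^2 + 2 / lam * X2 x" using T1 by simp
    have "u x - u0 x = Z x + c" by (simp add: Z_def c_def)
    then have g: "2 * (\<alpha> * (u x - u0 x) * Z x) = 2 * \<alpha> * (Z x)^2 + \<alpha> * (2 * c * Z x)"
      by (simp add: power2_eq_square algebra_simps)
    have "0 \<le> (c + Z x)^2" by simp
    then have "- (2 * c * Z x) \<le> c^2 + (Z x)^2" by (simp add: power2_sum)
    also have "\<dots> \<le> X1 x + (Z x)^2" using corr_le[of x] by (simp add: c_def)
    finally have "\<alpha> * - (2 * c * Z x) \<le> \<alpha> * (X1 x + (Z x)^2)" using \<alpha> by (intro mult_left_mono) auto
    then have "2 * (\<alpha> * (u x - u0 x) * Z x) \<ge> \<alpha> * (Z x)^2 - \<alpha> * X1 x" unfolding g by (simp add: algebra_simps)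
    with e T2 show ?case by (simp add: inner_diff_left)
  qed
  have "\<alpha> * (LBINT x. (Z x)^2) + lam * (LBINT x. (norm (DZ x))^2) = (LBINT x. \<alpha> * (Z x)^2 + lam * (norm (DZ x))^2)"
    using iZ by simp
  also have "\<dots> \<le> (LBINT x. \<alpha> * X1 x + 2 / lam * X2 x + 2 * ((A x *v DZ x - T x) \<bullet> DZ x + \<alpha> * (u x - u0 x) * Z x))"
    by (rule integral_mono_AE[OF _ _ pt]) (use iZ i1 i2 iF in auto)
  also have "\<dots> = \<alpha> * (LBINT x. X1 x) + 2 / lam * (LBINT x. X2 x)"
    using i1 i2 iF I0 by simp
  finally show "\<alpha> * (LBINT x. (Z x)^2) + lam * (LBINT x. (norm (DZ x))^2)
      \<le> \<alpha> * (LBINT x. X1 x) + 2 / lam * (LBINT x. X2 x)" .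
qed

lemma X_nonneg: "0 \<le> X1 x" "0 \<le> X2 x"
  unfolding X1_def X2_def by (auto intro!: mult_nonneg_nonneg add_nonneg_nonneg sum_nonneg)

text \<open>If one of the two integrals is infinite, so is the right-hand side, because \<alpha> and
  the constant are positive. Otherwise \<open>1 + 2 / lam\<close> dominates the two separate
  constants 1 and \<open>2 / lam\<close>.\<close>

lemma energy:
  "ennreal \<alpha> * (LBINT\<^sup>+ x. ennreal ((Z x)^2)) + ennreal lam * (LBINT\<^sup>+ x. ennreal ((norm (DZ x))^2))
    \<le> ennreal (1 + 2 / lam) * (ennreal \<alpha> * (LBINT\<^sup>+ x. ennreal (X1 x)) + (LBINT\<^sup>+ x. ennreal (X2 x)))"
proof (cases "(LBINT\<^sup>+ x. ennreal (X1 x)) < \<infinity> \<and> (LBINT\<^sup>+ x. ennreal (X2 x)) < \<infinity>")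
  case True
  have i: "integrable lborel X1" "integrable lborel X2"
    using True X_nonneg by (auto simp: integrable_iff_bounded)
  define a b where "a = (LBINT x. X1 x)" and "b = (LBINT x. X2 x)"
  have ab: "0 \<le> a" "0 \<le> b" unfolding a_def b_def using X_nonneg by auto
  have n: "(LBINT\<^sup>+ x. ennreal (X1 x)) = ennreal a" "(LBINT\<^sup>+ x. ennreal (X2 x)) = ennreal b"
    unfolding a_def b_def using i X_nonneg by (auto intro!: nn_integral_eq_integral)
  have z: "(LBINT\<^sup>+ x. ennreal ((Z x)^2)) = ennreal (LBINT x. (Z x)^2)"
    "(LBINT\<^sup>+ x. ennreal ((norm (DZ x))^2)) = ennreal (LBINT x. (norm (DZ x))^2)"
    using energy_finite(1)[OF i] L2_norm[OF energy_finite(2)[OF i]] by (auto intro!: nn_integral_eq_integral simp: L2_def)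
  have "\<alpha> * (LBINT x. (Z x)^2) + lam * (LBINT x. (norm (DZ x))^2) \<le> \<alpha> * a + 2 / lam * b"
    unfolding a_def b_def by (rule energy_finite(3)[OF i])
  also have "\<dots> \<le> (1 + 2 / lam) * (\<alpha> * a + b)"
  proof -
    have "0 \<le> 2 / lam * (\<alpha> * a)" using lam \<alpha> ab by simp
    then show ?thesis using ab by (simp add: distrib_left distrib_right)
  qed
  finally show ?thesis
    unfolding n z using lam \<alpha> ab
    by (simp add: ennreal_mult'[symmetric] ennreal_plus[symmetric] ennreal_leI del: ennreal_plus)
next
  case False
  have inf: "ennreal \<alpha> * (LBINT\<^sup>+ x. ennreal (X1 x)) + (LBINT\<^sup>+ x. ennreal (X2 x)) = top"
    using False \<alpha> by (auto simp: not_less top_unique ennreal_mult_top ennreal_mult_eq_top_iff)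
  have "ennreal (1 + 2 / lam) > 0" using lam by (simp add: add_pos_pos)
  then show ?thesis unfolding inf by (simp add: ennreal_mult_top)
qed

end

subsection \<open>Stationary random fields\<close>

lemma mem_cube: "r > 0 \<Longrightarrow> y \<in> cube x r \<longleftrightarrow> (\<forall>i. \<bar>y $ i - x $ i\<bar> < r / 2)"
proof
  assume r: "r > 0"
  { assume "y \<in> cube x r"
    then obtain z where z: "y = x + r *\<^sub>R z" "z \<in> unit_cube" by (auto simp: cube_def)
    show "\<forall>i. \<bar>y $ i - x $ i\<bar> < r / 2"
    proof
      fix i
      have "\<bar>z $ i\<bar> < 1 / 2" using z(2) by (auto simp: unit_cube_def mem_box_cart abs_less_iff dest!: spec[of _ i])
      then have "r * \<bar>z $ i\<bar> < r * (1 / 2)" using r by (intro mult_strict_left_mono)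
      then show "\<bar>y $ i - x $ i\<bar> < r / 2" using r by (simp add: z abs_mult)
    qed }
  { assume a: "\<forall>i. \<bar>y $ i - x $ i\<bar> < r / 2"
    have "(1 / r) *\<^sub>R (y - x) \<in> unit_cube"
      unfolding unit_cube_def mem_box_cart
    proof
      fix i
      have "\<bar>(y $ i - x $ i) / r\<bar> < 1 / 2" using a[rule_format, of i] r by (simp add: field_simps)
      then have "- 1 / 2 < (y $ i - x $ i) / r" "(y $ i - x $ i) / r < 1 / 2" unfolding abs_less_iff by linarith+
      moreover have "((1 / r) *\<^sub>R (y - x)) $ i = (y $ i - x $ i) / r" by simp
      ultimately show "(\<chi> i. - 1 / 2) $ i < ((1 / r) *\<^sub>R (y - x)) $ i \<and> ((1 / r) *\<^sub>R (y - x)) $ i < (\<chi> i. 1 / 2) $ i"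
        unfolding vec_lambda_beta by (simp only:)
    qed
    then have "x + r *\<^sub>R ((1 / r) *\<^sub>R (y - x)) \<in> cube x r" unfolding cube_def by blast
    then show "y \<in> cube x r" using r by simp }
qed

lemma unit_cube_eq: "unit_cube = cube 0 1"
  by (simp add: cube_def)

lemma cube_box: "r > 0 \<Longrightarrow> cube x r = box (x - (\<chi> i. r / 2)) (x + (\<chi> i. r / 2))"
  by (rule set_eqI) (simp only: mem_cube mem_box_cart abs_diff_less_iff vector_minus_component vector_add_component vec_lambda_beta)

lemma cube_measurable [measurable]: "r > 0 \<Longrightarrow> cube x r \<in> sets borel"
  by (simp add: cube_box)

lemma unit_cube_measurable [measurable, simp]: "unit_cube \<in> sets borel"
  by (simp add: unit_cube_def)

lemma cube_translate: "r > 0 \<Longrightarrow> (\<lambda>y. z + y) ` cube x r = cube (z + x) r"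
  by (auto simp: cube_def image_image add.assoc)

lemma cube_finite: "r > 0 \<Longrightarrow> emeasure lborel (cube x r) < \<infinity>"
  using emeasure_lborel_box_finite by (simp add: cube_box)

lemma cube_pos: "r > 0 \<Longrightarrow> emeasure lborel (cube x r :: (real ^ 'n::finite) set) > 0"
proof -
  assume r: "r > 0"
  have "open (cube x r)" "x \<in> cube x r" using r by (auto simp: cube_box mem_cube[symmetric] mem_box_cart)
  then show ?thesis
    using open_not_negligible[of "cube x r"] by (auto simp: negligible_iff_null_sets null_sets_def zero_less_iff_neq_zero)
qed

lemma emeasure_unit_cube: "emeasure lborel (unit_cube :: (real ^ 'n::finite) set) = 1"
proof -
  have "\<And>b. b \<in> Basis \<Longrightarrow> (\<chi> i. - 1 / 2) \<bullet> b \<le> (\<chi> i. 1 / 2) \<bullet> (b :: real ^ 'n)"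
    by (auto simp: Basis_vec_def inner_axis)
  then have "emeasure lborel (unit_cube :: (real ^ 'n) set) = (\<Prod>b\<in>Basis. ((\<chi> i. 1 / 2) - (\<chi> i. - 1 / 2)) \<bullet> (b :: real ^ 'n))"
    unfolding unit_cube_def by (rule emeasure_lborel_box)
  also have "(\<Prod>b\<in>Basis. ((\<chi> i. 1 / 2) - (\<chi> i. - 1 / 2)) \<bullet> (b :: real ^ 'n)) = (\<Prod>b\<in>(Basis :: (real ^ 'n) set). 1)"
    by (rule prod.cong) (auto simp: Basis_vec_def inner_axis)
  finally show ?thesis by simp
qed

lemma cball_subset_cube: "cball 0 R \<subseteq> cube 0 (2 * \<bar>R\<bar> + 1)"
proof
  fix y :: "real ^ 'a" assume "y \<in> cball 0 R"
  then have yR: "\<bar>y $ i\<bar> \<le> R" for i using component_le_norm_cart[of y i] by simp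
  have "\<bar>y $ i\<bar> < \<bar>R\<bar> + 1 / 2" for i using yR[of i] abs_ge_self[of R] by linarith
  then show "y \<in> cube 0 (2 * \<bar>R\<bar> + 1)" by (simp add: mem_cube add_divide_distrib)
qed

text \<open>The uniform law on a centred cube. With r = 1, the product with \<open>P\<close> turns
  an expectation of an integral over the unit cube into a single expectation, and with large r it
  describes spatial averages.\<close>

definition unifc :: "real \<Rightarrow> (real ^ 'n::finite) measure" where
  "unifc r = uniform_measure lborel (cube 0 r)"

lemma sets_unifc [measurable_cong, simp]: "sets (unifc r) = sets borel"
  by (simp add: unifc_def)

lemma prob_space_unifc: "r > 0 \<Longrightarrow> prob_space (unifc r :: (real ^ 'n::finite) measure)"
  unfolding unifc_def using cube_pos[of r "0 :: real ^ 'n"] cube_finite[of r "0 :: real ^ 'n"]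
  by (intro prob_space_uniform_measure) auto

lemma nn_integral_unifc_1:
  assumes [measurable]: "f \<in> borel_measurable borel"
  shows "(\<integral>\<^sup>+x. f x \<partial>unifc 1) = (LBINT\<^sup>+ x. f x * indicator unit_cube x)"
  unfolding unifc_def unit_cube_eq[symmetric]
  by (subst nn_integral_uniform_measure) (auto simp: emeasure_unit_cube divide_ennreal_def)

lemma kern_cube:
  assumes r: "r > 0"
  defines "V \<equiv> measure lborel (cube (0::real ^ 'n::finite) r)"
  shows "kern (\<lambda>x::real ^ 'n. indicator (cube 0 r) x / V) (real CARD('n) * r)" "V > 0"
proof -
  have m [measurable]: "cube (0::real ^ 'n) r \<in> sets borel" using r by simp
  show V: "V > 0" unfolding V_def using cube_pos[OF r, of "0::real ^ 'n"] cube_finite[OF r, of "0::real ^ 'n"]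
    by (simp add: measure_def enn2real_positive_iff)
  have z: "indicator (cube 0 r) x = (0::real)" if "real CARD('n) * r < norm x" for x :: "real ^ 'n"
  proof (rule ccontr)
    assume "indicator (cube 0 r) x \<noteq> (0::real)"
    then have "x \<in> cube 0 r" by (simp add: indicator_def split: if_splits)
    then have "\<bar>x $ i\<bar> \<le> r" for i using r by (auto simp: mem_cube dest!: spec[of _ i])
    \<comment> \<open>The radius is the crude bound of the Euclidean norm by the sum of the
      coordinates; only its convergence to 0 with r matters.\<close>
    then have "(\<Sum>i\<in>UNIV. \<bar>x $ i\<bar>) \<le> (\<Sum>i\<in>(UNIV::'n set). r)" by (intro sum_mono)
    then show False using that norm_le_l1_cart[of x] by simp
  qed
  show "kern (\<lambda>x::real ^ 'n. indicator (cube 0 r) x / V) (real CARD('n) * r)"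
    unfolding kern_def
  proof (intro conjI allI impI)
    have "\<bar>indicator (cube 0 r) x / V\<bar> \<le> 1 / V" for x :: "real ^ 'n" using V by (auto simp: indicator_def)
    then show "bcs (\<lambda>x::real ^ 'n. indicator (cube 0 r) x / V)"
      unfolding bcs_def using z by (intro conjI exI[of _ "1 / V"] exI[of _ "real CARD('n) * r"]) auto
    show "(LBINT x. indicator (cube 0 r) (x::real ^ 'n) / V) = 1"
      using V cube_finite[OF r, of "0::real ^ 'n"] by (simp add: V_def)
  qed (use V z in auto)
qed

lemma bcs_cube:
  assumes "r > 0" shows "bcs (indicator (cube x r) :: real ^ 'n::finite \<Rightarrow> real)"
proof -
  have m [measurable]: "cube x r \<in> sets borel" using assms by simp
  have "bounded (cube x r)" using assms by (simp add: cube_box bounded_box)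
  then obtain R where "\<forall>y\<in>cube x r. norm y \<le> R" unfolding bounded_iff by blast
  then have "(indicator (cube x r) y :: real) = 0" if "R < norm y" for y using that by (force simp: indicator_def)
  then show ?thesis unfolding bcs_def by (intro conjI exI[of _ 1] exI[of _ R]) (auto simp: indicator_def[of _ "_ :: real ^ 'n"] intro!: borel_measurable_indicator)
qed

text \<open>Averages over small cubes are convolutions with the kernels of \<open>kern_cube\<close>,
  so the fundamental lemma applies to the difference.\<close>

lemma AE_eq_if_cube_integrals_eq:
  fixes f g :: "real ^ 'n::finite \<Rightarrow> real"
  assumes f: "L1l f" and g: "L1l g"
    and eq: "\<And>x r. r > 0 \<Longrightarrow> (LINT y:cube x r|lborel. f y) = (LINT y:cube x r|lborel. g y)"
  shows "AE y in lborel. f y = g y"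
proof -
  define r where "r n = inverse (real (Suc n))" for n
  have r: "r n > 0" for n by (simp add: r_def)
  define V where "V n = measure lborel (cube (0::real ^ 'n) (r n))" for n
  have "AE y in lborel. f y - g y = 0"
  proof (rule AE_eq_0_if_conv_eq_0)
    show "L1l (\<lambda>y. f y - g y)" by (intro L1l_diff f g)
    show "kern (\<lambda>x::real ^ 'n. indicator (cube 0 (r n)) x / V n) (real CARD('n) * r n)" for n
      unfolding V_def by (rule kern_cube[OF r])
    have "(\<lambda>n. real CARD('n) * r n) \<longlonglongrightarrow> real CARD('n) * 0"
      unfolding r_def by (intro tendsto_intros LIMSEQ_inverse_real_of_nat)
    then show "(\<lambda>n. real CARD('n) * r n) \<longlonglongrightarrow> 0" by simp
    fix n and x :: "real ^ 'n"
    have m [measurable]: "cube x (r n) \<in> sets borel" using r by simp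
    have ind: "indicator (cube 0 (r n)) (x - y) = (indicator (cube x (r n)) y :: real)" for y
      using r by (simp add: mem_cube indicator_def abs_minus_commute)
    have b: "bcs (indicator (cube x (r n)) :: real ^ 'n \<Rightarrow> real)" by (rule bcs_cube[OF r])
    have i: "integrable lborel (\<lambda>y. f y * indicator (cube x (r n)) y)" "integrable lborel (\<lambda>y. g y * indicator (cube x (r n)) y)"
      by (intro L1l_bcs f g b)+
    have "conv (\<lambda>y. f y - g y) (\<lambda>x. indicator (cube 0 (r n)) x / V n) x
      = ((LBINT y. f y * indicator (cube x (r n)) y) - (LBINT y. g y * indicator (cube x (r n)) y)) / V n"
      unfolding conv_def ind using i by (simp add: left_diff_distrib diff_divide_distrib)
    also have "\<dots> = 0" using eq[OF r, of x n] by (simp add: set_lebesgue_integral_def mult.commute)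
    finally show "conv (\<lambda>y. f y - g y) (\<lambda>x. indicator (cube 0 (r n)) x / V n) x = 0" .
  qed
  then show ?thesis by simp
qed

lemma AE_lborel_translate:
  fixes w :: "'a::euclidean_space"
  assumes "AE y in lborel. Q y" shows "AE y in lborel. Q (w + y)"
proof (rule AE_distrD[of "\<lambda>y. w + y" lborel borel])
  show "AE y in distr lborel borel (\<lambda>y. w + y). Q y" unfolding lborel_distr_plus by (rule assms)
qed measurable

section \<open>Stationarity as invariance of the law, and stationary fields\<close>

locale medium = prob_space P for P :: "'n::finite coeff measure" +
  fixes lam :: real
  assumes rm: "random_medium lam P" and st: "stationary P"
begin

interpretation L: pair_sigma_finite P "lborel :: (real ^ 'n) measure" ..

lemma shift_joint [measurable]: "(\<lambda>(z, a). shift z a) \<in> measurable (borel \<Otimes>\<^sub>M P) P"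
  using rm by (simp add: random_medium_def)

lemma shift_measurable_comp [measurable (raw)]:
  assumes "f \<in> measurable M borel" "g \<in> measurable M P"
  shows "(\<lambda>x. shift (f x) (g x)) \<in> measurable M P"
  using measurable_compose[OF measurable_Pair[OF assms] shift_joint] by simp

lemma shift_measurable: "shift z \<in> measurable P P"
  by measurable

lemma distr_shift: "distr P P (shift z) = P"
proof (rule measure_eqI)
  fix A assume "A \<in> sets (distr P P (shift z))"
  then have A [measurable]: "A \<in> sets P" by simp
  have [measurable]: "shift z \<in> measurable P P" by (rule shift_measurable)
  have "(LINT a|P. (indicator A (shift z a) :: real)) = (LINT a|P. indicator A a)"
    using st unfolding stationary_def by (auto simp: less_top[symmetric])
  moreover have "(\<lambda>a. indicator A (shift z a) :: real) = indicator (shift z -` A)" by (auto simp: indicator_def)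
  then have "(LINT a|P. (indicator A (shift z a) :: real)) = measure P (shift z -` A \<inter> space P)"
    by simp
  ultimately have "measure P (shift z -` A \<inter> space P) = measure P A" by simp
  then show "emeasure (distr P P (shift z)) A = emeasure P A"
    by (simp add: emeasure_distr emeasure_eq_measure)
qed simp

lemma AE_shift: "AE a in P. Q a \<Longrightarrow> AE a in P. Q (shift z a)"
  by (rule AE_distrD[OF shift_measurable]) (simp only: distr_shift)

lemma nn_integral_shift: "f \<in> borel_measurable P \<Longrightarrow> (\<integral>\<^sup>+a. f (shift z a) \<partial>P) = (\<integral>\<^sup>+a. f a \<partial>P)"
  using nn_integral_distr[OF shift_measurable, of f z] distr_shift by simp

lemma shift_shift: "shift z (shift y a) = shift (y + z) a"
  by (simp add: shift_def add_ac)

definition jm :: "('n coeff \<Rightarrow> real ^ 'n \<Rightarrow> 'b::topological_space) \<Rightarrow> bool" where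
  "jm u \<longleftrightarrow> (\<lambda>(a, x). u a x) \<in> borel_measurable (P \<Otimes>\<^sub>M lborel)"

lemma jm_comp:
  assumes "jm u" "f \<in> measurable M P" "g \<in> measurable M borel"
  shows "(\<lambda>x. u (f x) (g x)) \<in> borel_measurable M"
proof -
  have "(\<lambda>x. (f x, g x)) \<in> measurable M (P \<Otimes>\<^sub>M lborel)" using assms(2,3) by simp
  from measurable_compose[OF this assms(1)[unfolded jm_def]] show ?thesis by simp
qed

lemma jm_section: "jm u \<Longrightarrow> a \<in> space P \<Longrightarrow> u a \<in> borel_measurable borel"
  by (rule jm_comp) auto

lemma random_field_jm: "random_field P u \<Longrightarrow> jm u"
  unfolding random_field_def jm_def
  by (subst measurable_cong_sets[OF sets_pair_measure_cong[OF refl sets_lborel] refl])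

text \<open>Stationarity as an almost-everywhere identity in space, for each shift separately.
  Unlike the identity between cube integrals in \<open>stationary_field\<close>, it is preserved
  under nonlinear compositions, and it makes sense for extended nonnegative values.\<close>

definition statf :: "('n coeff \<Rightarrow> real ^ 'n \<Rightarrow> 'b::topological_space) \<Rightarrow> bool" where
  "statf u \<longleftrightarrow> jm u \<and> (\<forall>z. AE a in P. AE y in lborel. u (shift z a) y = u a (z + y))"

lemma statf_jm: "statf u \<Longrightarrow> jm u" by (simp add: statf_def)

lemma stationary_field_L1l:
  assumes s: "stationary_field P u"
  shows "AE a in P. L1l (u a)"
proof -
  have j: "jm u" using s by (intro random_field_jm) (simp add: stationary_field_def)
  have "AE a in P. (LBINT\<^sup>+ y. ennreal \<bar>u a y\<bar> * indicator (cube 0 (2 * \<bar>real n\<bar> + 1)) y) \<noteq> \<infinity>" for n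
  proof (rule nn_integral_PInf_AE)
    have [measurable]: "(\<lambda>z. u (fst z) (snd z)) \<in> borel_measurable (P \<Otimes>\<^sub>M lborel)"
      by (rule jm_comp[OF j]) auto
    have [measurable]: "cube (0::real ^ 'n) (2 * \<bar>real n\<bar> + 1) \<in> sets borel" by simp
    show "(\<lambda>a. \<integral>\<^sup>+y. ennreal \<bar>u a y\<bar> * indicator (cube 0 (2 * \<bar>real n\<bar> + 1)) y \<partial>lborel) \<in> borel_measurable P"
      by (rule lborel.borel_measurable_nn_integral) (simp add: split_beta')
    have "(\<integral>\<^sup>+a. \<integral>\<^sup>+y. ennreal \<bar>u a y\<bar> * indicator (cube 0 (2 * \<bar>real n\<bar> + 1)) y \<partial>lebesgue \<partial>P) < \<infinity>"
      using s unfolding stationary_field_def by (auto dest!: spec[of _ "0::real ^ 'n"] spec[of _ "2 * \<bar>real n\<bar> + 1"])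
    then show "(\<integral>\<^sup>+a. \<integral>\<^sup>+y. ennreal \<bar>u a y\<bar> * indicator (cube 0 (2 * \<bar>real n\<bar> + 1)) y \<partial>lborel \<partial>P) \<noteq> \<infinity>"
      by (simp add: nn_integral_completion)
  qed
  then have "AE a in P. \<forall>n. (LBINT\<^sup>+ y. ennreal \<bar>u a y\<bar> * indicator (cube 0 (2 * \<bar>real n\<bar> + 1)) y) \<noteq> \<infinity>"
    by (simp add: AE_all_countable)
  then show ?thesis
  proof (rule AE_mp, intro AE_I2 impI)
    fix a assume a: "a \<in> space P" and fin: "\<forall>n. (LBINT\<^sup>+ y. ennreal \<bar>u a y\<bar> * indicator (cube 0 (2 * \<bar>real n\<bar> + 1)) y) \<noteq> \<infinity>"
    have [measurable]: "u a \<in> borel_measurable borel" by (rule jm_section[OF j a])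
    show "L1l (u a)"
      unfolding L1l_def
    proof (intro conjI allI)
      fix R :: real
      obtain n where n: "R \<le> real n" using real_arch_simple by blast
      have "cball (0::real ^ 'n) R \<subseteq> cube 0 (2 * \<bar>real n\<bar> + 1)"
        using cball_subset_cube[of "real n"] subset_cball[OF n] by blast
      then have "(LBINT\<^sup>+ y. ennreal (norm (indicator (cball 0 R) y * u a y))) \<le>
        (LBINT\<^sup>+ y. ennreal \<bar>u a y\<bar> * indicator (cube 0 (2 * \<bar>real n\<bar> + 1)) y)"
        by (intro nn_integral_mono) (auto simp: indicator_def)
      also have "\<dots> < \<infinity>" using fin by (simp add: top.not_eq_extremum)
      finally show "integrable lborel (\<lambda>y. indicator (cball 0 R) y * u a y)"
        by (simp add: integrable_iff_bounded)
    qed measurable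
  qed
qed

lemma set_integral_lebesgue:
  fixes f :: "real ^ 'n \<Rightarrow> 'c::{banach, second_countable_topology}"
  assumes [measurable]: "f \<in> borel_measurable borel" "B \<in> sets borel"
  shows "(LINT y:B|lebesgue. f y) = (LINT y:B|lborel. f y)"
  unfolding set_lebesgue_integral_def by (rule integral_completion) measurable

text \<open>For a fixed shift, the cube integrals of the shifted field and of the field of the
  shifted medium agree; local integrability of both, almost surely, lets the cubes determine the
  functions.\<close>

lemma stationary_field_statf:
  assumes s: "stationary_field P u"
  shows "statf u"
  unfolding statf_def
proof (intro conjI allI)
  show j: "jm u" using s by (intro random_field_jm) (simp add: stationary_field_def)
  fix z
  have c: "AE a in P. \<forall>x x0 r. r > 0 \<longrightarrow> (LINT y:(\<lambda>y. x + y) ` cube x0 r|lebesgue. u a y) = (LINT y:cube x0 r|lebesgue. u (shift x a) y)"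
    using s by (simp add: stationary_field_def)
  have L: "AE a in P. L1l (u a)" by (rule stationary_field_L1l[OF s])
  show "AE a in P. AE y in lborel. u (shift z a) y = u a (z + y)"
    using c L AE_shift[OF L, of z]
  proof eventually_elim
    case (elim a)
    have [measurable]: "u a \<in> borel_measurable borel" "u (shift z a) \<in> borel_measurable borel"
      using elim by (auto dest: L1l_borel)
    show ?case
    proof (rule AE_eq_if_cube_integrals_eq)
      show "L1l (u (shift z a))" by fact
      show "L1l (\<lambda>y. u a (z + y))" using L1l_affine[OF elim(2), of 1 z] by simp
      fix x and r :: real assume r: "r > 0"
      have [measurable]: "cube x r \<in> sets borel" "cube (z + x) r \<in> sets borel" using r by auto
      have "(LINT y:cube x r|lborel. u (shift z a) y) = (LINT y:cube x r|lebesgue. u (shift z a) y)"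
        by (rule set_integral_lebesgue[symmetric]) measurable
      also have "\<dots> = (LINT y:cube (z + x) r|lebesgue. u a y)"
        using elim(1) r by (simp add: cube_translate[symmetric])
      also have "\<dots> = (LINT y:cube (z + x) r|lborel. u a y)" by (rule set_integral_lebesgue) measurable
      also have "\<dots> = (LBINT y. indicator (cube (z + x) r) (z + y) *\<^sub>R u a (z + y))"
        unfolding set_lebesgue_integral_def by (rule integral_lborel_translate[symmetric]) measurable
      also have "\<dots> = (LINT y:cube x r|lborel. u a (z + y))"
        unfolding set_lebesgue_integral_def using r
        by (intro Bochner_Integration.integral_cong refl) (simp add: mem_cube indicator_def)
      finally show "(LINT y:cube x r|lborel. u (shift z a) y) = (LINT y:cube x r|lborel. u a (z + y))" .
    qed
  qed
qed

text \<open>The expectation as a function of the point is invariant, almost everywhere, under each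
  translation; Fubini's theorem upgrades this to constancy, and the constant is read off on the unit
  cube. Infinite values are allowed.\<close>

lemma stationary_mean_nn:
  fixes g :: "'n coeff \<Rightarrow> real ^ 'n \<Rightarrow> ennreal"
  assumes g: "statf g"
  shows "AE x in lborel. (\<integral>\<^sup>+a. g a x \<partial>P) = (\<integral>\<^sup>+y. \<integral>\<^sup>+a. g a y \<partial>P \<partial>unifc 1)"
proof -
  have j: "jm g" using g by (rule statf_jm)
  have [measurable]: "(\<lambda>z. g (fst z) (snd z)) \<in> borel_measurable (P \<Otimes>\<^sub>M lborel)"
    by (rule jm_comp[OF j]) auto
  have jt [measurable]: "(\<lambda>z. g (fst z) (w + snd z)) \<in> borel_measurable (P \<Otimes>\<^sub>M lborel)" for w
    by (rule jm_comp[OF j]) auto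
  define G where "G x = (\<integral>\<^sup>+a. g a x \<partial>P)" for x
  have Gm [measurable]: "G \<in> borel_measurable borel"
  proof -
    have "(\<lambda>z. g (snd z) (fst z)) \<in> borel_measurable (lborel \<Otimes>\<^sub>M P)"
      by (rule jm_comp[OF j]) auto
    then have "(\<lambda>x. \<integral>\<^sup>+a. g a x \<partial>P) \<in> borel_measurable lborel"
      by (intro borel_measurable_nn_integral) (simp add: split_beta')
    then show ?thesis by (simp add: G_def[abs_def])
  qed
  have inv: "AE x in lborel. G (z + x) = G x" for z
  proof -
    \<comment> \<open>A field is determined only almost everywhere in space, so the invariance is
      tested on Borel sets: Tonelli, stationarity of the field and invariance of \<open>P\<close>
      give equal integrals over each of them.\<close>
    have "density lborel (\<lambda>x. G (z + x)) = density lborel G"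
    proof (rule measure_eqI)
      fix B assume "B \<in> sets (density lborel (\<lambda>x. G (z + x)))"
      then have B [measurable]: "B \<in> sets borel" by simp
      have "emeasure (density lborel (\<lambda>x. G (z + x))) B = (LBINT\<^sup>+ x. G (z + x) * indicator B x)"
        by (subst emeasure_density) auto
      also have "\<dots> = (\<integral>\<^sup>+x. \<integral>\<^sup>+a. g a (z + x) * indicator B x \<partial>P \<partial>lborel)"
        unfolding G_def by (intro nn_integral_cong nn_integral_multc[symmetric] jm_comp[OF j]) auto
      also have "\<dots> = (\<integral>\<^sup>+a. \<integral>\<^sup>+x. g a (z + x) * indicator B x \<partial>lborel \<partial>P)"
        by (rule L.Fubini'[where f = "\<lambda>a x. g a (z + x) * indicator B x"]) (simp add: split_beta')
      also have "\<dots> = (\<integral>\<^sup>+a. \<integral>\<^sup>+x. g (shift z a) x * indicator B x \<partial>lborel \<partial>P)"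
      proof (rule nn_integral_cong_AE)
        have "AE a in P. AE y in lborel. g (shift z a) y = g a (z + y)" using g by (simp add: statf_def)
        then show "AE a in P. (LBINT\<^sup>+ x. g a (z + x) * indicator B x) = (LBINT\<^sup>+ x. g (shift z a) x * indicator B x)"
          by eventually_elim (rule nn_integral_cong_AE, auto)
      qed
      also have "\<dots> = (\<integral>\<^sup>+a. \<integral>\<^sup>+x. g a x * indicator B x \<partial>lborel \<partial>P)"
        by (rule nn_integral_shift[where f = "\<lambda>a. \<integral>\<^sup>+x. g a x * indicator B x \<partial>lborel"])
           (rule lborel.borel_measurable_nn_integral, simp add: split_beta')
      also have "\<dots> = (\<integral>\<^sup>+x. \<integral>\<^sup>+a. g a x * indicator B x \<partial>P \<partial>lborel)"
        by (rule L.Fubini'[symmetric, where f = "\<lambda>a x. g a x * indicator B x"]) (simp add: split_beta')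
      also have "\<dots> = (LBINT\<^sup>+ x. G x * indicator B x)"
        unfolding G_def by (intro nn_integral_cong nn_integral_multc jm_comp[OF j]) auto
      also have "\<dots> = emeasure (density lborel G) B" by (subst emeasure_density) auto
      finally show "emeasure (density lborel (\<lambda>x. G (z + x))) B = emeasure (density lborel G) B" .
    qed simp
    then show ?thesis by (subst (asm) sigma_finite_measure.density_unique_iff[OF sigma_finite_lborel]) auto
  qed
  \<comment> \<open>Exchanging the two quantifiers produces one point x0 such that G equals G(x0) at
    almost every translate, that is, almost everywhere.\<close>
  have "AE z in lborel. AE x in lborel. G (z + x) = G x" using inv by simp
  moreover have "{p \<in> space (lborel \<Otimes>\<^sub>M lborel). G (fst p + snd p) = G (snd p)} \<in> sets (lborel \<Otimes>\<^sub>M lborel)"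
    by measurable
  ultimately have "AE x in lborel. AE z in lborel. G (z + x) = G x"
    by (simp add: lborel_pair.AE_commute[where P = "\<lambda>z x. G (z + x) = G x"])
  then have "\<exists>x. AE z in lborel. G (z + x) = G x"
    by (rule eventually_happens'[rotated]) (simp add: ae_filter_eq_bot_iff)
  then obtain x0 where x0: "AE z in lborel. G (z + x0) = G x0" by blast
  have Gc: "AE x in lborel. G x = G x0"
  proof -
    have "AE x in lborel. G (- x0 + x + x0) = G x0" using AE_lborel_translate[OF x0, of "- x0"] .
    then show ?thesis by simp
  qed
  have "(\<integral>\<^sup>+y. G y \<partial>unifc 1) = (LBINT\<^sup>+ y. G x0 * indicator (unit_cube :: (real ^ 'n) set) y)"
    unfolding nn_integral_unifc_1[OF Gm] by (rule nn_integral_cong_AE) (use Gc in eventually_elim, simp)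
  also have "\<dots> = G x0"
    by (subst nn_integral_cmult) (auto simp: emeasure_unit_cube)
  finally show ?thesis using Gc by (simp add: G_def)
qed

end

lemma AE_unifc:
  assumes "AE y in lborel. Q y" "r > 0"
  shows "AE y in (unifc r :: (real ^ 'n::finite) measure). Q y"
proof -
  have [measurable]: "cube (0 :: real ^ 'n) r \<in> sets borel" using assms by simp
  show ?thesis unfolding unifc_def uniform_measure_def
    by (rule absolutely_continuous_AE[OF _ absolutely_continuousI_density assms(1)]) auto
qed

context medium
begin

interpretation L: pair_sigma_finite P "lborel :: (real ^ 'n) measure" ..
interpretation Q1: prob_space "unifc 1 :: (real ^ 'n) measure" by (rule prob_space_unifc) simp
interpretation N: pair_prob_space P "unifc 1 :: (real ^ 'n) measure" ..

abbreviation N where "N \<equiv> P \<Otimes>\<^sub>M (unifc 1 :: (real ^ 'n) measure)"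

lemma jm_iff: "jm u \<longleftrightarrow> (\<lambda>p. u (fst p) (snd p)) \<in> borel_measurable (P \<Otimes>\<^sub>M lborel)"
  by (simp add: jm_def split_beta')

lemma jm_N: "jm u \<Longrightarrow> (\<lambda>p. u (fst p) (snd p)) \<in> borel_measurable N"
  by (rule jm_comp) auto

lemma statf_comp:
  assumes u: "statf u" and f: "f \<in> borel_measurable borel"
  shows "statf (\<lambda>a y. f (u a y))"
  unfolding statf_def
proof (intro conjI allI)
  show "jm (\<lambda>a y. f (u a y))"
    using measurable_compose[OF u[THEN statf_jm, unfolded jm_iff] f] unfolding jm_iff .
  show "AE a in P. AE y in lborel. f (u (shift z a) y) = f (u a (z + y))" for z
  proof -
    have "AE a in P. AE y in lborel. u (shift z a) y = u a (z + y)" using u by (simp add: statf_def)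
    then show ?thesis
    proof eventually_elim
      case (elim a)
      then show ?case by eventually_elim simp
    qed
  qed
qed

lemma statf_comp2:
  fixes u v :: "'n coeff \<Rightarrow> real ^ 'n \<Rightarrow> real"
  assumes u: "statf u" and v: "statf v" and f: "(\<lambda>(s, t). f s t) \<in> borel_measurable (borel \<Otimes>\<^sub>M borel)"
  shows "statf (\<lambda>a y. f (u a y) (v a y))"
  unfolding statf_def
proof (intro conjI allI)
  have "(\<lambda>p. (u (fst p) (snd p), v (fst p) (snd p))) \<in> measurable (P \<Otimes>\<^sub>M lborel) (borel \<Otimes>\<^sub>M borel)"
    using u[THEN statf_jm] v[THEN statf_jm] unfolding jm_iff by simp
  from measurable_compose[OF this f] show "jm (\<lambda>a y. f (u a y) (v a y))" unfolding jm_iff by simp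
  fix z
  have "AE a in P. AE y in lborel. u (shift z a) y = u a (z + y)" "AE a in P. AE y in lborel. v (shift z a) y = v a (z + y)"
    using u v by (auto simp: statf_def)
  then show "AE a in P. AE y in lborel. f (u (shift z a) y) (v (shift z a) y) = f (u a (z + y)) (v a (z + y))"
  proof eventually_elim
    case (elim a)
    then show ?case by eventually_elim simp
  qed
qed

lemma statf_add: "statf u \<Longrightarrow> statf v \<Longrightarrow> statf (\<lambda>a y. u a y + v a y :: real)"
  by (rule statf_comp2) measurable

lemma statf_mult: "statf u \<Longrightarrow> statf v \<Longrightarrow> statf (\<lambda>a y. u a y * v a y :: real)"
  by (rule statf_comp2) measurable

lemma statf_const: "statf (\<lambda>a y. c)"
  by (simp add: statf_def jm_def)

lemma statf_sum: "finite I \<Longrightarrow> (\<And>i. i \<in> I \<Longrightarrow> statf (u i)) \<Longrightarrow> statf (\<lambda>a y. \<Sum>i\<in>I. u i a y :: real)"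
  by (induction I rule: finite_induct) (auto intro: statf_add statf_const)

lemma statf_translate:
  assumes u: "statf u" shows "statf (\<lambda>a y. u a (w + y))"
  unfolding statf_def
proof (intro conjI allI)
  show "jm (\<lambda>a y. u a (w + y))" unfolding jm_iff by (rule jm_comp[OF statf_jm[OF u]]) auto
  fix z
  have "AE a in P. AE y in lborel. u (shift z a) y = u a (z + y)" using u by (simp add: statf_def)
  then show "AE a in P. AE y in lborel. u (shift z a) (w + y) = u a (w + (z + y))"
  proof eventually_elim
    case (elim a)
    from AE_lborel_translate[OF elim, of w] show ?case by (simp add: add.left_commute)
  qed
qed

lemma nn_integral_N:
  assumes "jm g" shows "(\<integral>\<^sup>+p. g (fst p) (snd p) \<partial>N) = (\<integral>\<^sup>+y. \<integral>\<^sup>+a. g a y \<partial>P \<partial>(unifc 1 :: (real ^ 'n) measure))"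
  using N.nn_integral_snd[of "\<lambda>p. g (fst p) (snd p)"] jm_N[OF assms] by simp

lemma stationary_mean_N:
  assumes "statf g"
  shows "AE x in lborel. (\<integral>\<^sup>+a. g a x \<partial>P) = (\<integral>\<^sup>+p. g (fst p) (snd p) \<partial>N)"
  using stationary_mean_nn[OF assms] nn_integral_N[OF statf_jm[OF assms]] by simp

lemma stationary_mean:
  fixes h :: "'n coeff \<Rightarrow> real ^ 'n \<Rightarrow> real"
  assumes h: "statf h" and i: "integrable N (\<lambda>p. h (fst p) (snd p))"
  shows "AE x in lborel. (LINT a|P. h a x) = (LINT p|N. h (fst p) (snd p))"
proof -
  have "AE x in lborel. (\<integral>\<^sup>+a. ennreal (h a x) \<partial>P) = (\<integral>\<^sup>+p. ennreal (h (fst p) (snd p)) \<partial>N)"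
    by (rule stationary_mean_N[OF statf_comp[OF h]]) measurable
  moreover have "AE x in lborel. (\<integral>\<^sup>+a. ennreal (- h a x) \<partial>P) = (\<integral>\<^sup>+p. ennreal (- h (fst p) (snd p)) \<partial>N)"
    by (rule stationary_mean_N[OF statf_comp[OF h]]) measurable
  ultimately show ?thesis
  proof eventually_elim
    case (elim x)
    have hm: "(\<lambda>a. h a x) \<in> borel_measurable P" by (rule jm_comp[OF statf_jm[OF h]]) auto
    have fin: "(\<integral>\<^sup>+p. ennreal (h (fst p) (snd p)) \<partial>N) \<noteq> \<infinity>" "(\<integral>\<^sup>+p. ennreal (- h (fst p) (snd p)) \<partial>N) \<noteq> \<infinity>"
      using i by (auto simp: real_integrable_def)
    have "integrable P (\<lambda>a. h a x)" using hm fin elim by (simp add: real_integrable_def)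
    then show ?case using i elim by (simp add: real_lebesgue_integral_def)
  qed
qed

text \<open>Tonelli and constancy of the mean. This is how moments of stationary quantities are
  computed against cutoffs and their derivatives.\<close>

lemma statf_integral_nn:
  fixes \<zeta> :: "real ^ 'n \<Rightarrow> ennreal"
  assumes g: "statf g" and [measurable]: "\<zeta> \<in> borel_measurable borel"
  shows "(\<integral>\<^sup>+a. \<integral>\<^sup>+x. \<zeta> x * g a (w + x) \<partial>lborel \<partial>P) = (\<integral>\<^sup>+p. g (fst p) (snd p) \<partial>N) * (LBINT\<^sup>+ x. \<zeta> x)"
proof -
  have j: "jm (\<lambda>a y. g a (w + y))" using g by (intro statf_jm statf_translate)
  have [measurable]: "(\<lambda>p. g (fst p) (w + snd p)) \<in> borel_measurable (P \<Otimes>\<^sub>M lborel)"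
    using j by (simp add: jm_iff)
  have "(\<integral>\<^sup>+a. \<integral>\<^sup>+x. \<zeta> x * g a (w + x) \<partial>lborel \<partial>P) = (\<integral>\<^sup>+x. \<integral>\<^sup>+a. \<zeta> x * g a (w + x) \<partial>P \<partial>lborel)"
    by (rule L.Fubini'[symmetric, where f = "\<lambda>a x. \<zeta> x * g a (w + x)"]) (simp add: split_beta')
  also have "\<dots> = (LBINT\<^sup>+ x. \<zeta> x * (\<integral>\<^sup>+a. g a (w + x) \<partial>P))"
    by (intro nn_integral_cong nn_integral_cmult jm_comp[OF j]) auto
  also have "\<dots> = (LBINT\<^sup>+ x. \<zeta> x * (\<integral>\<^sup>+p. g (fst p) (snd p) \<partial>N))"
  proof (rule nn_integral_cong_AE)
    from AE_lborel_translate[OF stationary_mean_N[OF g], of w]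
    show "AE x in lborel. \<zeta> x * (\<integral>\<^sup>+a. g a (w + x) \<partial>P) = \<zeta> x * (\<integral>\<^sup>+p. g (fst p) (snd p) \<partial>N)"
      by eventually_elim simp
  qed
  also have "\<dots> = (\<integral>\<^sup>+p. g (fst p) (snd p) \<partial>N) * (LBINT\<^sup>+ x. \<zeta> x)"
    by (simp add: nn_integral_multc mult.commute)
  finally show ?thesis .
qed

lemma nn_integral_N_translate:
  fixes g :: "'n coeff \<Rightarrow> real ^ 'n \<Rightarrow> ennreal"
  assumes g: "statf g"
  shows "(\<integral>\<^sup>+p. g (fst p) (w + snd p) \<partial>N) = (\<integral>\<^sup>+p. g (fst p) (snd p) \<partial>N)"
proof -
  have "(\<integral>\<^sup>+p. g (fst p) (w + snd p) \<partial>N) = (\<integral>\<^sup>+y. \<integral>\<^sup>+a. g a (w + y) \<partial>P \<partial>(unifc 1 :: (real ^ 'n) measure))"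
    by (rule nn_integral_N[OF statf_jm[OF statf_translate[OF g]]])
  also have "\<dots> = (\<integral>\<^sup>+y. (\<integral>\<^sup>+p. g (fst p) (snd p) \<partial>N) \<partial>(unifc 1 :: (real ^ 'n) measure))"
    by (rule nn_integral_cong_AE) (rule AE_unifc[OF AE_lborel_translate[OF stationary_mean_N[OF g]] zero_less_one])
  also have "\<dots> = (\<integral>\<^sup>+p. g (fst p) (snd p) \<partial>N)" using Q1.emeasure_space_1 by (simp del: Q1.emeasure_space_1)
  finally show ?thesis .
qed

section \<open>Square-integrable stationary fields\<close>

definition L2N :: "('n coeff \<Rightarrow> real ^ 'n \<Rightarrow> real) \<Rightarrow> bool" where
  "L2N u \<longleftrightarrow> statf u \<and> integrable N (\<lambda>p. (u (fst p) (snd p))^2)"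

lemma L2N_statf: "L2N u \<Longrightarrow> statf u" by (simp add: L2N_def)

lemma L2N_nn: "L2N u \<Longrightarrow> (\<integral>\<^sup>+p. ennreal ((u (fst p) (snd p))^2) \<partial>N) < \<infinity>"
  by (simp add: L2N_def integrable_iff_bounded)

lemma L2N_iff: "L2N u \<longleftrightarrow> statf u \<and> (\<integral>\<^sup>+p. ennreal ((u (fst p) (snd p))^2) \<partial>N) < \<infinity>"
  unfolding L2N_def integrable_iff_bounded by (auto intro!: borel_measurable_power[OF jm_N[OF statf_jm]])

lemma L2N_translate: "L2N u \<Longrightarrow> L2N (\<lambda>a y. u a (w + y))"
  unfolding L2N_iff
  using nn_integral_N_translate[OF statf_comp[of u "\<lambda>t. ennreal (t^2)"], of w] by (auto intro: statf_translate)

lemma L2N_mult_integrable: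
  assumes "L2N u" "L2N v" shows "integrable N (\<lambda>p. u (fst p) (snd p) * v (fst p) (snd p))"
proof (rule Bochner_Integration.integrable_bound)
  show "integrable N (\<lambda>p. (u (fst p) (snd p))^2 + (v (fst p) (snd p))^2)" using assms by (simp add: L2N_def)
  show "(\<lambda>p. u (fst p) (snd p) * v (fst p) (snd p)) \<in> borel_measurable N"
    using assms by (intro borel_measurable_times jm_N statf_jm L2N_statf)
  have "\<bar>s * t\<bar> \<le> s^2 + t^2" for s t :: real
    using sum_squares_bound[of "\<bar>s\<bar>" "\<bar>t\<bar>"] mult_nonneg_nonneg[of "\<bar>s\<bar>" "\<bar>t\<bar>"] by (simp add: abs_mult del: mult_nonneg_nonneg)
  then show "AE p in N. norm (u (fst p) (snd p) * v (fst p) (snd p)) \<le> norm ((u (fst p) (snd p))^2 + (v (fst p) (snd p))^2)" by simp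
qed

lemma L2N_const: "L2N (\<lambda>a y. c)"
  by (simp add: L2N_def statf_const)

lemma L2N_add: assumes "L2N u" "L2N v" shows "L2N (\<lambda>a y. u a y + v a y)"
  unfolding L2N_def
proof (intro conjI statf_add L2N_statf assms)
  have "integrable N (\<lambda>p. (u (fst p) (snd p))^2 + 2 * (u (fst p) (snd p) * v (fst p) (snd p)) + (v (fst p) (snd p))^2)"
    using assms L2N_mult_integrable[OF assms] by (simp add: L2N_def)
  then show "integrable N (\<lambda>p. (u (fst p) (snd p) + v (fst p) (snd p))^2)"
    by (simp add: power2_sum algebra_simps)
qed

lemma L2N_cmult: "L2N u \<Longrightarrow> L2N (\<lambda>a y. c * u a y)"
  unfolding L2N_def by (auto simp: power_mult_distrib intro: statf_mult statf_const)

lemma L2N_sum: "finite I \<Longrightarrow> (\<And>i. i \<in> I \<Longrightarrow> L2N (u i)) \<Longrightarrow> L2N (\<lambda>a y. \<Sum>i\<in>I. u i a y)"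
  by (induction I rule: finite_induct) (auto intro: L2N_add L2N_const)

lemma L2N_integrable: "L2N u \<Longrightarrow> integrable N (\<lambda>p. u (fst p) (snd p))"
  using L2N_mult_integrable[OF _ L2N_const[of 1], of u] by simp

text \<open>The expected integral over a ball is the mean times the volume, hence finite; integer
  radii give countably many exceptional sets.\<close>

lemma L2N_L2l:
  assumes u: "L2N u" shows "AE a in P. L2l (u a)"
proof -
  have j: "jm u" using u by (intro statf_jm L2N_statf)
  have [measurable]: "(\<lambda>p. u (fst p) (snd p)) \<in> borel_measurable (P \<Otimes>\<^sub>M lborel)" using j by (simp add: jm_iff)
  have "AE a in P. (LBINT\<^sup>+ x. indicator (cball 0 (real n)) x * ennreal ((u a x)^2)) \<noteq> \<infinity>" for n
  proof (rule nn_integral_PInf_AE)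
    show "(\<lambda>a. \<integral>\<^sup>+x. indicator (cball 0 (real n)) x * ennreal ((u a x)^2) \<partial>lborel) \<in> borel_measurable P"
      by (rule lborel.borel_measurable_nn_integral) (simp add: split_beta')
    have "(\<integral>\<^sup>+a. \<integral>\<^sup>+x. indicator (cball 0 (real n)) x * ennreal ((u a (0 + x))^2) \<partial>lborel \<partial>P)
      = (\<integral>\<^sup>+p. ennreal ((u (fst p) (snd p))^2) \<partial>N) * (LBINT\<^sup>+ x. indicator (cball (0 :: real ^ 'n) (real n)) x)"
      by (rule statf_integral_nn[where g = "\<lambda>a x. ennreal ((u a x)^2)"]) (auto intro!: statf_comp[of u "\<lambda>t. ennreal (t^2)"] L2N_statf u)
    also have "\<dots> < \<infinity>" using L2N_nn[OF u] by (simp add: ennreal_mult_less_top emeasure_lborel_cball_finite[unfolded infinity_ennreal_def])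
    finally show "(\<integral>\<^sup>+a. \<integral>\<^sup>+x. indicator (cball 0 (real n)) x * ennreal ((u a x)^2) \<partial>lborel \<partial>P) \<noteq> \<infinity>" by simp
  qed
  then have "AE a in P. \<forall>n. (LBINT\<^sup>+ x. indicator (cball 0 (real n)) x * ennreal ((u a x)^2)) \<noteq> \<infinity>"
    by (simp add: AE_all_countable)
  then show ?thesis
  proof (rule AE_mp, intro AE_I2 impI)
    fix a assume a: "a \<in> space P" and fin: "\<forall>n. (LBINT\<^sup>+ x. indicator (cball 0 (real n)) x * ennreal ((u a x)^2)) \<noteq> \<infinity>"
    have [measurable]: "u a \<in> borel_measurable borel" by (rule jm_section[OF j a])
    show "L2l (u a)"
      unfolding L2l_def
    proof (intro conjI allI)
      fix R :: real
      obtain n where n: "R \<le> real n" using real_arch_simple by blast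
      have "(LBINT\<^sup>+ x. ennreal (norm (indicator (cball 0 R) x * (u a x)^2)))
         \<le> (LBINT\<^sup>+ x. indicator (cball 0 (real n)) x * ennreal ((u a x)^2))"
        using n by (intro nn_integral_mono) (auto simp: indicator_def)
      also have "\<dots> < \<infinity>" using fin by (simp add: top.not_eq_extremum)
      finally show "integrable lborel (\<lambda>x. indicator (cball 0 R) x * (u a x)^2)" by (simp add: integrable_iff_bounded)
    qed measurable
  qed
qed

text \<open>The increment is a segment average of the directional gradient, which is stationary.
  Hence its second moment is bounded uniformly in space, although the corrector itself may
  grow.\<close>

lemma increment_bound:
  assumes D: "\<And>k. L2N (D k)" and \<phi>: "AE a in P. \<forall>k. wd k (\<phi> a) (D k a)"
    and [measurable]: "\<zeta> \<in> borel_measurable borel"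
  shows "(\<integral>\<^sup>+a. \<integral>\<^sup>+x. \<zeta> x * ennreal ((\<phi> a (w + x) - \<phi> a x)^2) \<partial>lborel \<partial>P)
    \<le> (\<integral>\<^sup>+p. ennreal ((\<Sum>k\<in>UNIV. w $ k * D k (fst p) (snd p))^2) \<partial>N) * (LBINT\<^sup>+ x. \<zeta> x)"
proof -
  interpret U: prob_space unif by (rule prob_space_unif)
  interpret PU: pair_sigma_finite P unif ..
  define g where "g a x = ennreal ((\<Sum>k\<in>UNIV. w $ k * D k a x)^2)" for a x
  have sg: "statf g" unfolding g_def[abs_def]
    using statf_comp[OF statf_sum[of UNIV "\<lambda>k a x. w $ k * D k a x"], of "\<lambda>t. ennreal (t^2)"]
      statf_mult[OF statf_const L2N_statf[OF D]] by simp
  have m3: "(\<lambda>q. g (fst (fst q)) (snd q + snd (fst q) *\<^sub>R w)) \<in> borel_measurable ((P \<Otimes>\<^sub>M unif) \<Otimes>\<^sub>M lborel)"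
    by (rule jm_comp[OF statf_jm[OF sg]]) measurable
  have "(\<integral>\<^sup>+a. \<integral>\<^sup>+x. \<zeta> x * ennreal ((\<phi> a (w + x) - \<phi> a x)^2) \<partial>lborel \<partial>P)
    \<le> (\<integral>\<^sup>+a. \<integral>\<^sup>+t. \<integral>\<^sup>+x. \<zeta> x * g a (x + t *\<^sub>R w) \<partial>lborel \<partial>unif \<partial>P)"
  proof (rule nn_integral_mono_AE)
    show "AE a in P. (LBINT\<^sup>+ x. \<zeta> x * ennreal ((\<phi> a (w + x) - \<phi> a x)^2)) \<le> (\<integral>\<^sup>+t. \<integral>\<^sup>+x. \<zeta> x * g a (x + t *\<^sub>R w) \<partial>lborel \<partial>unif)"
      using \<phi>
    proof eventually_elim
      case (elim a)
      then show ?case using wd_difference_bound[of "\<phi> a" "\<lambda>k. D k a" \<zeta> w] by (simp add: g_def add.commute[of w])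
    qed
  qed
  also have "\<dots> = (\<integral>\<^sup>+t. \<integral>\<^sup>+a. \<integral>\<^sup>+x. \<zeta> x * g a (x + t *\<^sub>R w) \<partial>lborel \<partial>P \<partial>unif)"
  proof (rule PU.Fubini'[symmetric])
    have "(\<lambda>q. \<zeta> (snd q) * g (fst (fst q)) (snd q + snd (fst q) *\<^sub>R w)) \<in> borel_measurable ((P \<Otimes>\<^sub>M unif) \<Otimes>\<^sub>M lborel)"
      using m3 by measurable
    then have "(\<lambda>q. \<integral>\<^sup>+x. \<zeta> x * g (fst q) (x + snd q *\<^sub>R w) \<partial>lborel) \<in> borel_measurable (P \<Otimes>\<^sub>M unif)"
      by (intro lborel.borel_measurable_nn_integral) (simp add: split_beta')
    then show "(\<lambda>(a, t). \<integral>\<^sup>+x. \<zeta> x * g a (x + t *\<^sub>R w) \<partial>lborel) \<in> borel_measurable (P \<Otimes>\<^sub>M unif)"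
      by (simp add: split_beta')
  qed
  also have "\<dots> = (\<integral>\<^sup>+t. (\<integral>\<^sup>+p. g (fst p) (snd p) \<partial>N) * (LBINT\<^sup>+ x. \<zeta> x) \<partial>unif)"
  proof (rule nn_integral_cong)
    fix t
    show "(\<integral>\<^sup>+a. \<integral>\<^sup>+x. \<zeta> x * g a (x + t *\<^sub>R w) \<partial>lborel \<partial>P) = (\<integral>\<^sup>+p. g (fst p) (snd p) \<partial>N) * (LBINT\<^sup>+ x. \<zeta> x)"
      using statf_integral_nn[OF sg, of \<zeta> "t *\<^sub>R w"] unfolding add.commute[of "t *\<^sub>R w"] by simp
  qed
  also have "\<dots> = (\<integral>\<^sup>+p. g (fst p) (snd p) \<partial>N) * (LBINT\<^sup>+ x. \<zeta> x)"
    using U.emeasure_space_1 by (simp del: U.emeasure_space_1)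
  finally show ?thesis by (simp add: g_def)
qed


text \<open>Scaling shows that the mass of the gradient of the cutoff is smaller than the mass of
  the cutoff by the factor 1/(n+1). This quotient drives the argument of
  \<open>correlation_const\<close>.\<close>

lemma integral_cut:
  "(LBINT x. cut n (x :: real ^ 'n)) = real (Suc n) ^ CARD('n) * ((LBINT x. bump 0 (x :: real ^ 'n)) / bump 0 (0 :: real ^ 'n))"
  "(LBINT x. \<bar>partial k (cut n) (x :: real ^ 'n)\<bar>)
    = real (Suc n) ^ CARD('n) * (inverse (real (Suc n)) * (LBINT x. \<bar>partial k (bump 0) (x :: real ^ 'n)\<bar>) / bump 0 (0 :: real ^ 'n))"
proof -
  have m [measurable]: "(cut n :: real ^ 'n \<Rightarrow> real) \<in> borel_measurable borel" "(partial k (cut n) :: real ^ 'n \<Rightarrow> real) \<in> borel_measurable borel"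
    by (auto intro: test_fun_borel test_fun_cut test_fun_partial)
  have s: "inverse (real (Suc n)) *\<^sub>R (0 + real (Suc n) *\<^sub>R x) = x" for x :: "real ^ 'n" by (simp del: of_nat_Suc)
  have c: "cut n (0 + real (Suc n) *\<^sub>R x) = bump 0 x / bump 0 (0 :: real ^ 'n)" for x :: "real ^ 'n"
    unfolding cut_def s ..
  have p: "\<bar>partial k (cut n) (0 + real (Suc n) *\<^sub>R x)\<bar> = inverse (real (Suc n)) * \<bar>partial k (bump 0) x\<bar> / bump 0 (0 :: real ^ 'n)" for x :: "real ^ 'n"
    unfolding partial_cut s using bump_0[where 'a='n] by (simp add: abs_mult del: of_nat_Suc)
  show "(LBINT x. cut n (x :: real ^ 'n)) = real (Suc n) ^ CARD('n) * ((LBINT x. bump 0 (x :: real ^ 'n)) / bump 0 (0 :: real ^ 'n))"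
    using integral_lborel_affine[of "cut n :: real ^ 'n \<Rightarrow> real" "real (Suc n)" 0] unfolding c by (simp del: of_nat_Suc)
  show "(LBINT x. \<bar>partial k (cut n) (x :: real ^ 'n)\<bar>)
    = real (Suc n) ^ CARD('n) * (inverse (real (Suc n)) * (LBINT x. \<bar>partial k (bump 0) (x :: real ^ 'n)\<bar>) / bump 0 (0 :: real ^ 'n))"
    using integral_lborel_affine[of "\<lambda>x. \<bar>partial k (cut n) (x :: real ^ 'n)\<bar>" "real (Suc n)" 0] unfolding p by (simp del: of_nat_Suc)
qed

text \<open>For divergence-free \<open>F\<close>, testing with a cutoff times the increment \<open>\<phi> (w + \<cdot>) - \<phi>\<close>,
  which has second moments bounded uniformly in space, shows that the correlation of \<open>F\<close> and
  \<open>D (w + \<cdot>)\<close> does not depend on \<open>w\<close>.\<close>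

lemma correlation_const:
  assumes F: "\<And>k. L2N (F k)" and D: "\<And>k. L2N (D k)"
    and j: "jm \<phi>" and \<phi>: "AE a in P. \<forall>k. wd k (\<phi> a) (D k a)" "AE a in P. L2l (\<phi> a)"
    and div: "AE a in P. \<forall>\<psi>. test_fun \<psi> \<longrightarrow> (\<Sum>k\<in>UNIV. LBINT x. F k a x * partial k \<psi> x) = 0"
  shows "(\<Sum>k\<in>UNIV. LINT p|N. F k (fst p) (snd p) * D k (fst p) (w + snd p)) = (\<Sum>k\<in>UNIV. LINT p|N. F k (fst p) (snd p) * D k (fst p) (snd p))"
proof -
  let ?g = "\<lambda>n k a x. ennreal \<bar>partial k (cut n) x\<bar> * (ennreal ((\<phi> a (w + x) - \<phi> a x)^2) + ennreal ((F k a x)^2))"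
  \<comment> \<open>A stationary scalar whose mean is the difference of the two correlations; the
    aim is that this mean vanishes.\<close>
  define h where "h a x = (\<Sum>k\<in>UNIV. F k a x * (D k a (w + x) - D k a x))" for a x
  have DwD: "L2N (\<lambda>a x. D k a (w + x) + - 1 * D k a x)" for k by (intro L2N_add L2N_cmult L2N_translate D)
  have sh: "statf h" unfolding h_def[abs_def]
    using L2N_statf[OF DwD] by (intro statf_sum statf_mult L2N_statf[OF F]) auto
  have ih: "integrable N (\<lambda>p. h (fst p) (snd p))"
    unfolding h_def using L2N_mult_integrable[OF F DwD] by (intro Bochner_Integration.integrable_sum) simp
  define m where "m = (LINT p|N. h (fst p) (snd p))"
  have m_eq: "m = (\<Sum>k\<in>UNIV. LINT p|N. F k (fst p) (snd p) * D k (fst p) (w + snd p)) - (\<Sum>k\<in>UNIV. LINT p|N. F k (fst p) (snd p) * D k (fst p) (snd p))"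
    unfolding m_def h_def right_diff_distrib
    using L2N_mult_integrable[OF F L2N_translate[OF D]] L2N_mult_integrable[OF F D]
    by (simp add: Bochner_Integration.integral_sum sum_subtractf)
  \<comment> \<open>Second moments of the increment and of \<open>F k\<close>: the price, per unit
    of gradient mass of the cutoff, when the product is split into squares.\<close>
  define B where "B k = (\<integral>\<^sup>+p. ennreal ((\<Sum>k\<in>UNIV. w $ k * D k (fst p) (snd p))^2) \<partial>N) + (\<integral>\<^sup>+p. ennreal ((F k (fst p) (snd p))^2) \<partial>N)" for k
  have LwD: "L2N (\<lambda>a x. \<Sum>k\<in>UNIV. w $ k * D k a x)" by (intro L2N_sum L2N_cmult D) auto
  have B: "B k < \<infinity>" for k unfolding B_def using L2N_nn[OF LwD] L2N_nn[OF F[of k]] by simp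
  define J where "J n k = (LBINT x. \<bar>partial k (cut n) (x :: real ^ 'n)\<bar>)" for n k
  have tc: "test_fun (cut n :: real ^ 'n \<Rightarrow> real)" "test_fun (partial k (cut n) :: real ^ 'n \<Rightarrow> real)" for n k
    by (auto intro: test_fun_cut test_fun_partial)
  have [measurable]: "(cut n :: real ^ 'n \<Rightarrow> real) \<in> borel_measurable borel" "(partial k (cut n) :: real ^ 'n \<Rightarrow> real) \<in> borel_measurable borel" for n k
    using tc by (auto intro: test_fun_borel)
  have [measurable]: "(\<lambda>p. h (fst p) (snd p)) \<in> borel_measurable (P \<Otimes>\<^sub>M lborel)"
    using statf_jm[OF sh] by (simp add: jm_iff)
  have [measurable]: "(\<lambda>p. \<phi> (fst p) (snd p)) \<in> borel_measurable (P \<Otimes>\<^sub>M lborel)"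
    using j by (simp add: jm_iff)
  have [measurable]: "(\<lambda>p. \<phi> (fst p) (w + snd p)) \<in> borel_measurable (P \<Otimes>\<^sub>M lborel)"
    by (rule jm_comp[OF j]) auto
  have [measurable]: "(\<lambda>p. F k (fst p) (snd p)) \<in> borel_measurable (P \<Otimes>\<^sub>M lborel)" for k
    using statf_jm[OF L2N_statf[OF F]] by (simp add: jm_iff)
  have F2: "AE a in P. \<forall>k. L2l (F k a)" using L2N_L2l[OF F] by (simp add: AE_all_countable)
  have D2: "AE a in P. \<forall>k. L2l (D k a)" using L2N_L2l[OF D] by (simp add: AE_all_countable)
  have ci: "integrable lborel (\<lambda>x::real ^ 'n. cut n x)" "integrable lborel (\<lambda>x::real ^ 'n. \<bar>partial k (cut n) x\<bar>)" for n k
    using bcs_integrable[OF test_fun_bcs[OF tc(1)]] bcs_integrable[OF test_fun_bcs[OF tc(2)]] by auto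
  have key: "ennreal (\<bar>m\<bar> * (LBINT x. cut n (x :: real ^ 'n))) \<le> (\<Sum>k\<in>UNIV. ennreal (J n k) * B k)" for n
  proof -
    have c0: "0 \<le> cut n (x :: real ^ 'n)" for x unfolding cut_def by (intro divide_nonneg_pos bump_nonneg bump_0)
    have PL: "integrable (P \<Otimes>\<^sub>M lborel) (\<lambda>(a, x). cut n x * h a x)"
      unfolding integrable_iff_bounded
    proof
      show "(\<lambda>(a, x). cut n x * h a x) \<in> borel_measurable (P \<Otimes>\<^sub>M lborel)" by (simp add: split_beta')
      have "(\<integral>\<^sup>+p. ennreal (norm (case p of (a, x) \<Rightarrow> cut n x * h a x)) \<partial>(P \<Otimes>\<^sub>M lborel))
        = (\<integral>\<^sup>+a. \<integral>\<^sup>+x. ennreal (cut n x) * ennreal \<bar>h a (0 + x)\<bar> \<partial>lborel \<partial>P)"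
        using c0 by (subst lborel.nn_integral_fst[symmetric]) (auto simp: split_beta' abs_mult ennreal_mult')
      also have "\<dots> = (\<integral>\<^sup>+p. ennreal \<bar>h (fst p) (snd p)\<bar> \<partial>N) * (LBINT\<^sup>+ x. ennreal (cut n (x :: real ^ 'n)))"
        by (rule statf_integral_nn[where g = "\<lambda>a x. ennreal \<bar>h a x\<bar>"]) (auto intro!: statf_comp[OF sh, of "\<lambda>t. ennreal \<bar>t\<bar>"])
      also have "\<dots> < \<infinity>" using ih ci(1)[of n] c0 by (simp add: integrable_iff_bounded ennreal_mult_less_top)
      finally show "(\<integral>\<^sup>+p. ennreal (norm (case p of (a, x) \<Rightarrow> cut n x * h a x)) \<partial>(P \<Otimes>\<^sub>M lborel)) < \<infinity>" .
    qed
    have "m * (LBINT x. cut n (x :: real ^ 'n)) = (LBINT x. LINT a|P. cut n x * h a x)"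
    proof -
      have "(LBINT x. LINT a|P. cut n x * h a x) = (LBINT x. cut n x * (LINT a|P. h a x))" by simp
      also have "\<dots> = (LBINT x. cut n (x :: real ^ 'n) * m)"
      proof (rule integral_cong_AE)
        show "AE x in lborel. cut n x * (LINT a|P. h a x) = cut n x * m"
          using stationary_mean[OF sh ih] by eventually_elim (simp add: m_def)
        have "(\<lambda>p. h (snd p) (fst p)) \<in> borel_measurable (lborel \<Otimes>\<^sub>M P)" by (rule jm_comp[OF statf_jm[OF sh]]) auto
        then have "(\<lambda>x. LINT a|P. h a x) \<in> borel_measurable lborel"
          by (intro borel_measurable_lebesgue_integral) (simp add: split_beta')
        then show "(\<lambda>x. cut n x * (LINT a|P. h a x)) \<in> borel_measurable lborel" by measurable
      qed measurable
      finally show ?thesis by (simp add: mult.commute)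
    qed
    also have "\<dots> = (LINT a|P. LINT x|lborel. cut n x * h a x)" using L.Fubini_integral[OF PL] by simp
    finally have eq: "m * (LBINT x. cut n (x :: real ^ 'n)) = (LINT a|P. LINT x|lborel. cut n x * h a x)" .
    have "0 \<le> (LBINT x. cut n (x :: real ^ 'n))" using c0 by simp
    then have "ennreal (\<bar>m\<bar> * (LBINT x. cut n (x :: real ^ 'n))) = ennreal (norm (LINT a|P. LINT x|lborel. cut n x * h a x))"
      unfolding eq[symmetric] by (simp add: abs_mult)
    also have "\<dots> \<le> (\<integral>\<^sup>+a. ennreal (norm (LBINT x. cut n x * h a x)) \<partial>P)"
      using L.integrable_fst[OF PL] by (rule integral_norm_bound_ennreal)
    also have "\<dots> \<le> (\<integral>\<^sup>+a. (\<Sum>k\<in>UNIV. \<integral>\<^sup>+x. ?g n k a x \<partial>lborel) \<partial>P)"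
    proof (rule nn_integral_mono_AE)
      show "AE a in P. ennreal (norm (LBINT x. cut n x * h a x))
        \<le> (\<Sum>k\<in>UNIV. \<integral>\<^sup>+x. ?g n k a x \<partial>lborel)"
        using \<phi> F2 D2 div
      proof eventually_elim
        case (elim a)
        define v where "v x = \<phi> a (w + x) - \<phi> a x" for x
        define Dv where "Dv k x = D k a (w + x) - D k a x" for k x
        have wv: "wd k v (Dv k)" for k unfolding v_def[abs_def] Dv_def[abs_def] using elim by (intro wd_diff wd_translate) auto
        have L2lt: "L2l (\<lambda>x. u (w + x) - u x)" if "L2l u" for u :: "real ^ 'n \<Rightarrow> real"
          using L2l_add[OF L2l_affine[OF that, of 1 w] L2l_cmult[OF that, of "-1"]] by simp
        have Lv: "L2l v" "L2l (Dv k)" for k unfolding v_def[abs_def] Dv_def[abs_def] using elim by (auto intro!: L2lt)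
        obtain R where R: "R > 0" "\<And>x :: real ^ 'n. R < norm x \<Longrightarrow> cut n x = 0" "\<And>(x :: real ^ 'n) k. R < norm x \<Longrightarrow> partial k (cut n) x = 0"
          using test_funE[OF tc(1)] by metis
        have wd1: "wd k (\<lambda>x. cut n x * v x) (\<lambda>x. partial k (cut n) x * v x + cut n x * Dv k x)" for k
          by (intro wd_mult wd_smooth wv Lv smooth_L2l test_fun_smooth tc)
        have Lt: "L2 (\<lambda>x. \<psi> x * u x)" if "L2l u" "test_fun \<psi>" for u \<psi> :: "real ^ 'n \<Rightarrow> real"
          using L2l_mult_test[OF that] by (simp add: mult.commute)
        \<comment> \<open>The divergence-free condition tested with the cutoff times the increment.
          It trades the gradient of the increment, which carries \<open>h\<close>, for the gradient
          of the cutoff.\<close>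
        have "(\<Sum>k\<in>UNIV. LBINT x. F k a x * (partial k (cut n) x * v x + cut n x * Dv k x)) + (LBINT x. 0 * (cut n x * v x)) = 0"
          by (rule wd_test_extend_cs[where R = R and g = "\<lambda>x. 0"])
             (use elim wd1 R in \<open>auto intro!: L2_add Lt Lv tc simp: L2_L2l L2_0\<close>)
        then have s0: "(\<Sum>k\<in>UNIV. LBINT x. F k a x * (partial k (cut n) x * v x + cut n x * Dv k x)) = 0" by simp
        have ia: "integrable lborel (\<lambda>x. (partial k (cut n) x * v x) * F k a x)" for k
          by (rule L2l_cs_integrable[where R = R]) (use elim R in \<open>auto intro!: Lt Lv tc\<close>)
        have ib: "integrable lborel (\<lambda>x. (cut n x * Dv k x) * F k a x)" for k
          by (rule L2l_cs_integrable[where R = R]) (use elim R in \<open>auto intro!: Lt Lv tc\<close>)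
        have "(LBINT x. F k a x * (partial k (cut n) x * v x + cut n x * Dv k x))
          = (LBINT x. (partial k (cut n) x * v x) * F k a x) + (LBINT x. (cut n x * Dv k x) * F k a x)" for k
          using ia[of k] ib[of k] by (simp add: distrib_left mult.commute)
        then have "(\<Sum>k\<in>UNIV. LBINT x. (cut n x * Dv k x) * F k a x) = - (\<Sum>k\<in>UNIV. LBINT x. (partial k (cut n) x * v x) * F k a x)"
          using s0 by (simp add: sum.distrib)
        moreover have "(LBINT x. cut n x * h a x) = (\<Sum>k\<in>UNIV. LBINT x. (cut n x * Dv k x) * F k a x)"
        proof -
          have "cut n x * h a x = (\<Sum>k\<in>UNIV. (cut n x * Dv k x) * F k a x)" for x
            by (simp add: h_def Dv_def sum_distrib_left mult_ac)
          then show ?thesis using ib by (simp add: Bochner_Integration.integral_sum)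
        qed
        ultimately have "norm (LBINT x. cut n x * h a x) = norm (\<Sum>k\<in>UNIV. LBINT x. (partial k (cut n) x * v x) * F k a x)" by simp
        also have "\<dots> \<le> (\<Sum>k\<in>UNIV. norm (LBINT x. (partial k (cut n) x * v x) * F k a x))" by (rule norm_sum)
        finally have "ennreal (norm (LBINT x. cut n x * h a x)) \<le> ennreal (\<Sum>k\<in>UNIV. norm (LBINT x. (partial k (cut n) x * v x) * F k a x))"
          by (rule ennreal_leI)
        also have "\<dots> = (\<Sum>k\<in>UNIV. ennreal (norm (LBINT x. (partial k (cut n) x * v x) * F k a x)))" by (simp add: sum_ennreal)
        also have "\<dots> \<le> (\<Sum>k\<in>UNIV. \<integral>\<^sup>+x. ?g n k a x \<partial>lborel)"
        proof (rule sum_mono)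
          fix k
          have "ennreal (norm (LBINT x. (partial k (cut n) x * v x) * F k a x)) \<le> (LBINT\<^sup>+ x. ennreal (norm ((partial k (cut n) x * v x) * F k a x)))"
            by (rule integral_norm_bound_ennreal[OF ia])
          also have "\<dots> \<le> (LBINT\<^sup>+ x. ?g n k a x)"
          proof (rule nn_integral_mono)
            fix x
            have "\<bar>s * t\<bar> \<le> s^2 + t^2" for s t :: real
              using sum_squares_bound[of "\<bar>s\<bar>" "\<bar>t\<bar>"] mult_nonneg_nonneg[of "\<bar>s\<bar>" "\<bar>t\<bar>"] by (simp add: abs_mult del: mult_nonneg_nonneg)
            from mult_left_mono[OF this[of "v x" "F k a x"], of "\<bar>partial k (cut n) x\<bar>"]
            have "norm ((partial k (cut n) x * v x) * F k a x) \<le> \<bar>partial k (cut n) x\<bar> * ((v x)^2 + (F k a x)^2)"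
              by (simp add: abs_mult mult.assoc)
            then show "ennreal (norm ((partial k (cut n) x * v x) * F k a x)) \<le> ?g n k a x"
              by (simp add: v_def ennreal_mult'[symmetric] ennreal_plus[symmetric] ennreal_leI del: ennreal_plus)
          qed
          finally show "ennreal (norm (LBINT x. (partial k (cut n) x * v x) * F k a x))
            \<le> (LBINT\<^sup>+ x. ?g n k a x)" .
        qed
        finally show ?case .
      qed
    qed
    also have "\<dots> = (\<Sum>k\<in>UNIV. \<integral>\<^sup>+a. \<integral>\<^sup>+x. ?g n k a x \<partial>lborel \<partial>P)"
      by (rule nn_integral_sum) (rule lborel.borel_measurable_nn_integral, simp add: split_beta')
    also have "\<dots> \<le> (\<Sum>k\<in>UNIV. ennreal (J n k) * B k)"
    proof (rule sum_mono)
      fix k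
      have z: "(LBINT\<^sup>+ x. ennreal \<bar>partial k (cut n) (x :: real ^ 'n)\<bar>) = ennreal (J n k)"
        unfolding J_def by (rule nn_integral_eq_integral[OF ci(2)]) simp
      have "(\<integral>\<^sup>+a. \<integral>\<^sup>+x. ?g n k a x \<partial>lborel \<partial>P)
        = (\<integral>\<^sup>+a. (LBINT\<^sup>+ x. ennreal \<bar>partial k (cut n) x\<bar> * ennreal ((\<phi> a (w + x) - \<phi> a x)^2)) + (LBINT\<^sup>+ x. ennreal \<bar>partial k (cut n) x\<bar> * ennreal ((F k a (0 + x))^2)) \<partial>P)"
      proof (rule nn_integral_cong)
        fix a assume a: "a \<in> space P"
        have [measurable]: "\<phi> a \<in> borel_measurable borel" "F k a \<in> borel_measurable borel"
          using a j statf_jm[OF L2N_statf[OF F]] by (auto intro: jm_section)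
        show "(LBINT\<^sup>+ x. ?g n k a x)
          = (LBINT\<^sup>+ x. ennreal \<bar>partial k (cut n) x\<bar> * ennreal ((\<phi> a (w + x) - \<phi> a x)^2)) + (LBINT\<^sup>+ x. ennreal \<bar>partial k (cut n) x\<bar> * ennreal ((F k a (0 + x))^2))"
          by (simp add: distrib_left nn_integral_add)
      qed
      also have "\<dots> = (\<integral>\<^sup>+a. \<integral>\<^sup>+x. ennreal \<bar>partial k (cut n) x\<bar> * ennreal ((\<phi> a (w + x) - \<phi> a x)^2) \<partial>lborel \<partial>P)
         + (\<integral>\<^sup>+a. \<integral>\<^sup>+x. ennreal \<bar>partial k (cut n) x\<bar> * ennreal ((F k a (0 + x))^2) \<partial>lborel \<partial>P)"
        by (rule nn_integral_add) (rule lborel.borel_measurable_nn_integral, simp add: split_beta')+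
      also have "\<dots> \<le> (\<integral>\<^sup>+p. ennreal ((\<Sum>k\<in>UNIV. w $ k * D k (fst p) (snd p))^2) \<partial>N) * ennreal (J n k)
         + (\<integral>\<^sup>+p. ennreal ((F k (fst p) (snd p))^2) \<partial>N) * ennreal (J n k)"
      proof (rule add_mono)
        show "(\<integral>\<^sup>+a. \<integral>\<^sup>+x. ennreal \<bar>partial k (cut n) x\<bar> * ennreal ((\<phi> a (w + x) - \<phi> a x)^2) \<partial>lborel \<partial>P)
          \<le> (\<integral>\<^sup>+p. ennreal ((\<Sum>k\<in>UNIV. w $ k * D k (fst p) (snd p))^2) \<partial>N) * ennreal (J n k)"
          unfolding z[symmetric] by (rule increment_bound[OF D \<phi>(1)]) measurable
        show "(\<integral>\<^sup>+a. \<integral>\<^sup>+x. ennreal \<bar>partial k (cut n) x\<bar> * ennreal ((F k a (0 + x))^2) \<partial>lborel \<partial>P)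
          \<le> (\<integral>\<^sup>+p. ennreal ((F k (fst p) (snd p))^2) \<partial>N) * ennreal (J n k)"
          unfolding z[symmetric]
          by (rule eq_refl, rule statf_integral_nn[where g = "\<lambda>a x. ennreal ((F k a x)^2)"])
             (auto intro!: statf_comp[OF L2N_statf[OF F], of "\<lambda>t. ennreal (t^2)"])
      qed
      also have "\<dots> = ennreal (J n k) * B k" unfolding B_def by (simp add: distrib_left mult.commute)
      finally show "(\<integral>\<^sup>+a. \<integral>\<^sup>+x. ?g n k a x \<partial>lborel \<partial>P) \<le> ennreal (J n k) * B k" .
    qed
    finally show ?thesis .
  qed
  define b0 where "b0 = (LBINT x. bump 0 (x :: real ^ 'n)) / bump 0 (0 :: real ^ 'n)"
  have b0: "b0 > 0" unfolding b0_def by (intro divide_pos_pos integral_bump_pos bump_0)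
  define J0 where "J0 k = (LBINT x. \<bar>partial k (bump 0) (x :: real ^ 'n)\<bar>) / bump 0 (0 :: real ^ 'n)" for k
  have J0: "J0 k \<ge> 0" for k unfolding J0_def using bump_0[where 'a='n] by simp
  define C where "C = (\<Sum>k\<in>UNIV. J0 k * enn2real (B k))"
  \<comment> \<open>Both sides of \<open>key\<close> contain the volume factor (n+1)^d. After
    cancelling it, only the right-hand side retains 1/(n+1).\<close>
  have "\<bar>m\<bar> * b0 \<le> C * inverse (real (Suc n))" for n
  proof -
    define s where "s = real (Suc n) ^ CARD('n)"
    have s: "s > 0" by (simp add: s_def)
    have Jn: "J n k = s * (inverse (real (Suc n)) * J0 k)" for k
      unfolding J_def integral_cut(2) J0_def s_def by simp
    have "(\<Sum>k\<in>UNIV. ennreal (J n k) * B k) = (\<Sum>k\<in>UNIV. ennreal (J n k * enn2real (B k)))"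
    proof (rule sum.cong[OF refl])
      fix k
      have "B k = ennreal (enn2real (B k))" using B[of k] by (simp add: less_top)
      then show "ennreal (J n k) * B k = ennreal (J n k * enn2real (B k))" by (metis enn2real_nonneg ennreal_mult'')
    qed
    also have "\<dots> = ennreal (s * (inverse (real (Suc n)) * C))"
      using J0 s by (simp add: sum_ennreal Jn C_def sum_distrib_left mult_ac del: of_nat_Suc)
    finally have "ennreal (\<bar>m\<bar> * (s * b0)) \<le> ennreal (s * (inverse (real (Suc n)) * C))"
      using key[of n] unfolding integral_cut(1) b0_def[symmetric] s_def[symmetric] by simp
    moreover have "0 \<le> s * (inverse (real (Suc n)) * C)"
      using s J0 by (intro mult_nonneg_nonneg) (auto simp: C_def intro!: sum_nonneg)
    ultimately have "s * (\<bar>m\<bar> * b0) \<le> s * (inverse (real (Suc n)) * C)" by (simp add: ennreal_le_iff mult.left_commute)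
    then have "\<bar>m\<bar> * b0 \<le> inverse (real (Suc n)) * C" using s by (rule mult_left_le_imp_le)
    then show ?thesis by (simp only: mult.commute)
  qed
  moreover have "(\<lambda>n. C * inverse (real (Suc n))) \<longlonglongrightarrow> C * 0" by (intro tendsto_intros LIMSEQ_inverse_real_of_nat)
  ultimately have "\<bar>m\<bar> * b0 \<le> C * 0" by (intro LIMSEQ_le_const[of "\<lambda>n. C * inverse (real (Suc n))"]) auto
  then have "m = 0" using b0 by (simp add: mult_le_0_iff)
  then show ?thesis using m_eq by simp
qed


section \<open>The mean ergodic theorem\<close>

lemma integral_unifc:
  fixes f :: "real ^ 'n \<Rightarrow> real"
  assumes r: "r > 0" and [measurable]: "f \<in> borel_measurable borel"
  shows "(LINT z|unifc r. f z) = 1 / measure lebesgue (cube (0 :: real ^ 'n) r) * (LINT z:cube 0 r|lebesgue. f z)"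
proof -
  have m [measurable]: "cube (0 :: real ^ 'n) r \<in> sets borel" using r by simp
  have "unifc r = density lborel (\<lambda>x::real ^ 'n. ennreal (indicator (cube 0 r) x / measure lborel (cube (0 :: real ^ 'n) r)))"
    unfolding unifc_def uniform_measure_def
  proof (rule density_cong)
    show "AE x::real ^ 'n in lborel. indicator (cube 0 r) x / emeasure lborel (cube (0 :: real ^ 'n) r) = ennreal (indicator (cube 0 r) x / measure lborel (cube (0 :: real ^ 'n) r))"
    proof (rule AE_I2)
      fix x :: "real ^ 'n"
      have "emeasure lborel (cube (0 :: real ^ 'n) r) = ennreal (measure lborel (cube (0 :: real ^ 'n) r))"
        using cube_finite[OF r, of "0 :: real ^ 'n"] by (simp add: emeasure_eq_ennreal_measure)
      then show "indicator (cube 0 r) x / emeasure lborel (cube (0 :: real ^ 'n) r) = ennreal (indicator (cube 0 r) x / measure lborel (cube (0 :: real ^ 'n) r))"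
        using kern_cube(2)[OF r, where 'n='n] by (simp add: indicator_def divide_ennreal[symmetric])
    qed
  qed (use m in measurable)
  then have "(LINT z|unifc r. f z) = (LBINT z. indicator (cube 0 r) z / measure lborel (cube (0 :: real ^ 'n) r) * f z)"
    using kern_cube(2)[OF r, where 'n='n] by (simp add: integral_density)
  also have "\<dots> = 1 / measure lborel (cube (0 :: real ^ 'n) r) * (LINT z:cube 0 r|lborel. f z)"
    by (simp add: set_lebesgue_integral_def)
  also have "measure lborel (cube (0 :: real ^ 'n) r) = measure lebesgue (cube (0 :: real ^ 'n) r)" by simp
  also have "(LINT z:cube 0 r|lborel. f z) = (LINT z:cube 0 r|lebesgue. f z)"
    by (rule set_integral_lebesgue[symmetric]) measurable
  finally show ?thesis .
qed

definition avg :: "real \<Rightarrow> ('n coeff \<Rightarrow> real) \<Rightarrow> 'n coeff \<Rightarrow> real" where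
  "avg r f a = (LINT z|unifc r. f (shift z a))"

lemma avg_borel:
  assumes "r > 0" and [measurable]: "f \<in> borel_measurable P" shows "avg r f \<in> borel_measurable P"
proof -
  interpret U: prob_space "unifc r :: (real ^ 'n) measure" using assms(1) by (rule prob_space_unifc)
  show ?thesis unfolding avg_def[abs_def] by (intro U.borel_measurable_lebesgue_integral) measurable
qed

text \<open>Averaging over shifts is a contraction in mean square, by Jensen and invariance of the
  law. It controls the tail that truncation leaves.\<close>

lemma nn_integral_avg_le:
  assumes r: "r > 0" and [measurable]: "f \<in> borel_measurable P"
  shows "(\<integral>\<^sup>+a. ennreal ((avg r f a)^2) \<partial>P) \<le> (\<integral>\<^sup>+a. ennreal ((f a)^2) \<partial>P)"
proof -
  interpret U: prob_space "unifc r :: (real ^ 'n) measure" using r by (rule prob_space_unifc)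
  interpret PU: pair_sigma_finite P "unifc r :: (real ^ 'n) measure" ..
  have "(\<integral>\<^sup>+a. ennreal ((avg r f a)^2) \<partial>P) \<le> (\<integral>\<^sup>+a. \<integral>\<^sup>+z. ennreal ((f (shift z a))^2) \<partial>unifc r \<partial>P)"
    unfolding avg_def by (intro nn_integral_mono square_integral_le_nn_integral U.prob_space_axioms) measurable
  also have "\<dots> = (\<integral>\<^sup>+z. \<integral>\<^sup>+a. ennreal ((f (shift z a))^2) \<partial>P \<partial>unifc r)"
    by (rule PU.Fubini'[symmetric]) measurable
  also have "\<dots> = (\<integral>\<^sup>+z. (\<integral>\<^sup>+a. ennreal ((f a)^2) \<partial>P) \<partial>(unifc r :: (real ^ 'n) measure))"
    by (intro nn_integral_cong nn_integral_shift) measurable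
  also have "\<dots> = (\<integral>\<^sup>+a. ennreal ((f a)^2) \<partial>P)" using U.emeasure_space_1 by (simp del: U.emeasure_space_1)
  finally show ?thesis .
qed

lemma avg_integrable_AE:
  fixes f :: "'n coeff \<Rightarrow> real"
  assumes r: "r > 0" and f: "integrable P f"
  shows "AE a in P. integrable (unifc r) (\<lambda>z. f (shift z a))"
proof -
  interpret U: prob_space "unifc r :: (real ^ 'n) measure" using r by (rule prob_space_unifc)
  interpret PU: pair_sigma_finite P "unifc r :: (real ^ 'n) measure" ..
  have [measurable]: "f \<in> borel_measurable P" using f by auto
  have "(\<integral>\<^sup>+a. \<integral>\<^sup>+z. ennreal (norm (f (shift z a))) \<partial>unifc r \<partial>P) = (\<integral>\<^sup>+z. \<integral>\<^sup>+a. ennreal (norm (f (shift z a))) \<partial>P \<partial>unifc r)"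
    by (rule PU.Fubini'[symmetric]) measurable
  also have "\<dots> = (\<integral>\<^sup>+z. (\<integral>\<^sup>+a. ennreal (norm (f a)) \<partial>P) \<partial>(unifc r :: (real ^ 'n) measure))"
    by (intro nn_integral_cong nn_integral_shift) measurable
  also have "\<dots> = (\<integral>\<^sup>+a. ennreal (norm (f a)) \<partial>P)" using U.emeasure_space_1 by (simp del: U.emeasure_space_1)
  also have "\<dots> < \<infinity>" using f by (simp add: integrable_iff_bounded)
  finally have "AE a in P. (\<integral>\<^sup>+z. ennreal (norm (f (shift z a))) \<partial>unifc r) \<noteq> \<infinity>"
    by (intro nn_integral_PInf_AE U.borel_measurable_nn_integral) auto
  then show ?thesis
  proof (rule AE_mp, intro AE_I2 impI)
    fix a assume a: "a \<in> space P" and fin: "(\<integral>\<^sup>+z. ennreal (norm (f (shift z a))) \<partial>unifc r) \<noteq> \<infinity>"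
    have "(\<lambda>z. f (shift z a)) \<in> borel_measurable (unifc r)" using a by measurable
    then show "integrable (unifc r) (\<lambda>z. f (shift z a))"
      using fin by (simp add: integrable_iff_bounded top.not_eq_extremum)
  qed
qed

text \<open>Ergodicity provides convergence almost everywhere. For the truncation of
  \<open>f\<close> the averages are bounded, so dominated convergence gives convergence in mean
  square; the remainder is handled by contraction.\<close>

lemma mean_ergodic:
  assumes erg: "ergodic P" and f: "integrable P (\<lambda>a. (f a)^2)" "f \<in> borel_measurable P" and f0: "(LINT a|P. f a) = 0" and e: "e > 0"
  shows "eventually (\<lambda>n. (\<integral>\<^sup>+a. ennreal ((avg (real (Suc n)) f a)^2) \<partial>P) \<le> ennreal e) sequentially"
proof -
  have [measurable]: "f \<in> borel_measurable P" by fact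
  have fi: "integrable P f" by (rule square_integrable_imp_integrable[OF f(2,1)])
  define g where "g M a = max (- real M) (min (real M) (f a))" for M a
  have [measurable]: "g M \<in> borel_measurable P" for M unfolding g_def by measurable
  have gb: "\<bar>g M a\<bar> \<le> real M" for M a by (auto simp: g_def)
  have gf: "(f a - g M a)^2 \<le> (f a)^2" for M a
  proof -
    have "\<bar>f a - g M a\<bar> \<le> \<bar>f a\<bar>" by (simp add: g_def max_def min_def abs_if)
    then show ?thesis by (simp add: abs_le_square_iff)
  qed
  have "(\<lambda>M. LINT a|P. (f a - g M a)^2) \<longlonglongrightarrow> (LINT a|P. 0)"
  proof (rule integral_dominated_convergence[where w = "\<lambda>a. (f a)^2"])
    show "AE a in P. (\<lambda>M. (f a - g M a)^2) \<longlonglongrightarrow> 0"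
    proof (rule AE_I2)
      fix a
      have "eventually (\<lambda>M. (f a - g M a)^2 = 0) sequentially"
        using eventually_ge_at_top[of "nat \<lceil>\<bar>f a\<bar>\<rceil>"]
      proof eventually_elim
        case (elim M)
        then have "\<bar>f a\<bar> \<le> real M" by linarith
        then have "g M a = f a" by (auto simp: g_def)
        then show ?case by simp
      qed
      then show "(\<lambda>M. (f a - g M a)^2) \<longlonglongrightarrow> 0" by (rule tendsto_eventually)
    qed
    show "AE a in P. norm ((f a - g M a)^2) \<le> (f a)^2" for M using gf by simp
  next
    show "(\<lambda>a. (f a - g M a)^2) \<in> borel_measurable P" for M by measurable
    show "integrable P (\<lambda>a. (f a)^2)" by (rule f(1))
  qed simp
  from order_tendstoD(2)[OF this, of "e / 8"] e
  have "eventually (\<lambda>M. (LINT a|P. (f a - g M a)^2) < e / 8) sequentially" by simp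
  then obtain M where M: "(LINT a|P. (f a - g M a)^2) < e / 8" by (auto simp: eventually_sequentially)
  have gi: "integrable P (g M)" by (rule integrable_const_bound[of _ "real M"]) (simp_all add: gb)
  have fgi: "integrable P (\<lambda>a. (f a - g M a)^2)"
    by (rule Bochner_Integration.integrable_bound[OF f(1)]) (simp_all add: gf)
  \<comment> \<open>Truncation destroys mean zero, but only by the mean of the remainder, whose
    square is below e/8.\<close>
  have Eg: "(LINT a|P. g M a)^2 < e / 8"
  proof -
    have "(LINT a|P. f a - g M a) = - (LINT a|P. g M a)" using fi gi f0 by simp
    moreover have "(LINT a|P. f a - g M a)^2 \<le> (LINT a|P. (f a - g M a)^2)"
    proof -
      have "ennreal ((LINT a|P. f a - g M a)^2) \<le> (\<integral>\<^sup>+a. ennreal ((f a - g M a)^2) \<partial>P)"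
        by (intro square_integral_le_nn_integral prob_space_axioms) measurable
      also have "\<dots> = ennreal (LINT a|P. (f a - g M a)^2)" using fgi by (simp add: nn_integral_eq_integral)
      finally show ?thesis by (simp add: ennreal_le_iff)
    qed
    ultimately show ?thesis using M by simp
  qed
  have avgb: "\<bar>avg (real (Suc n)) (g M) a\<bar> \<le> real M" if a: "a \<in> space P" for n a
  proof -
    interpret U: prob_space "unifc (real (Suc n)) :: (real ^ 'n) measure" by (rule prob_space_unifc) simp
    have "(\<lambda>z. g M (shift z a)) \<in> borel_measurable (unifc (real (Suc n)))" using a by measurable
    then have i: "integrable (unifc (real (Suc n))) (\<lambda>z. g M (shift z a))"
      by (intro U.integrable_const_bound[of _ "real M"]) (simp_all add: gb)
    have "norm (LINT z|unifc (real (Suc n)). g M (shift z a)) \<le> (LINT z|(unifc (real (Suc n)) :: (real ^ 'n) measure). real M)"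
      by (rule Bochner_Integration.integral_norm_bound_integral[OF i]) (simp_all add: gb del: of_nat_Suc)
    then show ?thesis unfolding avg_def using U.prob_space by simp
  qed
  have lim: "(\<lambda>n. LINT a|P. (avg (real (Suc n)) (g M) a)^2) \<longlonglongrightarrow> (LINT a|P. (LINT a|P. g M a)^2)"
  proof (rule integral_dominated_convergence[where w = "\<lambda>a. (real M)^2"])
    have "AE a in P. ((\<lambda>R. (1 / measure lebesgue (cube (0 :: real ^ 'n) R)) * (LINT z:cube 0 R|lebesgue. g M (shift z a))) \<longlongrightarrow> (LINT a'|P. g M a')) at_top"
      using erg gi unfolding ergodic_def by blast
    then show "AE a in P. (\<lambda>n. (avg (real (Suc n)) (g M) a)^2) \<longlonglongrightarrow> (LINT a|P. g M a)^2"
    proof (rule AE_mp, intro AE_I2 impI)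
      fix a assume a: "a \<in> space P" and lim: "((\<lambda>R. (1 / measure lebesgue (cube (0 :: real ^ 'n) R)) * (LINT z:cube 0 R|lebesgue. g M (shift z a))) \<longlongrightarrow> (LINT a'|P. g M a')) at_top"
      have m: "(\<lambda>z. g M (shift z a)) \<in> borel_measurable borel" using a by measurable
      have "filterlim (\<lambda>n. real (Suc n)) at_top sequentially"
        by (rule filterlim_compose[OF filterlim_real_sequentially filterlim_Suc])
      from filterlim_compose[OF lim this]
      have "(\<lambda>n. avg (real (Suc n)) (g M) a) \<longlonglongrightarrow> (LINT a|P. g M a)"
        unfolding avg_def using m by (simp add: integral_unifc del: of_nat_Suc)
      then show "(\<lambda>n. (avg (real (Suc n)) (g M) a)^2) \<longlonglongrightarrow> (LINT a|P. g M a)^2" by (rule tendsto_power)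
    qed
    show "AE a in P. norm ((avg (real (Suc n)) (g M) a)^2) \<le> (real M)^2" for n
    proof (rule AE_I2)
      fix a assume "a \<in> space P"
      from power_mono[OF avgb[OF this, of n], of 2] show "norm ((avg (real (Suc n)) (g M) a)^2) \<le> (real M)^2" by simp
    qed
  next
    have [measurable]: "avg (real (Suc n)) (g M) \<in> borel_measurable P" for n by (rule avg_borel) auto
    show "(\<lambda>a. (LINT a|P. g M a)^2) \<in> borel_measurable P" "(\<lambda>a. (avg (real (Suc n)) (g M) a)^2) \<in> borel_measurable P" for n
      by measurable
    show "integrable P (\<lambda>a. (real M)^2)" by simp
  qed
  have "eventually (\<lambda>n. (LINT a|P. (avg (real (Suc n)) (g M) a)^2) < e / 8) sequentially"
    by (rule order_tendstoD(2)[OF lim]) (use Eg in \<open>simp add: prob_space\<close>)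
  then show ?thesis
  proof eventually_elim
  fix n assume n: "(LINT a|P. (avg (real (Suc n)) (g M) a)^2) < e / 8"
  define r where "r = real (Suc n)"
  have r: "r > 0" by (simp add: r_def)
  have agi: "integrable P (\<lambda>a. (avg r (g M) a)^2)"
  proof (rule integrable_const_bound[of _ "(real M)^2"])
    show "AE a in P. norm ((avg r (g M) a)^2) \<le> (real M)^2"
    proof (rule AE_I2)
      fix a assume "a \<in> space P"
      from power_mono[OF avgb[OF this, of n], of 2] show "norm ((avg r (g M) a)^2) \<le> (real M)^2" by (simp add: r_def)
    qed
    have [measurable]: "avg r (g M) \<in> borel_measurable P" by (rule avg_borel[OF r]) measurable
    show "(\<lambda>a. (avg r (g M) a)^2) \<in> borel_measurable P" by measurable
  qed
  have lin: "AE a in P. avg r f a = avg r (g M) a + avg r (\<lambda>a. f a - g M a) a"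
    using avg_integrable_AE[OF r fi] avg_integrable_AE[OF r gi]
    by eventually_elim (simp add: avg_def)
  have "(\<integral>\<^sup>+a. ennreal ((avg r f a)^2) \<partial>P) \<le> (\<integral>\<^sup>+a. 2 * ennreal ((avg r (g M) a)^2) + 2 * ennreal ((avg r (\<lambda>a. f a - g M a) a)^2) \<partial>P)"
  proof (rule nn_integral_mono_AE)
    show "AE a in P. ennreal ((avg r f a)^2) \<le> 2 * ennreal ((avg r (g M) a)^2) + 2 * ennreal ((avg r (\<lambda>a. f a - g M a) a)^2)"
      using lin
    proof eventually_elim
      case (elim a)
      have "(avg r f a)^2 \<le> 2 * (avg r (g M) a)^2 + 2 * (avg r (\<lambda>a. f a - g M a) a)^2"
        unfolding elim using sum_squares_bound[of "avg r (g M) a" "avg r (\<lambda>a. f a - g M a) a"] by (simp add: power2_sum)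
      moreover have "2 * ennreal t = ennreal (2 * t)" for t by (simp add: ennreal_mult')
      ultimately show ?case by (simp add: ennreal_plus[symmetric] ennreal_leI del: ennreal_plus)
    qed
  qed
  also have "\<dots> = 2 * (\<integral>\<^sup>+a. ennreal ((avg r (g M) a)^2) \<partial>P) + 2 * (\<integral>\<^sup>+a. ennreal ((avg r (\<lambda>a. f a - g M a) a)^2) \<partial>P)"
  proof -
    have [measurable]: "avg r (g M) \<in> borel_measurable P" "avg r (\<lambda>a. f a - g M a) \<in> borel_measurable P"
      by (rule avg_borel[OF r]; measurable)+
    show ?thesis by (simp add: nn_integral_add nn_integral_cmult)
  qed
  also have "\<dots> \<le> 2 * ennreal (e / 8) + 2 * ennreal (e / 8)"
  proof (intro add_mono mult_left_mono)
    show "(\<integral>\<^sup>+a. ennreal ((avg r (g M) a)^2) \<partial>P) \<le> ennreal (e / 8)"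
      using agi n by (simp add: nn_integral_eq_integral r_def ennreal_leI)
    have "(\<integral>\<^sup>+a. ennreal ((avg r (\<lambda>a. f a - g M a) a)^2) \<partial>P) \<le> (\<integral>\<^sup>+a. ennreal ((f a - g M a)^2) \<partial>P)"
      by (rule nn_integral_avg_le[OF r]) measurable
    also have "\<dots> \<le> ennreal (e / 8)" using fgi M by (simp add: nn_integral_eq_integral ennreal_leI)
    finally show "(\<integral>\<^sup>+a. ennreal ((avg r (\<lambda>a. f a - g M a) a)^2) \<partial>P) \<le> ennreal (e / 8)" .
  qed auto
  also have "\<dots> \<le> ennreal e"
  proof -
    have "2 * ennreal t = ennreal (2 * t)" for t by (simp add: ennreal_mult')
    then show ?thesis using e by (simp add: ennreal_plus[symmetric] ennreal_leI del: ennreal_plus)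
  qed
  finally show "(\<integral>\<^sup>+a. ennreal ((avg (real (Suc n)) f a)^2) \<partial>P) \<le> ennreal e" unfolding r_def .
  qed
qed


section \<open>Orthogonality of divergence-free fields and gradients\<close>

lemma nn_integral_N_fst:
  fixes g :: "'n coeff \<Rightarrow> real ^ 'n \<Rightarrow> ennreal"
  assumes "jm g" shows "(\<integral>\<^sup>+p. g (fst p) (snd p) \<partial>N) = (\<integral>\<^sup>+a. \<integral>\<^sup>+y. g a y \<partial>unifc 1 \<partial>P)"
  using Q1.nn_integral_fst[of "\<lambda>p. g (fst p) (snd p)" P] jm_N[OF assms] by simp

lemma L2N_average:
  assumes D: "L2N D" and r: "r > 0"
  shows "L2N (\<lambda>a x. LINT z|unifc r. D a (x + z))"
proof -
  interpret U: prob_space "unifc r :: (real ^ 'n) measure" using r by (rule prob_space_unifc)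
  interpret NU: pair_sigma_finite N "unifc r :: (real ^ 'n) measure" ..
  have j: "jm D" using D by (intro statf_jm L2N_statf)
  have m: "(\<lambda>q. D (fst (fst q)) (snd (fst q) + snd q)) \<in> borel_measurable ((P \<Otimes>\<^sub>M lborel) \<Otimes>\<^sub>M unifc r)"
    "(\<lambda>q. D (fst (fst q)) (snd (fst q) + snd q)) \<in> borel_measurable (N \<Otimes>\<^sub>M unifc r)"
    by (rule jm_comp[OF j]; measurable)+
  have jD: "jm (\<lambda>a x. LINT z|unifc r. D a (x + z))"
    unfolding jm_iff by (rule U.borel_measurable_lebesgue_integral) (use m(1) in \<open>simp add: split_beta'\<close>)
  have "statf (\<lambda>a x. LINT z|unifc r. D a (x + z))"
    unfolding statf_def
  proof (intro conjI allI jD)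
    fix w
    have "AE a in P. AE y in lborel. D (shift w a) y = D a (w + y)" using D by (auto simp: L2N_def statf_def)
    moreover have "AE a in P. a \<in> space P" "AE a in P. shift w a \<in> space P"
      using measurable_space[OF shift_measurable[of w]] by auto
    ultimately show "AE a in P. AE x in lborel. (LINT z|unifc r. D (shift w a) (x + z)) = (LINT z|unifc r. D a (w + x + z))"
    proof eventually_elim
      case (elim a)
      have [measurable]: "D a \<in> borel_measurable borel" "D (shift w a) \<in> borel_measurable borel"
        using elim by (auto intro: jm_section[OF j])
      have "(LINT z|unifc r. D (shift w a) (x + z)) = (LINT z|unifc r. D a (w + x + z))" for x
      proof (rule integral_cong_AE)
        from AE_unifc[OF AE_lborel_translate[OF elim(1), of x] r]
        show "AE z in unifc r. D (shift w a) (x + z) = D a (w + x + z)" by eventually_elim (simp add: add.assoc)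
      qed measurable
      then show ?case by simp
    qed
  qed
  moreover have "(\<integral>\<^sup>+p. ennreal ((LINT z|unifc r. D (fst p) (snd p + z))^2) \<partial>N) < \<infinity>"
  proof -
    have "(\<integral>\<^sup>+p. ennreal ((LINT z|unifc r. D (fst p) (snd p + z))^2) \<partial>N) \<le> (\<integral>\<^sup>+p. \<integral>\<^sup>+z. ennreal ((D (fst p) (snd p + z))^2) \<partial>unifc r \<partial>N)"
    proof (rule nn_integral_mono)
      fix p assume "p \<in> space N"
      then have "fst p \<in> space P" by (auto simp: space_pair_measure)
      then have [measurable]: "D (fst p) \<in> borel_measurable borel" by (rule jm_section[OF j])
      show "ennreal ((LINT z|unifc r. D (fst p) (snd p + z))^2) \<le> (\<integral>\<^sup>+z. ennreal ((D (fst p) (snd p + z))^2) \<partial>unifc r)"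
        by (intro square_integral_le_nn_integral U.prob_space_axioms) measurable
    qed
    also have "\<dots> = (\<integral>\<^sup>+z. \<integral>\<^sup>+p. ennreal ((D (fst p) (snd p + z))^2) \<partial>N \<partial>unifc r)"
      by (rule NU.Fubini'[symmetric]) (use m(2) in \<open>simp add: split_beta'\<close>)
    also have "\<dots> = (\<integral>\<^sup>+z. (\<integral>\<^sup>+p. ennreal ((D (fst p) (snd p))^2) \<partial>N) \<partial>(unifc r :: (real ^ 'n) measure))"
    proof (rule nn_integral_cong)
      fix z
      have "statf (\<lambda>a x. ennreal ((D a x)^2))" using D by (intro statf_comp[of D "\<lambda>t. ennreal (t^2)"] L2N_statf) auto
      from nn_integral_N_translate[OF this, of z]
      show "(\<integral>\<^sup>+p. ennreal ((D (fst p) (snd p + z))^2) \<partial>N) = (\<integral>\<^sup>+p. ennreal ((D (fst p) (snd p))^2) \<partial>N)"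
        unfolding add.commute[of z] .
    qed
    also have "\<dots> = (\<integral>\<^sup>+p. ennreal ((D (fst p) (snd p))^2) \<partial>N)" using U.emeasure_space_1 by (simp del: U.emeasure_space_1)
    also have "\<dots> < \<infinity>" using D by (rule L2N_nn)
    finally show ?thesis .
  qed
  ultimately show ?thesis by (simp add: L2N_iff)
qed

text \<open>Fubini's theorem; integrability on the triple product comes from splitting the product
  into squares and using that second moments do not depend on the translation.\<close>

lemma pairing_average:
  assumes F: "L2N F" and D: "L2N D" and r: "r > 0"
  shows "integrable (unifc r) (\<lambda>z. LINT p|N. F (fst p) (snd p) * D (fst p) (w + z + snd p))"
    "(LINT p|N. F (fst p) (snd p) * (LINT z|unifc r. D (fst p) (w + snd p + z)))
      = (LINT z|unifc r. LINT p|N. F (fst p) (snd p) * D (fst p) (w + z + snd p))"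
proof -
  interpret U: prob_space "unifc r :: (real ^ 'n) measure" using r by (rule prob_space_unifc)
  interpret NU: pair_sigma_finite N "unifc r :: (real ^ 'n) measure" ..
  have j: "jm D" "jm F" using D F by (auto intro: statf_jm L2N_statf)
  have mD [measurable]: "(\<lambda>q. D (fst (fst q)) (w + snd q + snd (fst q))) \<in> borel_measurable (N \<Otimes>\<^sub>M unifc r)"
    by (rule jm_comp[OF j(1)]) measurable
  have mF [measurable]: "(\<lambda>q. F (fst (fst q)) (snd (fst q))) \<in> borel_measurable (N \<Otimes>\<^sub>M unifc r)"
    by (rule jm_comp[OF j(2)]) measurable
  have sF: "statf (\<lambda>a x. ennreal ((F a x)^2))" and sD: "statf (\<lambda>a x. ennreal ((D a x)^2))"
    using F D by (auto intro!: statf_comp[of _ "\<lambda>t. ennreal (t^2)"] L2N_statf)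
  have P: "integrable (N \<Otimes>\<^sub>M unifc r) (\<lambda>(p, z). F (fst p) (snd p) * D (fst p) (w + z + snd p))"
    unfolding integrable_iff_bounded
  proof
    show "(\<lambda>(p, z). F (fst p) (snd p) * D (fst p) (w + z + snd p)) \<in> borel_measurable (N \<Otimes>\<^sub>M unifc r)"
      by (simp add: split_beta')
    have "(\<integral>\<^sup>+q. ennreal (norm (case q of (p, z) \<Rightarrow> F (fst p) (snd p) * D (fst p) (w + z + snd p))) \<partial>(N \<Otimes>\<^sub>M unifc r))
      \<le> (\<integral>\<^sup>+q. ennreal ((F (fst (fst q)) (snd (fst q)))^2) + ennreal ((D (fst (fst q)) (w + snd q + snd (fst q)))^2) \<partial>(N \<Otimes>\<^sub>M unifc r))"
    proof (rule nn_integral_mono)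
      fix q
      have "\<bar>s * t\<bar> \<le> s^2 + t^2" for s t :: real
        using sum_squares_bound[of "\<bar>s\<bar>" "\<bar>t\<bar>"] mult_nonneg_nonneg[of "\<bar>s\<bar>" "\<bar>t\<bar>"] by (simp add: abs_mult del: mult_nonneg_nonneg)
      then show "ennreal (norm (case q of (p, z) \<Rightarrow> F (fst p) (snd p) * D (fst p) (w + z + snd p)))
        \<le> ennreal ((F (fst (fst q)) (snd (fst q)))^2) + ennreal ((D (fst (fst q)) (w + snd q + snd (fst q)))^2)"
        by (simp add: split_beta' ennreal_plus[symmetric] ennreal_leI del: ennreal_plus)
    qed
    also have "\<dots> = (\<integral>\<^sup>+z. \<integral>\<^sup>+p. ennreal ((F (fst p) (snd p))^2) + ennreal ((D (fst p) (w + z + snd p))^2) \<partial>N \<partial>unifc r)"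
      by (subst NU.nn_integral_snd[symmetric]) auto
    also have "\<dots> = (\<integral>\<^sup>+z. (\<integral>\<^sup>+p. ennreal ((F (fst p) (snd p))^2) \<partial>N) + (\<integral>\<^sup>+p. ennreal ((D (fst p) (snd p))^2) \<partial>N) \<partial>(unifc r :: (real ^ 'n) measure))"
    proof (rule nn_integral_cong)
      fix z
      have "(\<integral>\<^sup>+p. ennreal ((F (fst p) (snd p))^2) + ennreal ((D (fst p) (w + z + snd p))^2) \<partial>N)
        = (\<integral>\<^sup>+p. ennreal ((F (fst p) (snd p))^2) \<partial>N) + (\<integral>\<^sup>+p. ennreal ((D (fst p) (w + z + snd p))^2) \<partial>N)"
        by (rule nn_integral_add[OF jm_N[OF statf_jm[OF sF]] jm_N[OF statf_jm[OF statf_translate[OF sD]]]])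
      then show "(\<integral>\<^sup>+p. ennreal ((F (fst p) (snd p))^2) + ennreal ((D (fst p) (w + z + snd p))^2) \<partial>N)
        = (\<integral>\<^sup>+p. ennreal ((F (fst p) (snd p))^2) \<partial>N) + (\<integral>\<^sup>+p. ennreal ((D (fst p) (snd p))^2) \<partial>N)"
        using nn_integral_N_translate[OF sD, of "w + z"] by simp
    qed
    also have "\<dots> < \<infinity>" using U.emeasure_space_1 L2N_nn[OF F] L2N_nn[OF D] by (simp del: U.emeasure_space_1)
    finally show "(\<integral>\<^sup>+q. ennreal (norm (case q of (p, z) \<Rightarrow> F (fst p) (snd p) * D (fst p) (w + z + snd p))) \<partial>(N \<Otimes>\<^sub>M unifc r)) < \<infinity>" .
  qed
  show "integrable (unifc r) (\<lambda>z. LINT p|N. F (fst p) (snd p) * D (fst p) (w + z + snd p))"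
    using NU.integrable_snd[OF P] .
  have "(LINT z|unifc r. LINT p|N. F (fst p) (snd p) * D (fst p) (w + z + snd p)) = (LINT p|N. LINT z|unifc r. F (fst p) (snd p) * D (fst p) (w + z + snd p))"
    using NU.Fubini_integral[OF P] by simp
  then show "(LINT p|N. F (fst p) (snd p) * (LINT z|unifc r. D (fst p) (w + snd p + z)))
      = (LINT z|unifc r. LINT p|N. F (fst p) (snd p) * D (fst p) (w + z + snd p))"
    by (simp add: add_ac)
qed

lemma correlation_average:
  assumes F: "\<And>k. L2N (F k)" and D: "\<And>k. L2N (D k)" and r: "r > 0"
    and c: "\<And>w. (\<Sum>k\<in>UNIV. LINT p|N. F k (fst p) (snd p) * D k (fst p) (w + snd p)) = c"
  shows "(\<Sum>k\<in>(UNIV::'n set). LINT p|N. F k (fst p) (snd p) * (LINT z|unifc r. D k (fst p) (w + snd p + z))) = c"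
proof -
  interpret U: prob_space "unifc r :: (real ^ 'n) measure" using r by (rule prob_space_unifc)
  have "(\<Sum>k\<in>UNIV. LINT p|N. F k (fst p) (snd p) * (LINT z|unifc r. D k (fst p) (w + snd p + z)))
    = (\<Sum>k\<in>UNIV. LINT z|unifc r. LINT p|N. F k (fst p) (snd p) * D k (fst p) (w + z + snd p))"
    unfolding pairing_average(2)[OF F D r] ..
  also have "\<dots> = (LINT z|unifc r. (\<Sum>k\<in>UNIV. LINT p|N. F k (fst p) (snd p) * D k (fst p) (w + z + snd p)))"
    by (rule Bochner_Integration.integral_sum[symmetric]) (rule pairing_average(1)[OF F D r])
  also have "\<dots> = c" unfolding c using U.prob_space by simp
  finally show ?thesis .
qed

text \<open>The correlation is independent of the shift, so \<open>D\<close> may be replaced by its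
  spatial averages. Two averages are taken: the one over the unit cube turns a field known only
  almost everywhere in space into a function of the shifted medium, to which ergodicity applies; the
  one over a large cube makes it small in mean square.\<close>

lemma div_curl:
  assumes erg: "ergodic P" and F: "\<And>k. L2N (F k)" and D: "\<And>k. L2N (D k)"
    and j: "jm \<phi>" and \<phi>: "AE a in P. \<forall>k. wd k (\<phi> a) (D k a)" "AE a in P. L2l (\<phi> a)"
    and div: "AE a in P. \<forall>\<psi>. test_fun \<psi> \<longrightarrow> (\<Sum>k\<in>UNIV. LBINT x. F k a x * partial k \<psi> x) = 0"
    and D0: "\<And>k. (LINT p|N. D k (fst p) (snd p)) = 0"
  shows "(\<Sum>k\<in>UNIV. LINT p|N. F k (fst p) (snd p) * D k (fst p) (snd p)) = 0"
proof -
  define c where "c = (\<Sum>k\<in>UNIV. LINT p|N. F k (fst p) (snd p) * D k (fst p) (snd p))"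
  have c1: "(\<Sum>k\<in>UNIV. LINT p|N. F k (fst p) (snd p) * D k (fst p) (w + snd p)) = c" for w
    unfolding c_def by (rule correlation_const[OF F D j \<phi> div])
  define g where "g k a x = (LINT y|unifc 1. D k a (x + y))" for k a x
  have Lg: "L2N (g k)" for k unfolding g_def[abs_def] by (rule L2N_average[OF D]) simp
  have c2: "(\<Sum>k\<in>UNIV. LINT p|N. F k (fst p) (snd p) * g k (fst p) (w + snd p)) = c" for w
    unfolding g_def by (rule correlation_average[OF F D _ c1]) simp
  define f where "f k a = (LINT y|unifc 1. D k a y)" for k a
  have jD: "jm (D k)" for k by (intro statf_jm L2N_statf D)
  have fm [measurable]: "f k \<in> borel_measurable P" for k unfolding f_def[abs_def]
    using jm_N[OF jD] by (intro Q1.borel_measurable_lebesgue_integral) (simp add: split_beta')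
  have f2: "integrable P (\<lambda>a. (f k a)^2)" for k
  proof -
    have "(\<integral>\<^sup>+a. ennreal ((f k a)^2) \<partial>P) \<le> (\<integral>\<^sup>+a. \<integral>\<^sup>+y. ennreal ((D k a y)^2) \<partial>unifc 1 \<partial>P)"
    proof (rule nn_integral_mono)
      fix a assume "a \<in> space P"
      then have [measurable]: "D k a \<in> borel_measurable borel" by (rule jm_section[OF jD])
      show "ennreal ((f k a)^2) \<le> (\<integral>\<^sup>+y. ennreal ((D k a y)^2) \<partial>unifc 1)"
        unfolding f_def by (intro square_integral_le_nn_integral Q1.prob_space_axioms) measurable
    qed
    also have "\<dots> = (\<integral>\<^sup>+p. ennreal ((D k (fst p) (snd p))^2) \<partial>N)"
      by (rule nn_integral_N_fst[symmetric, where g = "\<lambda>a y. ennreal ((D k a y)^2)"])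
         (intro statf_jm statf_comp[of "D k" "\<lambda>t. ennreal (t^2)"] L2N_statf D, simp)
    also have "\<dots> < \<infinity>" by (rule L2N_nn[OF D])
    finally show ?thesis by (simp add: integrable_iff_bounded)
  qed
  have f0: "(LINT a|P. f k a) = 0" for k
    unfolding f_def using N.integral_fst'[OF L2N_integrable[OF D]] D0 by simp
  \<comment> \<open>Here the identity holds for every point x, since an integral over the unit cube
    does not see the exceptional points.\<close>
  have gf: "AE a in P. g k a x = f k (shift x a)" for k x
  proof -
    have "AE a in P. AE y in lborel. D k (shift x a) y = D k a (x + y)" using D[of k] by (auto simp: L2N_def statf_def)
    moreover have "AE a in P. a \<in> space P" "AE a in P. shift x a \<in> space P"
      using measurable_space[OF shift_measurable[of x]] by auto
    ultimately show ?thesis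
    proof eventually_elim
      case (elim a)
      have [measurable]: "D k a \<in> borel_measurable borel" "D k (shift x a) \<in> borel_measurable borel"
        using elim by (auto intro: jm_section[OF jD])
      show ?case unfolding g_def f_def
        by (rule integral_cong_AE) (use AE_unifc[OF elim(1) zero_less_one] in \<open>auto simp: eq_commute\<close>)
    qed
  qed
  define A where "A = (\<Sum>k\<in>UNIV. LINT p|N. (F k (fst p) (snd p))^2)"
  have bound: "\<bar>c\<bar> \<le> \<delta> * (A + 1)" if \<delta>: "\<delta> > 0" for \<delta>
  proof -
    \<comment> \<open>Chosen so that the terms e/\<delta>, one for each of the coordinates, add up
      to \<delta>.\<close>
    define e where "e = \<delta>^2 / real CARD('n)"
    have e: "e > 0" using \<delta> by (simp add: e_def)
    have "eventually (\<lambda>n. (\<integral>\<^sup>+a. ennreal ((avg (real (Suc n)) (f k) a)^2) \<partial>P) \<le> ennreal e) sequentially" for k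
      by (rule mean_ergodic[OF erg f2 fm f0 e])
    then have "eventually (\<lambda>n. \<forall>k. (\<integral>\<^sup>+a. ennreal ((avg (real (Suc n)) (f k) a)^2) \<partial>P) \<le> ennreal e) sequentially"
      by (rule eventually_all_finite)
    then obtain n where n: "\<And>k. (\<integral>\<^sup>+a. ennreal ((avg (real (Suc n)) (f k) a)^2) \<partial>P) \<le> ennreal e"
      by (auto simp: eventually_sequentially)
    define r where "r = real (Suc n)"
    have r: "r > 0" by (simp add: r_def)
    interpret U: prob_space "unifc r :: (real ^ 'n) measure" using r by (rule prob_space_unifc)
    interpret PU: pair_sigma_finite P "unifc r :: (real ^ 'n) measure" ..
    define G where "G k a x = (LINT z|unifc r. g k a (x + z))" for k a x
    have LG: "L2N (G k)" for k unfolding G_def[abs_def] by (rule L2N_average[OF Lg r])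
    have c3: "(\<Sum>k\<in>UNIV. LINT p|N. F k (fst p) (snd p) * G k (fst p) (snd p)) = c"
      using correlation_average[OF F Lg r c2, of 0] by (simp add: G_def)
    \<comment> \<open>The exceptional set in \<open>gf\<close> depends on the point; exchanging the
      order of the two quantifiers makes the identity usable under the integral over the large
      cube.\<close>
    have Gavg: "AE a in P. G k a x = avg r (f k) (shift x a)" for k x
    proof -
      have m1: "(\<lambda>q. g k (fst q) (x + snd q)) \<in> borel_measurable (P \<Otimes>\<^sub>M unifc r)"
        by (rule jm_comp[OF statf_jm[OF L2N_statf[OF Lg]]]) measurable
      have m2: "(\<lambda>q. f k (shift (x + snd q) (fst q))) \<in> borel_measurable (P \<Otimes>\<^sub>M unifc r)" by measurable
      have "AE z in unifc r. AE a in P. g k a (x + z) = f k (shift (x + z) a)" using gf by simp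
      moreover have "{q \<in> space (P \<Otimes>\<^sub>M unifc r). g k (fst q) (x + snd q) = f k (shift (x + snd q) (fst q))} \<in> sets (P \<Otimes>\<^sub>M unifc r)"
        using m1 m2 by measurable
      ultimately have "AE a in P. AE z in unifc r. g k a (x + z) = f k (shift (x + z) a)"
        by (simp add: PU.AE_commute[where P = "\<lambda>a z. g k a (x + z) = f k (shift (x + z) a)"])
      moreover have "AE a in P. a \<in> space P" by simp
      ultimately show ?thesis
      proof eventually_elim
        case (elim a)
        have [measurable]: "g k a \<in> borel_measurable borel"
          using elim by (auto intro: jm_section[OF statf_jm[OF L2N_statf[OF Lg]]])
        have [measurable]: "(\<lambda>z. f k (shift (x + z) a)) \<in> borel_measurable borel" using elim(2) by measurable
        show ?case unfolding G_def avg_def shift_shift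
          by (rule integral_cong_AE) (use elim(1) in auto)
      qed
    qed
    have G2: "(\<integral>\<^sup>+p. ennreal ((G k (fst p) (snd p))^2) \<partial>N) \<le> ennreal e" for k
    proof -
      have sG: "statf (\<lambda>a x. ennreal ((G k a x)^2))" by (intro statf_comp[of "G k" "\<lambda>t. ennreal (t^2)"] L2N_statf LG) simp
      have "(\<integral>\<^sup>+p. ennreal ((G k (fst p) (snd p))^2) \<partial>N) = (\<integral>\<^sup>+y. \<integral>\<^sup>+a. ennreal ((G k a y)^2) \<partial>P \<partial>unifc 1)"
        by (rule nn_integral_N[OF statf_jm[OF sG]])
      also have "\<dots> = (\<integral>\<^sup>+y. (\<integral>\<^sup>+a. ennreal ((avg r (f k) a)^2) \<partial>P) \<partial>(unifc 1 :: (real ^ 'n) measure))"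
      proof (rule nn_integral_cong)
        fix y
        have "(\<integral>\<^sup>+a. ennreal ((G k a y)^2) \<partial>P) = (\<integral>\<^sup>+a. ennreal ((avg r (f k) (shift y a))^2) \<partial>P)"
          by (rule nn_integral_cong_AE) (use Gavg[of k y] in eventually_elim, simp)
        also have "\<dots> = (\<integral>\<^sup>+a. ennreal ((avg r (f k) a)^2) \<partial>P)"
          by (rule nn_integral_shift[where f = "\<lambda>a. ennreal ((avg r (f k) a)^2)"])
             (use avg_borel[OF r fm] in measurable)
        finally show "(\<integral>\<^sup>+a. ennreal ((G k a y)^2) \<partial>P) = (\<integral>\<^sup>+a. ennreal ((avg r (f k) a)^2) \<partial>P)" .
      qed
      also have "\<dots> = (\<integral>\<^sup>+a. ennreal ((avg r (f k) a)^2) \<partial>P)" using Q1.emeasure_space_1 by (simp del: Q1.emeasure_space_1)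
      also have "\<dots> \<le> ennreal e" using n by (simp add: r_def)
      finally show ?thesis .
    qed
    have G2': "(LINT p|N. (G k (fst p) (snd p))^2) \<le> e" for k
      using G2[of k] LG[of k] e by (simp add: L2N_def nn_integral_eq_integral)
    have "\<bar>LINT p|N. F k (fst p) (snd p) * G k (fst p) (snd p)\<bar> \<le> \<delta> * (LINT p|N. (F k (fst p) (snd p))^2) + 1 / \<delta> * e" for k
    proof -
      have i: "integrable N (\<lambda>p. (F k (fst p) (snd p))^2)" "integrable N (\<lambda>p. (G k (fst p) (snd p))^2)"
        using F[of k] LG[of k] by (auto simp: L2N_def)
      have "norm (LINT p|N. F k (fst p) (snd p) * G k (fst p) (snd p)) \<le> (LINT p|N. norm (F k (fst p) (snd p) * G k (fst p) (snd p)))"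
        by (rule integral_norm_bound)
      also have "\<dots> \<le> (LINT p|N. \<delta> * (F k (fst p) (snd p))^2 + 1 / \<delta> * (G k (fst p) (snd p))^2)"
      proof (rule integral_mono)
        show "integrable N (\<lambda>p. norm (F k (fst p) (snd p) * G k (fst p) (snd p)))"
          by (intro integrable_norm L2N_mult_integrable F LG)
        show "integrable N (\<lambda>p. \<delta> * (F k (fst p) (snd p))^2 + 1 / \<delta> * (G k (fst p) (snd p))^2)" using i by simp
        fix p
        define s t where "s = \<bar>F k (fst p) (snd p)\<bar>" and "t = \<bar>G k (fst p) (snd p)\<bar>"
        have "0 \<le> (\<delta> * s - t)^2" "0 \<le> \<delta> * s * t" using \<delta> by (auto simp: s_def t_def)
        then have "\<delta> * (s * t) \<le> \<delta>^2 * s^2 + t^2" by (simp add: power2_diff power_mult_distrib mult.assoc)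
        then have "s * t \<le> \<delta> * s^2 + 1 / \<delta> * t^2" using \<delta> by (simp add: field_simps power2_eq_square)
        then show "norm (F k (fst p) (snd p) * G k (fst p) (snd p)) \<le> \<delta> * (F k (fst p) (snd p))^2 + 1 / \<delta> * (G k (fst p) (snd p))^2"
          by (simp add: s_def t_def abs_mult)
      qed
      also have "\<dots> = \<delta> * (LINT p|N. (F k (fst p) (snd p))^2) + 1 / \<delta> * (LINT p|N. (G k (fst p) (snd p))^2)" using i by simp
      also have "\<dots> \<le> \<delta> * (LINT p|N. (F k (fst p) (snd p))^2) + 1 / \<delta> * e" using G2' \<delta> by (intro add_left_mono mult_left_mono) auto
      finally show ?thesis by simp
    qed
    then have "\<bar>c\<bar> \<le> (\<Sum>k\<in>(UNIV::'n set). \<delta> * (LINT p|N. (F k (fst p) (snd p))^2) + 1 / \<delta> * e)"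
      unfolding c3[symmetric] by (intro order_trans[OF sum_abs] sum_mono)
    also have "\<dots> = \<delta> * A + real CARD('n) * (1 / \<delta> * e)" by (simp add: A_def sum.distrib sum_distrib_left)
    also have "real CARD('n) * (1 / \<delta> * e) = \<delta>" using \<delta> by (simp add: e_def power2_eq_square)
    finally show ?thesis by (simp add: distrib_left)
  qed
  have A0: "A \<ge> 0" unfolding A_def by (intro sum_nonneg) auto
  have "\<bar>c\<bar> \<le> 0"
  proof (rule field_le_epsilon)
    fix e :: real assume "e > 0"
    then have "\<bar>c\<bar> \<le> e / (A + 1) * (A + 1)" using A0 by (intro bound) (simp add: add_nonneg_pos)
    then show "\<bar>c\<bar> \<le> 0 + e" using A0 by simp
  qed
  then show ?thesis by (simp add: c_def)
qed

end

subsection \<open>Borel representatives\<close>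

lemma ex_borel_representative:
  fixes f :: "real ^ 'n::finite \<Rightarrow> 'b::euclidean_space"
  assumes "f \<in> borel_measurable lebesgue"
  obtains g where "g \<in> borel_measurable borel" "AE x in lborel. f x = g x"
proof -
  have "\<exists>g. g \<in> borel_measurable borel \<and> (AE x in lborel. f x \<bullet> b = g x)" for b
  proof -
    have "(\<lambda>x. f x \<bullet> b) \<in> borel_measurable lebesgue" using assms by measurable
    from completion_ex_borel_measurable_real[OF this] obtain g where
      "g \<in> borel_measurable lborel" "AE x in lborel. f x \<bullet> b = g x" by (rule bexE)
    then show ?thesis by (intro exI[of _ g]) simp
  qed
  then have "\<forall>b. \<exists>g. g \<in> borel_measurable borel \<and> (AE x in lborel. f x \<bullet> b = g x)" by (rule allI)
  from choice[OF this] obtain G where G: "\<And>b. G b \<in> borel_measurable borel" "\<And>b. AE x in lborel. f x \<bullet> b = G b x"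
    by blast
  show ?thesis
  proof
    show "(\<lambda>x. \<Sum>b\<in>Basis. G b x *\<^sub>R b) \<in> borel_measurable borel" using G(1) by measurable
    have "AE x in lborel. \<forall>b\<in>Basis. f x \<bullet> b = G b x" using G(2) by (intro AE_finite_allI) auto
    then show "AE x in lborel. f x = (\<Sum>b\<in>Basis. G b x *\<^sub>R b)"
    proof eventually_elim
      case (elim x)
      have "f x = (\<Sum>b\<in>Basis. (f x \<bullet> b) *\<^sub>R b)" by (rule euclidean_representation[symmetric])
      also have "\<dots> = (\<Sum>b\<in>Basis. G b x *\<^sub>R b)" by (rule sum.cong) (use elim in auto)
      finally show ?case .
    qed
  qed
qed

lemma AE_lborel_affine:
  fixes w :: "'a::euclidean_space"
  assumes "AE y in lborel. Q y" "c \<noteq> 0" shows "AE y in lborel. Q (w + c *\<^sub>R y)"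
proof -
  obtain B where B: "{y \<in> space lborel. \<not> Q y} \<subseteq> B" "emeasure lborel B = 0" "B \<in> sets lborel"
    using assms(1) by (rule AE_E)
  then have [measurable]: "B \<in> sets borel" by simp
  have "AE y in lborel. w + c *\<^sub>R y \<notin> B"
  proof -
    have "0 = ennreal (\<bar>c\<bar> ^ DIM('a)) * (LBINT\<^sup>+ x. indicator B (w + c *\<^sub>R x))"
      using nn_integral_lborel_affine[of "indicator B" c w] assms(2) B by simp
    then have "(LBINT\<^sup>+ x. indicator B (w + c *\<^sub>R x)) = 0" using assms(2) by simp
    then have "AE x in lborel. indicator B (w + c *\<^sub>R x) = (0 :: ennreal)"
      by (subst (asm) nn_integral_0_iff_AE) auto
    then show ?thesis by eventually_elim (simp add: indicator_def split: if_splits)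
  qed
  then show ?thesis by eventually_elim (use B in auto)
qed

lemma loc_integrable_iff_L1l:
  assumes [measurable]: "f \<in> borel_measurable borel"
  shows "loc_integrable f \<longleftrightarrow> L1l f"
proof
  assume f: "loc_integrable f"
  show "L1l f" unfolding L1l_def
  proof (intro conjI allI assms)
    fix R
    have "integrable lebesgue (\<lambda>x. indicator (cball 0 R) x *\<^sub>R f x)"
      using f by (simp add: loc_integrable_def set_integrable_def)
    then show "integrable lborel (\<lambda>x. indicator (cball 0 R) x * f x)"
      by (subst (asm) integrable_completion) auto
  qed
next
  assume f: "L1l f"
  show "loc_integrable f" unfolding loc_integrable_def
  proof (intro allI impI)
    fix K :: "(real ^ 'a) set" assume K: "compact K"
    then obtain R where R: "K \<subseteq> cball 0 R" using bounded_subset_ballD[OF compact_imp_bounded[OF K], of 0] ball_subset_cball by blast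
    have "integrable lborel (\<lambda>x. indicator (cball 0 R) x *\<^sub>R f x)" using f by (simp add: L1l_def)
    then have "set_integrable lebesgue (cball 0 R) f"
      unfolding set_integrable_def by (subst integrable_completion) auto
    then show "set_integrable lebesgue K f"
      by (rule set_integrable_subset) (use K R in \<open>auto simp: compact_imp_closed borel_closed\<close>)
  qed
qed

lemma loc_integrable_vec_iff:
  fixes f :: "real ^ 'n::finite \<Rightarrow> real ^ 'm::finite"
  shows "loc_integrable f \<longleftrightarrow> (\<forall>k. loc_integrable (\<lambda>x. f x $ k))"
proof
  assume f: "loc_integrable f"
  have "set_integrable lebesgue K (\<lambda>x. f x $ k)" if "compact K" for K k
  proof -
    have "integrable lebesgue (\<lambda>x. (indicator K x *\<^sub>R f x) $ k)"
      using f that by (intro integrable_bounded_linear[OF bounded_linear_vec_nth]) (simp add: loc_integrable_def set_integrable_def)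
    then show ?thesis by (simp add: set_integrable_def)
  qed
  then show "\<forall>k. loc_integrable (\<lambda>x. f x $ k)" by (simp add: loc_integrable_def)
next
  assume f: "\<forall>k. loc_integrable (\<lambda>x. f x $ k)"
  have "set_integrable lebesgue K f" if "compact K" for K
  proof -
    have "integrable lebesgue (\<lambda>x. \<Sum>k\<in>UNIV. (indicator K x *\<^sub>R f x $ k) *\<^sub>R axis k (1::real))"
      using f that by (intro Bochner_Integration.integrable_sum integrable_scaleR_left) (simp add: loc_integrable_def set_integrable_def)
    also have "(\<lambda>x. \<Sum>k\<in>UNIV. (indicator K x *\<^sub>R f x $ k) *\<^sub>R axis k (1::real)) = (\<lambda>x. indicator K x *\<^sub>R f x)"
    proof
      fix x
      show "(\<Sum>k\<in>UNIV. (indicator K x *\<^sub>R f x $ k) *\<^sub>R axis k (1::real)) = indicator K x *\<^sub>R f x"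
        using basis_expansion[of "indicator K x *\<^sub>R f x"] by (simp add: scalar_mult_eq_scaleR)
    qed
    finally show ?thesis by (simp add: set_integrable_def)
  qed
  then show "loc_integrable f" by (simp add: loc_integrable_def)
qed

lemma lebesgue_measurable_AE_borel:
  fixes f :: "real ^ 'n::finite \<Rightarrow> 'b::topological_space"
  assumes "AE x in lborel. f x = g x" "g \<in> borel_measurable borel"
  shows "f \<in> borel_measurable lebesgue"
proof (rule measurableI)
  fix B :: "'b set" assume B: "B \<in> sets borel"
  have "AE x in lebesgue. x \<in> g -` B \<longleftrightarrow> x \<in> f -` B"
    by (rule AE_completion) (use assms(1) in eventually_elim, simp)
  moreover have "g -` B \<in> sets lebesgue" using measurable_sets[OF assms(2) B] by simp
  ultimately have "f -` B \<in> sets lebesgue" by (rule completion.in_sets_AE) auto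
  then show "f -` B \<inter> space lebesgue \<in> sets lebesgue" by simp
qed simp

lemma integral_lebesgue_eq:
  fixes f :: "real ^ 'n::finite \<Rightarrow> 'b::{banach, second_countable_topology}"
  assumes "AE x in lborel. f x = g x" "g \<in> borel_measurable borel"
  shows "(LINT x|lebesgue. f x) = (LBINT x. g x)"
proof -
  have "(LINT x|lebesgue. f x) = (LINT x|lebesgue. g x)"
    using assms(1) by (intro integral_cong_AE lebesgue_measurable_AE_borel[OF assms] measurable_completion AE_completion) (use assms(2) in auto)
  also have "\<dots> = (LBINT x. g x)" using assms(2) by (intro integral_completion) simp
  finally show ?thesis .
qed

lemma integrable_lebesgue_iff:
  fixes f :: "real ^ 'n::finite \<Rightarrow> 'b::{banach, second_countable_topology}"
  assumes "AE x in lborel. f x = g x" "g \<in> borel_measurable borel"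
  shows "integrable lebesgue f \<longleftrightarrow> integrable lborel g"
proof -
  have "integrable lebesgue f \<longleftrightarrow> integrable lebesgue g"
    using assms(1) by (intro integrable_cong_AE lebesgue_measurable_AE_borel[OF assms] measurable_completion AE_completion) (use assms(2) in auto)
  also have "\<dots> \<longleftrightarrow> integrable lborel g" using assms(2) by (intro integrable_completion) simp
  finally show ?thesis .
qed

lemma loc_integrable_cong_AE:
  fixes f :: "real ^ 'n::finite \<Rightarrow> 'b::{banach, second_countable_topology}"
  assumes "AE x in lborel. f x = g x" "g \<in> borel_measurable borel"
  shows "loc_integrable f \<longleftrightarrow> loc_integrable g"
proof -
  have "set_integrable lebesgue K f \<longleftrightarrow> set_integrable lebesgue K g" if "compact K" for K
  proof -
    have [measurable]: "K \<in> sets borel" using that by (simp add: compact_imp_closed borel_closed)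
    note [measurable] = assms(2)
    have "AE x in lborel. indicator K x *\<^sub>R f x = indicator K x *\<^sub>R g x" using assms(1) by eventually_elim simp
    moreover have "(\<lambda>x. indicator K x *\<^sub>R g x) \<in> borel_measurable borel" by measurable
    ultimately show ?thesis unfolding set_integrable_def
      using integrable_lebesgue_iff[of "\<lambda>x. indicator K x *\<^sub>R g x" "\<lambda>x. indicator K x *\<^sub>R g x"]
      by (subst integrable_lebesgue_iff) auto
  qed
  then show ?thesis by (simp add: loc_integrable_def)
qed

text \<open>Solutions come as Lebesgue measurable functions. All notions involved depend only on the
  class up to null sets, so a Borel representative carries them over to the preceding
  calculus.\<close>

lemma has_weak_grad_iff:
  fixes u :: "real ^ 'n::finite \<Rightarrow> real"
  assumes u: "AE x in lborel. u x = v x" "v \<in> borel_measurable borel"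
    and Du: "AE x in lborel. Du x = Dv x" "Dv \<in> borel_measurable borel"
  shows "has_weak_grad u Du \<longleftrightarrow> (\<forall>k. wd k v (\<lambda>x. Dv x $ k))"
proof -
  note [measurable] = u(2) Du(2)
  have "(LINT x|lebesgue. u x * partial k \<psi> x) = (LBINT x. v x * partial k \<psi> x)"
    "(LINT x|lebesgue. Du x $ k * \<psi> x) = (LBINT x. Dv x $ k * \<psi> x)" if "test_fun \<psi>" for k and \<psi> :: "real ^ 'n \<Rightarrow> real"
  proof -
    note [measurable] = test_fun_borel[OF that] test_fun_borel[OF test_fun_partial[OF that]]
    show "(LINT x|lebesgue. u x * partial k \<psi> x) = (LBINT x. v x * partial k \<psi> x)"
      by (rule integral_lebesgue_eq) (use u(1) in eventually_elim, simp, measurable)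
    show "(LINT x|lebesgue. Du x $ k * \<psi> x) = (LBINT x. Dv x $ k * \<psi> x)"
      by (rule integral_lebesgue_eq) (use Du(1) in eventually_elim, simp, measurable)
  qed
  moreover have "loc_integrable u \<longleftrightarrow> L1l v"
    using loc_integrable_cong_AE[OF u] loc_integrable_iff_L1l[OF u(2)] by simp
  moreover have "loc_integrable Du \<longleftrightarrow> (\<forall>k. L1l (\<lambda>x. Dv x $ k))"
    using loc_integrable_cong_AE[OF Du] loc_integrable_vec_iff[of Dv] by (simp add: loc_integrable_iff_L1l)
  moreover have "- s = t \<longleftrightarrow> s = - t" for s t :: real by linarith
  ultimately show ?thesis unfolding has_weak_grad_def wd_def distr_partial_def by (simp cong: imp_cong) blast
qed

lemma in_L2_L2:
  assumes f: "in_L2 f" and g: "AE x in lborel. f x = g x" "g \<in> borel_measurable borel"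
  shows "L2 g"
proof -
  note [measurable] = g(2)
  have "AE x in lborel. (norm (f x))^2 = (g x)^2" using g(1) by eventually_elim simp
  then show ?thesis using f integrable_lebesgue_iff[of "\<lambda>x. (norm (f x))^2" "\<lambda>x. (g x)^2"] by (simp add: in_L2_def L2_def)
qed

lemma in_L2_nth: "in_L2 (f :: real ^ 'n::finite \<Rightarrow> real ^ 'm::finite) \<Longrightarrow> in_L2 (\<lambda>x. f x $ k)"
  unfolding in_L2_def
proof safe
  assume f [measurable]: "f \<in> borel_measurable lebesgue" and i: "integrable lebesgue (\<lambda>x. (norm (f x))^2)"
  show m: "(\<lambda>x. f x $ k) \<in> borel_measurable lebesgue" by measurable
  have sq: "(f x $ k)^2 \<le> (norm (f x))^2" for x using power_mono[OF component_le_norm_cart[of "f x" k], of 2] by simp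
  show "integrable lebesgue (\<lambda>x. (norm (f x $ k))^2)"
    by (rule Bochner_Integration.integrable_bound[OF i]) (measurable, simp add: sq)
qed

lemma L2_in_L2:
  assumes "L2 f" shows "in_L2 f"
proof -
  have f: "f \<in> borel_measurable lborel" "(\<lambda>x. (f x)^2) \<in> borel_measurable lborel" "integrable lborel (\<lambda>x. (f x)^2)"
    using assms by (auto simp: L2_def)
  show ?thesis unfolding in_L2_def using measurable_completion[OF f(1)] integrable_completion[OF f(2)] f(3) by simp
qed

lemma L2_in_L2_vec:
  fixes F :: "real ^ 'n::finite \<Rightarrow> real ^ 'm::finite"
  assumes F: "\<And>k. L2 (\<lambda>x. F x $ k)" shows "in_L2 F"
proof -
  have m [measurable]: "F \<in> borel_measurable borel" using F by (intro borel_measurable_vecI L2_borel)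
  then have "F \<in> borel_measurable lebesgue" by (intro measurable_completion) simp
  moreover have "integrable lebesgue (\<lambda>x. (norm (F x))^2)" using L2_norm[OF F] by (subst integrable_completion) auto
  ultimately show ?thesis by (simp add: in_L2_def)
qed

lemma in_H1_test:
  fixes \<psi> :: "real ^ 'n::finite \<Rightarrow> real"
  assumes t: "test_fun \<psi>" shows "in_H1 \<psi> (\<lambda>x. \<chi> k. partial k \<psi> x)"
proof -
  have b: "\<psi> \<in> borel_measurable borel" "(\<lambda>x. \<chi> k. partial k \<psi> x) \<in> borel_measurable borel"
    using test_fun_borel[OF t] test_fun_borel[OF test_fun_partial[OF t]] by (auto intro!: borel_measurable_vecI)
  have "has_weak_grad \<psi> (\<lambda>x. \<chi> k. partial k \<psi> x)"
    using has_weak_grad_iff[OF AE_I2 b(1) AE_I2 b(2), of \<psi> "\<lambda>x. \<chi> k. partial k \<psi> x"] wd_smooth[OF test_fun_smooth[OF t]] by simp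
  moreover have "in_L2 \<psi>" by (rule L2_in_L2[OF bcs_L2[OF test_fun_bcs[OF t]]])
  moreover have "in_L2 (\<lambda>x. \<chi> k. partial k \<psi> x)"
    by (rule L2_in_L2_vec) (simp add: bcs_L2[OF test_fun_bcs[OF test_fun_partial[OF t]]])
  ultimately show ?thesis by (simp add: in_H1_def)
qed

section \<open>Weak solutions through Borel representatives\<close>

lemma weak_solution_borel:
  fixes u :: "real ^ 'n::finite \<Rightarrow> real"
  assumes s: "weak_solution \<alpha> A f u Du"
    and u: "AE x in lborel. u x = u' x" "u' \<in> borel_measurable borel"
    and Du: "AE x in lborel. Du x = Du' x" "Du' \<in> borel_measurable borel"
  shows "wd k u' (\<lambda>x. Du' x $ k)" "L2 u'" "L2 (\<lambda>x. Du' x $ k)"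
proof -
  have H: "has_weak_grad u Du" "in_L2 u" "in_L2 Du" using s by (auto simp: weak_solution_def in_H1_def)
  show "wd k u' (\<lambda>x. Du' x $ k)" using H has_weak_grad_iff[OF u Du] by simp
  show "L2 u'" by (rule in_L2_L2[OF H(2) u])
  note [measurable] = Du(2)
  show "L2 (\<lambda>x. Du' x $ k)" by (rule in_L2_L2[OF in_L2_nth[OF H(3)]]) (use Du(1) in eventually_elim, simp, measurable)
qed

text \<open>Test functions belong to H^1, so they may be inserted in the weak formulation; square
  integrability of the flux permits splitting the integral into components.\<close>

lemma weak_solution_test:
  fixes u :: "real ^ 'n::finite \<Rightarrow> real"
  assumes s: "weak_solution \<alpha> A f u Du"
    and u: "AE x in lborel. u x = u' x" "u' \<in> borel_measurable borel"
    and Du: "AE x in lborel. Du x = Du' x" "Du' \<in> borel_measurable borel"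
    and A: "AE x in lborel. A x = A' x" "A' \<in> borel_measurable borel"
    and f: "AE x in lborel. f x = f' x" "f' \<in> borel_measurable borel"
    and L: "\<And>k. L2 (\<lambda>x. (A' x *v Du' x) $ k)" and t: "test_fun \<psi>"
  shows "\<alpha> * (LBINT x. u' x * \<psi> x) + (\<Sum>k\<in>UNIV. LBINT x. (A' x *v Du' x) $ k * partial k \<psi> x)
      = (LBINT x. f' x * \<psi> x)"
proof -
  note [measurable] = u(2) Du(2) A(2) f(2) test_fun_borel[OF t] test_fun_borel[OF test_fun_partial[OF t]]
  have "\<alpha> * (LINT x|lebesgue. u x * \<psi> x) + (LINT x|lebesgue. (\<chi> k. partial k \<psi> x) \<bullet> (A x *v Du x)) = (LINT x|lebesgue. f x * \<psi> x)"
    using s in_H1_test[OF t] by (simp add: weak_solution_def)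
  moreover have "(LINT x|lebesgue. u x * \<psi> x) = (LBINT x. u' x * \<psi> x)"
    by (rule integral_lebesgue_eq) (use u(1) in eventually_elim, simp, measurable)
  moreover have "(LINT x|lebesgue. f x * \<psi> x) = (LBINT x. f' x * \<psi> x)"
    by (rule integral_lebesgue_eq) (use f(1) in eventually_elim, simp, measurable)
  moreover have "(LINT x|lebesgue. (\<chi> k. partial k \<psi> x) \<bullet> (A x *v Du x)) = (LBINT x. (\<Sum>k\<in>UNIV. (A' x *v Du' x) $ k * partial k \<psi> x))"
  proof (rule integral_lebesgue_eq)
    show "AE x in lborel. (\<chi> k. partial k \<psi> x) \<bullet> (A x *v Du x) = (\<Sum>k\<in>UNIV. (A' x *v Du' x) $ k * partial k \<psi> x)"
      using A(1) Du(1) by eventually_elim (simp add: inner_vec_def mult.commute)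
  qed measurable
  moreover have "(LBINT x. (\<Sum>k\<in>UNIV. (A' x *v Du' x) $ k * partial k \<psi> x)) = (\<Sum>k\<in>UNIV. LBINT x. (A' x *v Du' x) $ k * partial k \<psi> x)"
    by (intro Bochner_Integration.integral_sum L2_mult_integrable L bcs_L2 test_fun_bcs test_fun_partial t)
  ultimately show ?thesis by simp
qed

text \<open>The space \<H> controls a field in mean square on the unit cube only, while its gradient
  is controlled everywhere by stationarity. The difference estimate carries the bound to each
  translated cube.\<close>

lemma L2l_if_unit_cube:
  fixes u :: "real ^ 'n::finite \<Rightarrow> real"
  assumes u: "\<And>k. wd k u (Du k)" and D: "\<And>k. L2l (Du k)"
    and fin: "(LBINT\<^sup>+ x. indicator unit_cube x * ennreal ((u x)^2)) < \<infinity>"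
  shows "L2l u"
proof -
  interpret U: prob_space unif by (rule prob_space_unif)
  have [measurable]: "u \<in> borel_measurable borel" using u[of undefined] by (auto simp: wd_def L1l_def)
  have [measurable]: "Du k \<in> borel_measurable borel" for k using D[of k] by (rule L2l_borel)
  define Q where "Q w = cube w 1" for w :: "real ^ 'n"
  have [measurable]: "Q w \<in> sets borel" for w by (simp add: Q_def)
  have ind: "indicator (Q w) (x + w) = (indicator unit_cube x :: ennreal)" for x w
    unfolding Q_def unit_cube_eq by (simp add: indicator_def mem_cube)
  have shifted: "(LBINT\<^sup>+ x. indicator (Q w) x * ennreal ((u x)^2)) < \<infinity>" for w
  proof -
    define F where "F x = (\<Sum>k\<in>UNIV. w $ k * Du k x)" for x
    have LF: "L2l F" unfolding F_def[abs_def] by (intro L2l_sum L2l_cmult D)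
    have [measurable]: "F \<in> borel_measurable borel" using LF by (rule L2l_borel)
    obtain R where R: "unit_cube \<subseteq> cball (0 :: real ^ 'n) R"
      using bounded_subset_ballD[OF bounded_box, where x = 0] ball_subset_cball unfolding unit_cube_def by blast
    define K where "K = (LBINT\<^sup>+ x. indicator (cball 0 (R + norm w)) x * ennreal ((F x)^2))"
    have K: "K < \<infinity>"
    proof -
      have "integrable lborel (\<lambda>x. indicator (cball 0 (R + norm w)) x * (F x)^2)" using LF by (simp add: L2l_def)
      then show ?thesis unfolding K_def integrable_iff_bounded by (simp add: abs_mult ennreal_mult' ennreal_indicator)
    qed
    have "(LBINT\<^sup>+ x. indicator unit_cube x * ennreal ((u (x + w) - u x)^2))
      \<le> (\<integral>\<^sup>+t. \<integral>\<^sup>+x. indicator unit_cube x * ennreal ((F (x + t *\<^sub>R w))^2) \<partial>lborel \<partial>unif)"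
      unfolding F_def by (rule wd_difference_bound[OF u]) simp
    also have "\<dots> \<le> (\<integral>\<^sup>+t. K \<partial>unif)"
    proof (rule nn_integral_mono_AE)
      show "AE t in unif. (LBINT\<^sup>+ x. indicator unit_cube x * ennreal ((F (x + t *\<^sub>R w))^2)) \<le> K"
        using AE_unif
      proof eventually_elim
        case (elim t)
        have "(LBINT\<^sup>+ x. indicator unit_cube x * ennreal ((F (x + t *\<^sub>R w))^2))
          \<le> (LBINT\<^sup>+ x. indicator (cball 0 (R + norm w)) (t *\<^sub>R w + x) * ennreal ((F (t *\<^sub>R w + x))^2))"
        proof (rule nn_integral_mono)
          fix x
          have "t *\<^sub>R w + x \<in> cball 0 (R + norm w)" if "x \<in> unit_cube"
          proof -
            have "norm x \<le> R" using that R by auto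
            moreover have "norm (t *\<^sub>R w) \<le> norm w" using elim by (simp add: mult_left_le_one_le)
            ultimately show ?thesis using norm_triangle_ineq[of "t *\<^sub>R w" x] by simp
          qed
          then show "indicator unit_cube x * ennreal ((F (x + t *\<^sub>R w))^2)
            \<le> indicator (cball 0 (R + norm w)) (t *\<^sub>R w + x) * ennreal ((F (t *\<^sub>R w + x))^2)"
            by (auto simp: indicator_def add.commute)
        qed
        also have "\<dots> = K" unfolding K_def
          by (rule nn_integral_lborel_translate[of "\<lambda>x. indicator (cball 0 (R + norm w)) x * ennreal ((F x)^2)"]) measurable
        finally show ?case .
      qed
    qed
    also have "\<dots> = K" using U.emeasure_space_1 by simp
    finally have d: "(LBINT\<^sup>+ x. indicator unit_cube x * ennreal ((u (x + w) - u x)^2)) < \<infinity>" using K by simp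
    have "(LBINT\<^sup>+ x. indicator (Q w) x * ennreal ((u x)^2)) = (LBINT\<^sup>+ x. indicator (Q w) (w + x) * ennreal ((u (w + x))^2))"
      by (rule nn_integral_lborel_translate[symmetric]) measurable
    also have "\<dots> \<le> (LBINT\<^sup>+ x. 2 * (indicator unit_cube x * ennreal ((u (x + w) - u x)^2)) + 2 * (indicator unit_cube x * ennreal ((u x)^2)))"
    proof (rule nn_integral_mono)
      fix x
      have "(u (x + w))^2 \<le> 2 * (u (x + w) - u x)^2 + 2 * (u x)^2"
        using zero_le_power2[of "u (x + w) - 2 * u x"] by (simp add: power2_eq_square algebra_simps)
      then have "ennreal ((u (x + w))^2) \<le> 2 * ennreal ((u (x + w) - u x)^2) + 2 * ennreal ((u x)^2)"
        using ennreal_leI[of "(u (x + w))^2" "2 * (u (x + w) - u x)^2 + 2 * (u x)^2"] by (simp add: ennreal_mult')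
      then show "indicator (Q w) (w + x) * ennreal ((u (w + x))^2)
        \<le> 2 * (indicator unit_cube x * ennreal ((u (x + w) - u x)^2)) + 2 * (indicator unit_cube x * ennreal ((u x)^2))"
        using ind[of w x] by (auto simp: add.commute indicator_def[of unit_cube])
    qed
    also have "\<dots> = 2 * (LBINT\<^sup>+ x. indicator unit_cube x * ennreal ((u (x + w) - u x)^2)) + 2 * (LBINT\<^sup>+ x. indicator unit_cube x * ennreal ((u x)^2))"
      by (simp add: nn_integral_add nn_integral_cmult)
    also have "\<dots> < \<infinity>" using d fin by (simp add: ennreal_mult_less_top)
    finally show ?thesis .
  qed
  show ?thesis unfolding L2l_def
  proof (intro conjI allI)
    fix R
    have "\<And>w. w \<in> UNIV \<Longrightarrow> open (Q w)" by (simp add: Q_def cube_box open_box)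
    moreover have "x \<in> Q x" for x by (simp add: Q_def mem_cube)
    then have "cball 0 R \<subseteq> (\<Union>w\<in>UNIV. Q w)" by blast
    \<comment> \<open>Open unit cubes around all points cover the ball; compactness leaves finitely
      many, over which the finite integrals are added.\<close>
    ultimately obtain W where W: "finite W" "cball 0 R \<subseteq> (\<Union>w\<in>W. Q w)"
      using compactE_image[OF compact_cball, of UNIV Q 0 R] by metis
    have "(LBINT\<^sup>+ x. ennreal (norm (indicator (cball 0 R) x * (u x)^2)))
      \<le> (LBINT\<^sup>+ x. (\<Sum>w\<in>W. indicator (Q w) x * ennreal ((u x)^2)))"
    proof (rule nn_integral_mono)
      fix x
      show "ennreal (norm (indicator (cball 0 R) x * (u x)^2)) \<le> (\<Sum>w\<in>W. indicator (Q w) x * ennreal ((u x)^2))"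
      proof (cases "x \<in> cball 0 R")
        case True
        then obtain w where w: "w \<in> W" "x \<in> Q w" using W by blast
        have "ennreal ((u x)^2) = indicator (Q w) x * ennreal ((u x)^2)" using w by simp
        also have "\<dots> \<le> (\<Sum>w\<in>W. indicator (Q w) x * ennreal ((u x)^2))" by (rule member_le_sum[OF w(1) _ W(1)]) simp
        finally show ?thesis using True by simp
      qed simp
    qed
    also have "\<dots> = (\<Sum>w\<in>W. \<integral>\<^sup>+x. indicator (Q w) x * ennreal ((u x)^2) \<partial>lborel)" by (rule nn_integral_sum) measurable
    also have "\<dots> < \<infinity>" using W(1) shifted by (induction W rule: finite_induct) auto
    finally show "integrable lborel (\<lambda>x. indicator (cball 0 R) x * (u x)^2)" by (simp add: integrable_iff_bounded)
  qed simp
qed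

section \<open>The corrector as a stationary gradient, and coercivity of the homogenized
  matrix\<close>

context medium
begin

interpretation Q1: prob_space "unifc 1 :: (real ^ 'n) measure" by (rule prob_space_unifc) simp
interpretation N: pair_prob_space P "unifc 1 :: (real ^ 'n) measure" ..

lemma unit_cube_integral:
  fixes f :: "real ^ 'n \<Rightarrow> 'c::{banach, second_countable_topology}"
  assumes [measurable]: "f \<in> borel_measurable borel"
  shows "(LINT y:unit_cube|lebesgue. f y) = (LINT y|unifc 1. f y)"
proof -
  have "unifc 1 = density lborel (\<lambda>x::real ^ 'n. ennreal (indicator unit_cube x))"
    unfolding unifc_def uniform_measure_def unit_cube_eq[symmetric]
    by (intro arg_cong[where f = "density lborel"] ext) (simp add: emeasure_unit_cube ennreal_indicator divide_ennreal_def)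
  then have "(LINT y|unifc 1. f y) = (LINT y:unit_cube|lborel. f y)"
    by (simp add: integral_density set_lebesgue_integral_def)
  then show ?thesis by (simp add: set_integral_lebesgue)
qed

lemma jm_vec: "(\<And>k. jm (\<lambda>a x. F a x $ k)) \<Longrightarrow> jm (F :: 'n coeff \<Rightarrow> real ^ 'n \<Rightarrow> real ^ 'n)"
  unfolding jm_iff by (rule borel_measurable_vecI)

lemma in_H_jm:
  assumes "in_H P u Du" shows "jm u" "jm Du"
proof -
  show "jm u" using assms by (intro random_field_jm) (simp add: in_H_def)
  show "jm Du" using assms by (intro jm_vec random_field_jm) (simp add: in_H_def stationary_field_def)
qed

lemma in_H_bound:
  assumes H: "in_H P u Du"
  shows "(\<integral>\<^sup>+p. ennreal ((u (fst p) (snd p))^2 + (norm (Du (fst p) (snd p)))^2) \<partial>N) < \<infinity>"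
proof -
  note j = in_H_jm[OF H]
  have jj: "jm (\<lambda>a y. ennreal ((u a y)^2 + (norm (Du a y))^2))"
    using j unfolding jm_iff by measurable
  have "(\<integral>\<^sup>+p. ennreal ((u (fst p) (snd p))^2 + (norm (Du (fst p) (snd p)))^2) \<partial>N)
    = (\<integral>\<^sup>+a. \<integral>\<^sup>+y. ennreal ((u a y)^2 + (norm (Du a y))^2) \<partial>unifc 1 \<partial>P)"
    by (rule nn_integral_N_fst[OF jj])
  also have "\<dots> = (\<integral>\<^sup>+ a. (\<integral>\<^sup>+ y\<in>unit_cube. ennreal ((u a y)^2 + (norm (Du a y))^2) \<partial>lebesgue) \<partial>P)"
  proof (rule nn_integral_cong)
    fix a assume a: "a \<in> space P"
    have "(\<lambda>y. ennreal ((u a y)^2 + (norm (Du a y))^2)) \<in> borel_measurable borel"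
      using jm_section[OF jj a] .
    then show "(\<integral>\<^sup>+y. ennreal ((u a y)^2 + (norm (Du a y))^2) \<partial>unifc 1) = (\<integral>\<^sup>+ y\<in>unit_cube. ennreal ((u a y)^2 + (norm (Du a y))^2) \<partial>lebesgue)"
      by (simp add: nn_integral_unifc_1 nn_integral_completion)
  qed
  also have "\<dots> < \<infinity>" using H by (simp add: in_H_def)
  finally show ?thesis .
qed

lemma in_H_L2N:
  assumes H: "in_H P u Du" shows "L2N (\<lambda>a x. Du a x $ k)"
  unfolding L2N_iff
proof
  show "statf (\<lambda>a x. Du a x $ k)" using H by (intro stationary_field_statf) (simp add: in_H_def)
  have "(v $ k)^2 \<le> s^2 + (norm v)^2" for v :: "real ^ 'n" and s :: real
    using power_mono[OF component_le_norm_cart[of v k], of 2] by (simp add: add_increasing)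
  then have "(\<integral>\<^sup>+p. ennreal ((Du (fst p) (snd p) $ k)^2) \<partial>N) \<le> (\<integral>\<^sup>+p. ennreal ((u (fst p) (snd p))^2 + (norm (Du (fst p) (snd p)))^2) \<partial>N)"
    by (intro nn_integral_mono ennreal_leI)
  also have "\<dots> < \<infinity>" by (rule in_H_bound[OF H])
  finally show "(\<integral>\<^sup>+p. ennreal ((Du (fst p) (snd p) $ k)^2) \<partial>N) < \<infinity>" .
qed

text \<open>Finiteness of the expectation over the unit cube gives almost sure finiteness there;
  \<open>L2l_if_unit_cube\<close> extends it to all balls, although the field need not be
  stationary.\<close>

lemma in_H_wd:
  assumes H: "in_H P u Du"
  shows "AE a in P. (\<forall>k. wd k (u a) (\<lambda>x. Du a x $ k)) \<and> L2l (u a) \<and> (\<forall>k. L2l (\<lambda>x. Du a x $ k))"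
proof -
  note j = in_H_jm[OF H]
  have m: "u a \<in> borel_measurable borel" "Du a \<in> borel_measurable borel" if "a \<in> space P" for a
    using j[THEN jm_section, OF that] by auto
  have [measurable]: "(\<lambda>p. u (fst p) (snd p)) \<in> borel_measurable (P \<Otimes>\<^sub>M lborel)" using j by (simp add: jm_iff)
  have "AE a in P. (\<integral>\<^sup>+y. ennreal ((u a y)^2) \<partial>unifc 1) \<noteq> \<infinity>"
  proof (rule nn_integral_PInf_AE)
    have jj: "jm (\<lambda>a y. ennreal ((u a y)^2))" using j unfolding jm_iff by measurable
    show "(\<lambda>a. \<integral>\<^sup>+y. ennreal ((u a y)^2) \<partial>unifc 1) \<in> borel_measurable P"
      by (rule Q1.borel_measurable_nn_integral) (use jm_N[OF jj] in \<open>simp add: split_beta'\<close>)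
    have "(\<integral>\<^sup>+a. \<integral>\<^sup>+y. ennreal ((u a y)^2) \<partial>unifc 1 \<partial>P) = (\<integral>\<^sup>+p. ennreal ((u (fst p) (snd p))^2) \<partial>N)"
      by (rule nn_integral_N_fst[OF jj, symmetric])
    also have "\<dots> \<le> (\<integral>\<^sup>+p. ennreal ((u (fst p) (snd p))^2 + (norm (Du (fst p) (snd p)))^2) \<partial>N)"
      by (intro nn_integral_mono ennreal_leI) simp
    also have "\<dots> < \<infinity>" by (rule in_H_bound[OF H])
    finally show "(\<integral>\<^sup>+a. \<integral>\<^sup>+y. ennreal ((u a y)^2) \<partial>unifc 1 \<partial>P) \<noteq> \<infinity>" by simp
  qed
  moreover have "AE a in P. has_weak_grad (u a) (Du a)" using H by (simp add: in_H_def)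
  moreover have "AE a in P. \<forall>k. L2l (\<lambda>x. Du a x $ k)"
    using L2N_L2l[OF in_H_L2N[OF H]] by (simp add: AE_all_countable)
  moreover have "AE a in P. a \<in> space P" by (rule AE_space)
  ultimately show ?thesis
  proof eventually_elim
    case (elim a)
    have wd: "wd k (u a) (\<lambda>x. Du a x $ k)" for k
      using elim(2) has_weak_grad_iff[OF AE_I2 m(1)[OF elim(4)] AE_I2 m(2)[OF elim(4)], of "u a" "Du a"] by simp
    have [measurable]: "u a \<in> borel_measurable borel" by (rule m(1)[OF elim(4)])
    have fin: "(LBINT\<^sup>+ x. indicator unit_cube x * ennreal ((u a x)^2)) < \<infinity>"
      using elim(1) by (subst (asm) nn_integral_unifc_1) (auto simp: mult.commute less_top)
    from L2l_if_unit_cube[OF wd _ fin] wd elim(3) show ?case by simp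
  qed
qed

lemma in_H_mean:
  assumes H: "in_H P u Du"
  shows "(LINT p|N. Du (fst p) (snd p) $ k) = 0"
proof -
  have i: "integrable N (\<lambda>p. Du (fst p) (snd p))"
  proof -
    have "integrable N (\<lambda>p. \<Sum>k\<in>UNIV. Du (fst p) (snd p) $ k *\<^sub>R axis k (1::real))"
      by (intro Bochner_Integration.integrable_sum integrable_scaleR_left L2N_integrable[OF in_H_L2N[OF H]])
    moreover have "(\<Sum>k\<in>UNIV. v $ k *\<^sub>R axis k (1::real)) = v" for v :: "real ^ 'n"
      using basis_expansion[of v] by (simp add: scalar_mult_eq_scaleR)
    ultimately show ?thesis by simp
  qed
  have "(LINT p|N. Du (fst p) (snd p)) = (LINT a|P. (LINT y|unifc 1. Du a y))"
    using N.integral_fst'[OF i] by simp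
  also have "\<dots> = (LINT a|P. (LINT y:unit_cube|lebesgue. Du a y))"
    by (intro Bochner_Integration.integral_cong refl unit_cube_integral[symmetric] jm_section in_H_jm[OF H])
  also have "\<dots> = 0" using H by (simp add: in_H_def)
  finally show ?thesis using integral_bounded_linear[OF bounded_linear_vec_nth i, of k] by simp
qed

lemma a_hom_axis: "(a_hom P D\<phi> *v axis i 1) $ j = a_hom P D\<phi> $ j $ i"
  by (simp add: matrix_vector_mult_basis column_def)

lemma medium_elliptic:
  assumes a: "a \<in> space P"
  shows "a \<in> borel_measurable lebesgue"
    "AE x in lborel. \<forall>\<xi>. \<xi> \<bullet> (a x *v \<xi>) \<ge> lam * (norm \<xi>)^2 \<and> norm (a x *v \<xi>) \<le> norm \<xi>"
  using a rm by (auto simp: random_medium_def coeff_fields_def AE_completion_iff)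

text \<open>The flux is the divergence of \<open>\<sigma>\<close> plus a constant, which makes it stationary and
  jointly measurable although \<open>(a, x) \<mapsto> a x\<close> need not be, and determines its mean.\<close>

lemma a_hom_coercive:
  fixes h :: "'n \<Rightarrow> real"
  assumes erg: "ergodic P" and ec: "extended_corrector P \<phi> D\<phi> \<sigma> D\<sigma>" and lam: "lam > 0"
  shows "lam * (\<Sum>i\<in>UNIV. (h i)^2) \<le> (\<Sum>i\<in>UNIV. \<Sum>j\<in>UNIV. a_hom P D\<phi> $ i $ j * h i * h j)"
proof -
  define Ah where "Ah = a_hom P D\<phi>"
  have H: "in_H P (\<phi> i) (D\<phi> i)" "in_H P (\<sigma> i j k) (D\<sigma> i j k)" for i j k
    using ec by (auto simp: extended_corrector_def)
  define G where "G i j a x = Ah $ j $ i + (\<Sum>k\<in>UNIV. D\<sigma> i j k a x $ k)" for i j a x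
  have LG: "L2N (G i j)" for i j unfolding G_def[abs_def]
    by (intro L2N_add L2N_const L2N_sum in_H_L2N[OF H(2)]) simp
  have LD: "L2N (\<lambda>a x. D\<phi> i a x $ k)" for i k by (rule in_H_L2N[OF H(1)])
  have EG: "(LINT p|N. G i j (fst p) (snd p)) = Ah $ j $ i" for i j
  proof -
    have "(LINT p|N. G i j (fst p) (snd p)) = (LINT p|N. Ah $ j $ i) + (LINT p|N. (\<Sum>k\<in>UNIV. D\<sigma> i j k (fst p) (snd p) $ k))"
      unfolding G_def
      by (intro Bochner_Integration.integral_add Bochner_Integration.integrable_sum L2N_integrable[OF in_H_L2N[OF H(2)]]) simp
    also have "(LINT p|N. (\<Sum>k\<in>UNIV. D\<sigma> i j k (fst p) (snd p) $ k)) = (\<Sum>k\<in>UNIV. LINT p|N. D\<sigma> i j k (fst p) (snd p) $ k)"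
      by (intro Bochner_Integration.integral_sum L2N_integrable[OF in_H_L2N[OF H(2)]])
    also have "\<dots> = 0" using in_H_mean[OF H(2)] by simp
    finally show ?thesis by (simp add: N.prob_space)
  qed
  have flux: "AE a in P. AE x in lborel. \<forall>i j. (a x *v (D\<phi> i a x + axis i 1)) $ j = G i j a x"
  proof -
    have "AE a in P. AE x in lborel. (a x *v (D\<phi> i a x + axis i 1)) $ j = G i j a x" for i j
    proof -
      have "AE a in P. AE x in lborel. (\<Sum>k\<in>UNIV. D\<sigma> i j k a x $ k) = flux P D\<phi> i a x $ j"
        using ec by (simp add: extended_corrector_def AE_completion_iff)
      then show ?thesis
      proof eventually_elim
        case (elim a)
        then show ?case by eventually_elim (simp add: G_def flux_def a_hom_axis Ah_def)
      qed
    qed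
    then have "AE a in P. \<forall>i j. AE x in lborel. (a x *v (D\<phi> i a x + axis i 1)) $ j = G i j a x"
      by (simp add: AE_all_countable)
    then show ?thesis by (simp add: AE_all_countable)
  qed
  have div: "AE a in P. \<forall>\<psi>. test_fun \<psi> \<longrightarrow> (\<Sum>k\<in>UNIV. LBINT x. G i k a x * partial k \<psi> x) = 0" for i
  proof -
    have "AE a in P. \<forall>\<psi>. test_fun \<psi> \<longrightarrow> - distr_div (\<lambda>x. a x *v (D\<phi> i a x + axis i 1)) \<psi> = 0"
      using ec by (simp add: extended_corrector_def)
    with flux AE_space show ?thesis
    proof eventually_elim
      case (elim a)
      show ?case
      proof (intro allI impI)
        fix \<psi> :: "real ^ 'n \<Rightarrow> real" assume t: "test_fun \<psi>"
        have [measurable]: "G i k a \<in> borel_measurable borel" for k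
          by (rule jm_section[OF statf_jm[OF L2N_statf[OF LG]] elim(2)])
        note [measurable] = test_fun_borel[OF test_fun_partial[OF t]]
        have I: "(LINT x|lebesgue. (a x *v (D\<phi> i a x + axis i 1)) $ k * partial k \<psi> x) = (LBINT x. G i k a x * partial k \<psi> x)" for k
          by (rule integral_lebesgue_eq) (use elim(1) in eventually_elim, simp, measurable)
        have "(\<Sum>k\<in>UNIV. LINT x|lebesgue. (a x *v (D\<phi> i a x + axis i 1)) $ k * partial k \<psi> x) = 0"
          using elim(3) t by (simp add: distr_div_def distr_partial_def sum_negf)
        then show "(\<Sum>k\<in>UNIV. LBINT x. G i k a x * partial k \<psi> x) = 0" by (simp only: I)
      qed
    qed
  qed
  \<comment> \<open>The orthogonality: for each pair (m, i) the flux in direction m is divergence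
    free and the gradient of \<phi>_i has mean zero.\<close>
  have dc: "(\<Sum>k\<in>UNIV. LINT p|N. G m k (fst p) (snd p) * D\<phi> i (fst p) (snd p) $ k) = 0" for m i
  proof (rule div_curl[OF erg LG LD in_H_jm(1)[OF H(1)] _ _ div in_H_mean[OF H(1)]])
    show "AE a in P. \<forall>k. wd k (\<phi> i a) (\<lambda>x. D\<phi> i a x $ k)" "AE a in P. L2l (\<phi> i a)"
      using in_H_wd[OF H(1)] by auto
  qed
  \<comment> \<open>The gradient of the corrected affine function with slope h, and with
    \<open>W\<close> its flux. Ellipticity bounds V . W from below by lam |V|^2, and the mean of V
    is h.\<close>
  define V where "V k a x = h k + (\<Sum>i\<in>UNIV. h i * D\<phi> i a x $ k)" for k a x
  define W where "W k a x = (\<Sum>i\<in>UNIV. h i * G i k a x)" for k a x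
  have LV: "L2N (V k)" for k unfolding V_def[abs_def] by (rule L2N_add[OF L2N_const L2N_sum]) (simp_all add: L2N_cmult LD)
  have LW: "L2N (W k)" for k unfolding W_def[abs_def] by (intro L2N_sum L2N_cmult LG) simp
  have EV: "(LINT p|N. V k (fst p) (snd p)) = h k" for k
  proof -
    have "(LINT p|N. V k (fst p) (snd p)) = (LINT p|N. h k) + (LINT p|N. (\<Sum>i\<in>UNIV. h i * D\<phi> i (fst p) (snd p) $ k))"
      unfolding V_def
      by (intro Bochner_Integration.integral_add Bochner_Integration.integrable_sum integrable_mult_right L2N_integrable[OF LD]) simp
    also have "(LINT p|N. (\<Sum>i\<in>UNIV. h i * D\<phi> i (fst p) (snd p) $ k)) = (\<Sum>i\<in>UNIV. LINT p|N. h i * D\<phi> i (fst p) (snd p) $ k)"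
      by (intro Bochner_Integration.integral_sum integrable_mult_right L2N_integrable[OF LD])
    also have "\<dots> = 0" using in_H_mean[OF H(1)] by simp
    finally show ?thesis by (simp add: N.prob_space)
  qed
  have ell: "AE p in N. lam * (\<Sum>k\<in>UNIV. (V k (fst p) (snd p))^2) \<le> (\<Sum>k\<in>UNIV. V k (fst p) (snd p) * W k (fst p) (snd p))"
  proof (rule N.AE_pair_measure)
    have [measurable]: "(\<lambda>p. V k (fst p) (snd p)) \<in> borel_measurable N" "(\<lambda>p. W k (fst p) (snd p)) \<in> borel_measurable N" for k
      by (intro jm_N statf_jm L2N_statf LV LW)+
    show "{p \<in> space N. lam * (\<Sum>k\<in>UNIV. (V k (fst p) (snd p))^2) \<le> (\<Sum>k\<in>UNIV. V k (fst p) (snd p) * W k (fst p) (snd p))} \<in> sets N"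
      by measurable
    show "AE a in P. AE x in unifc 1. lam * (\<Sum>k\<in>UNIV. (V k (fst (a, x)) (snd (a, x)))^2) \<le> (\<Sum>k\<in>UNIV. V k (fst (a, x)) (snd (a, x)) * W k (fst (a, x)) (snd (a, x)))"
      using flux AE_space
    proof eventually_elim
      case (elim a)
      have "AE x in lborel. lam * (\<Sum>k\<in>UNIV. (V k a x)^2) \<le> (\<Sum>k\<in>UNIV. V k a x * W k a x)"
        using elim(1) medium_elliptic(2)[OF elim(2)]
      proof eventually_elim
        case (elim x)
        define v where "v = (\<Sum>i\<in>UNIV. h i *\<^sub>R (D\<phi> i a x + axis i 1))"
        have "v $ k = (\<Sum>i\<in>UNIV. h i * D\<phi> i a x $ k) + (\<Sum>i\<in>UNIV. if k = i then h i else 0)" for k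
          unfolding v_def by (simp add: axis_def distrib_left sum.distrib if_distrib[of "\<lambda>t. h _ * t"] cong: if_cong)
        then have v: "v $ k = V k a x" for k by (simp add: V_def)
        have "(a x *v v) = (\<Sum>i\<in>UNIV. h i *\<^sub>R (a x *v (D\<phi> i a x + axis i 1)))"
          unfolding v_def by (simp add: linear_sum[OF matrix_vector_mul_linear] linear_cmul[OF matrix_vector_mul_linear] o_def)
        then have w: "(a x *v v) $ k = W k a x" for k using elim(1) by (simp add: W_def)
        have "lam * (norm v)^2 \<le> v \<bullet> (a x *v v)" using elim(2) by blast
        then show ?case by (simp add: norm2_vec inner_vec_def v w)
      qed
      then show ?case by (simp add: AE_unifc)
    qed
  qed
  have iV2: "integrable N (\<lambda>p. (V k (fst p) (snd p))^2)" for k using LV[of k] by (simp add: L2N_def)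
  \<comment> \<open>Jensen in the form: the mean of (V - h)^2 is nonnegative and the mean of V is
    h.\<close>
  have V2: "(h k)^2 \<le> (LINT p|N. (V k (fst p) (snd p))^2)" for k
  proof -
    have "2 * h k * (LINT p|N. V k (fst p) (snd p)) - (h k)^2 = (LINT p|N. 2 * h k * V k (fst p) (snd p) - (h k)^2)"
      using L2N_integrable[OF LV[of k]] by (simp add: N.prob_space)
    also have "\<dots> \<le> (LINT p|N. (V k (fst p) (snd p))^2)"
    proof (rule integral_mono)
      show "integrable N (\<lambda>p. 2 * h k * V k (fst p) (snd p) - (h k)^2)" using L2N_integrable[OF LV[of k]] by simp
      fix p
      show "2 * h k * V k (fst p) (snd p) - (h k)^2 \<le> (V k (fst p) (snd p))^2"
        using zero_le_power2[of "V k (fst p) (snd p) - h k"] by (simp add: power2_diff algebra_simps)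
    qed (rule iV2)
    finally show ?thesis by (simp add: EV power2_eq_square)
  qed
  have "lam * (\<Sum>k\<in>UNIV. (h k)^2) \<le> lam * (\<Sum>k\<in>UNIV. LINT p|N. (V k (fst p) (snd p))^2)"
    using lam by (intro mult_left_mono sum_mono V2) auto
  also have "\<dots> = (LINT p|N. lam * (\<Sum>k\<in>UNIV. (V k (fst p) (snd p))^2))" using iV2 by simp
  also have "\<dots> \<le> (LINT p|N. (\<Sum>k\<in>UNIV. V k (fst p) (snd p) * W k (fst p) (snd p)))"
    using ell by (intro integral_mono_AE integrable_mult_right Bochner_Integration.integrable_sum iV2 L2N_mult_integrable LV LW)
  \<comment> \<open>The constant part h of V meets the mean flux and produces the quadratic form of
    \<open>a_hom\<close>; the gradient part produces the correlations that vanish by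
    \<open>dc\<close>.\<close>
  also have "\<dots> = (LINT p|N. (\<Sum>k\<in>UNIV. \<Sum>i\<in>UNIV. h k * h i * G i k (fst p) (snd p))
      + (\<Sum>i\<in>UNIV. \<Sum>m\<in>UNIV. h i * h m * (\<Sum>k\<in>UNIV. G m k (fst p) (snd p) * D\<phi> i (fst p) (snd p) $ k)))"
  proof (rule Bochner_Integration.integral_cong[OF refl])
    fix p
    have "(\<Sum>k\<in>UNIV. (\<Sum>i\<in>UNIV. h i * D\<phi> i (fst p) (snd p) $ k) * W k (fst p) (snd p))
      = (\<Sum>k\<in>UNIV. \<Sum>i\<in>UNIV. \<Sum>m\<in>UNIV. h i * h m * (G m k (fst p) (snd p) * D\<phi> i (fst p) (snd p) $ k))"
      unfolding W_def sum_product by (intro sum.cong refl) (simp only: mult_ac)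
    also have "\<dots> = (\<Sum>i\<in>UNIV. \<Sum>k\<in>UNIV. \<Sum>m\<in>UNIV. h i * h m * (G m k (fst p) (snd p) * D\<phi> i (fst p) (snd p) $ k))"
      by (rule sum.swap)
    also have "\<dots> = (\<Sum>i\<in>UNIV. \<Sum>m\<in>UNIV. \<Sum>k\<in>UNIV. h i * h m * (G m k (fst p) (snd p) * D\<phi> i (fst p) (snd p) $ k))"
      by (intro sum.cong refl sum.swap)
    finally show "(\<Sum>k\<in>UNIV. V k (fst p) (snd p) * W k (fst p) (snd p)) = (\<Sum>k\<in>UNIV. \<Sum>i\<in>UNIV. h k * h i * G i k (fst p) (snd p))
      + (\<Sum>i\<in>UNIV. \<Sum>m\<in>UNIV. h i * h m * (\<Sum>k\<in>UNIV. G m k (fst p) (snd p) * D\<phi> i (fst p) (snd p) $ k))"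
      by (simp add: V_def distrib_right sum.distrib sum_distrib_left W_def[of _ "fst p" "snd p"] mult.assoc)
  qed
  also have "\<dots> = (LINT p|N. (\<Sum>k\<in>UNIV. \<Sum>i\<in>UNIV. h k * h i * G i k (fst p) (snd p)))
      + (LINT p|N. (\<Sum>i\<in>UNIV. \<Sum>m\<in>UNIV. h i * h m * (\<Sum>k\<in>UNIV. G m k (fst p) (snd p) * D\<phi> i (fst p) (snd p) $ k)))"
    by (intro Bochner_Integration.integral_add Bochner_Integration.integrable_sum integrable_mult_right L2N_mult_integrable L2N_integrable LG LD)
  also have "(LINT p|N. (\<Sum>k\<in>UNIV. \<Sum>i\<in>UNIV. h k * h i * G i k (fst p) (snd p))) = (\<Sum>k\<in>UNIV. \<Sum>i\<in>UNIV. h k * h i * Ah $ k $ i)"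
    by (simp add: L2N_integrable[OF LG] EG)
  also have "(LINT p|N. (\<Sum>i\<in>UNIV. \<Sum>m\<in>UNIV. h i * h m * (\<Sum>k\<in>UNIV. G m k (fst p) (snd p) * D\<phi> i (fst p) (snd p) $ k))) = 0"
    using L2N_mult_integrable[OF LG LD] by (simp add: dc)
  finally show ?thesis by (simp add: Ah_def mult_ac)
qed

end

section \<open>Second derivatives, rescaling and conclusion\<close>

abbreviation two_scale_bound where
  "two_scale_bound lam \<alpha> \<epsilon> \<phi> \<sigma> a u u0 Du0 D2 \<equiv> (\<exists>DZ. has_weak_grad (two_scale_error \<epsilon> \<phi> a u u0 Du0) DZ \<and>
          ennreal \<alpha> * (\<integral>\<^sup>+ x. ennreal ((two_scale_error \<epsilon> \<phi> a u u0 Du0 x)^2) \<partial>lebesgue)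
            + ennreal lam * (\<integral>\<^sup>+ x. ennreal ((norm (DZ x))^2) \<partial>lebesgue)
          \<le> ennreal ((1 + 2 / lam) * \<epsilon>^2) *
             (ennreal \<alpha> * (\<integral>\<^sup>+ x. ennreal ((\<Sum>i\<in>UNIV. (\<phi> i a (x /\<^sub>R \<epsilon>))^2) * (norm (Du0 x))^2) \<partial>lebesgue)
              + (\<integral>\<^sup>+ x. ennreal (((\<Sum>i\<in>UNIV. \<Sum>j\<in>UNIV. \<Sum>k\<in>UNIV. (\<sigma> i j k a (x /\<^sub>R \<epsilon>))^2)
                     + (norm (a (x /\<^sub>R \<epsilon>)))^2 * (\<Sum>i\<in>UNIV. (\<phi> i a (x /\<^sub>R \<epsilon>))^2))
                   * (norm (D2 x))^2) \<partial>lebesgue)))"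

lemma weak_solution_measurable:
  assumes "weak_solution \<alpha> A f u Du"
  shows "u \<in> borel_measurable lebesgue" "Du \<in> borel_measurable lebesgue"
  using assms by (simp_all add: weak_solution_def in_H1_def in_L2_def)

context medium
begin

text \<open>Coercivity of \<open>a_hom\<close> puts the homogenized equation in the scope of
  \<open>H2_regularity\<close>. The derivatives are found for each pair of indices separately and
  assembled to a matrix field.\<close>

lemma ex_second_derivatives:
  assumes erg: "ergodic P" and ec: "extended_corrector P \<phi> D\<phi> \<sigma> D\<sigma>" and lam: "lam > 0" and \<alpha>: "\<alpha> > 0"
    and s: "weak_solution \<alpha> (\<lambda>x. a_hom P D\<phi>) f u0 Du0" and f: "AE x in lborel. f x = f' x" "L2 f'"
    and u0: "AE x in lborel. u0 x = u0' x" "u0' \<in> borel_measurable borel"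
    and Du0: "AE x in lborel. Du0 x = Du0' x" "Du0' \<in> borel_measurable borel"
  shows "\<exists>D2 :: real ^ 'n \<Rightarrow> real ^ 'n ^ 'n.
    (\<forall>i k. wd k (\<lambda>x. Du0' x $ i) (\<lambda>x. D2 x $ i $ k) \<and> L2 (\<lambda>x. D2 x $ i $ k))" (is ?D)
    and "test_fun \<psi> \<Longrightarrow> \<alpha> * (LBINT x. u0' x * \<psi> x) + (\<Sum>k\<in>UNIV. LBINT x. (a_hom P D\<phi> *v Du0' x) $ k * partial k \<psi> x)
      = (LBINT x. f' x * \<psi> x)"
proof -
  define Ah where "Ah = a_hom P D\<phi>"
  note b = weak_solution_borel[OF s u0 Du0]
  have L: "L2 (\<lambda>x. (Ah *v Du0' x) $ k)" for k
    unfolding matrix_vector_mult_def by (simp add: L2_sum L2_cmult b)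
  have eq: "\<alpha> * (LBINT x. u0' x * \<psi> x) + (\<Sum>k\<in>UNIV. LBINT x. (Ah *v Du0' x) $ k * partial k \<psi> x)
      = (LBINT x. f' x * \<psi> x)" if "test_fun \<psi>" for \<psi>
    by (rule weak_solution_test[OF s[folded Ah_def] u0 Du0 _ _ f(1) L2_borel[OF f(2)] L that]) auto
  have ex: "\<exists>G. L2 G \<and> wd k (\<lambda>x. Du0' x $ i) G" for i k
  proof -
    have weak: "\<alpha> * (LBINT x. u0' x * \<psi> x)
      + (\<Sum>i\<in>UNIV. \<Sum>j\<in>UNIV. Ah $ i $ j * (LBINT x. Du0' x $ j * partial i \<psi> x)) = (LBINT x. f' x * \<psi> x)"
      if t: "test_fun \<psi>" for \<psi>
    proof -
      have "(LBINT x. (Ah *v Du0' x) $ i * partial i \<psi> x) = (\<Sum>j\<in>UNIV. Ah $ i $ j * (LBINT x. Du0' x $ j * partial i \<psi> x))" for i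
      proof -
        have "(LBINT x. (Ah *v Du0' x) $ i * partial i \<psi> x) = (LBINT x. (\<Sum>j\<in>UNIV. Ah $ i $ j * (Du0' x $ j * partial i \<psi> x)))"
          by (simp add: matrix_vector_mult_def sum_distrib_right mult.assoc)
        also have "\<dots> = (\<Sum>j\<in>UNIV. LBINT x. Ah $ i $ j * (Du0' x $ j * partial i \<psi> x))"
          by (intro Bochner_Integration.integral_sum integrable_mult_right L2_mult_integrable b bcs_L2 test_fun_bcs test_fun_partial t)
        finally show ?thesis by simp
      qed
      then show ?thesis using eq[OF t] by simp
    qed
    have coer: "lam * (\<Sum>i\<in>UNIV. (h i)^2) \<le> (\<Sum>i\<in>UNIV. \<Sum>j\<in>UNIV. Ah $ i $ j * h i * h j)" for h :: "'n \<Rightarrow> real"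
      unfolding Ah_def by (rule a_hom_coercive[OF erg ec lam])
    obtain G where "L2 G" "wd k (\<lambda>x. Du0' x $ i) G"
      by (rule H2_regularity[OF lam coer b(1,2,3) f(2) less_imp_le[OF \<alpha>] weak])
    then show ?thesis by blast
  qed
  \<comment> \<open>A choice for all index pairs at once, since the regularity lemma provides the
    derivatives one at a time.\<close>
  define G where "G i k = (SOME G. L2 G \<and> wd k (\<lambda>x. Du0' x $ i) G)" for i k
  have G: "L2 (G i k) \<and> wd k (\<lambda>x. Du0' x $ i) (G i k)" for i k
  proof -
    have e: "\<exists>G. L2 G \<and> wd k (\<lambda>x. Du0' x $ i) G" by (rule ex)
    show ?thesis unfolding G_def using someI_ex[OF e] .
  qed
  show ?D by (rule exI[of _ "\<lambda>x. \<chi> i k. G i k x"]) (use G in simp)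
  show "\<alpha> * (LBINT x. u0' x * \<psi> x) + (\<Sum>k\<in>UNIV. LBINT x. (a_hom P D\<phi> *v Du0' x) $ k * partial k \<psi> x)
      = (LBINT x. f' x * \<psi> x)" if "test_fun \<psi>"
    using eq[OF that] by (simp add: Ah_def)
qed

text \<open>Instantiates \<open>two_scale\<close> with the dilated corrector. The factor \<epsilon>
  inside \<Phi> and S appears squared in \<open>X1\<close> and \<open>X2\<close>, which is the
  origin of \<epsilon>^2 in the bound.\<close>

lemma two_scale_estimate:
  fixes \<epsilon> :: real
  assumes lam: "lam > 0" and \<alpha>: "\<alpha> > 0" and \<epsilon>: "\<epsilon> > 0" and a: "a \<in> space P"
    and \<phi>: "\<And>i k. wd k (\<phi> i a) (\<lambda>x. D\<phi> i a x $ k)" "\<And>i. L2l (\<phi> i a)" "\<And>i k. L2l (\<lambda>x. D\<phi> i a x $ k)"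
    and \<sigma>: "\<And>i j l k. wd k (\<sigma> i j l a) (\<lambda>x. D\<sigma> i j l a x $ k)" "\<And>i j l. L2l (\<sigma> i j l a)" "\<And>i j l k. L2l (\<lambda>x. D\<sigma> i j l a x $ k)"
    and div: "\<And>i \<psi>. test_fun \<psi> \<Longrightarrow> distr_div (\<lambda>x. a x *v (D\<phi> i a x + axis i 1)) \<psi> = 0"
    and skew: "\<And>i j k. AE x in lborel. \<sigma> i j k a x = - \<sigma> i k j a x"
    and divS: "\<And>i j. AE x in lborel. (\<Sum>k\<in>UNIV. D\<sigma> i j k a x $ k) = flux P D\<phi> i a x $ j"
    and f: "AE x in lborel. f x = f' x" "f' \<in> borel_measurable borel"
    and s: "weak_solution \<alpha> (\<lambda>x. a (x /\<^sub>R \<epsilon>)) f u Du"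
    and s0: "weak_solution \<alpha> (\<lambda>x. a_hom P D\<phi>) f u0 Du0"
    and u0: "AE x in lborel. u0 x = u0' x" "u0' \<in> borel_measurable borel"
    and Du0: "AE x in lborel. Du0 x = Du0' x" "Du0' \<in> borel_measurable borel"
    and D2: "\<And>i k. wd k (\<lambda>x. Du0' x $ i) (\<lambda>x. D2 x $ i $ k)" "\<And>i k. L2 (\<lambda>x. D2 x $ i $ k)"
    and eq0: "\<And>\<psi>. test_fun \<psi> \<Longrightarrow> \<alpha> * (LBINT x. u0' x * \<psi> x) + (\<Sum>k\<in>UNIV. LBINT x. (a_hom P D\<phi> *v Du0' x) $ k * partial k \<psi> x)
      = (LBINT x. f' x * \<psi> x)"
  shows "two_scale_bound lam \<alpha> \<epsilon> \<phi> \<sigma> a u u0 Du0 D2"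
proof -
  let ?s\<phi> = "\<lambda>x. \<Sum>i\<in>UNIV. (\<phi> i a (x /\<^sub>R \<epsilon>))^2"
  let ?s\<sigma> = "\<lambda>x. \<Sum>i\<in>UNIV. \<Sum>j\<in>UNIV. \<Sum>k\<in>UNIV. (\<sigma> i j k a (x /\<^sub>R \<epsilon>))^2"
  have c: "inverse \<epsilon> \<noteq> 0" using \<epsilon> by simp
  note scaled_AE = AE_lborel_affine[where w = 0 and c = "inverse \<epsilon>", OF _ c, simplified]
  obtain a' where a': "a' \<in> borel_measurable borel" "AE x in lborel. a x = a' x"
    by (rule ex_borel_representative[OF medium_elliptic(1)[OF a]])
  define A where "A x = a' (x /\<^sub>R \<epsilon>)" for x
  have Ab [measurable]: "A \<in> borel_measurable borel" unfolding A_def[abs_def] using a'(1) by measurable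
  have aA: "AE x in lborel. a (x /\<^sub>R \<epsilon>) = A x" unfolding A_def by (rule scaled_AE[OF a'(2)])
  have Ae: "elliptic lam A"
    unfolding elliptic_def using aA scaled_AE[OF medium_elliptic(2)[OF a]] by (auto elim: AE_mp)
  obtain u' where u: "u' \<in> borel_measurable borel" "AE x in lborel. u x = u' x"
    by (rule ex_borel_representative[OF weak_solution_measurable(1)[OF s]])
  note u = u(2,1)
  obtain Du' where Du: "Du' \<in> borel_measurable borel" "AE x in lborel. Du x = Du' x"
    by (rule ex_borel_representative[OF weak_solution_measurable(2)[OF s]])
  note Du = Du(2,1)
  note ub = weak_solution_borel[OF s u Du] and u0b = weak_solution_borel[OF s0 u0 Du0]
  define \<Phi> where "\<Phi> i x = \<epsilon> * \<phi> i a (x /\<^sub>R \<epsilon>)" for i x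
  define D\<Phi> where "D\<Phi> i x = D\<phi> i a (x /\<^sub>R \<epsilon>)" for i x
  define S where "S i j k x = \<epsilon> * \<sigma> i j k a (x /\<^sub>R \<epsilon>)" for i j k x
  define DS where "DS i j k x = D\<sigma> i j k a (x /\<^sub>R \<epsilon>)" for i j k x
  have wd_scaled: "wd k (\<lambda>x. \<epsilon> * v (x /\<^sub>R \<epsilon>)) (\<lambda>x. g (x /\<^sub>R \<epsilon>))" if "wd k v g" for k v g
    using wd_cmult[OF wd_affine[OF that c, of 0], of \<epsilon>] \<epsilon> by (simp add: mult.assoc[symmetric])
  have L2l_scaled: "L2l (\<lambda>x. v (x /\<^sub>R \<epsilon>))" if "L2l v" for v
    using L2l_affine[OF that c, of 0] by simp
  interpret T: two_scale lam \<alpha> A "a_hom P D\<phi>" \<Phi> D\<Phi> S DS f' u' u0' Du' Du0' D2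
  proof
    show "wd k (\<Phi> i) (\<lambda>x. D\<Phi> i x $ k)" "L2l (\<Phi> i)" "L2l (\<lambda>x. D\<Phi> i x $ k)" for i k
      unfolding \<Phi>_def[abs_def] D\<Phi>_def[abs_def] by (intro wd_scaled L2l_cmult L2l_scaled \<phi>)+
    show "wd k (S i j l) (\<lambda>x. DS i j l x $ k)" "L2l (S i j l)" "L2l (\<lambda>x. DS i j l x $ k)" for i j l k
      unfolding S_def[abs_def] DS_def[abs_def] by (intro wd_scaled L2l_cmult L2l_scaled \<sigma>)+
    show "AE x in lborel. S i j k x = - S i k j x" for i j k
      unfolding S_def using scaled_AE[OF skew[of i j k]] by eventually_elim simp
    show "AE x in lborel. (\<Sum>k\<in>UNIV. DS i j k x $ k) = (A x *v (D\<Phi> i x + axis i 1) - a_hom P D\<phi> *v axis i 1) $ j" for i j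
      using scaled_AE[OF divS[of i j]] aA by eventually_elim (simp add: DS_def D\<Phi>_def flux_def)
    show "(\<Sum>k\<in>UNIV. LBINT x. (A x *v (D\<Phi> i x + axis i 1)) $ k * partial k \<psi> x) = 0" if t: "test_fun \<psi>" for i \<psi>
    proof -
      \<comment> \<open>The corrector equation holds at unit scale; dilating the test function
        transports it to the oscillating coefficient.\<close>
      define \<psi>' where "\<psi>' x = \<psi> (\<epsilon> *\<^sub>R x + 0)" for x
      have t': "test_fun \<psi>'" unfolding \<psi>'_def[abs_def] using \<epsilon> by (intro test_fun_affine t) simp
      have p: "partial k \<psi>' x = \<epsilon> * partial k \<psi> (\<epsilon> *\<^sub>R x)" for k x
        unfolding \<psi>'_def[abs_def] using partial_affine[of \<psi> k \<epsilon> 0 x] smooth_diff[OF test_fun_smooth[OF t]] by simp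
      note [measurable] = a'(1) test_fun_borel[OF test_fun_partial[OF t]] test_fun_borel[OF test_fun_partial[OF t']]
      have [measurable]: "D\<phi> i a \<in> borel_measurable borel" using \<phi>(3) by (intro borel_measurable_vecI L2l_borel)
      have [measurable]: "D\<Phi> i \<in> borel_measurable borel" unfolding D\<Phi>_def[abs_def] by measurable
      \<comment> \<open>The power of \<epsilon> comes from the change of variables and the division
        from differentiating the dilated test function. The factor is common to all components, so
        the vanishing sum stays zero.\<close>
      have I: "(LBINT x. (A x *v (D\<Phi> i x + axis i 1)) $ k * partial k \<psi> x)
        = \<epsilon> ^ CARD('n) / \<epsilon> * (LINT x|lebesgue. (a x *v (D\<phi> i a x + axis i 1)) $ k * partial k \<psi>' x)" for k
      proof -
        have "(LBINT x. (A x *v (D\<Phi> i x + axis i 1)) $ k * partial k \<psi> x)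
          = \<epsilon> ^ CARD('n) * (LBINT x. (a' x *v (D\<phi> i a x + axis i 1)) $ k * partial k \<psi> (\<epsilon> *\<^sub>R x))"
          using integral_lborel_affine[of "\<lambda>x. (A x *v (D\<Phi> i x + axis i 1)) $ k * partial k \<psi> x" \<epsilon> 0] \<epsilon>
          by (simp add: A_def D\<Phi>_def)
        also have "(LBINT x. (a' x *v (D\<phi> i a x + axis i 1)) $ k * partial k \<psi> (\<epsilon> *\<^sub>R x))
          = (LBINT x. 1 / \<epsilon> * ((a' x *v (D\<phi> i a x + axis i 1)) $ k * partial k \<psi>' x))"
          using \<epsilon> by (simp add: p)
        also have "\<dots> = 1 / \<epsilon> * (LBINT x. (a' x *v (D\<phi> i a x + axis i 1)) $ k * partial k \<psi>' x)" by simp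
        also have "(LBINT x. (a' x *v (D\<phi> i a x + axis i 1)) $ k * partial k \<psi>' x)
          = (LINT x|lebesgue. (a x *v (D\<phi> i a x + axis i 1)) $ k * partial k \<psi>' x)"
          by (rule integral_lebesgue_eq[symmetric]) (use a'(2) in eventually_elim, simp, measurable)
        finally show ?thesis by simp
      qed
      have "(\<Sum>k\<in>UNIV. LINT x|lebesgue. (a x *v (D\<phi> i a x + axis i 1)) $ k * partial k \<psi>' x) = 0"
        using div[OF t', of i] by (simp add: distr_div_def distr_partial_def sum_negf)
      then show ?thesis by (simp only: I sum_distrib_left[symmetric] mult_zero_right)
    qed
    show "\<alpha> * (LBINT x. u' x * \<psi> x) + (\<Sum>k\<in>UNIV. LBINT x. (A x *v Du' x) $ k * partial k \<psi> x) = (LBINT x. f' x * \<psi> x)"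
      if "test_fun \<psi>" for \<psi>
      by (rule weak_solution_test[OF s u Du aA Ab f elliptic_L2[OF Ae ub(3)] that])
  qed (fact lam \<alpha> Ae ub u0b D2 eq0)+
  have Zeq: "AE x in lborel. two_scale_error \<epsilon> \<phi> a u u0 Du0 x = T.Z x"
    using u(1) u0(1) Du0(1)
    by eventually_elim (simp add: two_scale_error_def T.Z_def \<Phi>_def sum_distrib_left mult.assoc)
  have "has_weak_grad (two_scale_error \<epsilon> \<phi> a u u0 Du0) T.DZ"
    using has_weak_grad_iff[OF Zeq, of T.DZ T.DZ] T.wd_Z by simp
  moreover have "(\<integral>\<^sup>+ x. ennreal ((two_scale_error \<epsilon> \<phi> a u u0 Du0 x)^2) \<partial>lebesgue) = (LBINT\<^sup>+ x. ennreal ((T.Z x)^2))"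
    unfolding nn_integral_completion by (rule nn_integral_cong_AE) (use Zeq in eventually_elim, simp)
  moreover have "(LBINT\<^sup>+ x. ennreal (T.X1 x))
    = ennreal (\<epsilon>^2) * (\<integral>\<^sup>+ x. ennreal (?s\<phi> x * (norm (Du0 x))^2) \<partial>lebesgue)"
  proof -
    have "(\<integral>\<^sup>+ x. ennreal (?s\<phi> x * (norm (Du0 x))^2) \<partial>lebesgue) = (LBINT\<^sup>+ x. ennreal (T.X1 x / \<epsilon>^2))"
      unfolding nn_integral_completion
    proof (rule nn_integral_cong_AE)
      show "AE x in lborel. ennreal (?s\<phi> x * (norm (Du0 x))^2) = ennreal (T.X1 x / \<epsilon>^2)"
        using Du0(1) by eventually_elim (use \<epsilon> in \<open>simp add: T.X1_def \<Phi>_def power_mult_distrib sum_distrib_left[symmetric]\<close>)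
    qed
    also have "ennreal (\<epsilon>^2) * \<dots> = (LBINT\<^sup>+ x. ennreal (\<epsilon>^2) * ennreal (T.X1 x / \<epsilon>^2))"
      by (rule nn_integral_cmult[symmetric]) measurable
    also have "\<dots> = (LBINT\<^sup>+ x. ennreal (T.X1 x))"
      using \<epsilon> by (intro nn_integral_cong) (simp add: ennreal_mult'[symmetric])
    finally show ?thesis by simp
  qed
  moreover have "(LBINT\<^sup>+ x. ennreal (T.X2 x))
    = ennreal (\<epsilon>^2) * (\<integral>\<^sup>+ x. ennreal ((?s\<sigma> x + (norm (a (x /\<^sub>R \<epsilon>)))^2 * ?s\<phi> x) * (norm (D2 x))^2) \<partial>lebesgue)"
  proof -
    have "(\<integral>\<^sup>+ x. ennreal ((?s\<sigma> x + (norm (a (x /\<^sub>R \<epsilon>)))^2 * ?s\<phi> x) * (norm (D2 x))^2) \<partial>lebesgue) = (LBINT\<^sup>+ x. ennreal (T.X2 x / \<epsilon>^2))"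
      unfolding nn_integral_completion
    proof (rule nn_integral_cong_AE)
      show "AE x in lborel. ennreal ((?s\<sigma> x + (norm (a (x /\<^sub>R \<epsilon>)))^2 * ?s\<phi> x) * (norm (D2 x))^2) = ennreal (T.X2 x / \<epsilon>^2)"
        using aA
      proof eventually_elim
        case (elim x)
        have "(\<Sum>i\<in>UNIV. (\<Phi> i x)^2) = \<epsilon>^2 * ?s\<phi> x"
          "(\<Sum>i\<in>UNIV. \<Sum>j\<in>UNIV. \<Sum>k\<in>UNIV. (S i j k x)^2) = \<epsilon>^2 * ?s\<sigma> x"
          by (simp_all add: \<Phi>_def S_def power_mult_distrib sum_distrib_left)
        then have "T.X2 x = \<epsilon>^2 * ((?s\<sigma> x + (norm (a (x /\<^sub>R \<epsilon>)))^2 * ?s\<phi> x) * (norm (D2 x))^2)"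
          by (simp add: T.X2_def elim algebra_simps)
        then show ?case using \<epsilon> by simp
      qed
    qed
    also have "ennreal (\<epsilon>^2) * \<dots> = (LBINT\<^sup>+ x. ennreal (\<epsilon>^2) * ennreal (T.X2 x / \<epsilon>^2))"
      by (rule nn_integral_cmult[symmetric]) measurable
    also have "\<dots> = (LBINT\<^sup>+ x. ennreal (T.X2 x))"
      using \<epsilon> by (intro nn_integral_cong) (simp add: ennreal_mult'[symmetric])
    finally show ?thesis by simp
  qed
  ultimately show ?thesis using T.energy lam
    by (intro exI[of _ T.DZ]) (simp add: nn_integral_completion ennreal_mult' distrib_left mult.assoc mult.left_commute)
qed

end

theorem theorem3p3:
  fixes lam :: real
  assumes "lam > 0"
  shows "\<exists>C :: real. C > 0 \<and>
    (\<forall>(P :: 'n::finite coeff measure) \<phi> D\<phi> \<sigma> D\<sigma> (\<alpha> :: real) (f :: real ^ 'n \<Rightarrow> real) u Du u\<^sub>0 Du\<^sub>0.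
      random_medium lam P \<longrightarrow> stationary P \<longrightarrow> ergodic P \<longrightarrow>
      extended_corrector P \<phi> D\<phi> \<sigma> D\<sigma> \<longrightarrow>
      \<alpha> > 0 \<longrightarrow> in_L2 f \<longrightarrow>
      (\<forall>\<epsilon>>0. \<forall>a\<in>space P. weak_solution \<alpha> (\<lambda>x. a (x /\<^sub>R \<epsilon>)) f (u \<epsilon> a) (Du \<epsilon> a)) \<longrightarrow>
      weak_solution \<alpha> (\<lambda>x. a_hom P D\<phi>) f u\<^sub>0 Du\<^sub>0 \<longrightarrow>
      (\<exists>D2u\<^sub>0 :: real ^ 'n \<Rightarrow> real ^ 'n ^ 'n.
        (\<forall>i. has_weak_grad (\<lambda>x. Du\<^sub>0 x $ i) (\<lambda>x. D2u\<^sub>0 x $ i)) \<and>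
        (AE a in P. \<forall>\<epsilon>>0. \<exists>DZ.
          has_weak_grad (two_scale_error \<epsilon> \<phi> a (u \<epsilon> a) u\<^sub>0 Du\<^sub>0) DZ \<and>
          ennreal \<alpha> * (\<integral>\<^sup>+ x. ennreal ((two_scale_error \<epsilon> \<phi> a (u \<epsilon> a) u\<^sub>0 Du\<^sub>0 x)\<^sup>2) \<partial>lebesgue)
            + ennreal lam * (\<integral>\<^sup>+ x. ennreal ((norm (DZ x))\<^sup>2) \<partial>lebesgue)
          \<le> ennreal (C * \<epsilon>\<^sup>2) *
             (ennreal \<alpha> * (\<integral>\<^sup>+ x. ennreal ((\<Sum>i\<in>UNIV. (\<phi> i a (x /\<^sub>R \<epsilon>))\<^sup>2) * (norm (Du\<^sub>0 x))\<^sup>2) \<partial>lebesgue)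
              + (\<integral>\<^sup>+ x. ennreal (((\<Sum>i\<in>UNIV. \<Sum>j\<in>UNIV. \<Sum>k\<in>UNIV. (\<sigma> i j k a (x /\<^sub>R \<epsilon>))\<^sup>2)
                     + (norm (a (x /\<^sub>R \<epsilon>)))\<^sup>2 * (\<Sum>i\<in>UNIV. (\<phi> i a (x /\<^sub>R \<epsilon>))\<^sup>2))
                   * (norm (D2u\<^sub>0 x))\<^sup>2) \<partial>lebesgue)))))"
proof (intro exI[of _ "1 + 2 / lam"] conjI allI impI)
  show "0 < 1 + 2 / lam" using assms by (simp add: add_pos_pos)
  fix P :: "'n coeff measure" and \<phi> D\<phi> \<sigma> D\<sigma> and \<alpha> :: real and f :: "real ^ 'n \<Rightarrow> real" and u Du u\<^sub>0 Du\<^sub>0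
  assume rm: "random_medium lam P" and st: "stationary P" and erg: "ergodic P"
    and ec: "extended_corrector P \<phi> D\<phi> \<sigma> D\<sigma>" and \<alpha>: "\<alpha> > 0" and f: "in_L2 f"
    and s: "\<forall>\<epsilon>>0. \<forall>a\<in>space P. weak_solution \<alpha> (\<lambda>x. a (x /\<^sub>R \<epsilon>)) f (u \<epsilon> a) (Du \<epsilon> a)"
    and s0: "weak_solution \<alpha> (\<lambda>x. a_hom P D\<phi>) f u\<^sub>0 Du\<^sub>0"
  interpret prob_space P using rm by (simp add: random_medium_def)
  interpret medium P lam by unfold_locales (fact rm st)+
  obtain f' where f': "f' \<in> borel_measurable borel" "AE x in lborel. f x = f' x"
    by (rule ex_borel_representative[OF conjunct1[OF f[unfolded in_L2_def]]])
  obtain u0 where u0: "u0 \<in> borel_measurable borel" "AE x in lborel. u\<^sub>0 x = u0 x"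
    by (rule ex_borel_representative[OF weak_solution_measurable(1)[OF s0]])
  obtain Du0 where Du0: "Du0 \<in> borel_measurable borel" "AE x in lborel. Du\<^sub>0 x = Du0 x"
    by (rule ex_borel_representative[OF weak_solution_measurable(2)[OF s0]])
  \<comment> \<open>The Hessian of the homogenized solution is fixed before any realization, so one
    and the same field serves for almost every \<open>a\<close> and every \<epsilon>.\<close>
  note second = ex_second_derivatives[OF erg ec assms \<alpha> s0 f'(2) in_L2_L2[OF f f'(2,1)] u0(2,1) Du0(2,1)]
  obtain D2 :: "real ^ 'n \<Rightarrow> real ^ 'n ^ 'n"
    where D2: "\<And>i k. wd k (\<lambda>x. Du0 x $ i) (\<lambda>x. D2 x $ i $ k)" "\<And>i k. L2 (\<lambda>x. D2 x $ i $ k)"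
    using second(1) by blast
  show "\<exists>D2u\<^sub>0 :: real ^ 'n \<Rightarrow> real ^ 'n ^ 'n.
        (\<forall>i. has_weak_grad (\<lambda>x. Du\<^sub>0 x $ i) (\<lambda>x. D2u\<^sub>0 x $ i)) \<and>
        (AE a in P. \<forall>\<epsilon>>0. two_scale_bound lam \<alpha> \<epsilon> \<phi> \<sigma> a (u \<epsilon> a) u\<^sub>0 Du\<^sub>0 D2u\<^sub>0)"
  proof (intro exI[of _ D2] conjI allI)
    fix i
    have [measurable]: "(\<lambda>x. D2 x $ i) \<in> borel_measurable borel" using D2(2) by (intro borel_measurable_vecI L2_borel)
    have "AE x in lborel. Du\<^sub>0 x $ i = Du0 x $ i" using Du0(2) by eventually_elim simp
    moreover have "(\<lambda>x. Du0 x $ i) \<in> borel_measurable borel" using Du0(1) by measurable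
    ultimately show "has_weak_grad (\<lambda>x. Du\<^sub>0 x $ i) (\<lambda>x. D2 x $ i)"
      using has_weak_grad_iff[of "\<lambda>x. Du\<^sub>0 x $ i" "\<lambda>x. Du0 x $ i" "\<lambda>x. D2 x $ i" "\<lambda>x. D2 x $ i"] D2(1) by simp
  next
    have H: "in_H P (\<phi> i) (D\<phi> i)" "in_H P (\<sigma> i j k) (D\<sigma> i j k)" for i j k
      using ec by (auto simp: extended_corrector_def)
    \<comment> \<open>The indices range over finite types, so finitely many null sets are united.
      None of these properties mentions \<epsilon>, so the quantifier over \<epsilon> may stand
      inside the almost-sure statement.\<close>
    have "AE a in P. \<forall>i. (\<forall>k. wd k (\<phi> i a) (\<lambda>x. D\<phi> i a x $ k)) \<and> L2l (\<phi> i a) \<and> (\<forall>k. L2l (\<lambda>x. D\<phi> i a x $ k))"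
      unfolding AE_all_countable by (intro allI in_H_wd H)
    moreover have "AE a in P. \<forall>i j l. (\<forall>k. wd k (\<sigma> i j l a) (\<lambda>x. D\<sigma> i j l a x $ k)) \<and> L2l (\<sigma> i j l a) \<and> (\<forall>k. L2l (\<lambda>x. D\<sigma> i j l a x $ k))"
      unfolding AE_all_countable by (intro allI in_H_wd H)
    moreover have "AE a in P. \<forall>i. \<forall>\<psi>. test_fun \<psi> \<longrightarrow> - distr_div (\<lambda>x. a x *v (D\<phi> i a x + axis i 1)) \<psi> = 0"
      using ec unfolding AE_all_countable extended_corrector_def by blast
    moreover have "AE a in P. \<forall>i j k. AE x in lebesgue. \<sigma> i j k a x = - \<sigma> i k j a x"
      using ec unfolding AE_all_countable extended_corrector_def by blast
    moreover have "AE a in P. \<forall>i j. AE x in lebesgue. (\<Sum>k\<in>UNIV. D\<sigma> i j k a x $ k) = flux P D\<phi> i a x $ j"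
      using ec unfolding AE_all_countable extended_corrector_def by blast
    moreover have "AE a in P. a \<in> space P" by (rule AE_space)
    ultimately show "AE a in P. \<forall>\<epsilon>>0. two_scale_bound lam \<alpha> \<epsilon> \<phi> \<sigma> a (u \<epsilon> a) u\<^sub>0 Du\<^sub>0 D2"
    proof eventually_elim
      case (elim a)
      show ?case
      proof (intro allI impI)
        fix \<epsilon> :: real assume \<epsilon>: "\<epsilon> > 0"
        have skew: "AE x in lborel. \<sigma> i j k a x = - \<sigma> i k j a x" for i j k using elim(4) by (simp add: AE_completion_iff)
        have divS: "AE x in lborel. (\<Sum>k\<in>UNIV. D\<sigma> i j k a x $ k) = flux P D\<phi> i a x $ j" for i j
          using elim(5) by (simp add: AE_completion_iff)
        have div: "distr_div (\<lambda>x. a x *v (D\<phi> i a x + axis i 1)) \<psi> = 0" if "test_fun \<psi>" for i \<psi> using elim(3) that by simp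
        show "two_scale_bound lam \<alpha> \<epsilon> \<phi> \<sigma> a (u \<epsilon> a) u\<^sub>0 Du\<^sub>0 D2"
        proof (rule two_scale_estimate[where D\<phi> = D\<phi> and D\<sigma> = D\<sigma> and f' = f' and u0' = u0 and Du0' = Du0 and Du = "Du \<epsilon> a"])
          show "wd k (\<phi> i a) (\<lambda>x. D\<phi> i a x $ k)" "L2l (\<phi> i a)" "L2l (\<lambda>x. D\<phi> i a x $ k)" for i k
            using elim(1) by auto
          show "wd k (\<sigma> i j l a) (\<lambda>x. D\<sigma> i j l a x $ k)" "L2l (\<sigma> i j l a)" "L2l (\<lambda>x. D\<sigma> i j l a x $ k)" for i j l k
            using elim(2) by auto
          show "weak_solution \<alpha> (\<lambda>x. a (x /\<^sub>R \<epsilon>)) f (u \<epsilon> a) (Du \<epsilon> a)" using s \<epsilon> elim(6) by blast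
        qed (fact assms \<alpha> \<epsilon> elim(6) div skew divS f' s0 u0 Du0 D2 second(2))+
      qed
    qed
  qed
qed

end
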